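(* Let $\mathbb{K}$ be a field, let $D$ be a dendriform bialgebra over $\mathbb{K}$ that is connected as a coalgebra, and let $B:=\operatorname{Prim}(D)$ be the brace algebra of primitive elements of $D$. Then there is a natural isomorphism of dendriform bialgebras $\widetilde{\mathcal U}(B)\to D$ (namely the morphism of unital dendriform algebras corresponding by adjunction to the inclusion of brace algebras $B\subset (D^+)_{\mathrm{Brace}}$).
   Context: Work over a field $\mathbb{K}$. **Dendriform algebras.** A dendriform algebra is a vector space $W$ with bilinear products $\prec,\succ$ such that $(x\prec y)\prec z=x\prec(y\prec z)+x\prec(y\succ z)$, $(x\succ y)\prec z=x\succ(y\prec z)$ (written $x\succ y\prec z$), $x\succ(y\succ z)=(x\succ y)\succ z+(x\prec y)\succ z$. The product $x*y:=x\prec y+x\succ y$ is associative. $D(V)$ denotes the free dendriform algebra on $V$. Define $\nearrow(x_1)=x_1$, $\nearrow(x_1,\dots,x_n)=x_1\prec\nearrow(x_2,\dots,x_n)$, and $\searrow(x_1)=x_1$, $\searrow(x_1,\dots,x_{n+1})=\searrow(x_1,\dots,x_n)\succ x_{n+1}$. **Brace algebras.** A brace algebra is a vector space $B$ with multilinear operations $\{x_1\mid x_2,\dots,x_{n+1}\}$, $n\ge1$, such that for all $n,m\ge 1$ $$\{\{z\mid x_1,\dots,x_n\}\mid y_1,\dots,y_m\}=\sum\{z\mid Y_0,\{x_1\mid Y_1\},Y_2,\{x_2\mid Y_3\},Y_4,\dots,Y_{2n-2},\{x_n\mid Y_{2n-1}\},Y_{2n}\},$$ the sum being over partitions of the ordered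 sequence $y_1,\dots,y_m$ into successive, possibly empty, intervals $Y_0\sqcup\dots\sqcup Y_{2n}$, with $\{x\mid\ \}=x$. A dendriform algebra $D$ has an underlying brace algebra $D_{\mathrm{Brace}}$ with $$\{x_1\mid x_2,\dots,x_{n+1}\}=\sum_{i=1}^{n+1}(-1)^{i-1}\nearrow(x_2,\dots,x_i)\succ x_1\prec\searrow(x_{i+1},\dots,x_{n+1}),$$ where the terms $i=1$ and $i=n+1$ are read as $x_1\prec\searrow(x_2,\dots,x_{n+1})$ and $(-1)^n\nearrow(x_2,\dots,x_{n+1})\succ x_1$. **Unital dendriform algebras.** A unital dendriform algebra is a vector space $W=\mathbb{K}\cdot1\oplus V$ with maps $\prec,\succ:V\otimes W+W\otimes V\to V$ such that $(V,\prec,\succ)$ is a dendriform algebra and $1\prec x=x\succ1=0$, $x\prec1=1\succ x=x$ for $x\in V$; put $W^+=V$ and $1*1=1$. Morphisms respect the decompositions, send $1$ to $1$ and are dendriform morphisms on $V$. For a dendriform algebra $D$, $\widetilde D:=\mathbb{K}\cdot1\oplus D$. **Dendriform bialgebras.** A dendriform bialgebra is a unital dendriform algebra $W=\mathbb{K}\cdot1\oplus V$ with a coassociative coproduct $\Delta:W\to W\otimes W$ such that $\Delta(1)=1\otimes1$, the projection onto $\mathbb{K}\cdot 1$ along $V$ is a counit, and for all $x,y\in V$ (Sweedler notation) $$\Delta(x\succ y)=(x_{(1)}*y_{(1)})\otimes(x_{(2)}\succ y_{(2)})-(x*y)\otimes(1\succ1)+(x\succ y)\otimes1,$$ $$\Delta(x\prec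 y)=(x_{(1)}*y_{(1)})\otimes(x_{(2)}\prec y_{(2)})-(x*y)\otimes(1\prec1)+(x\prec y)\otimes1,$$ where subtracting the undefined terms $1\succ1$, $1\prec1$ means that in the Sweedler sum the single term with $x_{(2)}=y_{(2)}=1$ is omitted. Morphisms are morphisms of unital dendriform algebras that are coalgebra morphisms. A coalgebra is connected if its coradical is $\mathbb{K}\cdot1$ and the coradical filtration is exhaustive. $\operatorname{Prim}(D)=\{x:\Delta(x)=x\otimes1+1\otimes x\}$ is a sub-brace-algebra of $(D^+)_{\mathrm{Brace}}$ (a result of Ronco). **Enveloping algebra.** For a brace algebra $B$, $\mathcal U(B)$ is the quotient of $D(B)$ by the dendriform ideal generated by the differences between the brace operation $\{x_1\mid x_2,\dots,x_{n+1}\}$ computed in $D(B)_{\mathrm{Brace}}$ and the one computed in $B$, for $n\ge1$, $x_i\in B$; $\mathcal U$ is left adjoint to $(\ )_{\mathrm{Brace}}$. Put $\widetilde{\mathcal U}(B)=\mathbb{K}\cdot1\oplus\mathcal U(B)$. It is a dendriform bialgebra, with the coproduct induced from the dendriform bialgebra structure on $\widetilde D(B)$ for which the elements of $B$ are primitive. *)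

theory Defs
  imports "HOL-Algebra.QuotRing" "HOL-Algebra.Module" "HOL-Library.FuncSet" "HOL.Hull"
begin

section \<open>Linear algebra\<close>

locale vspace = module K V + field K for K (structure) and V (structure)

definition lin_maps ::
  "('k, _) ring_scheme \<Rightarrow> ('k, 'a, _) module_scheme \<Rightarrow> ('k, 'b, _) module_scheme \<Rightarrow> ('a \<Rightarrow> 'b) set"
  where "lin_maps K V W = {f \<in> carrier V \<rightarrow> carrier W.
    (\<forall>x\<in>carrier V. \<forall>y\<in>carrier V. f (x \<oplus>\<^bsub>V\<^esub> y) = f x \<oplus>\<^bsub>W\<^esub> f y) \<and>
    (\<forall>a\<in>carrier K. \<forall>x\<in>carrier V. f (a \<odot>\<^bsub>V\<^esub> x) = a \<odot>\<^bsub>W\<^esub> f x)}"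

definition bilinear ::
  "('k, _) ring_scheme \<Rightarrow> ('k, 'a, _) module_scheme \<Rightarrow> ('k, 'b, _) module_scheme \<Rightarrow>
   ('k, 'c, _) module_scheme \<Rightarrow> ('a \<Rightarrow> 'b \<Rightarrow> 'c) \<Rightarrow> bool"
  where "bilinear K V W E f \<longleftrightarrow>
    (\<forall>w\<in>carrier W. (\<lambda>v. f v w) \<in> lin_maps K V E) \<and>
    (\<forall>v\<in>carrier V. f v \<in> lin_maps K W E)"

definition base_module :: "('k, _) ring_scheme \<Rightarrow> ('k, 'k) module"
  where "base_module K = \<lparr>carrier = carrier K, mult = mult K, one = one K,
    zero = zero K, add = add K, smult = mult K\<rparr>"

definition span_in :: "('k, _) ring_scheme \<Rightarrow> ('k, 'a, _) module_scheme \<Rightarrow> 'a set \<Rightarrow> 'a set"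
  where "span_in K V S = (\<lambda>N. submodule N K V) hull S"

text \<open>The ring multiplication and unit that every \<^type>\<open>module_ext\<close> record carries are irrelevant
  for a vector space; they are left unspecified in the vector spaces constructed below.\<close>

definition free_module :: "('k, _) ring_scheme \<Rightarrow> 'x set \<Rightarrow> ('k, 'x \<Rightarrow> 'k) module"
  where "free_module K X =
    \<lparr>carrier = {f. (\<forall>x. f x \<in> carrier K) \<and> finite {x. f x \<noteq> \<zero>\<^bsub>K\<^esub>} \<and> {x. f x \<noteq> \<zero>\<^bsub>K\<^esub>} \<subseteq> X},
     mult = undefined, one = undefined,
     zero = (\<lambda>_. \<zero>\<^bsub>K\<^esub>), add = (\<lambda>f g x. f x \<oplus>\<^bsub>K\<^esub> g x), smult = (\<lambda>a f x. a \<otimes>\<^bsub>K\<^esub> f x)\<rparr>"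

definition basis_elt :: "('k, _) ring_scheme \<Rightarrow> 'x \<Rightarrow> 'x \<Rightarrow> 'k"
  where "basis_elt K x = (\<lambda>y. if y = x then \<one>\<^bsub>K\<^esub> else \<zero>\<^bsub>K\<^esub>)"

definition lin_ext ::
  "('k, _) ring_scheme \<Rightarrow> ('k, 'e, _) module_scheme \<Rightarrow> ('x \<Rightarrow> 'e) \<Rightarrow> ('x \<Rightarrow> 'k) \<Rightarrow> 'e"
  where "lin_ext K E f u = (\<Oplus>\<^bsub>E\<^esub>x\<in>{x. u x \<noteq> \<zero>\<^bsub>K\<^esub>}. u x \<odot>\<^bsub>E\<^esub> f x)"

text \<open>Operations on the additive cosets of a subspace, in the style of \<^const>\<open>rcoset_mult\<close>.\<close>

definition coset_scale :: "('k, 'a, _) module_scheme \<Rightarrow> 'a set \<Rightarrow> 'k \<Rightarrow> 'a set \<Rightarrow> 'a set"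
  where "coset_scale V N a X = (\<Union>x\<in>X. N +>\<^bsub>V\<^esub> (a \<odot>\<^bsub>V\<^esub> x))"

definition coset_op ::
  "('a, _) ring_scheme \<Rightarrow> 'a set \<Rightarrow> ('a \<Rightarrow> 'a \<Rightarrow> 'a) \<Rightarrow> 'a set \<Rightarrow> 'a set \<Rightarrow> 'a set"
  where "coset_op V N f X Y = (\<Union>x\<in>X. \<Union>y\<in>Y. N +>\<^bsub>V\<^esub> (f x y))"

definition quotient_module :: "('k, 'a, _) module_scheme \<Rightarrow> 'a set \<Rightarrow> ('k, 'a set) module"
  where "quotient_module V N =
    \<lparr>carrier = a_rcosets\<^bsub>V\<^esub> N, mult = undefined, one = undefined,
     zero = N, add = set_add V, smult = coset_scale V N\<rparr>"


section \<open>Tensor products\<close>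

type_synonym ('k, 'a, 'b) tensor = "('a \<times> 'b \<Rightarrow> 'k) set"

definition tensor_rels ::
  "('k, _) ring_scheme \<Rightarrow> ('k, 'a, _) module_scheme \<Rightarrow> ('k, 'b, _) module_scheme \<Rightarrow>
   ('a \<times> 'b \<Rightarrow> 'k) set"
  where "tensor_rels K V W =
    (let F = free_module K (carrier V \<times> carrier W); e = (\<lambda>v w. basis_elt K (v, w)) in
      {e (v \<oplus>\<^bsub>V\<^esub> v') w \<ominus>\<^bsub>F\<^esub> (e v w \<oplus>\<^bsub>F\<^esub> e v' w) | v v' w.
         v \<in> carrier V \<and> v' \<in> carrier V \<and> w \<in> carrier W} \<union>
      {e v (w \<oplus>\<^bsub>W\<^esub> w') \<ominus>\<^bsub>F\<^esub> (e v w \<oplus>\<^bsub>F\<^esub> e v w') | v w w'.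
         v \<in> carrier V \<and> w \<in> carrier W \<and> w' \<in> carrier W} \<union>
      {e (a \<odot>\<^bsub>V\<^esub> v) w \<ominus>\<^bsub>F\<^esub> (a \<odot>\<^bsub>F\<^esub> e v w) | a v w.
         a \<in> carrier K \<and> v \<in> carrier V \<and> w \<in> carrier W} \<union>
      {e v (a \<odot>\<^bsub>W\<^esub> w) \<ominus>\<^bsub>F\<^esub> (a \<odot>\<^bsub>F\<^esub> e v w) | a v w.
         a \<in> carrier K \<and> v \<in> carrier V \<and> w \<in> carrier W})"

definition tensor_null ::
  "('k, _) ring_scheme \<Rightarrow> ('k, 'a, _) module_scheme \<Rightarrow> ('k, 'b, _) module_scheme \<Rightarrow>
   ('a \<times> 'b \<Rightarrow> 'k) set"
  where "tensor_null K V W =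
    span_in K (free_module K (carrier V \<times> carrier W)) (tensor_rels K V W)"

definition tensor ::
  "('k, _) ring_scheme \<Rightarrow> ('k, 'a, _) module_scheme \<Rightarrow> ('k, 'b, _) module_scheme \<Rightarrow>
   ('k, ('k, 'a, 'b) tensor) module"
  where "tensor K V W =
    quotient_module (free_module K (carrier V \<times> carrier W)) (tensor_null K V W)"

definition pure_tensor ::
  "('k, _) ring_scheme \<Rightarrow> ('k, 'a, _) module_scheme \<Rightarrow> ('k, 'b, _) module_scheme \<Rightarrow>
   'a \<Rightarrow> 'b \<Rightarrow> ('k, 'a, 'b) tensor"
  where "pure_tensor K V W v w =
    tensor_null K V W +>\<^bsub>free_module K (carrier V \<times> carrier W)\<^esub> basis_elt K (v, w)"

text \<open>The linear map out of a tensor product into \<open>E\<close> induced by a bilinear map \<open>f\<close>. For bilinear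
  \<open>f\<close> the value does not depend on the chosen representative, so that
  \<open>tensor_lift K E f X\<close> is the Sweedler-type sum of all \<open>f x1 x2\<close> for \<open>X = \<Sum> x1 \<otimes> x2\<close>.\<close>

definition tensor_lift ::
  "('k, _) ring_scheme \<Rightarrow> ('k, 'e, _) module_scheme \<Rightarrow> ('a \<Rightarrow> 'b \<Rightarrow> 'e) \<Rightarrow>
   ('k, 'a, 'b) tensor \<Rightarrow> 'e"
  where "tensor_lift K E f X = lin_ext K E (\<lambda>(v, w). f v w) (SOME u. u \<in> X)"

definition tensor_map ::
  "('k, _) ring_scheme \<Rightarrow> ('k, 'c, _) module_scheme \<Rightarrow> ('k, 'd, _) module_scheme \<Rightarrow>
   ('a \<Rightarrow> 'c) \<Rightarrow> ('b \<Rightarrow> 'd) \<Rightarrow> ('k, 'a, 'b) tensor \<Rightarrow> ('k, 'c, 'd) tensor"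
  where "tensor_map K V' W' f g =
    tensor_lift K (tensor K V' W') (\<lambda>v w. pure_tensor K V' W' (f v) (g w))"

definition tensor_assoc ::
  "('k, _) ring_scheme \<Rightarrow> ('k, 'a, _) module_scheme \<Rightarrow> ('k, 'b, _) module_scheme \<Rightarrow>
   ('k, 'c, _) module_scheme \<Rightarrow>
   ('k, 'a, ('k, 'b, 'c) tensor) tensor \<Rightarrow> ('k, ('k, 'a, 'b) tensor, 'c) tensor"
  where "tensor_assoc K U V W =
    (let T = tensor K (tensor K U V) W in
      tensor_lift K T (\<lambda>u. tensor_lift K T (\<lambda>v w.
        pure_tensor K (tensor K U V) W (pure_tensor K U V u v) w)))"

text \<open>The subspace \<open>S \<otimes> T\<close> of \<open>V \<otimes> W\<close>, for subspaces \<open>S\<close> of \<open>V\<close> and \<open>T\<close> of \<open>W\<close>.\<close>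

definition tensor_sub ::
  "('k, _) ring_scheme \<Rightarrow> ('k, 'a, _) module_scheme \<Rightarrow> ('k, 'b, _) module_scheme \<Rightarrow>
   'a set \<Rightarrow> 'b set \<Rightarrow> ('k, 'a, 'b) tensor set"
  where "tensor_sub K V W S T =
    span_in K (tensor K V W) {pure_tensor K V W s t | s t. s \<in> S \<and> t \<in> T}"


section \<open>Coalgebras\<close>

locale coalgebra = vspace K C for K (structure) and C (structure) +
  fixes \<Delta> \<epsilon>
  assumes comult_linear: "\<Delta> \<in> lin_maps K C (tensor K C C)"
    and counit_linear: "\<epsilon> \<in> lin_maps K C (base_module K)"
    and coassoc: "x \<in> carrier C \<Longrightarrow>
      tensor_map K (tensor K C C) C \<Delta> (\<lambda>y. y) (\<Delta> x) =
      tensor_assoc K C C C (tensor_map K C (tensor K C C) (\<lambda>y. y) \<Delta> (\<Delta> x))"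
    and counit_left: "x \<in> carrier C \<Longrightarrow> tensor_lift K C (\<lambda>y z. \<epsilon> y \<odot>\<^bsub>C\<^esub> z) (\<Delta> x) = x"
    and counit_right: "x \<in> carrier C \<Longrightarrow> tensor_lift K C (\<lambda>y z. \<epsilon> z \<odot>\<^bsub>C\<^esub> y) (\<Delta> x) = x"

definition subcoalgebra ::
  "('k, _) ring_scheme \<Rightarrow> ('k, 'a, _) module_scheme \<Rightarrow> ('a \<Rightarrow> ('k, 'a, 'a) tensor) \<Rightarrow> 'a set \<Rightarrow> bool"
  where "subcoalgebra K C \<Delta> S \<longleftrightarrow> submodule S K C \<and> \<Delta> ` S \<subseteq> tensor_sub K C C S S"

definition simple_subcoalgebra ::
  "('k, _) ring_scheme \<Rightarrow> ('k, 'a, _) module_scheme \<Rightarrow> ('a \<Rightarrow> ('k, 'a, 'a) tensor) \<Rightarrow> 'a set \<Rightarrow> bool"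
  where "simple_subcoalgebra K C \<Delta> S \<longleftrightarrow> subcoalgebra K C \<Delta> S \<and> S \<noteq> {\<zero>\<^bsub>C\<^esub>} \<and>
    (\<forall>T. subcoalgebra K C \<Delta> T \<and> T \<subseteq> S \<longrightarrow> T = {\<zero>\<^bsub>C\<^esub>} \<or> T = S)"

definition coradical ::
  "('k, _) ring_scheme \<Rightarrow> ('k, 'a, _) module_scheme \<Rightarrow> ('a \<Rightarrow> ('k, 'a, 'a) tensor) \<Rightarrow> 'a set"
  where "coradical K C \<Delta> = span_in K C (\<Union>{S. simple_subcoalgebra K C \<Delta> S})"

primrec coradical_filtration ::
  "('k, _) ring_scheme \<Rightarrow> ('k, 'a, _) module_scheme \<Rightarrow> ('a \<Rightarrow> ('k, 'a, 'a) tensor) \<Rightarrow> nat \<Rightarrow> 'a set"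
  where
    "coradical_filtration K C \<Delta> 0 = coradical K C \<Delta>"
  | "coradical_filtration K C \<Delta> (Suc n) = {x \<in> carrier C. \<Delta> x \<in>
      tensor_sub K C C (carrier C) (coradical_filtration K C \<Delta> n) <+>\<^bsub>tensor K C C\<^esub>
      tensor_sub K C C (coradical K C \<Delta>) (carrier C)}"

definition connected_coalgebra ::
  "('k, _) ring_scheme \<Rightarrow> ('k, 'a, _) module_scheme \<Rightarrow> ('a \<Rightarrow> ('k, 'a, 'a) tensor) \<Rightarrow> 'a \<Rightarrow> bool"
  where "connected_coalgebra K C \<Delta> u \<longleftrightarrow>
    coradical K C \<Delta> = {a \<odot>\<^bsub>C\<^esub> u | a. a \<in> carrier K} \<and>
    (\<Union>n. coradical_filtration K C \<Delta> n) = carrier C"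


section \<open>Dendriform algebras\<close>

text \<open>The multiplication inherited from the \<^type>\<open>ring_ext\<close> record is used for the associative product
  \<open>x * y = x \<prec> y + x \<succ> y\<close>. The inherited unit is meaningful for unital dendriform algebras only.\<close>

record ('k, 'a) dend = "('k, 'a) module" +
  prec :: "'a \<Rightarrow> 'a \<Rightarrow> 'a" (infixl \<open>\<prec>\<index>\<close> 70)
  succ :: "'a \<Rightarrow> 'a \<Rightarrow> 'a" (infixl \<open>\<succ>\<index>\<close> 70)

locale dendriform_algebra = vspace K D for K (structure) and D (structure) +
  assumes prec_bilinear: "bilinear K D D D (prec D)"
    and succ_bilinear: "bilinear K D D D (succ D)"
    and prec_prec: "\<lbrakk>x \<in> carrier D; y \<in> carrier D; z \<in> carrier D\<rbrakk> \<Longrightarrow>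
      (x \<prec>\<^bsub>D\<^esub> y) \<prec>\<^bsub>D\<^esub> z = x \<prec>\<^bsub>D\<^esub> (y \<prec>\<^bsub>D\<^esub> z) \<oplus>\<^bsub>D\<^esub> x \<prec>\<^bsub>D\<^esub> (y \<succ>\<^bsub>D\<^esub> z)"
    and succ_prec: "\<lbrakk>x \<in> carrier D; y \<in> carrier D; z \<in> carrier D\<rbrakk> \<Longrightarrow>
      (x \<succ>\<^bsub>D\<^esub> y) \<prec>\<^bsub>D\<^esub> z = x \<succ>\<^bsub>D\<^esub> (y \<prec>\<^bsub>D\<^esub> z)"
    and succ_succ: "\<lbrakk>x \<in> carrier D; y \<in> carrier D; z \<in> carrier D\<rbrakk> \<Longrightarrow>
      x \<succ>\<^bsub>D\<^esub> (y \<succ>\<^bsub>D\<^esub> z) = (x \<succ>\<^bsub>D\<^esub> y) \<succ>\<^bsub>D\<^esub> z \<oplus>\<^bsub>D\<^esub> (x \<prec>\<^bsub>D\<^esub> y) \<succ>\<^bsub>D\<^esub> z"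
    and star_def: "\<lbrakk>x \<in> carrier D; y \<in> carrier D\<rbrakk> \<Longrightarrow>
      x \<otimes>\<^bsub>D\<^esub> y = x \<prec>\<^bsub>D\<^esub> y \<oplus>\<^bsub>D\<^esub> x \<succ>\<^bsub>D\<^esub> y"

definition dendriform_ideal ::
  "'a set \<Rightarrow> ('k, _) ring_scheme \<Rightarrow> ('k, 'a, _) dend_scheme \<Rightarrow> bool"
  where "dendriform_ideal I K D \<longleftrightarrow> submodule I K D \<and>
    (\<forall>x\<in>carrier D. \<forall>i\<in>I. x \<prec>\<^bsub>D\<^esub> i \<in> I \<and> i \<prec>\<^bsub>D\<^esub> x \<in> I \<and> x \<succ>\<^bsub>D\<^esub> i \<in> I \<and> i \<succ>\<^bsub>D\<^esub> x \<in> I)"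

definition quotient_dend :: "('k, 'a, _) dend_scheme \<Rightarrow> 'a set \<Rightarrow> ('k, 'a set) dend"
  where "quotient_dend D I =
    \<lparr>carrier = a_rcosets\<^bsub>D\<^esub> I, mult = coset_op D I (mult D), one = undefined,
     zero = I, add = set_add D, smult = coset_scale D I,
     prec = coset_op D I (prec D), succ = coset_op D I (succ D)\<rparr>"

text \<open>\<open>\<nearrow>(x1, \<dots>, xn)\<close> and \<open>\<searrow>(x1, \<dots>, xn)\<close>, for nonempty lists.\<close>

fun nearrow :: "('k, 'a, _) dend_scheme \<Rightarrow> 'a list \<Rightarrow> 'a" where
  "nearrow D [] = undefined"
| "nearrow D [x] = x"
| "nearrow D (x # y # ys) = x \<prec>\<^bsub>D\<^esub> nearrow D (y # ys)"

definition searrow :: "('k, 'a, _) dend_scheme \<Rightarrow> 'a list \<Rightarrow> 'a"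
  where "searrow D xs = foldl (succ D) (hd xs) (tl xs)"

text \<open>The term \<open>\<nearrow>us \<succ> x \<prec> \<searrow>vs\<close>, in which an empty list \<open>us\<close> or \<open>vs\<close> contributes no factor.\<close>

definition brace_term :: "('k, 'a, _) dend_scheme \<Rightarrow> 'a \<Rightarrow> 'a list \<Rightarrow> 'a list \<Rightarrow> 'a"
  where "brace_term D x us vs =
    (let y = (if us = [] then x else nearrow D us \<succ>\<^bsub>D\<^esub> x)
     in if vs = [] then y else y \<prec>\<^bsub>D\<^esub> searrow D vs)"

text \<open>The brace \<open>{x | ys}\<close> of the underlying brace algebra; here \<open>{x | } = x\<close>.\<close>

definition dend_brace :: "('k, 'a, _) dend_scheme \<Rightarrow> 'a \<Rightarrow> 'a list \<Rightarrow> 'a"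
  where "dend_brace D x ys = (\<Oplus>\<^bsub>D\<^esub>i\<in>{..length ys}.
    (if even i then brace_term D x (take i ys) (drop i ys)
     else \<ominus>\<^bsub>D\<^esub> brace_term D x (take i ys) (drop i ys)))"


subsection \<open>The free dendriform algebra on a vector space\<close>

text \<open>The free algebra with two bilinear operations has the binary monomials as a basis;
  \<open>D(V)\<close> is its quotient by the dendriform relations and the linearity of the generators.\<close>

datatype 'v dmon = Gen 'v | PrecM "'v dmon" "'v dmon" | SuccM "'v dmon" "'v dmon"

definition free_magmatic ::
  "('k, _) ring_scheme \<Rightarrow> ('k, 'v, _) module_scheme \<Rightarrow> ('k, 'v dmon \<Rightarrow> 'k) dend"
  where "free_magmatic K V =
    (let F = free_module K {t. set_dmon t \<subseteq> carrier V};
         p = (\<lambda>x y t. case t of PrecM s r \<Rightarrow> x s \<otimes>\<^bsub>K\<^esub> y r | _ \<Rightarrow> \<zero>\<^bsub>K\<^esub>);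
         q = (\<lambda>x y t. case t of SuccM s r \<Rightarrow> x s \<otimes>\<^bsub>K\<^esub> y r | _ \<Rightarrow> \<zero>\<^bsub>K\<^esub>)
     in \<lparr>carrier = carrier F, mult = (\<lambda>x y. p x y \<oplus>\<^bsub>F\<^esub> q x y), one = undefined,
         zero = zero F, add = add F, smult = smult F, prec = p, succ = q\<rparr>)"

definition free_dend_rels ::
  "('k, _) ring_scheme \<Rightarrow> ('k, 'v, _) module_scheme \<Rightarrow> ('v dmon \<Rightarrow> 'k) set"
  where "free_dend_rels K V =
    (let F = free_magmatic K V; g = (\<lambda>v. basis_elt K (Gen v)) in
      {g (v \<oplus>\<^bsub>V\<^esub> w) \<ominus>\<^bsub>F\<^esub> (g v \<oplus>\<^bsub>F\<^esub> g w) | v w. v \<in> carrier V \<and> w \<in> carrier V} \<union>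
      {g (a \<odot>\<^bsub>V\<^esub> v) \<ominus>\<^bsub>F\<^esub> (a \<odot>\<^bsub>F\<^esub> g v) | a v. a \<in> carrier K \<and> v \<in> carrier V} \<union>
      {(x \<prec>\<^bsub>F\<^esub> y) \<prec>\<^bsub>F\<^esub> z \<ominus>\<^bsub>F\<^esub> (x \<prec>\<^bsub>F\<^esub> (y \<prec>\<^bsub>F\<^esub> z) \<oplus>\<^bsub>F\<^esub> x \<prec>\<^bsub>F\<^esub> (y \<succ>\<^bsub>F\<^esub> z)) | x y z.
         x \<in> carrier F \<and> y \<in> carrier F \<and> z \<in> carrier F} \<union>
      {(x \<succ>\<^bsub>F\<^esub> y) \<prec>\<^bsub>F\<^esub> z \<ominus>\<^bsub>F\<^esub> x \<succ>\<^bsub>F\<^esub> (y \<prec>\<^bsub>F\<^esub> z) | x y z.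
         x \<in> carrier F \<and> y \<in> carrier F \<and> z \<in> carrier F} \<union>
      {x \<succ>\<^bsub>F\<^esub> (y \<succ>\<^bsub>F\<^esub> z) \<ominus>\<^bsub>F\<^esub> ((x \<succ>\<^bsub>F\<^esub> y) \<succ>\<^bsub>F\<^esub> z \<oplus>\<^bsub>F\<^esub> (x \<prec>\<^bsub>F\<^esub> y) \<succ>\<^bsub>F\<^esub> z) | x y z.
         x \<in> carrier F \<and> y \<in> carrier F \<and> z \<in> carrier F})"

definition free_dend_null ::
  "('k, _) ring_scheme \<Rightarrow> ('k, 'v, _) module_scheme \<Rightarrow> ('v dmon \<Rightarrow> 'k) set"
  where "free_dend_null K V =
    (\<lambda>I. dendriform_ideal I K (free_magmatic K V)) hull free_dend_rels K V"

definition free_dend ::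
  "('k, _) ring_scheme \<Rightarrow> ('k, 'v, _) module_scheme \<Rightarrow> ('k, ('v dmon \<Rightarrow> 'k) set) dend"
  where "free_dend K V = quotient_dend (free_magmatic K V) (free_dend_null K V)"

definition free_gen ::
  "('k, _) ring_scheme \<Rightarrow> ('k, 'v, _) module_scheme \<Rightarrow> 'v \<Rightarrow> ('v dmon \<Rightarrow> 'k) set"
  where "free_gen K V v = free_dend_null K V +>\<^bsub>free_magmatic K V\<^esub> basis_elt K (Gen v)"


section \<open>Unital dendriform algebras\<close>

text \<open>\<open>pos W\<close> is the summand \<open>W\<^sup>+ = V\<close> of \<open>W = K \<cdot> 1 \<oplus> V\<close>. The multiplication is \<open>*\<close>, extended
  bilinearly to all of \<open>W\<close> by \<open>1 * 1 = 1\<close>.\<close>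

record ('k, 'a) udend = "('k, 'a) dend" +
  pos :: "'a set"

definition plus_part :: "('k, 'a, _) udend_scheme \<Rightarrow> ('k, 'a) dend"
  where "plus_part W = dend.truncate W \<lparr>carrier := pos W\<rparr>"

text \<open>The operations \<open>\<prec>\<close>, \<open>\<succ>\<close> are maps on \<open>V \<otimes> W + W \<otimes> V\<close>: nothing is assumed about the values
  of the total functions \<^const>\<open>prec\<close> and \<^const>\<open>succ\<close> at \<open>(1, 1)\<close>.\<close>

locale unital_dendriform_algebra = vspace K W for K (structure) and W (structure) +
  assumes one_in_carrier: "\<one>\<^bsub>W\<^esub> \<in> carrier W"
    and pos_submodule: "submodule (pos W) K W"
    and decomposition: "x \<in> carrier W \<Longrightarrow>
      \<exists>!(a, v). a \<in> carrier K \<and> v \<in> pos W \<and> x = a \<odot>\<^bsub>W\<^esub> \<one>\<^bsub>W\<^esub> \<oplus>\<^bsub>W\<^esub> v"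
    and plus_dendriform: "dendriform_algebra K (plus_part W)"
    and prec_bilinear_left: "bilinear K (plus_part W) W (plus_part W) (prec W)"
    and prec_bilinear_right: "bilinear K W (plus_part W) (plus_part W) (prec W)"
    and succ_bilinear_left: "bilinear K (plus_part W) W (plus_part W) (succ W)"
    and succ_bilinear_right: "bilinear K W (plus_part W) (plus_part W) (succ W)"
    and one_prec: "x \<in> pos W \<Longrightarrow> \<one>\<^bsub>W\<^esub> \<prec>\<^bsub>W\<^esub> x = \<zero>\<^bsub>W\<^esub>"
    and succ_one: "x \<in> pos W \<Longrightarrow> x \<succ>\<^bsub>W\<^esub> \<one>\<^bsub>W\<^esub> = \<zero>\<^bsub>W\<^esub>"
    and prec_one: "x \<in> pos W \<Longrightarrow> x \<prec>\<^bsub>W\<^esub> \<one>\<^bsub>W\<^esub> = x"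
    and one_succ: "x \<in> pos W \<Longrightarrow> \<one>\<^bsub>W\<^esub> \<succ>\<^bsub>W\<^esub> x = x"
    and star_bilinear: "bilinear K W W W (mult W)"
    and star_one_one: "\<one>\<^bsub>W\<^esub> \<otimes>\<^bsub>W\<^esub> \<one>\<^bsub>W\<^esub> = \<one>\<^bsub>W\<^esub>"
    and star_pos_left: "\<lbrakk>x \<in> pos W; y \<in> carrier W\<rbrakk> \<Longrightarrow>
      x \<otimes>\<^bsub>W\<^esub> y = x \<prec>\<^bsub>W\<^esub> y \<oplus>\<^bsub>W\<^esub> x \<succ>\<^bsub>W\<^esub> y"
    and star_pos_right: "\<lbrakk>x \<in> carrier W; y \<in> pos W\<rbrakk> \<Longrightarrow>
      x \<otimes>\<^bsub>W\<^esub> y = x \<prec>\<^bsub>W\<^esub> y \<oplus>\<^bsub>W\<^esub> x \<succ>\<^bsub>W\<^esub> y"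

definition unital_dend_homs ::
  "('k, _) ring_scheme \<Rightarrow> ('k, 'a, _) udend_scheme \<Rightarrow> ('k, 'b, _) udend_scheme \<Rightarrow> ('a \<Rightarrow> 'b) set"
  where "unital_dend_homs K W W' = {f \<in> lin_maps K W W'.
    f \<one>\<^bsub>W\<^esub> = \<one>\<^bsub>W'\<^esub> \<and> f ` pos W \<subseteq> pos W' \<and>
    (\<forall>x\<in>pos W. \<forall>y\<in>pos W. f (x \<prec>\<^bsub>W\<^esub> y) = f x \<prec>\<^bsub>W'\<^esub> f y \<and> f (x \<succ>\<^bsub>W\<^esub> y) = f x \<succ>\<^bsub>W'\<^esub> f y)}"

definition unitization ::
  "('k, _) ring_scheme \<Rightarrow> ('k, 'a, _) dend_scheme \<Rightarrow> ('k, 'k \<times> 'a) udend"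
  where "unitization K D =
    \<lparr>carrier = carrier K \<times> carrier D,
     mult = (\<lambda>(a, x) (b, y). (a \<otimes>\<^bsub>K\<^esub> b, x \<otimes>\<^bsub>D\<^esub> y \<oplus>\<^bsub>D\<^esub> a \<odot>\<^bsub>D\<^esub> y \<oplus>\<^bsub>D\<^esub> b \<odot>\<^bsub>D\<^esub> x)),
     one = (\<one>\<^bsub>K\<^esub>, \<zero>\<^bsub>D\<^esub>),
     zero = (\<zero>\<^bsub>K\<^esub>, \<zero>\<^bsub>D\<^esub>),
     add = (\<lambda>(a, x) (b, y). (a \<oplus>\<^bsub>K\<^esub> b, x \<oplus>\<^bsub>D\<^esub> y)),
     smult = (\<lambda>c (a, x). (c \<otimes>\<^bsub>K\<^esub> a, c \<odot>\<^bsub>D\<^esub> x)),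
     prec = (\<lambda>(a, x) (b, y). (\<zero>\<^bsub>K\<^esub>, x \<prec>\<^bsub>D\<^esub> y \<oplus>\<^bsub>D\<^esub> b \<odot>\<^bsub>D\<^esub> x)),
     succ = (\<lambda>(a, x) (b, y). (\<zero>\<^bsub>K\<^esub>, x \<succ>\<^bsub>D\<^esub> y \<oplus>\<^bsub>D\<^esub> a \<odot>\<^bsub>D\<^esub> y)),
     pos = {\<zero>\<^bsub>K\<^esub>} \<times> carrier D\<rparr>"

text \<open>The projections of \<open>W = K \<cdot> 1 \<oplus> V\<close> onto \<open>K\<close> and onto \<open>V\<close>.\<close>

definition proj_unit :: "('k, _) ring_scheme \<Rightarrow> ('k, 'a, _) udend_scheme \<Rightarrow> 'a \<Rightarrow> 'k"
  where "proj_unit K W x =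
    (THE a. a \<in> carrier K \<and> (\<exists>v\<in>pos W. x = a \<odot>\<^bsub>W\<^esub> \<one>\<^bsub>W\<^esub> \<oplus>\<^bsub>W\<^esub> v))"

definition proj_pos :: "('k, _) ring_scheme \<Rightarrow> ('k, 'a, _) udend_scheme \<Rightarrow> 'a \<Rightarrow> 'a"
  where "proj_pos K W x = x \<ominus>\<^bsub>W\<^esub> proj_unit K W x \<odot>\<^bsub>W\<^esub> \<one>\<^bsub>W\<^esub>"

text \<open>For \<open>f\<close> one of \<open>\<prec>\<close>, \<open>\<succ>\<close>: the bilinear extension of \<open>f\<close> from \<open>V \<otimes> W + W \<otimes> V\<close> to \<open>W \<otimes> W\<close> which
  omits the undefined term \<open>f 1 1\<close>.\<close>

definition omit_unit ::
  "('k, _) ring_scheme \<Rightarrow> ('k, 'a, _) udend_scheme \<Rightarrow> ('a \<Rightarrow> 'a \<Rightarrow> 'a) \<Rightarrow> 'a \<Rightarrow> 'a \<Rightarrow> 'a"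
  where "omit_unit K W f x y =
    f x (proj_pos K W y) \<oplus>\<^bsub>W\<^esub> proj_unit K W y \<odot>\<^bsub>W\<^esub> f (proj_pos K W x) \<one>\<^bsub>W\<^esub>"


section \<open>Dendriform bialgebras\<close>

record ('k, 'a) dend_bialg = "('k, 'a) udend" +
  comult :: "'a \<Rightarrow> ('k, 'a, 'a) tensor"

text \<open>\<open>\<Sum> (x1 * y1) \<otimes> f x2 y2\<close> in Sweedler notation, without the term where \<open>x2 = y2 = 1\<close>.\<close>

definition sweedler_prod ::
  "('k, _) ring_scheme \<Rightarrow> ('k, 'a, _) dend_bialg_scheme \<Rightarrow> ('a \<Rightarrow> 'a \<Rightarrow> 'a) \<Rightarrow>
   'a \<Rightarrow> 'a \<Rightarrow> ('k, 'a, 'a) tensor"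
  where "sweedler_prod K W f x y =
    tensor_lift K (tensor K W W) (\<lambda>x1 x2.
      tensor_lift K (tensor K W W) (\<lambda>y1 y2.
        pure_tensor K W W (x1 \<otimes>\<^bsub>W\<^esub> y1) (omit_unit K W f x2 y2))
      (comult W y)) (comult W x)"

locale dendriform_bialgebra =
  unital_dendriform_algebra K W + coalgebra K W "comult W" "proj_unit K W"
  for K (structure) and W (structure) +
  assumes comult_one: "comult W \<one>\<^bsub>W\<^esub> = pure_tensor K W W \<one>\<^bsub>W\<^esub> \<one>\<^bsub>W\<^esub>"
    and comult_succ: "\<lbrakk>x \<in> pos W; y \<in> pos W\<rbrakk> \<Longrightarrow>
      comult W (x \<succ>\<^bsub>W\<^esub> y) = sweedler_prod K W (succ W) x y
        \<oplus>\<^bsub>tensor K W W\<^esub> pure_tensor K W W (x \<succ>\<^bsub>W\<^esub> y) \<one>\<^bsub>W\<^esub>"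
    and comult_prec: "\<lbrakk>x \<in> pos W; y \<in> pos W\<rbrakk> \<Longrightarrow>
      comult W (x \<prec>\<^bsub>W\<^esub> y) = sweedler_prod K W (prec W) x y
        \<oplus>\<^bsub>tensor K W W\<^esub> pure_tensor K W W (x \<prec>\<^bsub>W\<^esub> y) \<one>\<^bsub>W\<^esub>"

definition dend_bialg_homs ::
  "('k, _) ring_scheme \<Rightarrow> ('k, 'a, _) dend_bialg_scheme \<Rightarrow> ('k, 'b, _) dend_bialg_scheme \<Rightarrow>
   ('a \<Rightarrow> 'b) set"
  where "dend_bialg_homs K W W' = {f \<in> unital_dend_homs K W W'.
    (\<forall>x\<in>carrier W. comult W' (f x) = tensor_map K W' W' f f (comult W x)) \<and>
    (\<forall>x\<in>carrier W. proj_unit K W' (f x) = proj_unit K W x)}"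

definition dend_bialg_isos ::
  "('k, _) ring_scheme \<Rightarrow> ('k, 'a, _) dend_bialg_scheme \<Rightarrow> ('k, 'b, _) dend_bialg_scheme \<Rightarrow>
   ('a \<Rightarrow> 'b) set"
  where "dend_bialg_isos K W W' =
    {f \<in> dend_bialg_homs K W W'. bij_betw f (carrier W) (carrier W')}"

definition connected_dend_bialg ::
  "('k, _) ring_scheme \<Rightarrow> ('k, 'a, _) dend_bialg_scheme \<Rightarrow> bool"
  where "connected_dend_bialg K W \<longleftrightarrow>
    dendriform_bialgebra K W \<and> connected_coalgebra K W (comult W) \<one>\<^bsub>W\<^esub>"

definition with_comult ::
  "('k, 'a) udend \<Rightarrow> ('a \<Rightarrow> ('k, 'a, 'a) tensor) \<Rightarrow> ('k, 'a) dend_bialg"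
  where "with_comult W \<Delta> = udend.extend W (dend_bialg.fields \<Delta>)"

definition prim :: "('k, _) ring_scheme \<Rightarrow> ('k, 'a, _) dend_bialg_scheme \<Rightarrow> 'a set"
  where "prim K W = {x \<in> carrier W. comult W x =
    pure_tensor K W W x \<one>\<^bsub>W\<^esub> \<oplus>\<^bsub>tensor K W W\<^esub> pure_tensor K W W \<one>\<^bsub>W\<^esub> x}"


section \<open>Brace operations and the enveloping algebra\<close>

text \<open>\<open>brace B x ys\<close> is \<open>{x | ys}\<close>, for nonempty \<open>ys\<close>. The enveloping algebra \<open>U(B)\<close> is constructed from
  the operations of \<open>B\<close> alone, so the identities of a brace algebra do not enter its definition.\<close>

record ('k, 'a) brace_alg = "('k, 'a) module" +
  brace :: "'a \<Rightarrow> 'a list \<Rightarrow> 'a"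

definition prim_brace ::
  "('k, _) ring_scheme \<Rightarrow> ('k, 'a, _) dend_bialg_scheme \<Rightarrow> ('k, 'a) brace_alg"
  where "prim_brace K W =
    \<lparr>carrier = prim K W, mult = undefined, one = undefined, zero = zero W, add = add W,
     smult = smult W, brace = dend_brace (plus_part W)\<rparr>"

definition env_rels ::
  "('k, _) ring_scheme \<Rightarrow> ('k, 'a, _) brace_alg_scheme \<Rightarrow> ('a dmon \<Rightarrow> 'k) set set"
  where "env_rels K B =
    (let F = free_dend K B; g = free_gen K B in
      {dend_brace F (g x) (map g ys) \<ominus>\<^bsub>F\<^esub> g (brace B x ys) | x ys.
         x \<in> carrier B \<and> ys \<noteq> [] \<and> set ys \<subseteq> carrier B})"

definition env_null ::
  "('k, _) ring_scheme \<Rightarrow> ('k, 'a, _) brace_alg_scheme \<Rightarrow> ('a dmon \<Rightarrow> 'k) set set"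
  where "env_null K B = (\<lambda>I. dendriform_ideal I K (free_dend K B)) hull env_rels K B"

definition env_proj ::
  "('k, _) ring_scheme \<Rightarrow> ('k, 'a, _) brace_alg_scheme \<Rightarrow>
   ('a dmon \<Rightarrow> 'k) set \<Rightarrow> ('a dmon \<Rightarrow> 'k) set set"
  where "env_proj K B x = env_null K B +>\<^bsub>free_dend K B\<^esub> x"

definition env ::
  "('k, _) ring_scheme \<Rightarrow> ('k, 'a, _) brace_alg_scheme \<Rightarrow> ('k, ('a dmon \<Rightarrow> 'k) set set) dend"
  where "env K B = quotient_dend (free_dend K B) (env_null K B)"

text \<open>The dendriform bialgebra structure on the unitization of \<open>D(V)\<close> for which the elements of \<open>V\<close>
  are primitive, and the coproduct that it induces on the unitization of \<open>U(B)\<close>.\<close>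

definition free_comult ::
  "('k, _) ring_scheme \<Rightarrow> ('k, 'v, _) module_scheme \<Rightarrow>
   'k \<times> ('v dmon \<Rightarrow> 'k) set \<Rightarrow>
   ('k, 'k \<times> ('v dmon \<Rightarrow> 'k) set, 'k \<times> ('v dmon \<Rightarrow> 'k) set) tensor"
  where "free_comult K V =
    (let W = unitization K (free_dend K V) in
      THE \<Delta>. \<Delta> \<in> extensional (carrier W) \<and> dendriform_bialgebra K (with_comult W \<Delta>) \<and>
        (\<forall>v\<in>carrier V. (\<zero>\<^bsub>K\<^esub>, free_gen K V v) \<in> prim K (with_comult W \<Delta>)))"

definition env_comult ::
  "('k, _) ring_scheme \<Rightarrow> ('k, 'a, _) brace_alg_scheme \<Rightarrow>
   'k \<times> ('a dmon \<Rightarrow> 'k) set set \<Rightarrow>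
   ('k, 'k \<times> ('a dmon \<Rightarrow> 'k) set set, 'k \<times> ('a dmon \<Rightarrow> 'k) set set) tensor"
  where "env_comult K B =
    (let W = unitization K (free_dend K B); U = unitization K (env K B);
         \<pi> = map_prod (\<lambda>a. a) (env_proj K B) in
      THE \<Delta>. \<Delta> \<in> extensional (carrier U) \<and>
        (\<forall>x\<in>carrier W. \<Delta> (\<pi> x) = tensor_map K U U \<pi> \<pi> (free_comult K B x)))"

definition env_bialg ::
  "('k, _) ring_scheme \<Rightarrow> ('k, 'a, _) brace_alg_scheme \<Rightarrow>
   ('k, 'k \<times> ('a dmon \<Rightarrow> 'k) set set) dend_bialg"
  where "env_bialg K B = with_comult (unitization K (env K B)) (env_comult K B)"

definition env_gen ::
  "('k, _) ring_scheme \<Rightarrow> ('k, 'a, _) brace_alg_scheme \<Rightarrow> 'a \<Rightarrow> 'k \<times> ('a dmon \<Rightarrow> 'k) set set"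
  where "env_gen K B b = (\<zero>\<^bsub>K\<^esub>, env_proj K B (free_gen K B b))"

text \<open>The morphism of unital dendriform algebras to \<open>W\<close> that corresponds by adjunction to the
  morphism of brace algebras \<open>g\<close> from \<open>B\<close> to \<open>W\<^sup>+\<close>.\<close>

definition env_adjunct ::
  "('k, _) ring_scheme \<Rightarrow> ('k, 'a, _) brace_alg_scheme \<Rightarrow> ('k, 'b, _) udend_scheme \<Rightarrow> ('a \<Rightarrow> 'b) \<Rightarrow>
   'k \<times> ('a dmon \<Rightarrow> 'k) set set \<Rightarrow> 'b"
  where "env_adjunct K B W g =
    (THE h. h \<in> extensional (carrier (env_bialg K B)) \<and> h \<in> unital_dend_homs K (env_bialg K B) W \<and>
      (\<forall>b\<in>carrier B. h (env_gen K B b) = g b))"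

definition env_map ::
  "('k, _) ring_scheme \<Rightarrow> ('k, 'a, _) brace_alg_scheme \<Rightarrow> ('k, 'b, _) brace_alg_scheme \<Rightarrow> ('a \<Rightarrow> 'b) \<Rightarrow>
   'k \<times> ('a dmon \<Rightarrow> 'k) set set \<Rightarrow> 'k \<times> ('b dmon \<Rightarrow> 'k) set set"
  where "env_map K B B' f = env_adjunct K B (env_bialg K B') (\<lambda>b. env_gen K B' (f b))"

definition canonical_map ::
  "('k, _) ring_scheme \<Rightarrow> ('k, 'a, _) dend_bialg_scheme \<Rightarrow>
   'k \<times> ('a dmon \<Rightarrow> 'k) set set \<Rightarrow> 'a"
  where "canonical_map K W = env_adjunct K (prim_brace K W) W (\<lambda>b. b)"

end

theory Submission
  imports Defs
begin

text \<open>The products are extended to maps on \<open>W \<otimes> W\<close> that vanish on \<open>1 \<otimes> 1\<close>; a dendriform bialgebra is then such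
  an algebra whose coproduct is a morphism into the tensor square. Since a word \<open>\<searrow>(b\<^sub>1, \<dots>, b\<^sub>n)\<close> in
  primitive elements has the deconcatenation coproduct, the recursion \<open>e(x) = x - \<Sum> x\<^sub>1 \<succ> e(x\<^sub>2)\<close>, with \<open>x\<close>
  and \<open>x\<^sub>1\<close> projected to the augmentation ideal, defines on a connected bialgebra a projection onto the
  primitive elements that kills all words of length at least two. Iterating the recursion writes every
  element of \<open>D\<close> as a combination of words in primitive elements, so the canonical map is surjective.
  In \<open>U(B)\<close> the brace relations rewrite \<open>b \<prec> \<searrow>(c)\<close> as a combination of words, so \<open>U(B)\<close> is spanned by words
  too; and \<open>e\<close> splits off the last letter of a word in \<open>D\<close>, which recursively gives a left inverse of the
  canonical map.\<close>

section \<open>Linear algebra\<close>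

text \<open>With total products every structure map of a bialgebra (coproduct, reassociation of
  tensors, counits) is a morphism of one kind of algebra, so coassociativity, the counit laws,
  compatibility with coproducts and naturality all reduce to equalities on generators. The brace
  formula comes from convolution of functions on words. The signed left products
  \<open>aug_n\<close> and the right products \<open>aug_s\<close> are convolution inverses, so {b |
  c} = sum of \<open>n v\<close> \<succ> b \<prec> \<open>s w\<close> over c = v w is what one gets
  by solving b \<prec> \<open>s c\<close> = sum of \<open>s v\<close> \<succ> {b | w} for the brace.
  The same cancellation, carried out in W \<otimes> W, shows that x -> x \<otimes> 1 + 1 \<otimes> x
  respects braces. This one fact yields both the coproduct of U(B) and the closure of primitive
  elements under braces. Two obstacles shape the second half. The recursion for e does not decrease
  its argument, so e is the stable value of approximations controlled by the coradical filtration.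
  And word length is not a function on U(B), so the left inverse is a sequence of maps that
  eventually fixes each element.\<close>

lemma lin_mapsI:
  assumes "\<And>x. x \<in> carrier V \<Longrightarrow> f x \<in> carrier W"
    and "\<And>x y. \<lbrakk>x \<in> carrier V; y \<in> carrier V\<rbrakk> \<Longrightarrow> f (x \<oplus>\<^bsub>V\<^esub> y) = f x \<oplus>\<^bsub>W\<^esub> f y"
    and "\<And>a x. \<lbrakk>a \<in> carrier K; x \<in> carrier V\<rbrakk> \<Longrightarrow> f (a \<odot>\<^bsub>V\<^esub> x) = a \<odot>\<^bsub>W\<^esub> f x"
  shows "f \<in> lin_maps K V W"
  using assms by (simp add: lin_maps_def)

lemma lin_closed: "\<lbrakk>f \<in> lin_maps K V W; x \<in> carrier V\<rbrakk> \<Longrightarrow> f x \<in> carrier W"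
  and lin_add: "\<lbrakk>f \<in> lin_maps K V W; x \<in> carrier V; y \<in> carrier V\<rbrakk> \<Longrightarrow> f (x \<oplus>\<^bsub>V\<^esub> y) = f x \<oplus>\<^bsub>W\<^esub> f y"
  and lin_smult: "\<lbrakk>f \<in> lin_maps K V W; a \<in> carrier K; x \<in> carrier V\<rbrakk> \<Longrightarrow> f (a \<odot>\<^bsub>V\<^esub> x) = a \<odot>\<^bsub>W\<^esub> f x"
  by (auto simp: lin_maps_def)

lemmas lin_simps = lin_closed lin_add lin_smult

lemma vspace_field: "vspace K V \<Longrightarrow> field K"
  and vspace_module: "vspace K V \<Longrightarrow> module K V"
  by (simp_all add: vspace_def module_def)

lemma vspaceI:
  assumes "field K" "module K V" shows "vspace K V"
  using assms by (simp add: vspace_def)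

section \<open>Linear maps, subspaces and spans\<close>

context vspace begin

lemma minus_smult: "x \<in> carrier V \<Longrightarrow> \<ominus>\<^bsub>V\<^esub> x = (\<ominus>\<^bsub>K\<^esub> \<one>\<^bsub>K\<^esub>) \<odot>\<^bsub>V\<^esub> x"
  by (simp add: smult_l_minus)

lemma minus_zero [simp]: "x \<in> carrier V \<Longrightarrow> x \<ominus>\<^bsub>V\<^esub> \<zero>\<^bsub>V\<^esub> = x"
  by (simp add: a_minus_def)

lemma minus_eq_zero_iff: "\<lbrakk>x \<in> carrier V; y \<in> carrier V\<rbrakk> \<Longrightarrow> x \<ominus>\<^bsub>V\<^esub> y = \<zero>\<^bsub>V\<^esub> \<longleftrightarrow> x = y"
  by (metis a_inv_closed a_minus_def add.inv_equality minus_minus r_neg)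

lemma lin_zero_vec: "\<lbrakk>vspace K W; f \<in> lin_maps K V W\<rbrakk> \<Longrightarrow> f \<zero>\<^bsub>V\<^esub> = \<zero>\<^bsub>W\<^esub>"
  using lin_smult[of f K V W "\<zero>\<^bsub>K\<^esub>" "\<zero>\<^bsub>V\<^esub>"] lin_closed[of f K V W "\<zero>\<^bsub>V\<^esub>"]
    module.smult_l_null[OF vspace_module] by fastforce

lemma lin_neg:
  assumes "vspace K W" "f \<in> lin_maps K V W" "x \<in> carrier V"
  shows "f (\<ominus>\<^bsub>V\<^esub> x) = \<ominus>\<^bsub>W\<^esub> f x"
  using assms minus_smult[of x] lin_smult[OF assms(2), of "\<ominus>\<^bsub>K\<^esub> \<one>\<^bsub>K\<^esub>" x]
    vspace.minus_smult[OF assms(1), of "f x"] lin_closed[OF assms(2)] by simp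

lemma lin_minus:
  assumes "vspace K W" "f \<in> lin_maps K V W" "x \<in> carrier V" "y \<in> carrier V"
  shows "f (x \<ominus>\<^bsub>V\<^esub> y) = f x \<ominus>\<^bsub>W\<^esub> f y"
  using assms by (simp add: a_minus_def lin_neg lin_add[OF assms(2)])

text \<open>Negation is multiplication by -1, so closure under scalars already yields the additive
  inverses that \<open>submoduleI\<close> asks for.\<close>

lemma submodule_spaceI:
  assumes "H \<subseteq> carrier V" "\<zero>\<^bsub>V\<^esub> \<in> H" "\<And>x y. \<lbrakk>x \<in> H; y \<in> H\<rbrakk> \<Longrightarrow> x \<oplus>\<^bsub>V\<^esub> y \<in> H"
    "\<And>a x. \<lbrakk>a \<in> carrier K; x \<in> H\<rbrakk> \<Longrightarrow> a \<odot>\<^bsub>V\<^esub> x \<in> H"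
  shows "submodule H K V"
proof (rule submoduleI)
  fix x assume "x \<in> H"
  then show "\<ominus>\<^bsub>V\<^esub> x \<in> H" using assms(1) assms(4)[of "\<ominus>\<^bsub>K\<^esub> \<one>\<^bsub>K\<^esub>" x] by (subst minus_smult) auto
qed (use assms in auto)

lemma submodule_zero: "submodule H K V \<Longrightarrow> \<zero>\<^bsub>V\<^esub> \<in> H"
  by (metis a_inv_def monoid.select_convs(2) submodule.axioms(1) subgroup.one_closed)

lemmas submodule_facts = submoduleE(1)[THEN subsetD] submodule_zero submoduleE(3-5)

lemma lin_equalizer_submodule:
  assumes "vspace K W" "f \<in> lin_maps K V W" "g \<in> lin_maps K V W"
  shows "submodule {x \<in> carrier V. f x = g x} K V"
  by (rule submodule_spaceI)
    (auto simp: lin_zero_vec[OF assms(1)] assms lin_add[OF assms(2)] lin_add[OF assms(3)]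
      lin_smult[OF assms(2)] lin_smult[OF assms(3)])

lemma lin_vimage_submodule:
  assumes W: "vspace K W" and f: "f \<in> lin_maps K V W" and H: "submodule H K W"
  shows "submodule {x \<in> carrier V. f x \<in> H} K V"
proof -
  interpret W: vspace K W by fact
  show ?thesis
    by (rule submodule_spaceI)
      (auto simp: lin_zero_vec[OF W f] lin_add[OF f] lin_smult[OF f] W.submodule_facts[OF H])
qed

lemma lin_image_submodule:
  assumes W: "vspace K W" and f: "f \<in> lin_maps K V W"
  shows "submodule (f ` carrier V) K W"
proof -
  interpret W: vspace K W by fact
  show ?thesis
    by (rule W.submodule_spaceI)
      (auto simp: lin_closed[OF f] lin_add[OF f, symmetric] lin_smult[OF f, symmetric]
        intro!: image_eqI[where f = f, OF lin_zero_vec[OF W f, symmetric]])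
qed

lemma submodule_Inter:
  assumes "\<And>N. N \<in> \<N> \<Longrightarrow> submodule N K V" "\<N> \<noteq> {}"
  shows "submodule (\<Inter>\<N>) K V"
  using assms by (intro submodule_spaceI) (auto dest: submodule_facts(1) intro: submodule_facts)

lemma span_submodule: "S \<subseteq> carrier V \<Longrightarrow> submodule (span_in K V S) K V"
  unfolding span_in_def hull_def using carrier_is_submodule by (intro submodule_Inter) auto

lemma span_incl: "x \<in> S \<Longrightarrow> x \<in> span_in K V S"
  unfolding span_in_def by (rule hull_inc)

lemma span_least: "\<lbrakk>S \<subseteq> N; submodule N K V\<rbrakk> \<Longrightarrow> span_in K V S \<subseteq> N"
  unfolding span_in_def by (rule hull_minimal)

lemma lin_eq_on_span:
  assumes "x \<in> span_in K V S" "S \<subseteq> carrier V" "vspace K W"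
    "f \<in> lin_maps K V W" "g \<in> lin_maps K V W" "\<And>x. x \<in> S \<Longrightarrow> f x = g x"
  shows "f x = g x"
proof -
  have "span_in K V S \<subseteq> {x \<in> carrier V. f x = g x}"
    using assms(2,6) by (intro span_least[OF _ lin_equalizer_submodule[OF assms(3-5)]]) auto
  then show ?thesis using assms(1) by auto
qed

end

lemma lin_id: "(\<lambda>x. x) \<in> lin_maps K V V"
  by (simp add: lin_maps_def)

lemma lin_comp: "\<lbrakk>f \<in> lin_maps K V W; g \<in> lin_maps K W U\<rbrakk> \<Longrightarrow> (\<lambda>x. g (f x)) \<in> lin_maps K V U"
  by (auto simp: lin_maps_def Pi_def)

lemma lin_cong:
  assumes "f \<in> lin_maps K V W" "\<And>x. x \<in> carrier V \<Longrightarrow> g x = f x" "vspace K V"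
  shows "g \<in> lin_maps K V W"
proof -
  interpret V: vspace K V by fact
  show ?thesis using assms(2) by (intro lin_mapsI) (simp_all add: lin_simps[OF assms(1)])
qed

lemma lin_zero_map:
  assumes "vspace K W" shows "(\<lambda>_. \<zero>\<^bsub>W\<^esub>) \<in> lin_maps K V W"
proof -
  interpret W: vspace K W by fact
  show ?thesis by (intro lin_mapsI) simp_all
qed

lemma lin_sum:
  assumes "vspace K W" and f: "f \<in> lin_maps K V W" and g: "g \<in> lin_maps K V W"
  shows "(\<lambda>x. f x \<oplus>\<^bsub>W\<^esub> g x) \<in> lin_maps K V W"
proof -
  interpret W: vspace K W by fact
  show ?thesis by (intro lin_mapsI) (simp_all add: lin_simps[OF f] lin_simps[OF g] W.a_ac W.smult_r_distr)
qed

lemma lin_diff: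
  assumes W: "vspace K W" and f: "f \<in> lin_maps K V W" and g: "g \<in> lin_maps K V W"
  shows "(\<lambda>x. f x \<ominus>\<^bsub>W\<^esub> g x) \<in> lin_maps K V W"
proof -
  interpret W: vspace K W by fact
  show ?thesis unfolding a_minus_def
    by (intro lin_mapsI) (simp_all add: lin_simps[OF f] lin_simps[OF g] W.a_ac W.smult_r_distr
      W.smult_r_minus W.minus_add)
qed

section \<open>Bilinear maps\<close>

lemma bilinearI:
  assumes "\<And>v w. \<lbrakk>v \<in> carrier V; w \<in> carrier W\<rbrakk> \<Longrightarrow> f v w \<in> carrier E"
    and "\<And>v v' w. \<lbrakk>v \<in> carrier V; v' \<in> carrier V; w \<in> carrier W\<rbrakk> \<Longrightarrow> f (v \<oplus>\<^bsub>V\<^esub> v') w = f v w \<oplus>\<^bsub>E\<^esub> f v' w"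
    and "\<And>v w w'. \<lbrakk>v \<in> carrier V; w \<in> carrier W; w' \<in> carrier W\<rbrakk> \<Longrightarrow> f v (w \<oplus>\<^bsub>W\<^esub> w') = f v w \<oplus>\<^bsub>E\<^esub> f v w'"
    and "\<And>a v w. \<lbrakk>a \<in> carrier K; v \<in> carrier V; w \<in> carrier W\<rbrakk> \<Longrightarrow> f (a \<odot>\<^bsub>V\<^esub> v) w = a \<odot>\<^bsub>E\<^esub> f v w"
    and "\<And>a v w. \<lbrakk>a \<in> carrier K; v \<in> carrier V; w \<in> carrier W\<rbrakk> \<Longrightarrow> f v (a \<odot>\<^bsub>W\<^esub> w) = a \<odot>\<^bsub>E\<^esub> f v w"
  shows "bilinear K V W E f"
  unfolding bilinear_def by (auto intro!: lin_mapsI assms)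

lemma bilinear_left: "\<lbrakk>bilinear K V W E f; w \<in> carrier W\<rbrakk> \<Longrightarrow> (\<lambda>v. f v w) \<in> lin_maps K V E"
  and bilinear_right: "\<lbrakk>bilinear K V W E f; v \<in> carrier V\<rbrakk> \<Longrightarrow> f v \<in> lin_maps K W E"
  by (auto simp: bilinear_def)

lemma bilinear_simps:
  assumes "bilinear K V W E f"
  shows "\<lbrakk>v \<in> carrier V; w \<in> carrier W\<rbrakk> \<Longrightarrow> f v w \<in> carrier E"
    and "\<lbrakk>v \<in> carrier V; v' \<in> carrier V; w \<in> carrier W\<rbrakk> \<Longrightarrow> f (v \<oplus>\<^bsub>V\<^esub> v') w = f v w \<oplus>\<^bsub>E\<^esub> f v' w"
    and "\<lbrakk>v \<in> carrier V; w \<in> carrier W; w' \<in> carrier W\<rbrakk> \<Longrightarrow> f v (w \<oplus>\<^bsub>W\<^esub> w') = f v w \<oplus>\<^bsub>E\<^esub> f v w'"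
    and "\<lbrakk>a \<in> carrier K; v \<in> carrier V; w \<in> carrier W\<rbrakk> \<Longrightarrow> f (a \<odot>\<^bsub>V\<^esub> v) w = a \<odot>\<^bsub>E\<^esub> f v w"
    and "\<lbrakk>a \<in> carrier K; v \<in> carrier V; w \<in> carrier W\<rbrakk> \<Longrightarrow> f v (a \<odot>\<^bsub>W\<^esub> w) = a \<odot>\<^bsub>E\<^esub> f v w"
  using assms by (auto simp: bilinear_def lin_maps_def)

lemma bilinear_zero:
  assumes "bilinear K V W E f" "vspace K V" "vspace K W" "vspace K E"
  shows "w \<in> carrier W \<Longrightarrow> f \<zero>\<^bsub>V\<^esub> w = \<zero>\<^bsub>E\<^esub>" and "v \<in> carrier V \<Longrightarrow> f v \<zero>\<^bsub>W\<^esub> = \<zero>\<^bsub>E\<^esub>"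
  using vspace.lin_zero_vec[OF assms(2,4) bilinear_left[OF assms(1)]]
    vspace.lin_zero_vec[OF assms(3,4) bilinear_right[OF assms(1)]] by auto

lemma bilinear_neg:
  assumes "bilinear K V W E f" "vspace K V" "vspace K W" "vspace K E" "v \<in> carrier V" "w \<in> carrier W"
  shows "f (\<ominus>\<^bsub>V\<^esub> v) w = \<ominus>\<^bsub>E\<^esub> f v w" and "f v (\<ominus>\<^bsub>W\<^esub> w) = \<ominus>\<^bsub>E\<^esub> f v w"
  using vspace.lin_neg[OF assms(2,4) bilinear_left[OF assms(1,6)] assms(5)]
    vspace.lin_neg[OF assms(3,4) bilinear_right[OF assms(1,5)] assms(6)] by auto

lemma bilinear_comp:
  assumes "bilinear K V' W' E f" "g \<in> lin_maps K V V'" "h \<in> lin_maps K W W'"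
  shows "bilinear K V W E (\<lambda>v w. f (g v) (h w))"
  using assms by (intro bilinearI) (simp_all add: bilinear_simps[OF assms(1)] lin_simps[OF assms(2)] lin_simps[OF assms(3)])

lemma bilinear_post:
  assumes "bilinear K V W E f" "g \<in> lin_maps K E E'"
  shows "bilinear K V W E' (\<lambda>v w. g (f v w))"
  using assms by (intro bilinearI) (simp_all add: bilinear_simps[OF assms(1)] lin_simps[OF assms(2)])

lemma bilinear_sum:
  assumes "vspace K E" and f: "bilinear K V W E f" and g: "bilinear K V W E g"
  shows "bilinear K V W E (\<lambda>v w. f v w \<oplus>\<^bsub>E\<^esub> g v w)"
proof -
  interpret E: vspace K E by fact
  show ?thesis
    by (intro bilinearI) (simp_all add: bilinear_simps[OF f] bilinear_simps[OF g] E.a_ac E.smult_r_distr)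
qed

lemma base_module_simps [simp]:
  "carrier (base_module K) = carrier K" "add (base_module K) = add K" "zero (base_module K) = zero K"
  "smult (base_module K) = mult K"
  by (simp_all add: base_module_def)

lemma vspace_base_module:
  assumes "field K" shows "vspace K (base_module K)"
proof -
  interpret field K by fact
  have "abelian_group (base_module K)"
    using l_neg by (intro abelian_groupI) (auto simp: a_ac)
  then show ?thesis
    by (intro vspaceI moduleI) (auto simp: assms l_distr r_distr m_assoc is_cring)
qed

subsection \<open>Quotient spaces\<close>

lemma additive_cong:
  assumes "carrier V' = carrier V" "add V' = add V" "zero V' = zero V"
  shows "a_rcosets\<^bsub>V'\<^esub> N = a_rcosets\<^bsub>V\<^esub> N" "a_r_coset V' = a_r_coset V" "set_add V' = set_add V"
    "a_inv V' = a_inv V" "a_minus V' = a_minus V"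
  using assms
  by (auto simp: A_RCOSETS_def RCOSETS_def a_r_coset_def r_coset_def a_inv_def m_inv_def a_minus_def
      set_add_def set_mult_def fun_eq_iff)

text \<open>One and the same vector space occurs inside several record types (plain modules,
  dendriform algebras, unital ones, bialgebras). Only these four fields matter, so facts can be
  carried from one record to another.\<close>

lemma module_cong:
  assumes "carrier V' = carrier V" "add V' = add V" "zero V' = zero V" "smult V' = smult V"
  shows "module K V' \<longleftrightarrow> module K V" and "submodule N K V' \<longleftrightarrow> submodule N K V"
  using assms
  by (simp_all add: module_def abelian_group_def abelian_monoid_def abelian_group_axioms_def
      module_axioms_def submodule_def submodule_axioms_def subgroup_def comm_group_def
      comm_monoid_def comm_monoid_axioms_def monoid_def group_def group_axioms_def Units_def m_inv_def)

lemma vspace_cong: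
  assumes "carrier V' = carrier V" "add V' = add V" "zero V' = zero V" "smult V' = smult V"
  shows "vspace K V' \<longleftrightarrow> vspace K V"
  by (simp add: vspace_def module_cong(1)[OF assms])

lemma lin_maps_cong:
  assumes "carrier V' = carrier V" "add V' = add V" "smult V' = smult V"
    "carrier W' = carrier W" "add W' = add W" "smult W' = smult W"
  shows "lin_maps K V' W' = lin_maps K V W"
  using assms by (simp add: lin_maps_def)

lemma bilinear_cong:
  assumes "carrier V' = carrier V" "add V' = add V" "smult V' = smult V"
    "carrier W' = carrier W" "add W' = add W" "smult W' = smult W"
    "carrier E' = carrier E" "add E' = add E" "smult E' = smult E"
  shows "bilinear K V' W' E' = bilinear K V W E"
  using assms by (intro ext) (simp add: bilinear_def lin_maps_cong[of V' V E' E] lin_maps_cong[of W' W E' E])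

locale subspace = vspace K V for K (structure) and V (structure) +
  fixes N assumes submodule_N: "submodule N K V"
begin

lemma abelian_subgroup_N: "abelian_subgroup N V"
  using submodule_N by (intro abelian_subgroupI3 additive_subgroup.intro)
    (simp_all add: submodule.axioms(1) abelian_group_axioms)

abbreviation "Q \<equiv> quotient_module V N"
abbreviation "proj \<equiv> a_r_coset V N"

lemma mem_coset_iff: "\<lbrakk>x \<in> carrier V; y \<in> carrier V\<rbrakk> \<Longrightarrow> y \<in> proj x \<longleftrightarrow> y \<ominus>\<^bsub>V\<^esub> x \<in> N"
  by (simp add: a_minus_def abelian_subgroup.a_rcos_module[OF abelian_subgroup_N])

lemma coset_self: "x \<in> carrier V \<Longrightarrow> x \<in> proj x"
  by (rule abelian_subgroup.a_rcos_self[OF abelian_subgroup_N])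

lemma coset_eq_iff:
  assumes "x \<in> carrier V" "y \<in> carrier V" shows "proj x = proj y \<longleftrightarrow> x \<ominus>\<^bsub>V\<^esub> y \<in> N"
  using assms mem_coset_iff[of y x] coset_self[of x]
    abelian_subgroup.a_repr_independence'[OF abelian_subgroup_N, of x y] by metis

lemma coset_memD: "\<lbrakk>x \<in> carrier V; y \<in> proj x\<rbrakk> \<Longrightarrow> y \<in> carrier V \<and> proj y = proj x"
  by (metis abelian_subgroup.a_elemrcos_carrier[OF abelian_subgroup_N]
      abelian_subgroup.a_repr_independence'[OF abelian_subgroup_N])

lemma carrier_Q: "carrier Q = proj ` carrier V"
  by (auto simp: quotient_module_def A_RCOSETS_def' )

lemma proj_in_Q: "x \<in> carrier V \<Longrightarrow> proj x \<in> carrier Q"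
  by (simp add: carrier_Q)

lemma zero_Q: "zero Q = proj \<zero>\<^bsub>V\<^esub>"
  using a_coset_add_zero[OF submoduleE(1)[OF submodule_N]] by (simp add: quotient_module_def)

lemma add_Q: "\<lbrakk>x \<in> carrier V; y \<in> carrier V\<rbrakk> \<Longrightarrow> proj x \<oplus>\<^bsub>Q\<^esub> proj y = proj (x \<oplus>\<^bsub>V\<^esub> y)"
  by (simp add: quotient_module_def abelian_subgroup.a_rcos_sum[OF abelian_subgroup_N])

lemma smult_Q:
  assumes "a \<in> carrier K" "x \<in> carrier V" shows "a \<odot>\<^bsub>Q\<^esub> proj x = proj (a \<odot>\<^bsub>V\<^esub> x)"
proof -
  have *: "proj (a \<odot>\<^bsub>V\<^esub> y) = proj (a \<odot>\<^bsub>V\<^esub> x)" if "y \<in> proj x" for y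
  proof -
    have y: "y \<in> carrier V" using coset_memD that assms by blast
    then have "a \<odot>\<^bsub>V\<^esub> y \<ominus>\<^bsub>V\<^esub> a \<odot>\<^bsub>V\<^esub> x = a \<odot>\<^bsub>V\<^esub> (y \<ominus>\<^bsub>V\<^esub> x)"
      using assms by (simp add: a_minus_def smult_r_distr smult_r_minus)
    then show ?thesis
      using that y assms by (simp add: coset_eq_iff mem_coset_iff submodule_facts[OF submodule_N])
  qed
  show ?thesis
    using UN_constant_eq[OF coset_self[OF assms(2)] ballI[OF *]] by (simp add: quotient_module_def coset_scale_def)
qed

text \<open>Representatives are replaced one at a time: f x' y' - f x y = f (x' - x) y' + f x (y' -
  y), and both terms lie in the absorbing subspace \<open>N\<close>.\<close>

lemma coset_op_proj:
  assumes f: "bilinear K V V V f"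
    and absorb: "\<And>x n. \<lbrakk>x \<in> carrier V; n \<in> N\<rbrakk> \<Longrightarrow> f x n \<in> N \<and> f n x \<in> N"
    and "x \<in> carrier V" "y \<in> carrier V"
  shows "coset_op V N f (proj x) (proj y) = proj (f x y)"
proof -
  have *: "proj (f x' y') = proj (f x y)" if "x' \<in> proj x" "y' \<in> proj y" for x' y'
  proof -
    have c: "x' \<in> carrier V" "y' \<in> carrier V" using coset_memD[OF assms(3) that(1)] coset_memD[OF assms(4) that(2)] by auto
    note m = f vspace_axioms vspace_axioms vspace_axioms
    have "f (x' \<ominus>\<^bsub>V\<^esub> x) y' = f x' y' \<ominus>\<^bsub>V\<^esub> f x y'" "f x (y' \<ominus>\<^bsub>V\<^esub> y) = f x y' \<ominus>\<^bsub>V\<^esub> f x y"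
      using c assms(3,4) by (simp_all add: a_minus_def bilinear_simps(2,3)[OF f] bilinear_neg[OF m])
    then have "f x' y' \<ominus>\<^bsub>V\<^esub> f x y = f (x' \<ominus>\<^bsub>V\<^esub> x) y' \<oplus>\<^bsub>V\<^esub> f x (y' \<ominus>\<^bsub>V\<^esub> y)"
      using bilinear_simps(1)[OF f] c assms(3,4) by (simp add: a_minus_def a_assoc r_neg2 r_neg1)
    moreover have "f (x' \<ominus>\<^bsub>V\<^esub> x) y' \<in> N" "f x (y' \<ominus>\<^bsub>V\<^esub> y) \<in> N"
      using absorb[of y' "x' \<ominus>\<^bsub>V\<^esub> x"] absorb[of x "y' \<ominus>\<^bsub>V\<^esub> y"] that c assms(3,4)
      by (auto simp: mem_coset_iff)
    ultimately have "f x' y' \<ominus>\<^bsub>V\<^esub> f x y \<in> N" using submodule_facts(5)[OF submodule_N] by metis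
    then show ?thesis using c assms(3,4) by (simp add: coset_eq_iff bilinear_simps[OF f])
  qed
  show ?thesis
    unfolding coset_op_def
    by (intro UN_constant_eq[OF coset_self[OF assms(3)]] UN_constant_eq[OF coset_self[OF assms(4)]] ballI *)
qed

lemma vspace_Q: "vspace K Q"
proof (intro vspaceI moduleI abelian_groupI)
  show "field K" "cring K" by (fact field_axioms, fact is_cring)
  show "\<exists>y\<in>carrier Q. y \<oplus>\<^bsub>Q\<^esub> x = \<zero>\<^bsub>Q\<^esub>" if x: "x \<in> carrier Q" for x
  proof -
    obtain v where v: "x = proj v" "v \<in> carrier V" using x unfolding carrier_Q by blast
    then have "proj (\<ominus>\<^bsub>V\<^esub> v) \<oplus>\<^bsub>Q\<^esub> x = \<zero>\<^bsub>Q\<^esub>" by (simp add: add_Q zero_Q l_neg)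
    then show ?thesis using v proj_in_Q a_inv_closed by blast
  qed
qed (auto simp: carrier_Q add_Q smult_Q zero_Q a_ac smult_l_distr smult_r_distr smult_assoc1)

lemma proj_lin: "proj \<in> lin_maps K V Q"
  by (intro lin_mapsI) (simp_all add: proj_in_Q add_Q smult_Q)

text \<open>Two representatives of a coset differ by an element of \<open>N\<close>, which
  \<open>f\<close> kills, so the arbitrary choice by \<open>SOME\<close> is harmless. The formula
  has the shape of \<open>tensor_lift\<close>, to which it is applied.\<close>

lemma
  assumes E: "vspace K E" and f: "f \<in> lin_maps K V E" and "\<And>x. x \<in> N \<Longrightarrow> f x = \<zero>\<^bsub>E\<^esub>"
  shows quotient_lift_proj: "x \<in> carrier V \<Longrightarrow> f (SOME u. u \<in> proj x) = f x"
    and quotient_lift_lin: "(\<lambda>X. f (SOME u. u \<in> X)) \<in> lin_maps K Q E"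
proof -
  interpret E: vspace K E by fact
  show *: "f (SOME u. u \<in> proj x) = f x" if x: "x \<in> carrier V" for x
  proof -
    let ?u = "SOME u. u \<in> proj x"
    have "?u \<in> proj x" using coset_self[OF x] by (rule someI)
    then have u: "?u \<in> carrier V" "?u \<ominus>\<^bsub>V\<^esub> x \<in> N" using x coset_memD mem_coset_iff by blast+
    then have "f ?u \<ominus>\<^bsub>E\<^esub> f x = \<zero>\<^bsub>E\<^esub>" using assms(3) lin_minus[OF E f u(1) x] by simp
    then show ?thesis using u(1) x by (simp add: lin_closed[OF f] E.minus_eq_zero_iff)
  qed
  show "(\<lambda>X. f (SOME u. u \<in> X)) \<in> lin_maps K Q E"
    by (intro lin_mapsI) (auto simp: carrier_Q add_Q smult_Q * lin_simps[OF f])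
qed

end

subsection \<open>Free modules\<close>

locale free_space = field K for K (structure) +
  fixes X :: "'x set"
begin

abbreviation "F \<equiv> free_module K X"
abbreviation "e \<equiv> basis_elt K"

lemma F_simps [simp]:
  "zero F = (\<lambda>_. \<zero>)" "(f \<oplus>\<^bsub>F\<^esub> g) = (\<lambda>x. f x \<oplus> g x)" "(a \<odot>\<^bsub>F\<^esub> f) = (\<lambda>x. a \<otimes> f x)"
  by (simp_all add: free_module_def)

lemma F_carrier: "f \<in> carrier F \<longleftrightarrow> range f \<subseteq> carrier K \<and> finite {x. f x \<noteq> \<zero>} \<and> {x. f x \<noteq> \<zero>} \<subseteq> X"
  by (auto simp: free_module_def)

lemma F_closed [simp]: "f \<in> carrier F \<Longrightarrow> f x \<in> carrier K"
  by (auto simp: free_module_def)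

lemma F_carrierI:
  assumes "\<And>x. f x \<in> carrier K" "finite S" "S \<subseteq> X" "\<And>x. x \<notin> S \<Longrightarrow> f x = \<zero>"
  shows "f \<in> carrier F"
  using assms finite_subset[of "{x. f x \<noteq> \<zero>}" S] by (auto simp: F_carrier)

lemma vspace_F: "vspace K F"
proof -
  have add: "f \<oplus>\<^bsub>F\<^esub> g \<in> carrier F" if "f \<in> carrier F" "g \<in> carrier F" for f g
    using that
    by (intro F_carrierI[where S = "{x. f x \<noteq> \<zero>} \<union> {x. g x \<noteq> \<zero>}"]) (auto simp: F_carrier)
  have smult: "a \<odot>\<^bsub>F\<^esub> f \<in> carrier F" if "f \<in> carrier F" "a \<in> carrier K" for a f
    using that by (intro F_carrierI[where S = "{x. f x \<noteq> \<zero>}"]) (auto simp: F_carrier)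
  have neg: "(\<lambda>x. \<ominus> f x) \<in> carrier F" if "f \<in> carrier F" for f
    using that by (intro F_carrierI[where S = "{x. f x \<noteq> \<zero>}"]) (auto simp: F_carrier)
  have zero: "(\<lambda>x. \<zero>) \<in> carrier F" by (simp add: F_carrier)
  show ?thesis
  proof (intro vspaceI moduleI abelian_groupI field_axioms is_cring)
    show "\<exists>g\<in>carrier F. g \<oplus>\<^bsub>F\<^esub> f = \<zero>\<^bsub>F\<^esub>" if "f \<in> carrier F" for f
      using neg[OF that] that by (intro bexI[of _ "\<lambda>x. \<ominus> f x"]) (auto simp: l_neg)
    show "a \<odot>\<^bsub>F\<^esub> (f \<oplus>\<^bsub>F\<^esub> g) = a \<odot>\<^bsub>F\<^esub> f \<oplus>\<^bsub>F\<^esub> a \<odot>\<^bsub>F\<^esub> g"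
      if "a \<in> carrier K" "f \<in> carrier F" "g \<in> carrier F" for a f g
      using that by (simp add: r_distr)
    show "(a \<oplus> b) \<odot>\<^bsub>F\<^esub> f = a \<odot>\<^bsub>F\<^esub> f \<oplus>\<^bsub>F\<^esub> b \<odot>\<^bsub>F\<^esub> f"
      if "a \<in> carrier K" "b \<in> carrier K" "f \<in> carrier F" for a b f
      using that by (simp add: l_distr)
  qed (use add smult zero in \<open>simp_all add: a_ac m_assoc\<close>)
qed

lemma basis_in_F: "x \<in> X \<Longrightarrow> e x \<in> carrier F"
  by (rule F_carrierI[where S = "{x}"]) (auto simp: basis_elt_def)

text \<open>Induction on a finite set that contains the support; a point of the support is removed
  by resetting the function to zero there.\<close>

lemma free_induct [consumes 1, case_names zero add]:
  assumes "u \<in> carrier F" and zero: "P (zero F)"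
    and add: "\<And>a x u. \<lbrakk>a \<in> carrier K; x \<in> X; u \<in> carrier F; P u\<rbrakk> \<Longrightarrow> P (a \<odot>\<^bsub>F\<^esub> e x \<oplus>\<^bsub>F\<^esub> u)"
  shows "P u"
proof -
  have "\<forall>u. u \<in> carrier F \<longrightarrow> {x. u x \<noteq> \<zero>} \<subseteq> S \<longrightarrow> P u" if "finite S" for S
    using that
  proof (induction S)
    case empty
    have "u = zero F" if "{x. u x \<noteq> \<zero>} \<subseteq> {}" for u using that by (auto simp: fun_eq_iff)
    then show ?case using zero by blast
  next
    case (insert x S)
    show ?case
    proof (intro allI impI)
      fix u assume u: "u \<in> carrier F" "{x. u x \<noteq> \<zero>} \<subseteq> insert x S"
      show "P u"
      proof (cases "u x = \<zero>")
        case True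
        then have "{x. u x \<noteq> \<zero>} \<subseteq> S" using u(2) by blast
        then show ?thesis using insert.IH u(1) by blast
      next
        case False
        let ?u = "u(x := \<zero>)"
        have x: "x \<in> X" using False u(1) by (auto simp: F_carrier)
        have u': "?u \<in> carrier F"
          using u(1) by (intro F_carrierI[where S = "{x. u x \<noteq> \<zero>}"]) (auto simp: F_carrier)
        have "{y. ?u y \<noteq> \<zero>} \<subseteq> S" using u(2) by (auto split: if_splits)
        then have "P ?u" using insert.IH u' by blast
        moreover have "u = u x \<odot>\<^bsub>F\<^esub> e x \<oplus>\<^bsub>F\<^esub> ?u" using u(1) by (auto simp: basis_elt_def fun_eq_iff)
        ultimately show ?thesis using add[OF _ x u', of "u x"] u(1) by simp
      qed
    qed
  qed
  then show ?thesis using assms(1) by (auto simp: F_carrier)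
qed

context
  fixes E :: "('a, 'e, 'm) module_scheme" and f :: "'x \<Rightarrow> 'e"
  assumes E: "vspace K E" and f: "f \<in> X \<rightarrow> carrier E"
begin

interpretation E: vspace K E by (rule E)

text \<open>Any finite set containing the support may serve as index set. This is what allows two
  functions with different supports to be added under one sum.\<close>

lemma lin_ext_finsum:
  assumes "u \<in> carrier F" "finite S" "{x. u x \<noteq> \<zero>} \<subseteq> S" "S \<subseteq> X"
  shows "lin_ext K E f u = (\<Oplus>\<^bsub>E\<^esub>x\<in>S. u x \<odot>\<^bsub>E\<^esub> f x)"
  unfolding lin_ext_def
  by (rule E.add.finprod_mono_neutral_cong_left) (use assms f in \<open>auto simp: Pi_def\<close>)

lemma lin_ext_lin: "lin_ext K E f \<in> lin_maps K F E"
proof (rule lin_mapsI)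
  interpret F: vspace K F by (rule vspace_F)
  have fs: "(\<lambda>x. u x \<odot>\<^bsub>E\<^esub> f x) \<in> S \<rightarrow> carrier E" if "u \<in> carrier F" "S \<subseteq> X" for u S
    using that f by (auto simp: subset_eq Pi_def)
  show "lin_ext K E f u \<in> carrier E" if "u \<in> carrier F" for u
    unfolding lin_ext_def using that by (intro E.finsum_closed fs) (auto simp: F_carrier)
  show "lin_ext K E f (u \<oplus>\<^bsub>F\<^esub> v) = lin_ext K E f u \<oplus>\<^bsub>E\<^esub> lin_ext K E f v"
    if uv: "u \<in> carrier F" "v \<in> carrier F" for u v
  proof -
    let ?S = "{x. u x \<noteq> \<zero>} \<union> {x. v x \<noteq> \<zero>}"
    have S: "finite ?S" "?S \<subseteq> X" using uv by (auto simp: F_carrier)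
    have "lin_ext K E f (u \<oplus>\<^bsub>F\<^esub> v) = (\<Oplus>\<^bsub>E\<^esub>x\<in>?S. (u \<oplus>\<^bsub>F\<^esub> v) x \<odot>\<^bsub>E\<^esub> f x)"
      using uv by (intro lin_ext_finsum F.a_closed S) auto
    also have "\<dots> = (\<Oplus>\<^bsub>E\<^esub>x\<in>?S. u x \<odot>\<^bsub>E\<^esub> f x \<oplus>\<^bsub>E\<^esub> v x \<odot>\<^bsub>E\<^esub> f x)"
      using uv S f by (intro E.finsum_cong') (auto simp: E.smult_l_distr Pi_def)
    also have "\<dots> = lin_ext K E f u \<oplus>\<^bsub>E\<^esub> lin_ext K E f v"
      using fs[OF uv(1) S(2)] fs[OF uv(2) S(2)] uv S
      by (simp add: E.finsum_addf lin_ext_finsum[of _ ?S])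
    finally show ?thesis .
  qed
  show "lin_ext K E f (a \<odot>\<^bsub>F\<^esub> u) = a \<odot>\<^bsub>E\<^esub> lin_ext K E f u" if "a \<in> carrier K" "u \<in> carrier F" for a u
  proof -
    let ?S = "{x. u x \<noteq> \<zero>}"
    have S: "finite ?S" "?S \<subseteq> X" using that by (auto simp: F_carrier)
    have "lin_ext K E f (a \<odot>\<^bsub>F\<^esub> u) = (\<Oplus>\<^bsub>E\<^esub>x\<in>?S. (a \<odot>\<^bsub>F\<^esub> u) x \<odot>\<^bsub>E\<^esub> f x)"
      using that by (intro lin_ext_finsum F.smult_closed S) auto
    also have "\<dots> = (\<Oplus>\<^bsub>E\<^esub>x\<in>?S. a \<odot>\<^bsub>E\<^esub> (u x \<odot>\<^bsub>E\<^esub> f x))"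
      using that S f by (intro E.finsum_cong') (auto simp: E.smult_assoc1 Pi_def)
    also have "\<dots> = a \<odot>\<^bsub>E\<^esub> lin_ext K E f u"
      using fs[OF that(2) S(2)] that S
      by (simp add: E.finsum_smult_ldistr lin_ext_def)
    finally show ?thesis .
  qed
qed

lemma lin_ext_basis: "x \<in> X \<Longrightarrow> lin_ext K E f (e x) = f x"
proof -
  assume x: "x \<in> X"
  have "lin_ext K E f (e x) = (\<Oplus>\<^bsub>E\<^esub>y\<in>{x}. e x y \<odot>\<^bsub>E\<^esub> f y)"
    using x by (intro lin_ext_finsum basis_in_F) (auto simp: basis_elt_def)
  also have "\<dots> = f x"
    using x f funcset_mem[OF f x] by (subst E.finsum_insert) (simp_all add: basis_elt_def)
  finally show ?thesis .
qed

end

end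

subsection \<open>Tensor products\<close>

locale two_spaces = V: vspace K V + W: vspace K W for K (structure) and V and W
begin

abbreviation "T \<equiv> tensor K V W"
abbreviation "pure \<equiv> pure_tensor K V W"

interpretation B: free_space K "carrier V \<times> carrier W"
  by (simp add: free_space_def V.field_axioms)

interpretation BV: vspace K B.F by (rule B.vspace_F)

lemma tensor_rels_subset: "tensor_rels K V W \<subseteq> carrier B.F"
  by (auto simp: tensor_rels_def Let_def intro!: BV.minus_closed BV.a_closed BV.smult_closed B.basis_in_F
      simp del: B.F_simps)

interpretation S: subspace K B.F "tensor_null K V W"
  by (intro subspace.intro BV.vspace_axioms subspace_axioms.intro)
    (simp add: tensor_null_def BV.span_submodule[OF tensor_rels_subset])

lemma tensor_eq_Q: "T = S.Q"
  by (simp add: tensor_def)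

lemma pure_eq_proj: "pure v w = S.proj (B.e (v, w))"
  by (simp add: pure_tensor_def)

lemma vspace_T: "vspace K T"
  unfolding tensor_eq_Q by (rule S.vspace_Q)

lemma pure_rel:
  assumes "x \<in> carrier B.F" "y \<in> carrier B.F" "x \<ominus>\<^bsub>B.F\<^esub> y \<in> tensor_rels K V W"
  shows "S.proj x = S.proj y"
  using BV.span_incl[OF assms(3)] S.coset_eq_iff[OF assms(1,2)] by (simp add: tensor_null_def)

lemma bilinear_pure: "bilinear K V W T pure"
proof (rule bilinearI)
  note simps = pure_eq_proj tensor_eq_Q S.add_Q S.smult_Q B.basis_in_F
  show "pure v w \<in> carrier T" if "v \<in> carrier V" "w \<in> carrier W" for v w
    using that by (simp add: simps S.proj_in_Q)
  show "pure (v \<oplus>\<^bsub>V\<^esub> v') w = pure v w \<oplus>\<^bsub>T\<^esub> pure v' w"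
    if "v \<in> carrier V" "v' \<in> carrier V" "w \<in> carrier W" for v v' w
    using that by (simp add: simps del: B.F_simps)
      (rule pure_rel, auto simp: tensor_rels_def Let_def B.basis_in_F simp del: B.F_simps)
  show "pure v (w \<oplus>\<^bsub>W\<^esub> w') = pure v w \<oplus>\<^bsub>T\<^esub> pure v w'"
    if "v \<in> carrier V" "w \<in> carrier W" "w' \<in> carrier W" for v w w'
    using that by (simp add: simps del: B.F_simps)
      (rule pure_rel, auto simp: tensor_rels_def Let_def B.basis_in_F simp del: B.F_simps)
  show "pure (a \<odot>\<^bsub>V\<^esub> v) w = a \<odot>\<^bsub>T\<^esub> pure v w"
    if "a \<in> carrier K" "v \<in> carrier V" "w \<in> carrier W" for a v w
    using that by (simp add: simps del: B.F_simps)
      (rule pure_rel, auto simp: tensor_rels_def Let_def B.basis_in_F simp del: B.F_simps)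
  show "pure v (a \<odot>\<^bsub>W\<^esub> w) = a \<odot>\<^bsub>T\<^esub> pure v w"
    if "a \<in> carrier K" "v \<in> carrier V" "w \<in> carrier W" for a v w
    using that by (simp add: simps del: B.F_simps)
      (rule pure_rel, auto simp: tensor_rels_def Let_def B.basis_in_F simp del: B.F_simps)
qed

lemmas pure_simps [simp] = bilinear_simps[OF bilinear_pure]
lemmas pure_zero [simp] = bilinear_zero[OF bilinear_pure V.vspace_axioms W.vspace_axioms vspace_T]

text \<open>Scalars need no case of their own: they are absorbed into the left factor of a pure
  tensor, and zero is the pure tensor of two zeros.\<close>

lemma tensor_induct [consumes 1, case_names pure add]:
  assumes X: "X \<in> carrier T"
    and pure: "\<And>v w. \<lbrakk>v \<in> carrier V; w \<in> carrier W\<rbrakk> \<Longrightarrow> P (pure v w)"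
    and add: "\<And>X Y. \<lbrakk>X \<in> carrier T; Y \<in> carrier T; P X; P Y\<rbrakk> \<Longrightarrow> P (X \<oplus>\<^bsub>T\<^esub> Y)"
  shows "P X"
proof -
  interpret T: vspace K T by (rule vspace_T)
  obtain u where u: "u \<in> carrier B.F" "X = S.proj u" using X by (auto simp: tensor_eq_Q S.carrier_Q)
  have "P (S.proj u)" using u(1)
  proof (induction rule: B.free_induct)
    case zero
    have "P \<zero>\<^bsub>T\<^esub>" using pure[of "\<zero>\<^bsub>V\<^esub>" "\<zero>\<^bsub>W\<^esub>"] by simp
    then show ?case by (simp add: tensor_eq_Q S.zero_Q del: B.F_simps)
  next
    case (add a x u)
    obtain v w where x: "x = (v, w)" "v \<in> carrier V" "w \<in> carrier W" using add by auto
    have "S.proj (a \<odot>\<^bsub>B.F\<^esub> B.e x \<oplus>\<^bsub>B.F\<^esub> u) = pure (a \<odot>\<^bsub>V\<^esub> v) w \<oplus>\<^bsub>T\<^esub> S.proj u"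
      using add(1,2,3) x
      by (simp add: pure_eq_proj[of v] tensor_eq_Q S.add_Q S.smult_Q B.basis_in_F BV.smult_closed del: B.F_simps)
    moreover have "S.proj u \<in> carrier T" using add(3) by (simp add: tensor_eq_Q S.proj_in_Q)
    ultimately show ?case
      using add(1,4) x assms(3)[of "pure (a \<odot>\<^bsub>V\<^esub> v) w" "S.proj u"] pure[of "a \<odot>\<^bsub>V\<^esub> v" w]
        pure_simps(1)[of "a \<odot>\<^bsub>V\<^esub> v" w] V.smult_closed[of a v] by metis
  qed
  then show ?thesis by (simp add: u)
qed

lemma tensor_eqI:
  assumes "f \<in> lin_maps K T E" "g \<in> lin_maps K T E" "X \<in> carrier T"
    and "\<And>v w. \<lbrakk>v \<in> carrier V; w \<in> carrier W\<rbrakk> \<Longrightarrow> f (pure v w) = g (pure v w)"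
  shows "f X = g X"
  using assms(3)
  by (induction rule: tensor_induct) (simp_all add: assms(4) lin_add[OF assms(1)] lin_add[OF assms(2)])

context
  fixes E :: "('a, 'z, 'y) module_scheme" and f
  assumes E: "vspace K E" and f: "bilinear K V W E f"
begin

interpretation E: vspace K E by (rule E)

lemma lin_ext_bilinear:
  shows "lin_ext K E (\<lambda>(v, w). f v w) \<in> lin_maps K B.F E"
    and "\<lbrakk>v \<in> carrier V; w \<in> carrier W\<rbrakk> \<Longrightarrow> lin_ext K E (\<lambda>(v, w). f v w) (B.e (v, w)) = f v w"
proof -
  have "(\<lambda>(v, w). f v w) \<in> carrier V \<times> carrier W \<rightarrow> carrier E" by (auto simp: bilinear_simps[OF f])
  from B.lin_ext_lin[OF E this] B.lin_ext_basis[OF E this]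
  show "lin_ext K E (\<lambda>(v, w). f v w) \<in> lin_maps K B.F E"
    and "\<lbrakk>v \<in> carrier V; w \<in> carrier W\<rbrakk> \<Longrightarrow> lin_ext K E (\<lambda>(v, w). f v w) (B.e (v, w)) = f v w"
    by auto
qed

lemma lin_ext_tensor_null:
  assumes "x \<in> tensor_null K V W" shows "lin_ext K E (\<lambda>(v, w). f v w) x = \<zero>\<^bsub>E\<^esub>"
proof (rule BV.lin_eq_on_span[OF assms[unfolded tensor_null_def] tensor_rels_subset E lin_ext_bilinear(1) lin_zero_map[OF E]])
  note lin = lin_simps[OF lin_ext_bilinear(1)] BV.lin_minus[OF E lin_ext_bilinear(1)]
  fix x assume "x \<in> tensor_rels K V W"
  then show "lin_ext K E (\<lambda>(v, w). f v w) x = \<zero>\<^bsub>E\<^esub>"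
    unfolding tensor_rels_def Let_def
    by (elim UnE CollectE exE conjE)
      (simp_all add: lin B.basis_in_F lin_ext_bilinear(2) bilinear_simps[OF f] E.minus_eq_zero_iff
        BV.a_closed BV.smult_closed del: B.F_simps)
qed

lemma tensor_lift_lin: "tensor_lift K E f \<in> lin_maps K T E"
  unfolding tensor_lift_def tensor_eq_Q
  by (rule S.quotient_lift_lin[OF E lin_ext_bilinear(1) lin_ext_tensor_null])

lemma tensor_lift_pure: "\<lbrakk>v \<in> carrier V; w \<in> carrier W\<rbrakk> \<Longrightarrow> tensor_lift K E f (pure v w) = f v w"
  unfolding tensor_lift_def pure_eq_proj
  by (simp add: S.quotient_lift_proj[OF E lin_ext_bilinear(1) lin_ext_tensor_null] B.basis_in_F lin_ext_bilinear(2))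

lemma tensor_lift_unique:
  assumes "g \<in> lin_maps K T E" "\<And>v w. \<lbrakk>v \<in> carrier V; w \<in> carrier W\<rbrakk> \<Longrightarrow> g (pure v w) = f v w" "X \<in> carrier T"
  shows "g X = tensor_lift K E f X"
  by (rule tensor_eqI[OF assms(1) tensor_lift_lin assms(3)]) (simp add: assms(2) tensor_lift_pure)

end

lemma tensor_lift_cong:
  assumes E: "vspace K E" and f: "bilinear K V W E f" and X: "X \<in> carrier T"
    and fg: "\<And>v w. \<lbrakk>v \<in> carrier V; w \<in> carrier W\<rbrakk> \<Longrightarrow> g v w = f v w"
  shows "tensor_lift K E g X = tensor_lift K E f X"
proof -
  have g: "bilinear K V W E g"
    by (intro bilinearI) (simp_all add: fg bilinear_simps[OF f])
  show ?thesis
    by (rule tensor_lift_unique[OF E f tensor_lift_lin[OF E g] _ X]) (simp add: tensor_lift_pure[OF E g] fg)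
qed

text \<open>Linear dependence on a parameter survives the passage to the induced map. The tensor is
  fixed and decomposed, while the parameter stays free; nested lifts rely on this.\<close>

lemma lin_tensor_lift:
  assumes A: "vspace K A" and E: "vspace K E" and X: "X \<in> carrier T"
    and f: "\<And>a. a \<in> carrier A \<Longrightarrow> bilinear K V W E (f a)"
    and g: "\<And>v w. \<lbrakk>v \<in> carrier V; w \<in> carrier W\<rbrakk> \<Longrightarrow> (\<lambda>a. f a v w) \<in> lin_maps K A E"
  shows "(\<lambda>a. tensor_lift K E (f a) X) \<in> lin_maps K A E"
  using X
proof (induction rule: tensor_induct)
  case (pure v w)
  show ?case by (rule lin_cong[OF g[OF pure] _ A]) (simp add: tensor_lift_pure[OF E f] pure)
next
  case (add X Y)
  show ?case
    by (rule lin_cong[OF lin_sum[OF E add(3,4)] _ A]) (simp add: lin_add[OF tensor_lift_lin[OF E f]] add)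
qed

lemma bilinear_tensor_lift:
  assumes "vspace K A" "vspace K B" "vspace K E" "X \<in> carrier T"
    and f: "\<And>a b. \<lbrakk>a \<in> carrier A; b \<in> carrier B\<rbrakk> \<Longrightarrow> bilinear K V W E (f a b)"
    and g: "\<And>v w. \<lbrakk>v \<in> carrier V; w \<in> carrier W\<rbrakk> \<Longrightarrow> bilinear K A B E (\<lambda>a b. f a b v w)"
  shows "bilinear K A B E (\<lambda>a b. tensor_lift K E (f a b) X)"
  unfolding bilinear_def
  using assms(1-4)
  by (auto intro!: lin_tensor_lift f bilinear_left[OF g] bilinear_right[OF g])

end

lemma vspace_tensor: "\<lbrakk>vspace K V; vspace K W\<rbrakk> \<Longrightarrow> vspace K (tensor K V W)"
  by (rule two_spaces.vspace_T[OF two_spaces.intro])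

lemma tensor_map_lin:
  assumes "vspace K V" "vspace K W" "vspace K V'" "vspace K W'"
    and "f \<in> lin_maps K V V'" "g \<in> lin_maps K W W'"
  shows "tensor_map K V' W' f g \<in> lin_maps K (tensor K V W) (tensor K V' W')"
    and "\<lbrakk>v \<in> carrier V; w \<in> carrier W\<rbrakk> \<Longrightarrow>
      tensor_map K V' W' f g (pure_tensor K V W v w) = pure_tensor K V' W' (f v) (g w)"
proof -
  interpret A: two_spaces K V W using assms by (simp add: two_spaces_def)
  interpret B: two_spaces K V' W' using assms by (simp add: two_spaces_def)
  note b = bilinear_comp[OF B.bilinear_pure assms(5,6)]
  show "tensor_map K V' W' f g \<in> lin_maps K A.T B.T"
    and "\<lbrakk>v \<in> carrier V; w \<in> carrier W\<rbrakk> \<Longrightarrow> tensor_map K V' W' f g (A.pure v w) = B.pure (f v) (g w)"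
    by (simp_all add: tensor_map_def A.tensor_lift_lin[OF B.vspace_T b] A.tensor_lift_pure[OF B.vspace_T b])
qed

lemma tensor_assoc_lin:
  assumes "vspace K U" "vspace K V" "vspace K W"
  shows "tensor_assoc K U V W \<in> lin_maps K (tensor K U (tensor K V W)) (tensor K (tensor K U V) W)"
    and "\<lbrakk>u \<in> carrier U; v \<in> carrier V; w \<in> carrier W\<rbrakk> \<Longrightarrow>
      tensor_assoc K U V W (pure_tensor K U (tensor K V W) u (pure_tensor K V W v w)) =
      pure_tensor K (tensor K U V) W (pure_tensor K U V u v) w"
proof -
  interpret VW: two_spaces K V W using assms by (simp add: two_spaces_def)
  interpret UV: two_spaces K U V using assms by (simp add: two_spaces_def)
  interpret U: two_spaces K U VW.T using assms by (simp add: two_spaces_def VW.vspace_T)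
  interpret W: two_spaces K UV.T W using assms by (simp add: two_spaces_def UV.vspace_T)
  have b: "bilinear K V W W.T (\<lambda>v w. W.pure (UV.pure u v) w)" if "u \<in> carrier U" for u
    using that by (intro bilinearI) simp_all
  have l: "(\<lambda>u. W.pure (UV.pure u v) w) \<in> lin_maps K U W.T" if "v \<in> carrier V" "w \<in> carrier W" for v w
    using that by (intro lin_mapsI) simp_all
  have "bilinear K U VW.T W.T (\<lambda>u. tensor_lift K W.T (\<lambda>v w. W.pure (UV.pure u v) w))"
    unfolding bilinear_def
    by (intro conjI ballI VW.lin_tensor_lift VW.tensor_lift_lin assms W.vspace_T b l)
  note * = U.tensor_lift_lin[OF W.vspace_T this] U.tensor_lift_pure[OF W.vspace_T this]
  show "tensor_assoc K U V W \<in> lin_maps K U.T W.T"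
    and "\<lbrakk>u \<in> carrier U; v \<in> carrier V; w \<in> carrier W\<rbrakk> \<Longrightarrow>
      tensor_assoc K U V W (U.pure u (VW.pure v w)) = W.pure (UV.pure u v) w"
    by (simp_all add: tensor_assoc_def Let_def * VW.tensor_lift_pure[OF W.vspace_T b])
qed

lemma tensor_cong:
  assumes "carrier V' = carrier V" "add V' = add V" "smult V' = smult V"
    "carrier W' = carrier W" "add W' = add W" "smult W' = smult W"
  shows "tensor K V' W' = tensor K V W" and "pure_tensor K V' W' = pure_tensor K V W"
  using assms by (simp_all add: tensor_def pure_tensor_def tensor_null_def tensor_rels_def fun_eq_iff)

text \<open>The map on two tensors given by a function linear in each of four arguments. The
  nesting, outer sum over the first tensor, is that of \<open>sweedler_prod\<close>, so the two
  agree by unfolding.\<close>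

definition tensor_lift2 ::
  "('k, _) ring_scheme \<Rightarrow> ('k, 'e, _) module_scheme \<Rightarrow> ('a \<Rightarrow> 'b \<Rightarrow> 'c \<Rightarrow> 'd \<Rightarrow> 'e) \<Rightarrow>
   ('k, 'a, 'b) tensor \<Rightarrow> ('k, 'c, 'd) tensor \<Rightarrow> 'e"
  where "tensor_lift2 K E f X Y = tensor_lift K E (\<lambda>a b. tensor_lift K E (f a b) Y) X"

lemma tensor_lift2:
  assumes "vspace K V" "vspace K W" "vspace K V'" "vspace K W'" "vspace K E"
    and f: "\<And>a b. \<lbrakk>a \<in> carrier V; b \<in> carrier W\<rbrakk> \<Longrightarrow> bilinear K V' W' E (f a b)"
    and g: "\<And>c d. \<lbrakk>c \<in> carrier V'; d \<in> carrier W'\<rbrakk> \<Longrightarrow> bilinear K V W E (\<lambda>a b. f a b c d)"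
  shows "bilinear K (tensor K V W) (tensor K V' W') E (tensor_lift2 K E f)"
    and "\<lbrakk>a \<in> carrier V; b \<in> carrier W; c \<in> carrier V'; d \<in> carrier W'\<rbrakk> \<Longrightarrow>
      tensor_lift2 K E f (pure_tensor K V W a b) (pure_tensor K V' W' c d) = f a b c d"
proof -
  interpret A: two_spaces K V W using assms by (simp add: two_spaces_def)
  interpret B: two_spaces K V' W' using assms by (simp add: two_spaces_def)
  have b: "bilinear K V W E (\<lambda>a b. tensor_lift K E (f a b) Y)" if "Y \<in> carrier B.T" for Y
    using assms that by (intro B.bilinear_tensor_lift) auto
  have l: "(\<lambda>Y. tensor_lift K E (f a b) Y) \<in> lin_maps K B.T E" if "a \<in> carrier V" "b \<in> carrier W" for a b
    using that assms(5) by (intro B.tensor_lift_lin f)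
  show "bilinear K A.T B.T E (tensor_lift2 K E f)"
    unfolding bilinear_def tensor_lift2_def
    using assms(5) by (auto intro!: A.tensor_lift_lin A.lin_tensor_lift b B.vspace_T l)
  show "\<lbrakk>a \<in> carrier V; b \<in> carrier W; c \<in> carrier V'; d \<in> carrier W'\<rbrakk> \<Longrightarrow>
      tensor_lift2 K E f (A.pure a b) (B.pure c d) = f a b c d"
    by (simp add: tensor_lift2_def A.tensor_lift_pure[OF assms(5) b] B.tensor_lift_pure[OF assms(5) f])
qed

section \<open>Augmented dendriform algebras\<close>

text \<open>A unital dendriform algebra is encoded by \<^emph>\<open>total\<close> bilinear products on \<open>W = K \<cdot> 1 \<oplus> V\<close>, with
  \<open>1 \<prec> 1 = 1 \<succ> 1 = 0\<close>, and the projection \<open>\<epsilon>\<close> onto \<open>K\<close>. With the associative product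
  \<open>x * y = x \<prec> y + x \<succ> y + \<epsilon> x \<epsilon> y 1\<close> the dendriform axioms then hold on all of \<open>W\<close>, and the
  structure is inherited by tensor products.\<close>

record ('k, 'a) aug =
  amul :: "'a \<Rightarrow> 'a \<Rightarrow> 'a"
  aleft :: "'a \<Rightarrow> 'a \<Rightarrow> 'a"
  aright :: "'a \<Rightarrow> 'a \<Rightarrow> 'a"
  aone :: 'a
  aeps :: "'a \<Rightarrow> 'k"

text \<open>\<open>left_one\<close> joins two laws: on the kernel of \<epsilon> it says x \<prec> 1
  = x, and at x = 1 it says 1 \<prec> 1 = 0; \<open>one_right\<close> does the same for \<succ>.
  Since the associative product \<open>amul A\<close> contains the unit term,
  \<open>left_left\<close> and \<open>right_right\<close> also hold when arguments equal 1.\<close>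

locale augmented = vspace K W for K (structure) and W :: "('k, 'a, 'm) module_scheme" +
  fixes A :: "('k, 'a) aug"
  assumes one_closed [simp, intro]: "aone A \<in> carrier W"
    and eps_lin: "aeps A \<in> lin_maps K W (base_module K)"
    and eps_one [simp]: "aeps A (aone A) = \<one>"
    and left_bilinear: "bilinear K W W W (aleft A)"
    and right_bilinear: "bilinear K W W W (aright A)"
    and mul_eq: "\<lbrakk>x \<in> carrier W; y \<in> carrier W\<rbrakk> \<Longrightarrow>
      amul A x y = aleft A x y \<oplus>\<^bsub>W\<^esub> aright A x y \<oplus>\<^bsub>W\<^esub> (aeps A x \<otimes> aeps A y) \<odot>\<^bsub>W\<^esub> aone A"
    and eps_left [simp]: "\<lbrakk>x \<in> carrier W; y \<in> carrier W\<rbrakk> \<Longrightarrow> aeps A (aleft A x y) = \<zero>"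
    and eps_right [simp]: "\<lbrakk>x \<in> carrier W; y \<in> carrier W\<rbrakk> \<Longrightarrow> aeps A (aright A x y) = \<zero>"
    and one_left [simp]: "x \<in> carrier W \<Longrightarrow> aleft A (aone A) x = \<zero>\<^bsub>W\<^esub>"
    and right_one [simp]: "x \<in> carrier W \<Longrightarrow> aright A x (aone A) = \<zero>\<^bsub>W\<^esub>"
    and left_one: "x \<in> carrier W \<Longrightarrow> aleft A x (aone A) \<oplus>\<^bsub>W\<^esub> aeps A x \<odot>\<^bsub>W\<^esub> aone A = x"
    and one_right: "x \<in> carrier W \<Longrightarrow> aright A (aone A) x \<oplus>\<^bsub>W\<^esub> aeps A x \<odot>\<^bsub>W\<^esub> aone A = x"
    and left_left: "\<lbrakk>x \<in> carrier W; y \<in> carrier W; z \<in> carrier W\<rbrakk> \<Longrightarrow>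
      aleft A (aleft A x y) z = aleft A x (amul A y z)"
    and right_left: "\<lbrakk>x \<in> carrier W; y \<in> carrier W; z \<in> carrier W\<rbrakk> \<Longrightarrow>
      aleft A (aright A x y) z = aright A x (aleft A y z)"
    and right_right: "\<lbrakk>x \<in> carrier W; y \<in> carrier W; z \<in> carrier W\<rbrakk> \<Longrightarrow>
      aright A x (aright A y z) = aright A (amul A x y) z"
begin

abbreviation "L \<equiv> aleft A"
abbreviation "R \<equiv> aright A"
abbreviation "M \<equiv> amul A"
abbreviation "u \<equiv> aone A"
abbreviation "\<epsilon> \<equiv> aeps A"

lemmas eps_simps [simp] = lin_simps[OF eps_lin, simplified]
lemmas left_simps [simp] = bilinear_simps[OF left_bilinear]
lemmas right_simps [simp] = bilinear_simps[OF right_bilinear]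
lemmas left_zero [simp] = bilinear_zero[OF left_bilinear vspace_axioms vspace_axioms vspace_axioms]
lemmas right_zero [simp] = bilinear_zero[OF right_bilinear vspace_axioms vspace_axioms vspace_axioms]

lemma eps_zero [simp]: "\<epsilon> \<zero>\<^bsub>W\<^esub> = \<zero>"
  using lin_zero_vec[OF vspace_base_module eps_lin] field_axioms by simp

lemma mul_bilinear: "bilinear K W W W M"
  by (intro bilinearI) (simp_all add: mul_eq a_ac l_distr r_distr smult_l_distr smult_r_distr smult_assoc1 m_ac)

lemmas mul_simps [simp] = bilinear_simps[OF mul_bilinear]

lemma eps_mul [simp]: "\<lbrakk>x \<in> carrier W; y \<in> carrier W\<rbrakk> \<Longrightarrow> \<epsilon> (M x y) = \<epsilon> x \<otimes> \<epsilon> y"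
  by (simp add: mul_eq)

lemma one_mul [simp]: "x \<in> carrier W \<Longrightarrow> M u x = x"
  by (simp add: mul_eq one_right)

lemma mul_one [simp]: "x \<in> carrier W \<Longrightarrow> M x u = x"
  by (simp add: mul_eq left_one)

lemma right_one_pos [simp]: "\<lbrakk>x \<in> carrier W; \<epsilon> x = \<zero>\<rbrakk> \<Longrightarrow> R u x = x"
  using one_right[of x] by simp

lemma left_one_pos [simp]: "\<lbrakk>x \<in> carrier W; \<epsilon> x = \<zero>\<rbrakk> \<Longrightarrow> L x u = x"
  using left_one[of x] by simp

lemma mul_pos: "\<lbrakk>x \<in> carrier W; y \<in> carrier W; \<epsilon> x = \<zero>\<rbrakk> \<Longrightarrow> M x y = L x y \<oplus>\<^bsub>W\<^esub> R x y"
  by (simp add: mul_eq)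

text \<open>The sum of the three dendriform identities. The unit terms of the inner products
  disappear because 1 \<prec> z = 0 and x \<succ> 1 = 0.\<close>

lemma mul_assoc:
  assumes "x \<in> carrier W" "y \<in> carrier W" "z \<in> carrier W"
  shows "M (M x y) z = M x (M y z)"
proof -
  have "L (M x y) z = L x (M y z) \<oplus>\<^bsub>W\<^esub> R x (L y z)"
    using assms by (simp add: mul_eq[of x y] left_left right_left)
  moreover have "R x (M y z) = R x (L y z) \<oplus>\<^bsub>W\<^esub> R (M x y) z"
    using assms by (simp add: mul_eq[of y z] right_right)
  ultimately show ?thesis
    using assms by (simp add: mul_eq[of "M x y" z] mul_eq[of x "M y z"] a_ac m_assoc)
qed

end

text \<open>Reduces an identity that is additive in three tensors to pure tensors. Identities in two
  tensors are obtained by instantiating it with a third argument that does not occur in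
  them.\<close>

lemma (in two_spaces) tensor_induct3:
  assumes "X \<in> carrier T" "Y \<in> carrier T" "Z \<in> carrier T"
    and pure: "\<And>a b c d e f. \<lbrakk>a \<in> carrier V; b \<in> carrier W; c \<in> carrier V; d \<in> carrier W;
      e \<in> carrier V; f \<in> carrier W\<rbrakk> \<Longrightarrow> P (pure a b) (pure c d) (pure e f)"
    and add1: "\<And>X X' Y Z. \<lbrakk>X \<in> carrier T; X' \<in> carrier T; Y \<in> carrier T; Z \<in> carrier T; P X Y Z; P X' Y Z\<rbrakk>
      \<Longrightarrow> P (X \<oplus>\<^bsub>T\<^esub> X') Y Z"
    and add2: "\<And>X Y Y' Z. \<lbrakk>X \<in> carrier T; Y \<in> carrier T; Y' \<in> carrier T; Z \<in> carrier T; P X Y Z; P X Y' Z\<rbrakk>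
      \<Longrightarrow> P X (Y \<oplus>\<^bsub>T\<^esub> Y') Z"
    and add3: "\<And>X Y Z Z'. \<lbrakk>X \<in> carrier T; Y \<in> carrier T; Z \<in> carrier T; Z' \<in> carrier T; P X Y Z; P X Y Z'\<rbrakk>
      \<Longrightarrow> P X Y (Z \<oplus>\<^bsub>T\<^esub> Z')"
  shows "P X Y Z"
proof -
  have 1: "P (pure a b) (pure c d) Z"
    if "a \<in> carrier V" "b \<in> carrier W" "c \<in> carrier V" "d \<in> carrier W" for a b c d
    using assms(3) by (induction rule: tensor_induct) (simp_all add: pure add3 that)
  have 2: "P (pure a b) Y Z" if "a \<in> carrier V" "b \<in> carrier W" for a b
    using assms(2) by (induction rule: tensor_induct) (simp_all add: 1 add2 that assms(3))
  show ?thesis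
    using assms(1) by (induction rule: tensor_induct) (simp_all add: 2 add1 assms(2,3))
qed

text \<open>The second summand takes the place of the term that the coproduct rule treats
  separately: if both second factors are 1, the product is carried out in the first factors.
  Multiplying by the two counits makes this bilinear.\<close>

definition tensor_aug ::
  "('k, _) ring_scheme \<Rightarrow> ('k, 'a, _) module_scheme \<Rightarrow> ('k, 'a) aug \<Rightarrow> ('k, 'b, _) module_scheme \<Rightarrow>
   ('k, 'b) aug \<Rightarrow> ('k, ('k, 'a, 'b) tensor) aug"
  where "tensor_aug K V A W B =
    (let T = tensor K V W; p = pure_tensor K V W;
         f = (\<lambda>g h. tensor_lift2 K T (\<lambda>a b c d. p (amul A a c) (h b d) \<oplus>\<^bsub>T\<^esub>
           (aeps B b \<otimes>\<^bsub>K\<^esub> aeps B d) \<odot>\<^bsub>T\<^esub> p (g a c) (aone B)))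
     in \<lparr>amul = tensor_lift2 K T (\<lambda>a b c d. p (amul A a c) (amul B b d)),
       aleft = f (aleft A) (aleft B), aright = f (aright A) (aright B), aone = p (aone A) (aone B),
       aeps = tensor_lift K (base_module K) (\<lambda>a b. aeps A a \<otimes>\<^bsub>K\<^esub> aeps B b)\<rparr>)"

locale two_augs = A: augmented K V A + B: augmented K W B for K (structure) and V A W B
begin

sublocale two_spaces K V W ..

sublocale T: vspace K T by (rule vspace_T)

abbreviation "TA \<equiv> tensor_aug K V A W B"

lemma tensor_aug_one [simp]: "aone TA = pure (aone A) (aone B)"
  by (simp add: tensor_aug_def Let_def)

lemma tensor_aug_mul:
  shows "bilinear K T T T (amul TA)"
    and "\<lbrakk>a \<in> carrier V; b \<in> carrier W; c \<in> carrier V; d \<in> carrier W\<rbrakk> \<Longrightarrow>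
      amul TA (pure a b) (pure c d) = pure (amul A a c) (amul B b d)"
proof -
  have 1: "bilinear K V W T (\<lambda>c d. pure (amul A a c) (amul B b d))" if "a \<in> carrier V" "b \<in> carrier W" for a b
    using that by (intro bilinearI) simp_all
  have 2: "bilinear K V W T (\<lambda>a b. pure (amul A a c) (amul B b d))" if "c \<in> carrier V" "d \<in> carrier W" for c d
    using that by (intro bilinearI) simp_all
  note * = tensor_lift2[OF A.vspace_axioms B.vspace_axioms A.vspace_axioms B.vspace_axioms vspace_T 1 2]
  show "bilinear K T T T (amul TA)"
    and "\<lbrakk>a \<in> carrier V; b \<in> carrier W; c \<in> carrier V; d \<in> carrier W\<rbrakk> \<Longrightarrow>
      amul TA (pure a b) (pure c d) = pure (amul A a c) (amul B b d)"
    using * by (simp_all add: tensor_aug_def Let_def)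
qed

lemma tensor_aug_op:
  assumes g: "bilinear K V V V g" and h: "bilinear K W W W h"
  defines "f \<equiv> tensor_lift2 K T (\<lambda>a b c d. pure (amul A a c) (h b d) \<oplus>\<^bsub>T\<^esub>
           (aeps B b \<otimes> aeps B d) \<odot>\<^bsub>T\<^esub> pure (g a c) (aone B))"
  shows "bilinear K T T T f"
    and "\<lbrakk>a \<in> carrier V; b \<in> carrier W; c \<in> carrier V; d \<in> carrier W\<rbrakk> \<Longrightarrow>
      f (pure a b) (pure c d) = pure (amul A a c) (h b d) \<oplus>\<^bsub>T\<^esub>
           (aeps B b \<otimes> aeps B d) \<odot>\<^bsub>T\<^esub> pure (g a c) (aone B)"
proof -
  let ?f = "\<lambda>a b c d. pure (amul A a c) (h b d) \<oplus>\<^bsub>T\<^esub> (aeps B b \<otimes> aeps B d) \<odot>\<^bsub>T\<^esub> pure (g a c) (aone B)"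
  note s = bilinear_simps[OF g] bilinear_simps[OF h] T.smult_l_distr T.smult_r_distr T.a_ac
    T.smult_assoc1[symmetric] A.l_distr A.r_distr A.m_ac
  have 1: "bilinear K V W T (?f a b)" if "a \<in> carrier V" "b \<in> carrier W" for a b
    using that by (intro bilinearI) (simp_all add: s)
  have 2: "bilinear K V W T (\<lambda>a b. ?f a b c d)" if "c \<in> carrier V" "d \<in> carrier W" for c d
    using that by (intro bilinearI) (simp_all add: s)
  note * = tensor_lift2[OF A.vspace_axioms B.vspace_axioms A.vspace_axioms B.vspace_axioms vspace_T 1 2]
  show "bilinear K T T T f"
    and "\<lbrakk>a \<in> carrier V; b \<in> carrier W; c \<in> carrier V; d \<in> carrier W\<rbrakk> \<Longrightarrow>
      f (pure a b) (pure c d) = pure (amul A a c) (h b d) \<oplus>\<^bsub>T\<^esub>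
           (aeps B b \<otimes> aeps B d) \<odot>\<^bsub>T\<^esub> pure (g a c) (aone B)"
    using * unfolding f_def by simp_all
qed

lemma tensor_aug_left:
  shows "bilinear K T T T (aleft TA)"
    and "\<lbrakk>a \<in> carrier V; b \<in> carrier W; c \<in> carrier V; d \<in> carrier W\<rbrakk> \<Longrightarrow>
      aleft TA (pure a b) (pure c d) = pure (amul A a c) (aleft B b d) \<oplus>\<^bsub>T\<^esub>
           (aeps B b \<otimes> aeps B d) \<odot>\<^bsub>T\<^esub> pure (aleft A a c) (aone B)"
  using tensor_aug_op[OF A.left_bilinear B.left_bilinear] by (simp_all add: tensor_aug_def Let_def)

lemma tensor_aug_right:
  shows "bilinear K T T T (aright TA)"
    and "\<lbrakk>a \<in> carrier V; b \<in> carrier W; c \<in> carrier V; d \<in> carrier W\<rbrakk> \<Longrightarrow>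
      aright TA (pure a b) (pure c d) = pure (amul A a c) (aright B b d) \<oplus>\<^bsub>T\<^esub>
           (aeps B b \<otimes> aeps B d) \<odot>\<^bsub>T\<^esub> pure (aright A a c) (aone B)"
  using tensor_aug_op[OF A.right_bilinear B.right_bilinear] by (simp_all add: tensor_aug_def Let_def)

lemma tensor_aug_eps:
  shows "aeps TA \<in> lin_maps K T (base_module K)"
    and "\<lbrakk>a \<in> carrier V; b \<in> carrier W\<rbrakk> \<Longrightarrow> aeps TA (pure a b) = aeps A a \<otimes> aeps B b"
proof -
  have b: "bilinear K V W (base_module K) (\<lambda>a b. aeps A a \<otimes> aeps B b)"
    by (intro bilinearI) (simp_all add: A.l_distr A.r_distr A.m_ac)
  have K: "vspace K (base_module K)" by (rule vspace_base_module) (rule A.field_axioms)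
  show "aeps TA \<in> lin_maps K T (base_module K)"
    and "\<lbrakk>a \<in> carrier V; b \<in> carrier W\<rbrakk> \<Longrightarrow> aeps TA (pure a b) = aeps A a \<otimes> aeps B b"
    using tensor_lift_lin[OF K b] tensor_lift_pure[OF K b] by (simp_all add: tensor_aug_def Let_def)
qed

lemmas TA_simps = bilinear_simps[OF tensor_aug_mul(1)] bilinear_simps[OF tensor_aug_left(1)]
  bilinear_simps[OF tensor_aug_right(1)] lin_simps[OF tensor_aug_eps(1), simplified]
  tensor_aug_mul(2) tensor_aug_left(2) tensor_aug_right(2) tensor_aug_eps(2)

text \<open>The product is expanded in the second factor first; its unit term leaves a * c in front
  of 1, and only this remainder is expanded in the first factor.\<close>

lemma tensor_mul_eq_pure:
  assumes "a \<in> carrier V" "b \<in> carrier W" "c \<in> carrier V" "d \<in> carrier W"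
  shows "pure (amul A a c) (amul B b d) =
    aleft TA (pure a b) (pure c d) \<oplus>\<^bsub>T\<^esub> aright TA (pure a b) (pure c d) \<oplus>\<^bsub>T\<^esub>
      (aeps TA (pure a b) \<otimes> aeps TA (pure c d)) \<odot>\<^bsub>T\<^esub> aone TA"
proof -
  have "pure (amul A a c) (amul B b d) =
    pure (amul A a c) (aleft B b d) \<oplus>\<^bsub>T\<^esub> pure (amul A a c) (aright B b d) \<oplus>\<^bsub>T\<^esub>
    (aeps B b \<otimes> aeps B d) \<odot>\<^bsub>T\<^esub> pure (amul A a c) (aone B)"
    using assms by (simp add: B.mul_eq[of b d])
  also have "pure (amul A a c) (aone B) = pure (aleft A a c) (aone B) \<oplus>\<^bsub>T\<^esub> pure (aright A a c) (aone B) \<oplus>\<^bsub>T\<^esub>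
    (aeps A a \<otimes> aeps A c) \<odot>\<^bsub>T\<^esub> pure (aone A) (aone B)"
    using assms by (simp add: A.mul_eq[of a c])
  finally show ?thesis
    using assms by (simp add: TA_simps T.smult_r_distr T.smult_assoc1[symmetric] T.a_ac A.m_ac)
qed

lemma tensor_left_one_pure:
  assumes "a \<in> carrier V" "b \<in> carrier W"
  shows "aleft TA (pure a b) (aone TA) \<oplus>\<^bsub>T\<^esub> aeps TA (pure a b) \<odot>\<^bsub>T\<^esub> aone TA = pure a b"
proof -
  have "pure a b = pure a (aleft B b (aone B)) \<oplus>\<^bsub>T\<^esub> aeps B b \<odot>\<^bsub>T\<^esub> pure a (aone B)"
    using assms B.left_one[of b] pure_simps(3)[of a "aleft B b (aone B)" "aeps B b \<odot>\<^bsub>W\<^esub> aone B"] by simp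
  also have "pure a (aone B) = pure (aleft A a (aone A)) (aone B) \<oplus>\<^bsub>T\<^esub> aeps A a \<odot>\<^bsub>T\<^esub> pure (aone A) (aone B)"
    using assms A.left_one[of a] pure_simps(2)[of "aleft A a (aone A)" "aeps A a \<odot>\<^bsub>V\<^esub> aone A" "aone B"] by simp
  finally show ?thesis
    using assms by (simp add: TA_simps T.smult_r_distr T.smult_assoc1[symmetric] T.a_ac A.m_ac)
qed

lemma tensor_one_right_pure:
  assumes "a \<in> carrier V" "b \<in> carrier W"
  shows "aright TA (aone TA) (pure a b) \<oplus>\<^bsub>T\<^esub> aeps TA (pure a b) \<odot>\<^bsub>T\<^esub> aone TA = pure a b"
proof -
  have "pure a b = pure a (aright B (aone B) b) \<oplus>\<^bsub>T\<^esub> aeps B b \<odot>\<^bsub>T\<^esub> pure a (aone B)"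
    using assms B.one_right[of b] pure_simps(3)[of a "aright B (aone B) b" "aeps B b \<odot>\<^bsub>W\<^esub> aone B"] by simp
  also have "pure a (aone B) = pure (aright A (aone A) a) (aone B) \<oplus>\<^bsub>T\<^esub> aeps A a \<odot>\<^bsub>T\<^esub> pure (aone A) (aone B)"
    using assms A.one_right[of a] pure_simps(2)[of "aright A (aone A) a" "aeps A a \<odot>\<^bsub>V\<^esub> aone A" "aone B"] by simp
  finally show ?thesis
    using assms by (simp add: TA_simps T.smult_r_distr T.smult_assoc1[symmetric] T.a_ac A.m_ac)
qed

text \<open>On pure tensors each dendriform identity splits in two. The main terms use the identity
  of \<open>B\<close> in the second factor and associativity of \<open>amul A\<close> in the first;
  the terms ending in 1 reproduce the identity of \<open>A\<close>.\<close>

sublocale TA: augmented K T TA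
proof (intro augmented.intro T.vspace_axioms augmented_axioms.intro)
  note ac = T.a_ac T.smult_r_distr T.smult_l_distr T.smult_assoc1[symmetric] A.m_ac A.l_distr A.r_distr
  note ops = TA_simps A.left_left B.left_left A.right_left B.right_left A.right_right B.right_right
    A.mul_assoc B.mul_assoc
  fix X assume X: "X \<in> carrier T"
  show "aleft TA (aone TA) X = \<zero>\<^bsub>T\<^esub>" "aright TA X (aone TA) = \<zero>\<^bsub>T\<^esub>"
    using X by (induction rule: tensor_induct) (simp_all add: TA_simps)
  show "aleft TA X (aone TA) \<oplus>\<^bsub>T\<^esub> aeps TA X \<odot>\<^bsub>T\<^esub> aone TA = X"
    using X
  proof (induction rule: tensor_induct)
    case (add X Y)
    \<comment> \<open>The induction hypothesis is used backwards, and only on the right-hand side: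
      the third occurrence of each summand.\<close>
    then show ?case
      by (subst (3) add(3)[symmetric], subst (3) add(4)[symmetric]) (simp add: TA_simps ac)
  qed (rule tensor_left_one_pure)
  show "aright TA (aone TA) X \<oplus>\<^bsub>T\<^esub> aeps TA X \<odot>\<^bsub>T\<^esub> aone TA = X"
    using X
  proof (induction rule: tensor_induct)
    case (add X Y)
    then show ?case
      by (subst (3) add(3)[symmetric], subst (3) add(4)[symmetric]) (simp add: TA_simps ac)
  qed (rule tensor_one_right_pure)
  fix Y assume Y: "Y \<in> carrier T"
  show "aeps TA (aleft TA X Y) = \<zero>"
    by (rule tensor_induct3[OF X Y Y]) (simp_all add: TA_simps)
  show "aeps TA (aright TA X Y) = \<zero>"
    by (rule tensor_induct3[OF X Y Y]) (simp_all add: TA_simps)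
  show "amul TA X Y = aleft TA X Y \<oplus>\<^bsub>T\<^esub> aright TA X Y \<oplus>\<^bsub>T\<^esub> (aeps TA X \<otimes> aeps TA Y) \<odot>\<^bsub>T\<^esub> aone TA"
    by (rule tensor_induct3[OF X Y Y]) (use tensor_mul_eq_pure in \<open>simp_all add: TA_simps ac\<close>)
  fix Z assume Z: "Z \<in> carrier T"
  show "aleft TA (aleft TA X Y) Z = aleft TA X (amul TA Y Z)"
    by (rule tensor_induct3[OF X Y Z]) (simp_all add: ops ac)
  show "aleft TA (aright TA X Y) Z = aright TA X (aleft TA Y Z)"
    by (rule tensor_induct3[OF X Y Z]) (simp_all add: ops ac)
  show "aright TA X (aright TA Y Z) = aright TA (amul TA X Y) Z"
    by (rule tensor_induct3[OF X Y Z]) (simp_all add: ops ac)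
qed (simp_all add: tensor_aug_left(1) tensor_aug_right(1) tensor_aug_eps)

end


subsection \<open>Morphisms\<close>

definition aug_homs ::
  "('k, _) ring_scheme \<Rightarrow> ('k, 'a, _) module_scheme \<Rightarrow> ('k, 'a) aug \<Rightarrow> ('k, 'b, _) module_scheme \<Rightarrow>
   ('k, 'b) aug \<Rightarrow> ('a \<Rightarrow> 'b) set"
  where "aug_homs K W A W' A' = {f \<in> lin_maps K W W'. f (aone A) = aone A' \<and>
    (\<forall>x\<in>carrier W. aeps A' (f x) = aeps A x) \<and>
    (\<forall>x\<in>carrier W. \<forall>y\<in>carrier W. f (aleft A x y) = aleft A' (f x) (f y) \<and>
      f (aright A x y) = aright A' (f x) (f y))}"

lemma aug_homsI:
  assumes "f \<in> lin_maps K W W'" "f (aone A) = aone A'"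
    "\<And>x. x \<in> carrier W \<Longrightarrow> aeps A' (f x) = aeps A x"
    "\<And>x y. \<lbrakk>x \<in> carrier W; y \<in> carrier W\<rbrakk> \<Longrightarrow> f (aleft A x y) = aleft A' (f x) (f y)"
    "\<And>x y. \<lbrakk>x \<in> carrier W; y \<in> carrier W\<rbrakk> \<Longrightarrow> f (aright A x y) = aright A' (f x) (f y)"
  shows "f \<in> aug_homs K W A W' A'"
  using assms by (simp add: aug_homs_def)

lemma aug_homs_lin: "f \<in> aug_homs K W A W' A' \<Longrightarrow> f \<in> lin_maps K W W'"
  by (simp add: aug_homs_def)

lemma aug_homs_simps:
  assumes "f \<in> aug_homs K W A W' A'"
  shows "f (aone A) = aone A'" "x \<in> carrier W \<Longrightarrow> aeps A' (f x) = aeps A x"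
    "\<lbrakk>x \<in> carrier W; y \<in> carrier W\<rbrakk> \<Longrightarrow> f (aleft A x y) = aleft A' (f x) (f y)"
    "\<lbrakk>x \<in> carrier W; y \<in> carrier W\<rbrakk> \<Longrightarrow> f (aright A x y) = aright A' (f x) (f y)"
  using assms by (simp_all add: aug_homs_def)

lemma aug_homs_mul:
  assumes "augmented K W A" "augmented K W' A'" and f: "f \<in> aug_homs K W A W' A'"
    and "x \<in> carrier W" "y \<in> carrier W"
  shows "f (amul A x y) = amul A' (f x) (f y)"
proof -
  interpret A: augmented K W A by fact
  interpret A': augmented K W' A' by fact
  note l = lin_simps[OF aug_homs_lin[OF f]]
  show ?thesis
    using assms(4,5) by (simp add: A.mul_eq A'.mul_eq l aug_homs_simps[OF f])
qed

lemma aug_homs_id: "(\<lambda>x. x) \<in> aug_homs K W A W A"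
  by (simp add: aug_homs_def lin_id)

lemma aug_homs_comp:
  assumes f: "f \<in> aug_homs K W A W' A'" and g: "g \<in> aug_homs K W' A' W'' A''"
  shows "(\<lambda>x. g (f x)) \<in> aug_homs K W A W'' A''"
  by (intro aug_homsI lin_comp[OF aug_homs_lin[OF f] aug_homs_lin[OF g]])
    (simp_all add: aug_homs_simps[OF f] aug_homs_simps[OF g] lin_closed[OF aug_homs_lin[OF f]])

lemma aug_homs_tensor_map:
  assumes "augmented K V A" "augmented K W B" "augmented K V' A'" "augmented K W' B'"
    and f: "f \<in> aug_homs K V A V' A'" and g: "g \<in> aug_homs K W B W' B'"
  shows "tensor_map K V' W' f g \<in>
    aug_homs K (tensor K V W) (tensor_aug K V A W B) (tensor K V' W') (tensor_aug K V' A' W' B')"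
proof -
  interpret S: two_augs K V A W B using assms by (simp add: two_augs_def)
  interpret S': two_augs K V' A' W' B' using assms by (simp add: two_augs_def)
  note lin = aug_homs_lin[OF f] aug_homs_lin[OF g]
  note tm = tensor_map_lin[OF S.A.vspace_axioms S.B.vspace_axioms S'.A.vspace_axioms S'.B.vspace_axioms lin]
  note simps = tm(2) lin_simps[OF tm(1)] S.TA_simps S'.TA_simps lin_simps[OF lin(1)] lin_simps[OF lin(2)]
    aug_homs_simps[OF f] aug_homs_simps[OF g] aug_homs_mul[OF assms(1,3) f] aug_homs_mul[OF assms(2,4) g]
  show ?thesis
  proof (intro aug_homsI tm(1))
    fix X assume X: "X \<in> carrier S.T"
    show "aeps S'.TA (tensor_map K V' W' f g X) = aeps S.TA X"
      using X by (induction rule: S.tensor_induct) (simp_all add: simps)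
    fix Y assume Y: "Y \<in> carrier S.T"
    show "tensor_map K V' W' f g (aleft S.TA X Y) =
        aleft S'.TA (tensor_map K V' W' f g X) (tensor_map K V' W' f g Y)"
      by (rule S.tensor_induct3[OF X Y Y]) (simp_all add: simps)
    show "tensor_map K V' W' f g (aright S.TA X Y) =
        aright S'.TA (tensor_map K V' W' f g X) (tensor_map K V' W' f g Y)"
      by (rule S.tensor_induct3[OF X Y Y]) (simp_all add: simps)
  qed (simp add: simps)
qed

lemma tensor_assoc_induct [consumes 4, case_names pure add]:
  assumes "vspace K U" "vspace K V" "vspace K W" "X \<in> carrier (tensor K U (tensor K V W))"
    and pure: "\<And>u v w. \<lbrakk>u \<in> carrier U; v \<in> carrier V; w \<in> carrier W\<rbrakk> \<Longrightarrow>
      P (pure_tensor K U (tensor K V W) u (pure_tensor K V W v w))"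
    and add: "\<And>X Y. \<lbrakk>X \<in> carrier (tensor K U (tensor K V W)); Y \<in> carrier (tensor K U (tensor K V W)); P X; P Y\<rbrakk> \<Longrightarrow>
      P (X \<oplus>\<^bsub>tensor K U (tensor K V W)\<^esub> Y)"
  shows "P X"
proof -
  interpret VW: two_spaces K V W using assms by (simp add: two_spaces_def)
  interpret U: two_spaces K U VW.T using assms by (simp add: two_spaces_def VW.vspace_T)
  have 1: "P (U.pure u Y)" if "u \<in> carrier U" "Y \<in> carrier VW.T" for u Y
    using that(2,1) by (induction rule: VW.tensor_induct) (simp_all add: pure add)
  show ?thesis using assms(4) by (induction rule: U.tensor_induct) (simp_all add: 1 add)
qed

text \<open>Makes both sides of coassociativity morphisms into the same algebra, so that they can be
  compared on generators.\<close>

lemma aug_homs_assoc: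
  assumes "augmented K U A" "augmented K V B" "augmented K W C"
  shows "tensor_assoc K U V W \<in>
    aug_homs K (tensor K U (tensor K V W)) (tensor_aug K U A (tensor K V W) (tensor_aug K V B W C))
      (tensor K (tensor K U V) W) (tensor_aug K (tensor K U V) (tensor_aug K U A V B) W C)"
proof -
  interpret VW: two_augs K V B W C using assms by (simp add: two_augs_def)
  interpret UV: two_augs K U A V B using assms by (simp add: two_augs_def)
  interpret U: two_augs K U A VW.T VW.TA
    by (intro two_augs.intro UV.A.augmented_axioms VW.TA.augmented_axioms)
  interpret W: two_augs K UV.T UV.TA W C
    by (intro two_augs.intro VW.B.augmented_axioms UV.TA.augmented_axioms)
  note vs = UV.A.vspace_axioms VW.A.vspace_axioms VW.B.vspace_axioms
  note al = tensor_assoc_lin[OF vs]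
  note simps = al(2) lin_simps[OF al(1)] U.TA_simps VW.TA_simps UV.TA_simps W.TA_simps
    W.T.smult_r_distr W.T.smult_assoc1[symmetric] W.T.a_ac VW.A.m_ac
  \<comment> \<open>Two bilinear maps agree as soon as they agree on tensors of the form a \<otimes>
    (b \<otimes> c), in each argument.\<close>
  have eq2: "f X Y = g X Y"
    if f: "bilinear K U.T U.T W.T f" and g: "bilinear K U.T U.T W.T g"
      and XY: "X \<in> carrier U.T" "Y \<in> carrier U.T"
      and fg: "\<And>a b c a' b' c'. \<lbrakk>a \<in> carrier U; b \<in> carrier V; c \<in> carrier W; a' \<in> carrier U; b' \<in> carrier V; c' \<in> carrier W\<rbrakk> \<Longrightarrow>
        f (U.pure a (VW.pure b c)) (U.pure a' (VW.pure b' c')) = g (U.pure a (VW.pure b c)) (U.pure a' (VW.pure b' c'))"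
    for f g X Y
  proof -
    have 1: "f (U.pure a (VW.pure b c)) Y = g (U.pure a (VW.pure b c)) Y"
      if "a \<in> carrier U" "b \<in> carrier V" "c \<in> carrier W" for a b c
      using vs XY(2) by (induction rule: tensor_assoc_induct)
        (simp_all add: fg that bilinear_simps[OF f] bilinear_simps[OF g])
    show ?thesis
      using vs XY(1) by (induction rule: tensor_assoc_induct)
        (simp_all add: 1 XY(2) bilinear_simps[OF f] bilinear_simps[OF g])
  qed
  show ?thesis
  proof (intro aug_homsI al(1))
    fix X assume X: "X \<in> carrier U.T"
    show "aeps W.TA (tensor_assoc K U V W X) = aeps U.TA X"
      using vs X by (induction rule: tensor_assoc_induct) (simp_all add: simps)
    fix Y assume Y: "Y \<in> carrier U.T"
    show "tensor_assoc K U V W (aleft U.TA X Y) = aleft W.TA (tensor_assoc K U V W X) (tensor_assoc K U V W Y)"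
      by (rule eq2[OF bilinear_post[OF U.TA.left_bilinear al(1)]
            bilinear_comp[OF W.TA.left_bilinear al(1) al(1)] X Y]) (simp add: simps)
    show "tensor_assoc K U V W (aright U.TA X Y) = aright W.TA (tensor_assoc K U V W X) (tensor_assoc K U V W Y)"
      by (rule eq2[OF bilinear_post[OF U.TA.right_bilinear al(1)]
            bilinear_comp[OF W.TA.right_bilinear al(1) al(1)] X Y]) (simp add: simps)
  qed (simp add: simps)
qed

section \<open>The counits of the tensor square as morphisms\<close>

context augmented begin

interpretation S: two_augs K W A W A by (intro two_augs.intro augmented_axioms)

lemma counit_bilinear:
  "bilinear K W W W (\<lambda>y z. \<epsilon> y \<odot>\<^bsub>W\<^esub> z)" "bilinear K W W W (\<lambda>y z. \<epsilon> z \<odot>\<^bsub>W\<^esub> y)"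
  by (intro bilinearI; simp add: smult_l_distr smult_r_distr smult_assoc1[symmetric] m_ac)+

lemma aug_homs_counit_left:
  "tensor_lift K W (\<lambda>y z. \<epsilon> y \<odot>\<^bsub>W\<^esub> z) \<in> aug_homs K (tensor K W W) (tensor_aug K W A W A) W A"
proof -
  note l = S.tensor_lift_lin[OF vspace_axioms counit_bilinear(1)] S.tensor_lift_pure[OF vspace_axioms counit_bilinear(1)]
  note simps = l(2) lin_simps[OF l(1)] S.TA_simps smult_assoc1[symmetric] m_ac
  show ?thesis
  proof (intro aug_homsI l(1))
    fix X assume X: "X \<in> carrier S.T"
    show "\<epsilon> (tensor_lift K W (\<lambda>y z. \<epsilon> y \<odot>\<^bsub>W\<^esub> z) X) = aeps S.TA X"
      using X by (induction rule: S.tensor_induct) (simp_all add: simps)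
    fix Y assume Y: "Y \<in> carrier S.T"
    show "tensor_lift K W (\<lambda>y z. \<epsilon> y \<odot>\<^bsub>W\<^esub> z) (aleft S.TA X Y) =
      L (tensor_lift K W (\<lambda>y z. \<epsilon> y \<odot>\<^bsub>W\<^esub> z) X) (tensor_lift K W (\<lambda>y z. \<epsilon> y \<odot>\<^bsub>W\<^esub> z) Y)"
      by (rule S.tensor_induct3[OF X Y Y]) (simp_all add: simps)
    show "tensor_lift K W (\<lambda>y z. \<epsilon> y \<odot>\<^bsub>W\<^esub> z) (aright S.TA X Y) =
      R (tensor_lift K W (\<lambda>y z. \<epsilon> y \<odot>\<^bsub>W\<^esub> z) X) (tensor_lift K W (\<lambda>y z. \<epsilon> y \<odot>\<^bsub>W\<^esub> z) Y)"
      by (rule S.tensor_induct3[OF X Y Y]) (simp_all add: simps)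
  qed (simp add: simps)
qed

text \<open>Here the second summand in \<open>tensor_aug\<close> does the work: \<epsilon> kills b
  \<prec> d in the main term, so the product a \<prec> c must come from the correction. On the left
  side the roles of the two summands are exchanged.\<close>

lemma aug_homs_counit_right:
  "tensor_lift K W (\<lambda>y z. \<epsilon> z \<odot>\<^bsub>W\<^esub> y) \<in> aug_homs K (tensor K W W) (tensor_aug K W A W A) W A"
proof -
  note l = S.tensor_lift_lin[OF vspace_axioms counit_bilinear(2)] S.tensor_lift_pure[OF vspace_axioms counit_bilinear(2)]
  note simps = l(2) lin_simps[OF l(1)] S.TA_simps smult_assoc1[symmetric] m_ac
  show ?thesis
  proof (intro aug_homsI l(1))
    fix X assume X: "X \<in> carrier S.T"
    show "\<epsilon> (tensor_lift K W (\<lambda>y z. \<epsilon> z \<odot>\<^bsub>W\<^esub> y) X) = aeps S.TA X"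
      using X by (induction rule: S.tensor_induct) (simp_all add: simps)
    fix Y assume Y: "Y \<in> carrier S.T"
    show "tensor_lift K W (\<lambda>y z. \<epsilon> z \<odot>\<^bsub>W\<^esub> y) (aleft S.TA X Y) =
      L (tensor_lift K W (\<lambda>y z. \<epsilon> z \<odot>\<^bsub>W\<^esub> y) X) (tensor_lift K W (\<lambda>y z. \<epsilon> z \<odot>\<^bsub>W\<^esub> y) Y)"
      by (rule S.tensor_induct3[OF X Y Y]) (simp_all add: simps)
    show "tensor_lift K W (\<lambda>y z. \<epsilon> z \<odot>\<^bsub>W\<^esub> y) (aright S.TA X Y) =
      R (tensor_lift K W (\<lambda>y z. \<epsilon> z \<odot>\<^bsub>W\<^esub> y) X) (tensor_lift K W (\<lambda>y z. \<epsilon> z \<odot>\<^bsub>W\<^esub> y) Y)"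
      by (rule S.tensor_induct3[OF X Y Y]) (simp_all add: simps)
  qed (simp add: simps)
qed

end

subsection \<open>Unital dendriform algebras as augmented ones\<close>

definition aug_of :: "('k, _) ring_scheme \<Rightarrow> ('k, 'a, _) udend_scheme \<Rightarrow> ('k, 'a) aug"
  where "aug_of K W = \<lparr>amul = mult W, aleft = omit_unit K W (prec W), aright = omit_unit K W (succ W),
    aone = one W, aeps = proj_unit K W\<rparr>"

lemma aug_of_simps [simp]:
  "amul (aug_of K W) = mult W" "aleft (aug_of K W) = omit_unit K W (prec W)"
  "aright (aug_of K W) = omit_unit K W (succ W)" "aone (aug_of K W) = one W"
  "aeps (aug_of K W) = proj_unit K W"
  by (simp_all add: aug_of_def)

lemma plus_part_simps [simp]:
  "carrier (plus_part W) = pos W" "add (plus_part W) = add W" "zero (plus_part W) = zero W"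
  "smult (plus_part W) = smult W" "mult (plus_part W) = mult W" "prec (plus_part W) = prec W"
  "succ (plus_part W) = succ W"
  by (simp_all add: plus_part_def dend.defs)

context unital_dendriform_algebra begin

abbreviation "\<epsilon> \<equiv> proj_unit K W"
abbreviation "p \<equiv> proj_pos K W"

lemmas pos_facts [simp] = submodule_facts[OF pos_submodule]

lemma proj_unique:
  assumes "a \<in> carrier K" "v \<in> pos W" "x = a \<odot>\<^bsub>W\<^esub> \<one>\<^bsub>W\<^esub> \<oplus>\<^bsub>W\<^esub> v"
  shows "\<epsilon> x = a" and "p x = v"
proof -
  have x: "x \<in> carrier W" using assms one_in_carrier by simp
  show 1: "\<epsilon> x = a"
    unfolding proj_unit_def using decomposition[OF x] assms by (intro the_equality) auto
  have "p x = x \<ominus>\<^bsub>W\<^esub> a \<odot>\<^bsub>W\<^esub> \<one>\<^bsub>W\<^esub>" by (simp add: proj_pos_def 1)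
  also have "\<dots> = v" using assms one_in_carrier by (simp add: a_minus_def a_ac r_neg)
  finally show "p x = v" .
qed

lemma proj_decomp:
  assumes "x \<in> carrier W"
  shows "\<epsilon> x \<in> carrier K" "p x \<in> pos W" "\<epsilon> x \<odot>\<^bsub>W\<^esub> \<one>\<^bsub>W\<^esub> \<oplus>\<^bsub>W\<^esub> p x = x"
proof -
  obtain a v where "a \<in> carrier K" "v \<in> pos W" "x = a \<odot>\<^bsub>W\<^esub> \<one>\<^bsub>W\<^esub> \<oplus>\<^bsub>W\<^esub> v"
    using decomposition[OF assms] by blast
  with proj_unique[OF this] show "\<epsilon> x \<in> carrier K" "p x \<in> pos W" "\<epsilon> x \<odot>\<^bsub>W\<^esub> \<one>\<^bsub>W\<^esub> \<oplus>\<^bsub>W\<^esub> p x = x"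
    by simp_all
qed

lemmas proj_closed [simp] = proj_decomp(1,2) proj_decomp(2)[THEN pos_facts(1)]

lemma proj_add:
  assumes "x \<in> carrier W" "y \<in> carrier W"
  shows "\<epsilon> (x \<oplus>\<^bsub>W\<^esub> y) = \<epsilon> x \<oplus> \<epsilon> y" "p (x \<oplus>\<^bsub>W\<^esub> y) = p x \<oplus>\<^bsub>W\<^esub> p y"
proof -
  have *: "x \<oplus>\<^bsub>W\<^esub> y = (\<epsilon> x \<oplus> \<epsilon> y) \<odot>\<^bsub>W\<^esub> \<one>\<^bsub>W\<^esub> \<oplus>\<^bsub>W\<^esub> (p x \<oplus>\<^bsub>W\<^esub> p y)"
    using assms one_in_carrier arg_cong2[OF proj_decomp(3)[OF assms(1)] proj_decomp(3)[OF assms(2)], of "add W"]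
    by (simp add: smult_l_distr a_ac)
  show "\<epsilon> (x \<oplus>\<^bsub>W\<^esub> y) = \<epsilon> x \<oplus> \<epsilon> y" "p (x \<oplus>\<^bsub>W\<^esub> y) = p x \<oplus>\<^bsub>W\<^esub> p y"
    using assms proj_unique[OF _ _ *] by simp_all
qed

lemma proj_smult:
  assumes "a \<in> carrier K" "x \<in> carrier W"
  shows "\<epsilon> (a \<odot>\<^bsub>W\<^esub> x) = a \<otimes> \<epsilon> x" "p (a \<odot>\<^bsub>W\<^esub> x) = a \<odot>\<^bsub>W\<^esub> p x"
proof -
  have *: "a \<odot>\<^bsub>W\<^esub> x = (a \<otimes> \<epsilon> x) \<odot>\<^bsub>W\<^esub> \<one>\<^bsub>W\<^esub> \<oplus>\<^bsub>W\<^esub> a \<odot>\<^bsub>W\<^esub> p x"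
    using assms one_in_carrier arg_cong[OF proj_decomp(3)[OF assms(2)], of "smult W a"]
    by (simp add: smult_r_distr smult_assoc1)
  show "\<epsilon> (a \<odot>\<^bsub>W\<^esub> x) = a \<otimes> \<epsilon> x" "p (a \<odot>\<^bsub>W\<^esub> x) = a \<odot>\<^bsub>W\<^esub> p x"
    using assms proj_unique[OF _ _ *] by simp_all
qed

lemma proj_pos [simp]: "v \<in> pos W \<Longrightarrow> \<epsilon> v = \<zero>" "v \<in> pos W \<Longrightarrow> p v = v"
  using proj_unique[of \<zero> v v] one_in_carrier by simp_all

lemma proj_one [simp]: "\<epsilon> \<one>\<^bsub>W\<^esub> = \<one>" "p \<one>\<^bsub>W\<^esub> = \<zero>\<^bsub>W\<^esub>"
  using proj_unique[of \<one> "\<zero>\<^bsub>W\<^esub>" "\<one>\<^bsub>W\<^esub>"] one_in_carrier pos_facts(2) by simp_all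

lemma pos_iff: "x \<in> pos W \<longleftrightarrow> x \<in> carrier W \<and> \<epsilon> x = \<zero>"
  using proj_decomp(2,3)[of x] one_in_carrier by (auto, metis l_zero pos_facts(1) proj_decomp(2) smult_l_null)

lemma posI: "\<lbrakk>x \<in> carrier W; \<epsilon> x = \<zero>\<rbrakk> \<Longrightarrow> x \<in> pos W"
  by (simp only: pos_iff)

lemma proj_unit_lin: "\<epsilon> \<in> lin_maps K W (base_module K)"
  by (intro lin_mapsI) (simp_all add: proj_add proj_smult)

interpretation P: dendriform_algebra K "plus_part W" by (rule plus_dendriform)

lemmas pos_prec [simp] = bilinear_simps[OF P.prec_bilinear, simplified]
lemmas pos_succ [simp] = bilinear_simps[OF P.succ_bilinear, simplified]

lemma prec_pos: "\<lbrakk>x \<in> carrier W; y \<in> pos W\<rbrakk> \<Longrightarrow> x \<prec>\<^bsub>W\<^esub> y = p x \<prec>\<^bsub>W\<^esub> y"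
  using bilinear_simps(2)[OF prec_bilinear_right, of "\<epsilon> x \<odot>\<^bsub>W\<^esub> \<one>\<^bsub>W\<^esub>" "p x" y]
  by (simp add: proj_decomp(3) bilinear_simps[OF prec_bilinear_right, simplified] one_in_carrier one_prec)

lemma succ_pos: "\<lbrakk>x \<in> carrier W; y \<in> pos W\<rbrakk> \<Longrightarrow> x \<succ>\<^bsub>W\<^esub> y = p x \<succ>\<^bsub>W\<^esub> y \<oplus>\<^bsub>W\<^esub> \<epsilon> x \<odot>\<^bsub>W\<^esub> y"
  using bilinear_simps(2)[OF succ_bilinear_right, of "\<epsilon> x \<odot>\<^bsub>W\<^esub> \<one>\<^bsub>W\<^esub>" "p x" y]
    a_comm[of "\<epsilon> x \<odot>\<^bsub>W\<^esub> y" "p x \<succ>\<^bsub>W\<^esub> y"]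
  by (simp add: proj_decomp(3) bilinear_simps[OF succ_bilinear_right, simplified] one_in_carrier one_succ)

lemma omit_prec: "\<lbrakk>x \<in> carrier W; y \<in> carrier W\<rbrakk> \<Longrightarrow>
    omit_unit K W (prec W) x y = p x \<prec>\<^bsub>W\<^esub> p y \<oplus>\<^bsub>W\<^esub> \<epsilon> y \<odot>\<^bsub>W\<^esub> p x"
  and omit_succ: "\<lbrakk>x \<in> carrier W; y \<in> carrier W\<rbrakk> \<Longrightarrow>
    omit_unit K W (succ W) x y = p x \<succ>\<^bsub>W\<^esub> p y \<oplus>\<^bsub>W\<^esub> \<epsilon> x \<odot>\<^bsub>W\<^esub> p y"
  by (simp_all add: omit_unit_def prec_pos[of x] succ_pos[of x] prec_one succ_one)

lemma mult_decomp:
  assumes "x \<in> carrier W" "y \<in> carrier W"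
  shows "x \<otimes>\<^bsub>W\<^esub> y = omit_unit K W (prec W) x y \<oplus>\<^bsub>W\<^esub> omit_unit K W (succ W) x y \<oplus>\<^bsub>W\<^esub> (\<epsilon> x \<otimes> \<epsilon> y) \<odot>\<^bsub>W\<^esub> \<one>\<^bsub>W\<^esub>"
proof -
  note b = bilinear_simps[OF star_bilinear]
  have "x \<otimes>\<^bsub>W\<^esub> y = (\<epsilon> x \<odot>\<^bsub>W\<^esub> \<one>\<^bsub>W\<^esub> \<oplus>\<^bsub>W\<^esub> p x) \<otimes>\<^bsub>W\<^esub> (\<epsilon> y \<odot>\<^bsub>W\<^esub> \<one>\<^bsub>W\<^esub> \<oplus>\<^bsub>W\<^esub> p y)"
    using assms by (simp add: proj_decomp(3))
  also have "\<dots> = omit_unit K W (prec W) x y \<oplus>\<^bsub>W\<^esub> omit_unit K W (succ W) x y \<oplus>\<^bsub>W\<^esub> (\<epsilon> x \<otimes> \<epsilon> y) \<odot>\<^bsub>W\<^esub> \<one>\<^bsub>W\<^esub>"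
    using assms one_in_carrier
    by (simp add: b bilinear_simps[OF prec_bilinear_right, simplified] bilinear_simps[OF succ_bilinear_right, simplified]
        omit_prec omit_succ star_one_one star_pos_left star_pos_right one_prec one_succ prec_one succ_one
        smult_assoc1[symmetric] smult_r_distr a_ac m_ac)
  finally show ?thesis .
qed

lemma augmented_aug_of: "augmented K W (aug_of K W)"
proof (intro augmented.intro vspace_axioms augmented_axioms.intro; simp?)
  note s = proj_add proj_smult omit_prec omit_succ a_ac smult_l_distr smult_r_distr smult_assoc1[symmetric] m_ac
  show "\<one>\<^bsub>W\<^esub> \<in> carrier W" by (rule one_in_carrier)
  show "\<epsilon> \<in> lin_maps K W (base_module K)" by (rule proj_unit_lin)
  show "bilinear K W W W (omit_unit K W (prec W))" "bilinear K W W W (omit_unit K W (succ W))"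
    by (intro bilinearI; simp add: s)+
  note z = bilinear_zero[OF P.prec_bilinear P.vspace_axioms P.vspace_axioms P.vspace_axioms, simplified]
    bilinear_zero[OF P.succ_bilinear P.vspace_axioms P.vspace_axioms P.vspace_axioms, simplified]
  fix x assume x: "x \<in> carrier W"
  show "omit_unit K W (prec W) \<one>\<^bsub>W\<^esub> x = \<zero>\<^bsub>W\<^esub>" "omit_unit K W (succ W) x \<one>\<^bsub>W\<^esub> = \<zero>\<^bsub>W\<^esub>"
    using x one_in_carrier by (simp_all add: omit_prec omit_succ z)
  show "omit_unit K W (prec W) x \<one>\<^bsub>W\<^esub> \<oplus>\<^bsub>W\<^esub> \<epsilon> x \<odot>\<^bsub>W\<^esub> \<one>\<^bsub>W\<^esub> = x"
    "omit_unit K W (succ W) \<one>\<^bsub>W\<^esub> x \<oplus>\<^bsub>W\<^esub> \<epsilon> x \<odot>\<^bsub>W\<^esub> \<one>\<^bsub>W\<^esub> = x"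
    using x one_in_carrier proj_decomp(3)[of x] by (simp_all add: omit_prec omit_succ z a_comm)
  fix y assume y: "y \<in> carrier W"
  show "x \<otimes>\<^bsub>W\<^esub> y = omit_unit K W (prec W) x y \<oplus>\<^bsub>W\<^esub> omit_unit K W (succ W) x y \<oplus>\<^bsub>W\<^esub> (\<epsilon> x \<otimes> \<epsilon> y) \<odot>\<^bsub>W\<^esub> \<one>\<^bsub>W\<^esub>"
    using x y by (rule mult_decomp)
  show "\<epsilon> (omit_unit K W (prec W) x y) = \<zero>" "\<epsilon> (omit_unit K W (succ W) x y) = \<zero>"
    using x y by (simp_all add: omit_prec omit_succ)
  fix z assume z: "z \<in> carrier W"
  note ax = P.prec_prec[simplified] P.succ_prec[simplified] P.succ_succ[simplified]
  show "omit_unit K W (prec W) (omit_unit K W (prec W) x y) z = omit_unit K W (prec W) x (y \<otimes>\<^bsub>W\<^esub> z)"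
    "omit_unit K W (prec W) (omit_unit K W (succ W) x y) z = omit_unit K W (succ W) x (omit_unit K W (prec W) y z)"
    "omit_unit K W (succ W) x (omit_unit K W (succ W) y z) = omit_unit K W (succ W) (x \<otimes>\<^bsub>W\<^esub> y) z"
    using x y z one_in_carrier by (simp_all add: mult_decomp s ax)
qed

end


text \<open>The products in which one factor is 1 are fixed by the axioms, so a linear map
  preserving 1 and \<epsilon> needs to be tested on the kernel of \<epsilon> only.\<close>

lemma (in augmented) aug_homsI_pos:
  assumes A': "augmented K W' A'" and f: "f \<in> lin_maps K W W'" and f1: "f u = aone A'"
    and eps: "\<And>x. x \<in> carrier W \<Longrightarrow> aeps A' (f x) = \<epsilon> x"
    and left: "\<And>x y. \<lbrakk>x \<in> carrier W; y \<in> carrier W; \<epsilon> x = \<zero>; \<epsilon> y = \<zero>\<rbrakk> \<Longrightarrow> f (L x y) = aleft A' (f x) (f y)"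
    and right: "\<And>x y. \<lbrakk>x \<in> carrier W; y \<in> carrier W; \<epsilon> x = \<zero>; \<epsilon> y = \<zero>\<rbrakk> \<Longrightarrow> f (R x y) = aright A' (f x) (f y)"
  shows "f \<in> aug_homs K W A W' A'"
proof (rule aug_homsI[OF f f1 eps])
  interpret A': augmented K W' A' by fact
  note l = lin_simps[OF f]
  fix x y assume xy: "x \<in> carrier W" "y \<in> carrier W"
  \<comment> \<open>Multiplication by 1 from the right under \<prec> is the projection onto the
    kernel of \<epsilon>.\<close>
  define a b where "a = L x u" and "b = L y u"
  have a: "a \<in> carrier W" "\<epsilon> a = \<zero>" "x = a \<oplus>\<^bsub>W\<^esub> \<epsilon> x \<odot>\<^bsub>W\<^esub> u"
    and b: "b \<in> carrier W" "\<epsilon> b = \<zero>" "y = b \<oplus>\<^bsub>W\<^esub> \<epsilon> y \<odot>\<^bsub>W\<^esub> u"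
    using xy left_one by (simp_all add: a_def b_def)
  have e: "aeps A' (f a) = \<zero>\<^bsub>K\<^esub>" "aeps A' (f b) = \<zero>\<^bsub>K\<^esub>" using a b eps by simp_all
  \<comment> \<open>The coefficients get names of their own, because the equation for
    \<open>x\<close> with \<open>\<epsilon> x\<close> in it would rewrite \<open>x\<close> into a
    term containing \<open>x\<close>.\<close>
  obtain c d where cd: "c \<in> carrier K" "d \<in> carrier K" "x = a \<oplus>\<^bsub>W\<^esub> c \<odot>\<^bsub>W\<^esub> u" "y = b \<oplus>\<^bsub>W\<^esub> d \<odot>\<^bsub>W\<^esub> u"
    using a b xy eps_simps(1) by metis
  show "f (L x y) = aleft A' (f x) (f y)" "f (R x y) = aright A' (f x) (f y)"
    unfolding cd using a(1,2) b(1,2) cd(1,2) e by (simp_all add: l left right f1)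
qed (use eps in auto)

text \<open>Preserving 1 and the positive parts amounts to commuting with the projections onto K,
  and on the positive parts the total products coincide with the given ones. Afterwards morphisms
  are handled in the augmented form only.\<close>

lemma unital_dend_homs_eq:
  assumes "unital_dendriform_algebra K W" "unital_dendriform_algebra K W'"
  shows "unital_dend_homs K W W' = aug_homs K W (aug_of K W) W' (aug_of K W')"
proof -
  interpret W: unital_dendriform_algebra K W by fact
  interpret W': unital_dendriform_algebra K W' by fact
  interpret A: augmented K W "aug_of K W" by (rule W.augmented_aug_of)
  have "f \<in> aug_homs K W (aug_of K W) W' (aug_of K W')" if f: "f \<in> unital_dend_homs K W W'" for f
  proof -
    have f': "f \<in> lin_maps K W W'" "f \<one>\<^bsub>W\<^esub> = \<one>\<^bsub>W'\<^esub>" "\<And>x. x \<in> pos W \<Longrightarrow> f x \<in> pos W'"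
      "\<And>x y. \<lbrakk>x \<in> pos W; y \<in> pos W\<rbrakk> \<Longrightarrow> f (x \<prec>\<^bsub>W\<^esub> y) = f x \<prec>\<^bsub>W'\<^esub> f y"
      "\<And>x y. \<lbrakk>x \<in> pos W; y \<in> pos W\<rbrakk> \<Longrightarrow> f (x \<succ>\<^bsub>W\<^esub> y) = f x \<succ>\<^bsub>W'\<^esub> f y"
      using f by (auto simp: unital_dend_homs_def)
    note l = lin_simps[OF f'(1)]
    show ?thesis
    proof (rule A.aug_homsI_pos[OF W'.augmented_aug_of f'(1)])
      fix x assume x: "x \<in> carrier W"
      have "f x = f (proj_unit K W x \<odot>\<^bsub>W\<^esub> \<one>\<^bsub>W\<^esub> \<oplus>\<^bsub>W\<^esub> proj_pos K W x)"
        by (simp only: W.proj_decomp(3)[OF x])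
      also have "\<dots> = proj_unit K W x \<odot>\<^bsub>W'\<^esub> \<one>\<^bsub>W'\<^esub> \<oplus>\<^bsub>W'\<^esub> f (proj_pos K W x)"
        using x W.one_in_carrier by (simp add: l f'(2))
      finally show "aeps (aug_of K W') (f x) = aeps (aug_of K W) x"
        using W'.proj_unique(1)[of "proj_unit K W x" "f (proj_pos K W x)" "f x"] x f'(3) by simp
    next
      fix x y assume "x \<in> carrier W" "y \<in> carrier W" "aeps (aug_of K W) x = \<zero>\<^bsub>K\<^esub>" "aeps (aug_of K W) y = \<zero>\<^bsub>K\<^esub>"
      then have xy: "x \<in> pos W" "y \<in> pos W" using W.posI by simp_all
      then have c: "x \<in> carrier W" "y \<in> carrier W" "f x \<in> carrier W'" "f y \<in> carrier W'" using l(1) by auto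
      show "f (aleft (aug_of K W) x y) = aleft (aug_of K W') (f x) (f y)"
        "f (aright (aug_of K W) x y) = aright (aug_of K W') (f x) (f y)"
        using xy f'(3)[OF xy(1)] f'(3)[OF xy(2)] f'(4,5)[OF xy]
        by (simp_all add: W.omit_prec[OF c(1,2)] W'.omit_prec[OF c(3,4)] W.omit_succ[OF c(1,2)] W'.omit_succ[OF c(3,4)])
    qed (simp add: f'(2))
  qed
  moreover have "f \<in> unital_dend_homs K W W'" if f: "f \<in> aug_homs K W (aug_of K W) W' (aug_of K W')" for f
  proof -
    note l = lin_simps[OF aug_homs_lin[OF f]] and h = aug_homs_simps[OF f, simplified]
    have pos: "f x \<in> pos W'" if "x \<in> pos W" for x
      using that l(1) h(2) W.proj_pos(1) W'.pos_iff W.pos_facts(1) by metis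
    have "f (x \<prec>\<^bsub>W\<^esub> y) = f x \<prec>\<^bsub>W'\<^esub> f y \<and> f (x \<succ>\<^bsub>W\<^esub> y) = f x \<succ>\<^bsub>W'\<^esub> f y" if xy: "x \<in> pos W" "y \<in> pos W" for x y
    proof -
      have c: "x \<in> carrier W" "y \<in> carrier W" "f x \<in> carrier W'" "f y \<in> carrier W'" using l(1) xy by simp_all
      show ?thesis
        using h(3,4)[OF c(1,2)] xy pos[OF xy(1)] pos[OF xy(2)]
        by (simp add: W.omit_prec[OF c(1,2)] W'.omit_prec[OF c(3,4)] W.omit_succ[OF c(1,2)] W'.omit_succ[OF c(3,4)])
    qed
    then show ?thesis
      using aug_homs_lin[OF f] h(1) pos by (auto simp: unital_dend_homs_def)
  qed
  ultimately show ?thesis by blast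
qed

subsection \<open>Dendriform bialgebras\<close>

context unital_dendriform_algebra begin

interpretation A: augmented K W "aug_of K W" by (rule augmented_aug_of)

interpretation S: two_augs K W "aug_of K W" W "aug_of K W" by (intro two_augs.intro augmented_aug_of)

lemma counit_right_lift:
  shows "tensor_lift K W (\<lambda>y z. \<epsilon> z \<odot>\<^bsub>W\<^esub> y) \<in> lin_maps K S.T W"
    and "\<lbrakk>a \<in> carrier W; b \<in> carrier W\<rbrakk> \<Longrightarrow> tensor_lift K W (\<lambda>y z. \<epsilon> z \<odot>\<^bsub>W\<^esub> y) (S.pure a b) = \<epsilon> b \<odot>\<^bsub>W\<^esub> a"
  using S.tensor_lift_lin[OF vspace_axioms A.counit_bilinear(2)] S.tensor_lift_pure[OF vspace_axioms A.counit_bilinear(2)]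
  by simp_all

text \<open>\<open>r\<close> is the map id \<otimes> \<epsilon>. The correction terms of the
  product, weighted by the counits of the second factors, collect to a single tensor ending in
  1.\<close>

lemma tensor_aug_sweedler:
  assumes f: "bilinear K W W W (omit_unit K W f)" and X: "X \<in> carrier S.T" and Y: "Y \<in> carrier S.T"
  defines "r \<equiv> tensor_lift K W (\<lambda>y z. \<epsilon> z \<odot>\<^bsub>W\<^esub> y)"
  shows "tensor_lift2 K S.T (\<lambda>a b c d. S.pure (a \<otimes>\<^bsub>W\<^esub> c) (omit_unit K W f b d) \<oplus>\<^bsub>S.T\<^esub>
           (\<epsilon> b \<otimes> \<epsilon> d) \<odot>\<^bsub>S.T\<^esub> S.pure (omit_unit K W f a c) \<one>\<^bsub>W\<^esub>) X Y =
    tensor_lift2 K S.T (\<lambda>a b c d. S.pure (a \<otimes>\<^bsub>W\<^esub> c) (omit_unit K W f b d)) X Y \<oplus>\<^bsub>S.T\<^esub>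
      S.pure (omit_unit K W f (r X) (r Y)) \<one>\<^bsub>W\<^esub>"
proof -
  note r = counit_right_lift[folded r_def]
  note op = S.tensor_aug_op[OF f f, simplified]
  have 1: "bilinear K W W S.T (\<lambda>c d. S.pure (a \<otimes>\<^bsub>W\<^esub> c) (omit_unit K W f b d))"
    if "a \<in> carrier W" "b \<in> carrier W" for a b
    using that bilinear_simps[OF f] A.mul_simps by (intro bilinearI) simp_all
  have 2: "bilinear K W W S.T (\<lambda>a b. S.pure (a \<otimes>\<^bsub>W\<^esub> c) (omit_unit K W f b d))"
    if "c \<in> carrier W" "d \<in> carrier W" for c d
    using that bilinear_simps[OF f] A.mul_simps by (intro bilinearI) simp_all
  note t = tensor_lift2[OF vspace_axioms vspace_axioms vspace_axioms vspace_axioms S.vspace_T 1 2]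
  show ?thesis
    by (rule S.tensor_induct3[OF X Y Y])
      (simp_all add: op(2) t(2) bilinear_simps[OF op(1)] bilinear_simps[OF t(1)] r(2) lin_simps[OF r(1)]
        bilinear_simps[OF f] S.T.smult_assoc1[symmetric] S.T.a_ac one_in_carrier m_ac)
qed

end

lemma sweedler_prod_eq:
  assumes W: "unital_dendriform_algebra K W"
    and X: "comult W x \<in> carrier (tensor K W W)" "comult W y \<in> carrier (tensor K W W)"
    and r: "tensor_lift K W (\<lambda>y z. proj_unit K W z \<odot>\<^bsub>W\<^esub> y) (comult W x) = x"
      "tensor_lift K W (\<lambda>y z. proj_unit K W z \<odot>\<^bsub>W\<^esub> y) (comult W y) = y"
  shows "aleft (tensor_aug K W (aug_of K W) W (aug_of K W)) (comult W x) (comult W y) =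
      sweedler_prod K W (prec W) x y \<oplus>\<^bsub>tensor K W W\<^esub> pure_tensor K W W (omit_unit K W (prec W) x y) \<one>\<^bsub>W\<^esub>"
    and "aright (tensor_aug K W (aug_of K W) W (aug_of K W)) (comult W x) (comult W y) =
      sweedler_prod K W (succ W) x y \<oplus>\<^bsub>tensor K W W\<^esub> pure_tensor K W W (omit_unit K W (succ W) x y) \<one>\<^bsub>W\<^esub>"
proof -
  interpret W: unital_dendriform_algebra K W by (rule W)
  interpret A: augmented K W "aug_of K W" by (rule W.augmented_aug_of)
  note sw = W.tensor_aug_sweedler[OF _ X, unfolded r]
  show "aleft (tensor_aug K W (aug_of K W) W (aug_of K W)) (comult W x) (comult W y) =
      sweedler_prod K W (prec W) x y \<oplus>\<^bsub>tensor K W W\<^esub> pure_tensor K W W (omit_unit K W (prec W) x y) \<one>\<^bsub>W\<^esub>"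
    "aright (tensor_aug K W (aug_of K W) W (aug_of K W)) (comult W x) (comult W y) =
      sweedler_prod K W (succ W) x y \<oplus>\<^bsub>tensor K W W\<^esub> pure_tensor K W W (omit_unit K W (succ W) x y) \<one>\<^bsub>W\<^esub>"
    using sw[OF A.left_bilinear[simplified]] sw[OF A.right_bilinear[simplified]]
    by (simp_all add: tensor_aug_def Let_def sweedler_prod_def tensor_lift2_def)
qed

text \<open>By the counit law the collected correction becomes (x \<prec> y) \<otimes> 1, which is
  exactly the summand by which the coproduct rule exceeds the Sweedler sum. So the two rules and the
  value at 1 together say that the coproduct is a morphism.\<close>

lemma dendriform_bialgebra_iff:
  assumes "unital_dendriform_algebra K W"
  shows "dendriform_bialgebra K W \<longleftrightarrow> coalgebra K W (comult W) (proj_unit K W) \<and>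
    comult W \<in> aug_homs K W (aug_of K W) (tensor K W W) (tensor_aug K W (aug_of K W) W (aug_of K W))"
proof -
  interpret W: unital_dendriform_algebra K W by fact
  interpret A: augmented K W "aug_of K W" by (rule W.augmented_aug_of)
  interpret S: two_augs K W "aug_of K W" W "aug_of K W" by (intro two_augs.intro W.augmented_aug_of)
  note sw = sweedler_prod_eq[OF assms]
  have pp: "omit_unit K W (prec W) x y = x \<prec>\<^bsub>W\<^esub> y" "omit_unit K W (succ W) x y = x \<succ>\<^bsub>W\<^esub> y"
    if "x \<in> pos W" "y \<in> pos W" for x y
    using that W.omit_prec[of x y] W.omit_succ[of x y] by simp_all
  show ?thesis
  proof (intro iffI conjI)
    assume "dendriform_bialgebra K W"
    then interpret D: dendriform_bialgebra K W .
    show "coalgebra K W (comult W) (proj_unit K W)" by (rule D.coalgebra_axioms)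
    note \<Delta> = lin_closed[OF D.comult_linear]
    show "comult W \<in> aug_homs K W (aug_of K W) S.T S.TA"
    proof (rule A.aug_homsI_pos[OF S.TA.augmented_axioms D.comult_linear])
      note r = W.counit_right_lift
      \<comment> \<open>\<epsilon> \<otimes> \<epsilon> is \<epsilon> after id \<otimes> \<epsilon>;
        the counit law then shows that the coproduct preserves the augmentation.\<close>
      have eps: "aeps S.TA X = proj_unit K W (tensor_lift K W (\<lambda>y z. proj_unit K W z \<odot>\<^bsub>W\<^esub> y) X)"
        if "X \<in> carrier S.T" for X
        using that
        by (induction rule: S.tensor_induct)
          (simp_all add: S.TA_simps r(2) lin_simps[OF r(1)] W.proj_add W.proj_smult W.m_comm)
      show "aeps S.TA (comult W x) = aeps (aug_of K W) x" if "x \<in> carrier W" for x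
        using that by (simp add: eps \<Delta> D.counit_right)
      fix x y assume xy: "x \<in> carrier W" "y \<in> carrier W" "aeps (aug_of K W) x = \<zero>\<^bsub>K\<^esub>" "aeps (aug_of K W) y = \<zero>\<^bsub>K\<^esub>"
      then have p: "x \<in> pos W" "y \<in> pos W" using W.posI by simp_all
      note sw' = sw[OF \<Delta>[OF xy(1)] \<Delta>[OF xy(2)] D.counit_right[OF xy(1)] D.counit_right[OF xy(2)]]
      show "comult W (aleft (aug_of K W) x y) = aleft S.TA (comult W x) (comult W y)"
        "comult W (aright (aug_of K W) x y) = aright S.TA (comult W x) (comult W y)"
        using p by (simp_all add: sw' pp D.comult_prec D.comult_succ)
    qed (simp add: D.comult_one)
  next
    assume "coalgebra K W (comult W) (proj_unit K W) \<and> comult W \<in> aug_homs K W (aug_of K W) S.T S.TA"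
    then have C: "coalgebra K W (comult W) (proj_unit K W)" and h: "comult W \<in> aug_homs K W (aug_of K W) S.T S.TA"
      by auto
    interpret C: coalgebra K W "comult W" "proj_unit K W" by (rule C)
    note \<Delta> = lin_closed[OF C.comult_linear] and hs = aug_homs_simps[OF h, simplified]
    show "dendriform_bialgebra K W"
    proof (intro dendriform_bialgebra.intro assms C dendriform_bialgebra_axioms.intro)
      show "comult W \<one>\<^bsub>W\<^esub> = S.pure \<one>\<^bsub>W\<^esub> \<one>\<^bsub>W\<^esub>" using hs(1) by simp
      fix x y assume p: "x \<in> pos W" "y \<in> pos W"
      then have xy: "x \<in> carrier W" "y \<in> carrier W" by auto
      note sw' = sw[OF \<Delta>[OF xy(1)] \<Delta>[OF xy(2)] C.counit_right[OF xy(1)] C.counit_right[OF xy(2)]]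
      show "comult W (x \<succ>\<^bsub>W\<^esub> y) = sweedler_prod K W (succ W) x y \<oplus>\<^bsub>S.T\<^esub> S.pure (x \<succ>\<^bsub>W\<^esub> y) \<one>\<^bsub>W\<^esub>"
        "comult W (x \<prec>\<^bsub>W\<^esub> y) = sweedler_prod K W (prec W) x y \<oplus>\<^bsub>S.T\<^esub> S.pure (x \<prec>\<^bsub>W\<^esub> y) \<one>\<^bsub>W\<^esub>"
        using hs(3,4)[OF xy] sw' pp[OF p] by simp_all
    qed
  qed
qed


subsection \<open>Generation by primitive elements\<close>

definition aug_generated :: "('k, _) ring_scheme \<Rightarrow> ('k, 'a, _) module_scheme \<Rightarrow> ('k, 'a) aug \<Rightarrow> 'a set \<Rightarrow> bool"
  where "aug_generated K W A S \<longleftrightarrow> S \<subseteq> carrier W \<and>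
    (\<forall>N. submodule N K W \<and> S \<subseteq> N \<and> aone A \<in> N \<and> (\<forall>x\<in>N. \<forall>y\<in>N. aleft A x y \<in> N \<and> aright A x y \<in> N) \<longrightarrow>
      carrier W \<subseteq> N)"

text \<open>The equalizer of two morphisms is a subspace that contains 1 and is closed under both
  products.\<close>

lemma aug_homs_eqI:
  assumes "vspace K W" "vspace K W'" and f: "f \<in> aug_homs K W A W' A'" and g: "g \<in> aug_homs K W A W' A'"
    and gen: "aug_generated K W A S" "\<And>s. s \<in> S \<Longrightarrow> f s = g s" and "x \<in> carrier W" "augmented K W A"
  shows "f x = g x"
proof -
  interpret A: augmented K W A by fact
  let ?N = "{x \<in> carrier W. f x = g x}"
  have "submodule ?N K W"
    by (rule A.lin_equalizer_submodule[OF assms(2) aug_homs_lin[OF f] aug_homs_lin[OF g]])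
  moreover have "\<forall>x\<in>?N. \<forall>y\<in>?N. aleft A x y \<in> ?N \<and> aright A x y \<in> ?N"
    by (auto simp: aug_homs_simps[OF f] aug_homs_simps[OF g])
  moreover have "S \<subseteq> ?N" "aone A \<in> ?N"
    using gen by (auto simp: aug_generated_def aug_homs_simps[OF f] aug_homs_simps[OF g])
  ultimately have "carrier W \<subseteq> ?N" using gen(1) unfolding aug_generated_def by blast
  then show ?thesis using assms(7) by blast
qed

text \<open>Both sides of coassociativity and of the counit laws are morphisms of augmented algebras, so it
  suffices to compare them on the primitive generators.\<close>

lemma (in augmented) coalgebra_of_generated:
  assumes \<Delta>: "\<Delta> \<in> aug_homs K W A (tensor K W W) (tensor_aug K W A W A)"
    and gen: "aug_generated K W A S"
    and prim: "\<And>s. s \<in> S \<Longrightarrow> \<Delta> s = pure_tensor K W W s u \<oplus>\<^bsub>tensor K W W\<^esub> pure_tensor K W W u s"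
    and S: "\<And>s. s \<in> S \<Longrightarrow> \<epsilon> s = \<zero>"
  shows "coalgebra K W \<Delta> \<epsilon>"
proof (intro coalgebra.intro vspace_axioms coalgebra_axioms.intro)
  interpret T: two_augs K W A W A by (intro two_augs.intro augmented_axioms)
  interpret T1: two_augs K T.T T.TA W A by (intro two_augs.intro augmented_axioms T.TA.augmented_axioms)
  interpret T2: two_augs K W A T.T T.TA by (intro two_augs.intro augmented_axioms T.TA.augmented_axioms)
  have S_car: "\<And>s. s \<in> S \<Longrightarrow> s \<in> carrier W" using gen by (auto simp: aug_generated_def)
  note aug = augmented_axioms T.TA.augmented_axioms
  note \<Delta>1 = aug_homs_simps(1)[OF \<Delta>, simplified]
  show "\<Delta> \<in> lin_maps K W T.T" by (rule aug_homs_lin[OF \<Delta>])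
  show "\<epsilon> \<in> lin_maps K W (base_module K)" by (rule eps_lin)
  fix x assume x: "x \<in> carrier W"
  note eq = aug_homs_eqI[OF vspace_axioms _ _ _ gen _ x aug(1)]
  have "tensor_lift K W (\<lambda>y z. \<epsilon> y \<odot>\<^bsub>W\<^esub> z) (\<Delta> x) = (\<lambda>x. x) x"
    by (rule eq[OF vspace_axioms aug_homs_comp[OF \<Delta> aug_homs_counit_left] aug_homs_id])
      (simp add: prim S S_car lin_add[OF T.tensor_lift_lin[OF vspace_axioms counit_bilinear(1)]]
        T.tensor_lift_pure[OF vspace_axioms counit_bilinear(1)])
  then show "tensor_lift K W (\<lambda>y z. \<epsilon> y \<odot>\<^bsub>W\<^esub> z) (\<Delta> x) = x" .
  have "tensor_lift K W (\<lambda>y z. \<epsilon> z \<odot>\<^bsub>W\<^esub> y) (\<Delta> x) = (\<lambda>x. x) x"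
    by (rule eq[OF vspace_axioms aug_homs_comp[OF \<Delta> aug_homs_counit_right] aug_homs_id])
      (simp add: prim S S_car lin_add[OF T.tensor_lift_lin[OF vspace_axioms counit_bilinear(2)]]
        T.tensor_lift_pure[OF vspace_axioms counit_bilinear(2)])
  then show "tensor_lift K W (\<lambda>y z. \<epsilon> z \<odot>\<^bsub>W\<^esub> y) (\<Delta> x) = x" .
  note vs = vspace_axioms vspace_axioms
  note m1 = tensor_map_lin[OF vs T.vspace_T vspace_axioms aug_homs_lin[OF \<Delta>] lin_id]
  note m2 = tensor_map_lin[OF vs vspace_axioms T.vspace_T lin_id aug_homs_lin[OF \<Delta>]]
  note as = tensor_assoc_lin[OF vspace_axioms vs]
  \<comment> \<open>Both sides send a primitive s to s \<otimes> 1 \<otimes> 1 + 1 \<otimes> s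
    \<otimes> 1 + 1 \<otimes> 1 \<otimes> s.\<close>
  show "tensor_map K T.T W \<Delta> (\<lambda>y. y) (\<Delta> x) = tensor_assoc K W W W (tensor_map K W T.T (\<lambda>y. y) \<Delta> (\<Delta> x))"
    by (rule eq[OF T1.vspace_T aug_homs_comp[OF \<Delta> aug_homs_tensor_map[OF aug(1,1,2,1) \<Delta> aug_homs_id]]
          aug_homs_comp[OF aug_homs_comp[OF \<Delta> aug_homs_tensor_map[OF aug(1,1,1,2) aug_homs_id \<Delta>]]
            aug_homs_assoc[OF aug(1,1,1)]]])
      (simp add: prim S_car lin_simps[OF m1(1)] lin_simps[OF m2(1)] m1(2) m2(2) \<Delta>1 lin_simps[OF as(1)] as(2) T1.T.a_ac)
qed

section \<open>Attaching a coproduct to a unital dendriform algebra\<close>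

lemma with_comult_simps [simp]:
  "carrier (with_comult W \<Delta>) = carrier W" "add (with_comult W \<Delta>) = add W"
  "zero (with_comult W \<Delta>) = zero W" "smult (with_comult W \<Delta>) = smult W"
  "mult (with_comult W \<Delta>) = mult W" "one (with_comult W \<Delta>) = one W"
  "prec (with_comult W \<Delta>) = prec W" "succ (with_comult W \<Delta>) = succ W"
  "pos (with_comult W \<Delta>) = pos W" "comult (with_comult W \<Delta>) = \<Delta>"
  by (simp_all add: with_comult_def udend.defs dend_bialg.defs)

lemma with_comult_cong [simp]:
  fixes W :: "('k, 'a) udend"
  shows "a_minus (with_comult W \<Delta>) = a_minus W" "plus_part (with_comult W \<Delta>) = plus_part W"
    "proj_unit K (with_comult W \<Delta>) = proj_unit K W" "proj_pos K (with_comult W \<Delta>) = proj_pos K W"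
    "omit_unit K (with_comult W \<Delta>) = omit_unit K W" "aug_of K (with_comult W \<Delta>) = aug_of K W"
    "tensor K (with_comult W \<Delta>) (with_comult W \<Delta>) = tensor K W W"
    "pure_tensor K (with_comult W \<Delta>) (with_comult W \<Delta>) = pure_tensor K W W"
    "tensor_aug K (with_comult W \<Delta>) A (with_comult W \<Delta>) B = tensor_aug K W A W B"
proof -
  let ?W = "with_comult W \<Delta>"
  show [simp]: "a_minus ?W = a_minus W" by (rule additive_cong) simp_all
  show "plus_part ?W = plus_part W" by (simp add: plus_part_def dend.defs)
  show [simp]: "proj_unit K ?W = proj_unit K W" by (simp add: proj_unit_def fun_eq_iff)
  show [simp]: "proj_pos K ?W = proj_pos K W" by (simp add: proj_pos_def fun_eq_iff)
  show [simp]: "omit_unit K ?W = omit_unit K W" by (simp add: omit_unit_def fun_eq_iff)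
  show "aug_of K ?W = aug_of K W" by (simp add: aug_of_def)
  show [simp]: "tensor K ?W ?W = tensor K W W" "pure_tensor K ?W ?W = pure_tensor K W W"
    by (rule tensor_cong; simp)+
  show "tensor_aug K ?W A ?W B = tensor_aug K W A W B" by (simp add: tensor_aug_def)
qed

lemma with_comult_lin_maps [simp]:
  "lin_maps K (with_comult W \<Delta>) V = lin_maps K W V" "lin_maps K V (with_comult W \<Delta>) = lin_maps K V W"
  by (rule lin_maps_cong; simp)+

lemma with_comult_aug_homs [simp]:
  "aug_homs K (with_comult W \<Delta>) A V B = aug_homs K W A V B" "aug_homs K V B (with_comult W \<Delta>) A = aug_homs K V B W A"
  by (simp_all add: aug_homs_def)

lemma with_comult_unital:
  fixes W :: "('k, 'a) udend"
  shows "unital_dendriform_algebra K (with_comult W \<Delta>) \<longleftrightarrow> unital_dendriform_algebra K W"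
proof -
  have b: "bilinear K (with_comult W \<Delta>) V E = bilinear K W V E" "bilinear K V (with_comult W \<Delta>) E = bilinear K V W E"
    "bilinear K V E (with_comult W \<Delta>) = bilinear K V E W"
    for V :: "('k, 'a) dend" and E :: "('k, 'a) dend"
    by (rule bilinear_cong; simp)+
  have b3: "bilinear K (with_comult W \<Delta>) (with_comult W \<Delta>) (with_comult W \<Delta>) = bilinear K W W W"
    by (rule bilinear_cong; simp)
  have v: "vspace K (with_comult W \<Delta>) = vspace K W" "submodule N K (with_comult W \<Delta>) = submodule N K W" for N
    by (rule vspace_cong module_cong; simp)+
  show ?thesis
    by (simp add: unital_dendriform_algebra_def unital_dendriform_algebra_axioms_def b b3 v)
qed

text \<open>The coproducts in the definitions are required to be extensional, so a constructed
  coproduct has to be exchanged for its restriction to the carrier. The coalgebra axioms see only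
  the values on the carrier.\<close>

lemma coalgebra_with_comult:
  fixes W :: "('k, 'a) udend"
  assumes "coalgebra K W \<Delta> \<epsilon>" "\<And>x. x \<in> carrier W \<Longrightarrow> \<Delta>' x = \<Delta> x"
  shows "coalgebra K (with_comult W \<Delta>') \<Delta>' \<epsilon>"
proof -
  interpret C: coalgebra K W \<Delta> \<epsilon> by fact
  interpret T: two_spaces K W W by (intro two_spaces.intro C.vspace_axioms)
  let ?W = "with_comult W \<Delta>'"
  note E = assms(2)
  note vs = C.vspace_axioms
  have \<Delta>': "\<Delta>' \<in> lin_maps K W T.T" by (rule lin_cong[OF C.comult_linear E vs])
  have 1: "tensor_map K T.T W \<Delta>' (\<lambda>y. y) X = tensor_map K T.T W \<Delta> (\<lambda>y. y) X"
    "tensor_map K W T.T (\<lambda>y. y) \<Delta>' X = tensor_map K W T.T (\<lambda>y. y) \<Delta> X" if X: "X \<in> carrier T.T" for X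
  proof -
    note m = tensor_map_lin[OF vs vs T.vspace_T vs _ lin_id] tensor_map_lin[OF vs vs vs T.vspace_T lin_id]
    show "tensor_map K T.T W \<Delta>' (\<lambda>y. y) X = tensor_map K T.T W \<Delta> (\<lambda>y. y) X"
      by (rule T.tensor_eqI[OF m(1)[OF \<Delta>'] m(1)[OF C.comult_linear] X])
        (simp add: m(2)[OF \<Delta>'] m(2)[OF C.comult_linear] E)
    show "tensor_map K W T.T (\<lambda>y. y) \<Delta>' X = tensor_map K W T.T (\<lambda>y. y) \<Delta> X"
      by (rule T.tensor_eqI[OF m(3)[OF \<Delta>'] m(3)[OF C.comult_linear] X])
        (simp add: m(4)[OF \<Delta>'] m(4)[OF C.comult_linear] E)
  qed
  have 2: "tensor K (tensor K W W) ?W = tensor K (tensor K W W) W" "tensor K ?W (tensor K W W) = tensor K W (tensor K W W)"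
    "pure_tensor K (tensor K W W) ?W = pure_tensor K (tensor K W W) W"
    "pure_tensor K ?W (tensor K W W) = pure_tensor K W (tensor K W W)"
    by (rule tensor_cong; simp)+
  have 3: "tensor_lift K ?W f X = tensor_lift K W f X" for f :: "'a \<Rightarrow> 'a \<Rightarrow> 'a" and X
    by (simp add: tensor_lift_def lin_ext_def finsum_def finprod_def)
  have v: "vspace K ?W = vspace K W" by (rule vspace_cong; simp)
  note c = lin_closed[OF C.comult_linear]
  show ?thesis
    using C.coassoc C.counit_left C.counit_right c \<Delta>' C.counit_linear vs
    by (intro coalgebra.intro coalgebra_axioms.intro)
      (simp_all add: v tensor_map_def tensor_assoc_def 2 3 1[unfolded tensor_map_def] E)
qed

text \<open>The common existence criterion for D(V) and U(B): a morphism into the tensor square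
  under which a generating set is primitive is the coproduct of a bialgebra.\<close>

lemma dendriform_bialgebra_of_generated:
  fixes W :: "('k, 'a) udend"
  assumes W: "unital_dendriform_algebra K W"
    and \<Delta>: "\<Delta> \<in> aug_homs K W (aug_of K W) (tensor K W W) (tensor_aug K W (aug_of K W) W (aug_of K W))"
    and gen: "aug_generated K W (aug_of K W) S" "S \<subseteq> pos W"
    and prim: "\<And>s. s \<in> S \<Longrightarrow> \<Delta> s = pure_tensor K W W s \<one>\<^bsub>W\<^esub> \<oplus>\<^bsub>tensor K W W\<^esub> pure_tensor K W W \<one>\<^bsub>W\<^esub> s"
    and eq: "\<And>x. x \<in> carrier W \<Longrightarrow> \<Delta>' x = \<Delta> x"
  shows "dendriform_bialgebra K (with_comult W \<Delta>')"
proof -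
  interpret W: unital_dendriform_algebra K W by fact
  interpret A: augmented K W "aug_of K W" by (rule W.augmented_aug_of)
  have "coalgebra K W \<Delta> (proj_unit K W)"
    using A.coalgebra_of_generated[OF \<Delta> gen(1)] prim gen(2) by (auto simp: subset_eq)
  then have "coalgebra K (with_comult W \<Delta>') \<Delta>' (proj_unit K W)" using eq by (rule coalgebra_with_comult)
  moreover have "\<Delta>' \<in> aug_homs K W (aug_of K W) (tensor K W W) (tensor_aug K W (aug_of K W) W (aug_of K W))"
    using aug_homs_simps[OF \<Delta>] lin_cong[OF aug_homs_lin[OF \<Delta>] eq W.vspace_axioms]
    by (intro aug_homsI) (simp_all add: eq W.one_in_carrier A.left_simps(1)[simplified] A.right_simps(1)[simplified])
  ultimately show ?thesis
    using W by (subst dendriform_bialgebra_iff) (simp_all add: with_comult_unital)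
qed

section \<open>Free and enveloping dendriform algebras\<close>

subsection \<open>Dendriform maps into augmented algebras\<close>

definition pos_maps ::
  "('k, _) ring_scheme \<Rightarrow> ('k, 'e, _) dend_scheme \<Rightarrow> ('k, 'a, _) module_scheme \<Rightarrow> ('k, 'a) aug \<Rightarrow> ('e \<Rightarrow> 'a) set"
  where "pos_maps K E W A = {h \<in> lin_maps K E W. (\<forall>x\<in>carrier E. aeps A (h x) = \<zero>\<^bsub>K\<^esub>) \<and>
    (\<forall>x\<in>carrier E. \<forall>y\<in>carrier E. h (x \<prec>\<^bsub>E\<^esub> y) = aleft A (h x) (h y) \<and> h (x \<succ>\<^bsub>E\<^esub> y) = aright A (h x) (h y))}"

lemma pos_mapsI:
  assumes "h \<in> lin_maps K E W" "\<And>x. x \<in> carrier E \<Longrightarrow> aeps A (h x) = \<zero>\<^bsub>K\<^esub>"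
    "\<And>x y. \<lbrakk>x \<in> carrier E; y \<in> carrier E\<rbrakk> \<Longrightarrow> h (x \<prec>\<^bsub>E\<^esub> y) = aleft A (h x) (h y)"
    "\<And>x y. \<lbrakk>x \<in> carrier E; y \<in> carrier E\<rbrakk> \<Longrightarrow> h (x \<succ>\<^bsub>E\<^esub> y) = aright A (h x) (h y)"
  shows "h \<in> pos_maps K E W A"
  using assms by (simp add: pos_maps_def)

lemma pos_maps_lin: "h \<in> pos_maps K E W A \<Longrightarrow> h \<in> lin_maps K E W"
  by (simp add: pos_maps_def)

lemma pos_maps_simps:
  assumes "h \<in> pos_maps K E W A"
  shows "x \<in> carrier E \<Longrightarrow> aeps A (h x) = \<zero>\<^bsub>K\<^esub>"
    "\<lbrakk>x \<in> carrier E; y \<in> carrier E\<rbrakk> \<Longrightarrow> h (x \<prec>\<^bsub>E\<^esub> y) = aleft A (h x) (h y)"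
    "\<lbrakk>x \<in> carrier E; y \<in> carrier E\<rbrakk> \<Longrightarrow> h (x \<succ>\<^bsub>E\<^esub> y) = aright A (h x) (h y)"
  using assms by (simp_all add: pos_maps_def)

definition dend_generated :: "('k, _) ring_scheme \<Rightarrow> ('k, 'e, _) dend_scheme \<Rightarrow> 'e set \<Rightarrow> bool"
  where "dend_generated K E S \<longleftrightarrow> S \<subseteq> carrier E \<and>
    (\<forall>N. submodule N K E \<and> S \<subseteq> N \<and> (\<forall>x\<in>N. \<forall>y\<in>N. x \<prec>\<^bsub>E\<^esub> y \<in> N \<and> x \<succ>\<^bsub>E\<^esub> y \<in> N) \<longrightarrow> carrier E \<subseteq> N)"

text \<open>Two bilinear products without the dendriform identities, so that the free magmatic
  algebra and its quotients fall under one notion. The identities are supplied by the target of a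
  map.\<close>

locale dend_space = vspace K E for K (structure) and E :: "('k, 'e, 'm) dend_scheme" +
  assumes prec_bil: "bilinear K E E E (prec E)" and succ_bil: "bilinear K E E E (succ E)"
    and mult_eq: "\<lbrakk>x \<in> carrier E; y \<in> carrier E\<rbrakk> \<Longrightarrow> x \<otimes>\<^bsub>E\<^esub> y = x \<prec>\<^bsub>E\<^esub> y \<oplus>\<^bsub>E\<^esub> x \<succ>\<^bsub>E\<^esub> y"
begin

lemmas prec_simps [simp] = bilinear_simps[OF prec_bil]
lemmas succ_simps [simp] = bilinear_simps[OF succ_bil]
lemmas prec_zero [simp] = bilinear_zero[OF prec_bil vspace_axioms vspace_axioms vspace_axioms]
lemmas succ_zero [simp] = bilinear_zero[OF succ_bil vspace_axioms vspace_axioms vspace_axioms]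

lemma kernel_ideal:
  assumes "augmented K W A" "h \<in> pos_maps K E W A"
  shows "dendriform_ideal {x \<in> carrier E. h x = \<zero>\<^bsub>W\<^esub>} K E"
proof -
  interpret A: augmented K W A by fact
  show ?thesis
    unfolding dendriform_ideal_def
    using lin_equalizer_submodule[OF A.vspace_axioms pos_maps_lin[OF assms(2)] lin_zero_map[OF A.vspace_axioms]]
    by (auto simp: pos_maps_simps[OF assms(2)] lin_closed[OF pos_maps_lin[OF assms(2)]])
qed

lemma hull_ideal:
  assumes "S \<subseteq> carrier E"
  shows "dendriform_ideal ((\<lambda>I. dendriform_ideal I K E) hull S) K E"
proof -
  have "dendriform_ideal (carrier E) K E"
    unfolding dendriform_ideal_def using carrier_is_submodule by auto
  then show ?thesis
    unfolding dendriform_ideal_def hull_def using assms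
    by (intro conjI submodule_Inter) (auto simp: dendriform_ideal_def)
qed

end

locale dend_quotient = dend_space K E for K (structure) and E :: "('k, 'e, 'm) dend_scheme" +
  fixes I assumes ideal: "dendriform_ideal I K E"
begin

sublocale Q: subspace K E I
  using ideal by (intro subspace.intro vspace_axioms) (simp add: subspace_axioms_def dendriform_ideal_def)

abbreviation "QD \<equiv> quotient_dend E I"

lemma QD_simps [simp]:
  "carrier QD = carrier Q.Q" "add QD = add Q.Q" "zero QD = zero Q.Q" "smult QD = smult Q.Q"
  by (simp_all add: quotient_dend_def quotient_module_def)

lemma QD_ops [simp]:
  assumes "x \<in> carrier E" "y \<in> carrier E"
  shows "Q.proj x \<prec>\<^bsub>QD\<^esub> Q.proj y = Q.proj (x \<prec>\<^bsub>E\<^esub> y)" "Q.proj x \<succ>\<^bsub>QD\<^esub> Q.proj y = Q.proj (x \<succ>\<^bsub>E\<^esub> y)"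
    "Q.proj x \<otimes>\<^bsub>QD\<^esub> Q.proj y = Q.proj (x \<otimes>\<^bsub>E\<^esub> y)"
proof -
  have i: "i \<in> I \<Longrightarrow> i \<in> carrier E" for i by (rule submodule_facts(1)[OF Q.submodule_N])
  have 1: "x \<prec>\<^bsub>E\<^esub> i \<in> I \<and> i \<prec>\<^bsub>E\<^esub> x \<in> I" "x \<succ>\<^bsub>E\<^esub> i \<in> I \<and> i \<succ>\<^bsub>E\<^esub> x \<in> I" if "x \<in> carrier E" "i \<in> I" for x i
    using ideal that by (auto simp: dendriform_ideal_def)
  have m: "bilinear K E E E (mult E)"
    by (intro bilinearI) (simp_all add: mult_eq a_ac smult_r_distr)
  have 2: "x \<otimes>\<^bsub>E\<^esub> i \<in> I \<and> i \<otimes>\<^bsub>E\<^esub> x \<in> I" if "x \<in> carrier E" "i \<in> I" for x i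
    using that 1 i by (simp add: mult_eq submodule_facts[OF Q.submodule_N])
  show "Q.proj x \<prec>\<^bsub>QD\<^esub> Q.proj y = Q.proj (x \<prec>\<^bsub>E\<^esub> y)" "Q.proj x \<succ>\<^bsub>QD\<^esub> Q.proj y = Q.proj (x \<succ>\<^bsub>E\<^esub> y)"
    "Q.proj x \<otimes>\<^bsub>QD\<^esub> Q.proj y = Q.proj (x \<otimes>\<^bsub>E\<^esub> y)"
    using assms Q.coset_op_proj[OF prec_bil 1(1)] Q.coset_op_proj[OF succ_bil 1(2)] Q.coset_op_proj[OF m 2]
    by (simp_all add: quotient_dend_def)
qed

lemma dend_space_QD: "dend_space K QD"
proof (intro dend_space.intro dend_space_axioms.intro)
  show "vspace K QD" using Q.vspace_Q vspace_cong[of QD Q.Q, where K = K] by simp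
  show "bilinear K QD QD QD (prec QD)"
    by (intro bilinearI) (auto simp: Q.carrier_Q Q.add_Q Q.smult_Q)
  show "bilinear K QD QD QD (succ QD)"
    by (intro bilinearI) (auto simp: Q.carrier_Q Q.add_Q Q.smult_Q)
  show "X \<otimes>\<^bsub>QD\<^esub> Y = X \<prec>\<^bsub>QD\<^esub> Y \<oplus>\<^bsub>QD\<^esub> X \<succ>\<^bsub>QD\<^esub> Y" if "X \<in> carrier QD" "Y \<in> carrier QD" for X Y
    using that by (auto simp: Q.carrier_Q Q.add_Q mult_eq)
qed

lemma proj_lin_QD: "Q.proj \<in> lin_maps K E QD"
  using Q.proj_lin lin_maps_cong[of E E QD Q.Q K] by simp

lemma lift_pos_map:
  assumes A: "augmented K W A" and h: "h \<in> pos_maps K E W A" and z: "\<And>x. x \<in> I \<Longrightarrow> h x = \<zero>\<^bsub>W\<^esub>"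
  shows "\<exists>h' \<in> pos_maps K QD W A. \<forall>x\<in>carrier E. h' (Q.proj x) = h x"
proof -
  interpret A: augmented K W A by fact
  let ?h = "\<lambda>X. h (SOME u. u \<in> X)"
  note l = Q.quotient_lift_proj[OF A.vspace_axioms pos_maps_lin[OF h] z]
    Q.quotient_lift_lin[OF A.vspace_axioms pos_maps_lin[OF h] z]
  have lin: "?h \<in> lin_maps K QD W"
    using l(2) by (subst lin_maps_cong[of QD Q.Q W W K]) simp_all
  have "?h \<in> pos_maps K QD W A"
  proof (rule pos_mapsI[OF lin])
    fix X assume "X \<in> carrier QD"
    then obtain x where x: "x \<in> carrier E" "X = Q.proj x" unfolding QD_simps Q.carrier_Q by blast
    then show "aeps A (?h X) = \<zero>" by (simp add: l(1) pos_maps_simps[OF h])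
    fix Y assume "Y \<in> carrier QD"
    then obtain y where "y \<in> carrier E" "Y = Q.proj y" unfolding QD_simps Q.carrier_Q by blast
    with x show "?h (X \<prec>\<^bsub>QD\<^esub> Y) = aleft A (?h X) (?h Y)" "?h (X \<succ>\<^bsub>QD\<^esub> Y) = aright A (?h X) (?h Y)"
      by (simp_all add: l(1) pos_maps_simps[OF h])
  qed
  then show ?thesis by (intro bexI[of _ ?h] ballI l(1))
qed

lemma QD_generated:
  assumes "dend_generated K E S" shows "dend_generated K QD (Q.proj ` S)"
  unfolding dend_generated_def
proof (intro conjI allI impI)
  show "Q.proj ` S \<subseteq> carrier QD" using assms by (auto simp: dend_generated_def Q.carrier_Q)
  fix N assume N: "submodule N K QD \<and> Q.proj ` S \<subseteq> N \<and> (\<forall>x\<in>N. \<forall>y\<in>N. x \<prec>\<^bsub>QD\<^esub> y \<in> N \<and> x \<succ>\<^bsub>QD\<^esub> y \<in> N)"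
  have "submodule {x \<in> carrier E. Q.proj x \<in> N} K E"
    using N lin_vimage_submodule[OF Q.vspace_Q Q.proj_lin] module_cong(2)[of QD Q.Q, where K = K] by simp
  moreover have "Q.proj (x \<prec>\<^bsub>E\<^esub> y) \<in> N \<and> Q.proj (x \<succ>\<^bsub>E\<^esub> y) \<in> N"
    if "x \<in> carrier E" "y \<in> carrier E" "Q.proj x \<in> N" "Q.proj y \<in> N" for x y
    using N that QD_ops(1,2)[OF that(1,2)] by metis
  ultimately have "carrier E \<subseteq> {x \<in> carrier E. Q.proj x \<in> N}"
    using assms N unfolding dend_generated_def
    by (elim conjE allE[of _ "{x \<in> carrier E. Q.proj x \<in> N}"] impE) (auto simp del: QD_ops)
  then show "carrier QD \<subseteq> N" by (auto simp: Q.carrier_Q)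
qed

lemma dendriform_QD:
  assumes "dendriform_algebra K E" shows "dendriform_algebra K QD"
proof -
  interpret E: dendriform_algebra K E by fact
  interpret QD: dend_space K QD by (rule dend_space_QD)
  show ?thesis
    by (intro dendriform_algebra.intro dendriform_algebra_axioms.intro QD.vspace_axioms QD.prec_bil QD.succ_bil)
      (auto simp: Q.carrier_Q Q.add_Q E.prec_prec E.succ_prec E.succ_succ mult_eq)
qed

end

lemma (in dendriform_algebra) dend_space: "dend_space K D"
  by (intro dend_space.intro vspace_axioms dend_space_axioms.intro prec_bilinear succ_bilinear star_def)

subsection \<open>The free dendriform algebra\<close>

locale free_dendriform = vspace K V for K (structure) and V
begin

abbreviation "mons \<equiv> {t. set_dmon t \<subseteq> carrier V}"
abbreviation "FM \<equiv> free_magmatic K V"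
abbreviation "FD \<equiv> free_dend K V"
abbreviation "gen \<equiv> free_gen K V"

sublocale B: free_space K mons
  by (intro free_space.intro field_axioms)

lemma FM_simps [simp]:
  "carrier FM = carrier B.F" "add FM = add B.F" "zero FM = zero B.F" "smult FM = smult B.F"
  "x \<prec>\<^bsub>FM\<^esub> y = (\<lambda>t. case t of PrecM s r \<Rightarrow> x s \<otimes> y r | _ \<Rightarrow> \<zero>)"
  "x \<succ>\<^bsub>FM\<^esub> y = (\<lambda>t. case t of SuccM s r \<Rightarrow> x s \<otimes> y r | _ \<Rightarrow> \<zero>)"
  by (simp_all add: free_magmatic_def Let_def)

lemma FM_mult: "x \<otimes>\<^bsub>FM\<^esub> y = x \<prec>\<^bsub>FM\<^esub> y \<oplus>\<^bsub>FM\<^esub> x \<succ>\<^bsub>FM\<^esub> y"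
  by (simp add: free_magmatic_def Let_def)

lemma vspace_FM: "vspace K FM"
  using B.vspace_F vspace_cong[of FM B.F, where K = K] by (simp del: B.F_simps)

lemma FM_closed:
  assumes x: "x \<in> carrier B.F" and y: "y \<in> carrier B.F"
  shows "x \<prec>\<^bsub>FM\<^esub> y \<in> carrier B.F" "x \<succ>\<^bsub>FM\<^esub> y \<in> carrier B.F"
proof -
  \<comment> \<open>A product is supported on the monomials formed from one support point of each
    factor.\<close>
  let ?S = "{s. x s \<noteq> \<zero>} \<times> {r. y r \<noteq> \<zero>}"
  have S: "finite ?S" "\<And>s r. (s, r) \<in> ?S \<Longrightarrow> set_dmon s \<subseteq> carrier V \<and> set_dmon r \<subseteq> carrier V"
    using x y unfolding B.F_carrier by auto
  show "x \<prec>\<^bsub>FM\<^esub> y \<in> carrier B.F"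
    using S x y by (intro B.F_carrierI[where S = "(\<lambda>(s, r). PrecM s r) ` ?S"])
      (auto split: dmon.splits, blast+)
  show "x \<succ>\<^bsub>FM\<^esub> y \<in> carrier B.F"
    using S x y by (intro B.F_carrierI[where S = "(\<lambda>(s, r). SuccM s r) ` ?S"])
      (auto split: dmon.splits, blast+)
qed

sublocale FM: dend_space K FM
proof (intro dend_space.intro vspace_FM dend_space_axioms.intro FM_mult)
  show "bilinear K FM FM FM (prec FM)"
    by (intro bilinearI) (use FM_closed(1) in \<open>auto simp: l_distr r_distr m_ac split: dmon.splits\<close>)
  show "bilinear K FM FM FM (succ FM)"
    by (intro bilinearI) (use FM_closed(2) in \<open>auto simp: l_distr r_distr m_ac split: dmon.splits\<close>)
qed

lemma FM_basis: "B.e s \<prec>\<^bsub>FM\<^esub> B.e t = B.e (PrecM s t)" "B.e s \<succ>\<^bsub>FM\<^esub> B.e t = B.e (SuccM s t)"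
  by (auto simp: basis_elt_def fun_eq_iff split: dmon.splits)

lemma basis_in_FM: "v \<in> carrier V \<Longrightarrow> B.e (Gen v) \<in> carrier FM"
  by (simp add: B.basis_in_F)

lemma rels_subset: "free_dend_rels K V \<subseteq> carrier FM"
  unfolding free_dend_rels_def Let_def
  by (auto intro!: FM.minus_closed FM.a_closed FM.smult_closed FM.prec_simps(1) FM.succ_simps(1) basis_in_FM
      simp del: FM_simps B.F_simps)

sublocale Q: dend_quotient K FM "free_dend_null K V"
  unfolding free_dend_null_def
  by (intro dend_quotient.intro dend_quotient_axioms.intro FM.dend_space_axioms FM.hull_ideal rels_subset)

lemma FD_eq: "FD = Q.QD"
  by (simp add: free_dend_def)

lemma gen_eq: "gen v = Q.Q.proj (B.e (Gen v))"
  by (simp add: free_gen_def)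

sublocale FD: dend_space K FD
  unfolding FD_eq by (rule Q.dend_space_QD)

lemma FM_rel:
  assumes "x \<in> carrier FM" "y \<in> carrier FM" "x \<ominus>\<^bsub>FM\<^esub> y \<in> free_dend_rels K V"
  shows "Q.Q.proj x = Q.Q.proj y"
  using assms Q.Q.coset_eq_iff[OF assms(1,2)] by (simp add: free_dend_null_def hull_inc del: FM_simps)

lemma FD_dendriform: "dendriform_algebra K FD"
proof (intro dendriform_algebra.intro FD.vspace_axioms dendriform_algebra_axioms.intro FD.prec_bil FD.succ_bil FD.mult_eq)
  note s = FD_eq Q.Q.add_Q
  fix X Y Z assume "X \<in> carrier FD" "Y \<in> carrier FD" "Z \<in> carrier FD"
  then obtain x y z where xyz: "x \<in> carrier FM" "y \<in> carrier FM" "z \<in> carrier FM"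
    and [simp]: "X = Q.Q.proj x" "Y = Q.Q.proj y" "Z = Q.Q.proj z"
    by (auto simp: FD_eq Q.Q.carrier_Q simp del: FM_simps)
  show "X \<prec>\<^bsub>FD\<^esub> Y \<prec>\<^bsub>FD\<^esub> Z = X \<prec>\<^bsub>FD\<^esub> (Y \<prec>\<^bsub>FD\<^esub> Z) \<oplus>\<^bsub>FD\<^esub> X \<prec>\<^bsub>FD\<^esub> (Y \<succ>\<^bsub>FD\<^esub> Z)"
    using xyz by (simp add: s del: FM_simps B.F_simps)
      (rule FM_rel, use xyz in \<open>simp_all add: free_dend_rels_def Let_def del: FM_simps B.F_simps\<close>, blast)
  show "X \<succ>\<^bsub>FD\<^esub> Y \<prec>\<^bsub>FD\<^esub> Z = X \<succ>\<^bsub>FD\<^esub> (Y \<prec>\<^bsub>FD\<^esub> Z)"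
    using xyz by (simp add: s del: FM_simps B.F_simps)
      (rule FM_rel, use xyz in \<open>simp_all add: free_dend_rels_def Let_def del: FM_simps B.F_simps\<close>, blast)
  show "X \<succ>\<^bsub>FD\<^esub> (Y \<succ>\<^bsub>FD\<^esub> Z) = X \<succ>\<^bsub>FD\<^esub> Y \<succ>\<^bsub>FD\<^esub> Z \<oplus>\<^bsub>FD\<^esub> (X \<prec>\<^bsub>FD\<^esub> Y) \<succ>\<^bsub>FD\<^esub> Z"
    using xyz by (simp add: s del: FM_simps B.F_simps)
      (rule FM_rel, use xyz in \<open>simp_all add: free_dend_rels_def Let_def del: FM_simps B.F_simps\<close>, blast)
qed

lemma gen_lin: "gen \<in> lin_maps K V FD"
proof (rule lin_mapsI)
  note s = gen_eq FD_eq Q.Q.add_Q Q.Q.smult_Q basis_in_FM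
  show "gen v \<in> carrier FD" if "v \<in> carrier V" for v
    using that by (simp add: s Q.Q.proj_in_Q del: FM_simps)
  show "gen (v \<oplus>\<^bsub>V\<^esub> w) = gen v \<oplus>\<^bsub>FD\<^esub> gen w" if "v \<in> carrier V" "w \<in> carrier V" for v w
    using that by (simp add: s del: FM_simps B.F_simps)
      (rule FM_rel, use that in \<open>simp_all add: basis_in_FM free_dend_rels_def Let_def del: FM_simps B.F_simps\<close>, blast)
  show "gen (a \<odot>\<^bsub>V\<^esub> v) = a \<odot>\<^bsub>FD\<^esub> gen v" if "a \<in> carrier K" "v \<in> carrier V" for a v
    using that by (simp add: s del: FM_simps B.F_simps)
      (rule FM_rel, use that in \<open>simp_all add: basis_in_FM free_dend_rels_def Let_def del: FM_simps B.F_simps\<close>, blast)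
qed

lemma FD_generated: "dend_generated K FD (gen ` carrier V)"
proof -
  have "dend_generated K FM ((\<lambda>v. B.e (Gen v)) ` carrier V)"
    unfolding dend_generated_def
  proof (intro conjI allI impI subsetI)
    fix x assume "x \<in> (\<lambda>v. B.e (Gen v)) ` carrier V" then show "x \<in> carrier FM" using basis_in_FM by blast
  next
    fix N x assume N: "submodule N K FM \<and> (\<lambda>v. B.e (Gen v)) ` carrier V \<subseteq> N \<and>
      (\<forall>x\<in>N. \<forall>y\<in>N. x \<prec>\<^bsub>FM\<^esub> y \<in> N \<and> x \<succ>\<^bsub>FM\<^esub> y \<in> N)" and x: "x \<in> carrier FM"
    have t: "B.e t \<in> N" if "set_dmon t \<subseteq> carrier V" for t
      using that
    proof (induction t)
      case (Gen v) then show ?case using N by auto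
    next
      case (PrecM s t) then show ?case using N unfolding FM_basis[symmetric] by auto
    next
      case (SuccM s t) then show ?case using N unfolding FM_basis[symmetric] by auto
    qed
    note f = FM.submodule_facts[OF conjunct1[OF N]]
    show "x \<in> N"
      using x[unfolded FM_simps(1)]
    proof (induction rule: B.free_induct)
      case zero then show ?case using f(2) by (simp del: B.F_simps)
    next
      case (add a t x) then show ?case using f(4)[of a "B.e t"] f(5)[of "a \<odot>\<^bsub>B.F\<^esub> B.e t" x] t by (simp del: B.F_simps)
    qed
  qed
  from Q.QD_generated[OF this] show ?thesis by (simp add: FD_eq gen_eq[abs_def] image_image)
qed

end

primrec eval_mon :: "('k, 'a) aug \<Rightarrow> ('v \<Rightarrow> 'a) \<Rightarrow> 'v dmon \<Rightarrow> 'a" where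
  "eval_mon A g (Gen v) = g v"
| "eval_mon A g (PrecM s t) = aleft A (eval_mon A g s) (eval_mon A g t)"
| "eval_mon A g (SuccM s t) = aright A (eval_mon A g s) (eval_mon A g t)"

text \<open>Monomials are evaluated in \<open>A\<close> and the result is extended linearly. The
  kernel is an ideal containing the defining relations, hence contains the ideal they
  generate.\<close>

lemma (in free_dendriform) FD_lift:
  assumes A: "augmented K W A" and g: "g \<in> lin_maps K V W" and g0: "\<And>v. v \<in> carrier V \<Longrightarrow> aeps A (g v) = \<zero>"
  shows "\<exists>h \<in> pos_maps K FD W A. \<forall>v\<in>carrier V. h (gen v) = g v"
proof -
  interpret A: augmented K W A by fact
  note gs = lin_simps[OF g]
  have ev: "eval_mon A g t \<in> carrier W" "aeps A (eval_mon A g t) = \<zero>" if "set_dmon t \<subseteq> carrier V" for t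
    using that by (induction t) (auto simp: gs g0)
  then have evF: "eval_mon A g \<in> mons \<rightarrow> carrier W" by auto
  define h where "h = lin_ext K W (eval_mon A g)"
  note l = B.lin_ext_lin[OF A.vspace_axioms evF, folded h_def] and b = B.lin_ext_basis[OF A.vspace_axioms evF, folded h_def]
  note ls = lin_simps[OF l]
  have hF: "h \<in> lin_maps K FM W" using l lin_maps_cong[of FM B.F W W K] by (simp del: B.F_simps)
  interpret BF: vspace K B.F by (rule B.vspace_F)
  have h0: "h (zero B.F) = \<zero>\<^bsub>W\<^esub>" by (rule BF.lin_zero_vec[OF A.vspace_axioms l])
  have eps: "aeps A (h x) = \<zero>" if "x \<in> carrier B.F" for x
    using that
  proof (induction rule: B.free_induct)
    case (add a t x) then show ?case
      using ev[of t] by (simp add: ls b B.basis_in_F BF.smult_closed del: B.F_simps)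
  qed (simp add: h0 del: B.F_simps)
  \<comment> \<open>Bilinear extension in two rounds: first a monomial times an arbitrary element,
    then arbitrary times arbitrary.\<close>
  have bil: "h (x \<prec>\<^bsub>FM\<^esub> y) = aleft A (h x) (h y) \<and> h (x \<succ>\<^bsub>FM\<^esub> y) = aright A (h x) (h y)"
    if x: "x \<in> carrier B.F" and y: "y \<in> carrier B.F" for x y
  proof -
    note s = lin_simps[OF hF] FM.prec_simps FM.succ_simps b B.basis_in_F
    note del = FM_simps(5,6) B.F_simps
    have 1: "h (B.e t \<prec>\<^bsub>FM\<^esub> y) = aleft A (h (B.e t)) (h y) \<and> h (B.e t \<succ>\<^bsub>FM\<^esub> y) = aright A (h (B.e t)) (h y)"
      if t: "t \<in> mons" for t
      using y
    proof (induction rule: B.free_induct)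
      case zero show ?case
        using FM.prec_zero(2)[of "B.e t"] FM.succ_zero(2)[of "B.e t"] ev(1)[of t] t h0 b[OF t] by (simp add: B.basis_in_F del: B.F_simps FM_simps(5,6))
    next
      case (add a r y)
      have r: "B.e r \<in> carrier FM" "y \<in> carrier FM" "a \<odot>\<^bsub>FM\<^esub> B.e r \<in> carrier FM" "B.e t \<in> carrier FM"
        using add t by (simp_all add: B.basis_in_F BF.smult_closed del: B.F_simps)
      have e: "set_dmon r \<subseteq> carrier V" "set_dmon t \<subseteq> carrier V" using add(2) t by auto
      have hb: "h (B.e (PrecM t r)) = aleft A (h (B.e t)) (h (B.e r))" "h (B.e (SuccM t r)) = aright A (h (B.e t)) (h (B.e r))"
        using e by (simp_all add: b)
      show ?case
        using add(4) r add(1) FM.prec_simps(1)[OF r(4,1)] FM.succ_simps(1)[OF r(4,1)] FM.prec_simps(1)[OF r(4,2)] FM.succ_simps(1)[OF r(4,2)]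
          lin_closed[OF hF r(1)] lin_closed[OF hF r(2)] lin_closed[OF hF r(4)]
        unfolding FM_simps(2,4)[symmetric]
        by (simp add: lin_simps[OF hF] FM_basis hb FM.smult_closed del: FM_simps B.F_simps)
    qed
    show ?thesis
      using x
    proof (induction rule: B.free_induct)
      case zero show ?case
        using FM.prec_zero(1)[of y] FM.succ_zero(1)[of y] lin_closed[OF l y] y h0 by (simp del: B.F_simps FM_simps(5,6))
    next
      case (add a t x)
      have r: "B.e t \<in> carrier FM" "x \<in> carrier FM" "a \<odot>\<^bsub>FM\<^esub> B.e t \<in> carrier FM" "y \<in> carrier FM"
        using add y by (simp_all add: B.basis_in_F BF.smult_closed del: B.F_simps)
      show ?case
        using add(4) 1[OF add(2)] r add(1) FM.prec_simps(1)[OF r(1,4)] FM.succ_simps(1)[OF r(1,4)] FM.prec_simps(1)[OF r(2,4)] FM.succ_simps(1)[OF r(2,4)]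
          lin_closed[OF hF r(1)] lin_closed[OF hF r(2)] lin_closed[OF hF r(4)]
        unfolding FM_simps(2,4)[symmetric]
        by (simp add: lin_simps[OF hF] FM.smult_closed del: FM_simps B.F_simps)
    qed
  qed
  have hp: "h \<in> pos_maps K FM W A"
    by (intro pos_mapsI hF) (use eps bil in \<open>simp_all del: B.F_simps FM_simps(5,6)\<close>)
  note hs = lin_simps[OF hF] pos_maps_simps[OF hp] FM.lin_minus[OF A.vspace_axioms hF]
  have "free_dend_null K V \<subseteq> {x \<in> carrier FM. h x = \<zero>\<^bsub>W\<^esub>}"
    unfolding free_dend_null_def
  proof (rule hull_minimal)
    show "dendriform_ideal {x \<in> carrier FM. h x = \<zero>\<^bsub>W\<^esub>} K FM" by (rule FM.kernel_ideal[OF A hp])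
    \<comment> \<open>All values lie in the kernel of \<epsilon>, where the associative product is
      just the sum of \<prec> and \<succ>; there \<open>left_left\<close> and
      \<open>right_right\<close> become the dendriform relations.\<close>
    have "h x = \<zero>\<^bsub>W\<^esub>" if "x \<in> free_dend_rels K V" for x
      using that unfolding free_dend_rels_def Let_def
      by (elim UnE CollectE exE conjE)
        (simp_all add: hs basis_in_FM b gs A.minus_eq_zero_iff A.left_left A.right_left A.right_right A.mul_pos
          A.a_comm del: FM_simps B.F_simps)
    then show "free_dend_rels K V \<subseteq> {x \<in> carrier FM. h x = \<zero>\<^bsub>W\<^esub>}" using rels_subset by blast
  qed
  then obtain h' where "h' \<in> pos_maps K Q.QD W A" "\<forall>x\<in>carrier FM. h' (Q.Q.proj x) = h x"
    using Q.lift_pos_map[OF A hp] by blast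
  then show ?thesis
    using b basis_in_FM by (intro bexI[of _ h']) (auto simp: FD_eq gen_eq)
qed


subsection \<open>Unitization\<close>

lemma unitization_simps [simp]:
  "carrier (unitization K E) = carrier K \<times> carrier E"
  "mult (unitization K E) (a, x) (b, y) = (a \<otimes>\<^bsub>K\<^esub> b, x \<otimes>\<^bsub>E\<^esub> y \<oplus>\<^bsub>E\<^esub> a \<odot>\<^bsub>E\<^esub> y \<oplus>\<^bsub>E\<^esub> b \<odot>\<^bsub>E\<^esub> x)"
  "one (unitization K E) = (\<one>\<^bsub>K\<^esub>, \<zero>\<^bsub>E\<^esub>)" "zero (unitization K E) = (\<zero>\<^bsub>K\<^esub>, \<zero>\<^bsub>E\<^esub>)"
  "add (unitization K E) (a, x) (b, y) = (a \<oplus>\<^bsub>K\<^esub> b, x \<oplus>\<^bsub>E\<^esub> y)"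
  "smult (unitization K E) c (a, x) = (c \<otimes>\<^bsub>K\<^esub> a, c \<odot>\<^bsub>E\<^esub> x)"
  "prec (unitization K E) (a, x) (b, y) = (\<zero>\<^bsub>K\<^esub>, x \<prec>\<^bsub>E\<^esub> y \<oplus>\<^bsub>E\<^esub> b \<odot>\<^bsub>E\<^esub> x)"
  "succ (unitization K E) (a, x) (b, y) = (\<zero>\<^bsub>K\<^esub>, x \<succ>\<^bsub>E\<^esub> y \<oplus>\<^bsub>E\<^esub> a \<odot>\<^bsub>E\<^esub> y)"
  "pos (unitization K E) = {\<zero>\<^bsub>K\<^esub>} \<times> carrier E"
  by (simp_all add: unitization_def)

lemma plus_part_vspace:
  assumes "vspace K W" "submodule (pos W) K W" shows "vspace K (plus_part W)"
  using submodule.submodule_is_module[OF assms(2) vspace_module[OF assms(1)]] vspace_field[OF assms(1)]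
    module_cong(1)[of "plus_part W" "W\<lparr>carrier := pos W\<rparr>", where K = K]
  by (intro vspaceI) simp_all

context dendriform_algebra begin

abbreviation "W \<equiv> unitization K D"

interpretation D: dend_space K D by (rule dend_space)

lemma vspace_unitization: "vspace K W"
proof (intro vspaceI moduleI abelian_groupI field_axioms is_cring)
  show "\<exists>y\<in>carrier W. y \<oplus>\<^bsub>W\<^esub> x = \<zero>\<^bsub>W\<^esub>" if "x \<in> carrier W" for x
    using that by (intro bexI[of _ "(\<ominus> fst x, \<ominus>\<^bsub>D\<^esub> snd x)"]) (auto simp: l_neg R.l_neg)
qed (auto simp: R.a_ac a_ac l_distr r_distr m_assoc smult_l_distr smult_r_distr smult_assoc1)

interpretation W: vspace K W by (rule vspace_unitization)

lemma pos_submodule_unitization: "submodule (pos W) K W"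
  by (rule W.submodule_spaceI) auto

lemma unital_unitization: "unital_dendriform_algebra K W"
proof (intro unital_dendriform_algebra.intro vspace_unitization unital_dendriform_algebra_axioms.intro)
  note s = smult_l_distr smult_r_distr smult_assoc1[symmetric] R.a_ac a_ac l_distr r_distr m_ac
  interpret P: vspace K "plus_part W" by (rule plus_part_vspace[OF vspace_unitization pos_submodule_unitization])
  show "\<one>\<^bsub>W\<^esub> \<in> carrier W" by simp
  show "submodule (pos W) K W" by (rule pos_submodule_unitization)
  show "\<exists>!(a, v). a \<in> carrier K \<and> v \<in> pos W \<and> x = a \<odot>\<^bsub>W\<^esub> \<one>\<^bsub>W\<^esub> \<oplus>\<^bsub>W\<^esub> v" if "x \<in> carrier W" for x
    using that by (intro ex1I[of _ "(fst x, (\<zero>, snd x))"]) auto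
  have m: "smult W a x = (a \<otimes> fst x, a \<odot>\<^bsub>D\<^esub> snd x)" for a x by (cases x) simp
  show "dendriform_algebra K (plus_part W)"
  proof (intro dendriform_algebra.intro dendriform_algebra_axioms.intro P.vspace_axioms)
    show "bilinear K (plus_part W) (plus_part W) (plus_part W) (prec (plus_part W))"
      by (rule bilinearI) auto
    show "bilinear K (plus_part W) (plus_part W) (plus_part W) (succ (plus_part W))"
      by (rule bilinearI) auto
  qed (auto simp: prec_prec succ_prec succ_succ star_def)
  show "bilinear K (plus_part W) W (plus_part W) (prec W)" "bilinear K W (plus_part W) (plus_part W) (prec W)"
    "bilinear K (plus_part W) W (plus_part W) (succ W)" "bilinear K W (plus_part W) (plus_part W) (succ W)"
    "bilinear K W W W (mult W)"
    by (rule bilinearI; auto simp: s star_def)+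
qed (auto simp: star_def a_ac)

interpretation U: unital_dendriform_algebra K W by (rule unital_unitization)

lemma unitization_proj [simp]:
  assumes "a \<in> carrier K" "x \<in> carrier D" shows "proj_unit K W (a, x) = a" "proj_pos K W (a, x) = (\<zero>, x)"
  using U.proj_unique[of a "(\<zero>, x)" "(a, x)"] assms by auto

lemma unitization_aug [simp]:
  assumes "a \<in> carrier K" "x \<in> carrier D" "b \<in> carrier K" "y \<in> carrier D"
  shows "omit_unit K W (prec W) (a, x) (b, y) = (\<zero>, x \<prec>\<^bsub>D\<^esub> y \<oplus>\<^bsub>D\<^esub> b \<odot>\<^bsub>D\<^esub> x)"
    "omit_unit K W (succ W) (a, x) (b, y) = (\<zero>, x \<succ>\<^bsub>D\<^esub> y \<oplus>\<^bsub>D\<^esub> a \<odot>\<^bsub>D\<^esub> y)"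
  using assms by (simp_all add: U.omit_prec U.omit_succ)

lemma augmented_unitization: "augmented K W (aug_of K W)"
  by (rule U.augmented_aug_of)

lemma unitization_incl: "(\<lambda>x. (\<zero>, x)) \<in> pos_maps K D W (aug_of K W)"
  by (intro pos_mapsI lin_mapsI) simp_all

lemma unitization_lift:
  assumes A: "augmented K W' A" and h: "h \<in> pos_maps K D W' A"
  shows "(\<lambda>(a, x). a \<odot>\<^bsub>W'\<^esub> aone A \<oplus>\<^bsub>W'\<^esub> h x) \<in> aug_homs K W (aug_of K W) W' A"
proof -
  interpret A: augmented K W' A by fact
  interpret AU: augmented K W "aug_of K W" by (rule augmented_unitization)
  note l = lin_simps[OF pos_maps_lin[OF h]] lin_zero_vec[OF A.vspace_axioms pos_maps_lin[OF h]] pos_maps_simps[OF h]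
  show ?thesis
  proof (rule AU.aug_homsI_pos[OF A])
    show "(\<lambda>(a, x). a \<odot>\<^bsub>W'\<^esub> aone A \<oplus>\<^bsub>W'\<^esub> h x) \<in> lin_maps K W W'"
      by (intro lin_mapsI) (auto simp: l A.smult_l_distr A.smult_r_distr A.smult_assoc1 A.a_ac)
  qed (auto simp: l)
qed

lemma unitization_generated:
  assumes "dend_generated K D S" shows "aug_generated K W (aug_of K W) (Pair \<zero> ` S)"
  unfolding aug_generated_def
proof (intro conjI allI impI subsetI)
  fix x assume "x \<in> Pair \<zero> ` S" then show "x \<in> carrier W" using assms by (auto simp: dend_generated_def)
next
  fix N x assume N: "submodule N K W \<and> Pair \<zero> ` S \<subseteq> N \<and> aone (aug_of K W) \<in> N \<and>
    (\<forall>x\<in>N. \<forall>y\<in>N. aleft (aug_of K W) x y \<in> N \<and> aright (aug_of K W) x y \<in> N)" and x: "x \<in> carrier W"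
  note N' = W.submodule_facts[OF conjunct1[OF N]]
  let ?M = "{x \<in> carrier D. (\<zero>, x) \<in> N}"
  have "submodule ?M K D"
    using lin_vimage_submodule[OF vspace_unitization pos_maps_lin[OF unitization_incl] conjunct1[OF N]] .
  moreover have "x \<prec>\<^bsub>D\<^esub> y \<in> ?M \<and> x \<succ>\<^bsub>D\<^esub> y \<in> ?M" if "x \<in> ?M" "y \<in> ?M" for x y
  proof -
    have "aleft (aug_of K W) (\<zero>, x) (\<zero>, y) \<in> N \<and> aright (aug_of K W) (\<zero>, x) (\<zero>, y) \<in> N" using N that by blast
    then show ?thesis using that by simp
  qed
  moreover have "S \<subseteq> ?M" using N assms by (auto simp: dend_generated_def)
  ultimately have M: "carrier D \<subseteq> ?M"
    using assms unfolding dend_generated_def by (elim conjE allE[of _ ?M] impE) auto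
  obtain a y where ay: "x = (a, y)" "a \<in> carrier K" "y \<in> carrier D" using x by auto
  have "(\<one>, \<zero>\<^bsub>D\<^esub>) \<in> N" "(\<zero>, y) \<in> N" using N M ay by auto
  then have "a \<odot>\<^bsub>W\<^esub> (\<one>, \<zero>\<^bsub>D\<^esub>) \<oplus>\<^bsub>W\<^esub> (\<zero>, y) \<in> N" using N'(4,5) ay(2) by presburger
  then show "x \<in> N" using ay by simp
qed

end

section \<open>Words of primitive elements and braces\<close>

subsection \<open>Sums over the factorizations of a word\<close>

text \<open>A recursion on the word, rather than a sum over cut positions, lets identities be proved
  by induction on the first letter with an arbitrary summand.\<close>

primrec split_sum :: "('a, 'm) ring_scheme \<Rightarrow> ('b list \<Rightarrow> 'b list \<Rightarrow> 'a) \<Rightarrow> 'b list \<Rightarrow> 'a" where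
  "split_sum W f [] = f [] []"
| "split_sum W f (a # c) = f [] (a # c) \<oplus>\<^bsub>W\<^esub> split_sum W (\<lambda>v w. f (a # v) w) c"

lemma split_sum_cong:
  assumes "\<And>v w. c = v @ w \<Longrightarrow> f v w = g v w"
  shows "split_sum W f c = split_sum W g c"
  using assms
proof (induction c arbitrary: f g)
  case (Cons a c)
  have "split_sum W (\<lambda>v w. f (a # v) w) c = split_sum W (\<lambda>v w. g (a # v) w) c"
    by (rule Cons.IH) (rule Cons.prems, simp)
  then show ?case using Cons.prems[of "[]" "a # c"] by simp
qed simp

lemma split_sum_map: "split_sum W f (map g c) = split_sum W (\<lambda>v w. f (map g v) (map g w)) c"
  by (induction c arbitrary: f) simp_all

context vspace begin

lemma split_sum_closed:
  assumes "\<And>v w. c = v @ w \<Longrightarrow> f v w \<in> carrier V"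
  shows "split_sum V f c \<in> carrier V"
  using assms by (induction c arbitrary: f) simp_all

lemma split_sum_add:
  assumes "\<And>v w. c = v @ w \<Longrightarrow> f v w \<in> carrier V" "\<And>v w. c = v @ w \<Longrightarrow> g v w \<in> carrier V"
  shows "split_sum V (\<lambda>v w. f v w \<oplus>\<^bsub>V\<^esub> g v w) c = split_sum V f c \<oplus>\<^bsub>V\<^esub> split_sum V g c"
  using assms
proof (induction c arbitrary: f g)
  case (Cons a c)
  have "split_sum V (\<lambda>v w. f (a # v) w) c \<in> carrier V" "split_sum V (\<lambda>v w. g (a # v) w) c \<in> carrier V"
    using Cons.prems by (auto intro!: split_sum_closed)
  then show ?case using Cons by (simp add: a_ac)
qed simp

lemma split_sum_lin:
  assumes h: "h \<in> lin_maps K V W" and "\<And>v w. c = v @ w \<Longrightarrow> f v w \<in> carrier V"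
  shows "h (split_sum V f c) = split_sum W (\<lambda>v w. h (f v w)) c"
  using assms(2)
proof (induction c arbitrary: f)
  case (Cons a c)
  have "split_sum V (\<lambda>v w. f (a # v) w) c \<in> carrier V"
    using Cons.prems by (auto intro!: split_sum_closed)
  then show ?case using Cons by (simp add: lin_add[OF h])
qed simp

text \<open>The recursion at the other end of the word, suited to \<open>aug_s\<close>, which grows
  on the right.\<close>

lemma split_sum_snoc:
  assumes "\<And>v w. c @ [z] = v @ w \<Longrightarrow> f v w \<in> carrier V"
  shows "split_sum V f (c @ [z]) = split_sum V (\<lambda>v w. f v (w @ [z])) c \<oplus>\<^bsub>V\<^esub> f (c @ [z]) []"
  using assms
proof (induction c arbitrary: f)
  case (Cons a c)
  have "split_sum V (\<lambda>v w. f (a # v) (w @ [z])) c \<in> carrier V"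
    using Cons.prems by (auto intro!: split_sum_closed)
  moreover have "f [] (a # c @ [z]) \<in> carrier V" "f (a # c @ [z]) [] \<in> carrier V" using Cons.prems by auto
  ultimately show ?case using Cons.IH[of "\<lambda>v w. f (a # v) w"] Cons.prems by (simp add: a_assoc)
qed simp

lemma split_sum_zero:
  assumes "\<And>v w. c = v @ w \<Longrightarrow> f v w = \<zero>\<^bsub>V\<^esub>" shows "split_sum V f c = \<zero>\<^bsub>V\<^esub>"
  using assms by (induction c arbitrary: f) simp_all

lemma split_sum_first:
  assumes "f [] c \<in> carrier V" "\<And>v w. \<lbrakk>c = v @ w; v \<noteq> []\<rbrakk> \<Longrightarrow> f v w = \<zero>\<^bsub>V\<^esub>"
  shows "split_sum V f c = f [] c"
  using assms by (cases c) (simp_all add: split_sum_zero)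

lemma split_sum_last:
  assumes "f c [] \<in> carrier V" "\<And>v w. \<lbrakk>c = v @ w; w \<noteq> []\<rbrakk> \<Longrightarrow> f v w = \<zero>\<^bsub>V\<^esub>"
  shows "split_sum V f c = f c []"
  using assms by (induction c arbitrary: f) simp_all

text \<open>Coassociativity of deconcatenation: both sides run over all factorizations of the word
  into three parts.\<close>

lemma split_sum_assoc:
  assumes "\<And>v w x. c = v @ w @ x \<Longrightarrow> f v w x \<in> carrier V"
  shows "split_sum V (\<lambda>v w. split_sum V (\<lambda>v1 v2. f v1 v2 w) v) c =
    split_sum V (\<lambda>v w. split_sum V (\<lambda>w1 w2. f v w1 w2) w) c"
  using assms
proof (induction c arbitrary: f)
  case (Cons a c)
  have c: "f [] [] (a # c) \<in> carrier V" "\<And>v w. c = v @ w \<Longrightarrow> f [] (a # v) w \<in> carrier V"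
    "\<And>v w x. c = v @ w @ x \<Longrightarrow> f (a # v) w x \<in> carrier V"
    using Cons.prems by auto
  have "split_sum V (\<lambda>v w. f [] (a # v) w) c \<in> carrier V"
    "split_sum V (\<lambda>v w. split_sum V (\<lambda>w1 w2. f (a # v) w1 w2) w) c \<in> carrier V"
    using c by (auto intro!: split_sum_closed)
  moreover have "split_sum V (\<lambda>v w. f [] (a # v) w \<oplus>\<^bsub>V\<^esub> split_sum V (\<lambda>v1 v2. f (a # v1) v2 w) v) c =
    split_sum V (\<lambda>v w. f [] (a # v) w) c \<oplus>\<^bsub>V\<^esub>
    split_sum V (\<lambda>v w. split_sum V (\<lambda>v1 v2. f (a # v1) v2 w) v) c"
    using c by (intro split_sum_add split_sum_closed) auto
  ultimately show ?case using Cons.IH[of "\<lambda>v w x. f (a # v) w x"] c by (simp add: a_assoc)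
qed simp

lemma split_sum_swap:
  assumes "\<And>v1 v2 w1 w2. \<lbrakk>c = v1 @ v2; d = w1 @ w2\<rbrakk> \<Longrightarrow> f v1 v2 w1 w2 \<in> carrier V"
  shows "split_sum V (\<lambda>w1 w2. split_sum V (\<lambda>v1 v2. f v1 v2 w1 w2) c) d =
    split_sum V (\<lambda>v1 v2. split_sum V (\<lambda>w1 w2. f v1 v2 w1 w2) d) c"
  using assms
proof (induction c arbitrary: f)
  case (Cons a c)
  have 1: "split_sum V (\<lambda>w1 w2. split_sum V (\<lambda>v1 v2. f (a # v1) v2 w1 w2) c) d =
      split_sum V (\<lambda>v1 v2. split_sum V (\<lambda>w1 w2. f (a # v1) v2 w1 w2) d) c"
    by (rule Cons.IH) (rule Cons.prems, simp_all)
  have 2: "split_sum V (\<lambda>v1 v2. f (a # v1) v2 w1 w2) c \<in> carrier V" if "d = w1 @ w2" for w1 w2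
    by (rule split_sum_closed) (rule Cons.prems, simp_all add: that)
  show ?case using 1 2 Cons.prems[of "[]" "a # c"] by (simp add: split_sum_add)
qed simp

text \<open>Connects the recursive form with \<open>dend_brace\<close>, which is a sum over cut
  positions.\<close>

lemma split_sum_finsum:
  assumes "\<And>v w. c = v @ w \<Longrightarrow> f v w \<in> carrier V"
  shows "split_sum V f c = (\<Oplus>\<^bsub>V\<^esub>i\<in>{..length c}. f (take i c) (drop i c))"
  using assms
proof (induction c arbitrary: f)
  case (Cons a c)
  have "(\<lambda>i. f (take i (a # c)) (drop i (a # c))) \<in> {..Suc (length c)} \<rightarrow> carrier V"
    by (rule Pi_I) (rule Cons.prems, simp)
  moreover have "split_sum V (\<lambda>v w. f (a # v) w) c \<in> carrier V"
    using Cons.prems by (auto intro!: split_sum_closed)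
  moreover have "split_sum V (\<lambda>v w. f (a # v) w) c = (\<Oplus>\<^bsub>V\<^esub>i\<in>{..length c}. f (a # take i c) (drop i c))"
    by (rule Cons.IH) (rule Cons.prems, simp)
  moreover have "f [] (a # c) \<in> carrier V" by (rule Cons.prems) simp
  ultimately show ?case by (simp add: finsum_Suc2 a_comm del: finsum_Suc)
qed simp

end

subsection \<open>Left and right iterated products\<close>

text \<open>\<open>aug_s\<close> is \<open>\<searrow>\<close>, and \<open>aug_n\<close> is \<open>\<nearrow>\<close> with the sign \<open>(-1)\<^sup>n\<close>, both extended by \<open>1\<close> to the empty
  word. They are inverse to each other for the convolution of functions on words.\<close>

definition aug_s :: "('k, 'a) aug \<Rightarrow> 'a list \<Rightarrow> 'a"
  where "aug_s A c = foldl (aright A) (aone A) c"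

primrec aug_n :: "('a, 'm) ring_scheme \<Rightarrow> ('k, 'a) aug \<Rightarrow> 'a list \<Rightarrow> 'a" where
  "aug_n W A [] = aone A"
| "aug_n W A (a # c) = \<ominus>\<^bsub>W\<^esub> aleft A a (aug_n W A c)"

text \<open>The sign is absorbed in \<open>aug_n\<close>. The end terms need no separate reading:
  for x in the kernel of \<epsilon> the empty words contribute 1, and 1 \<succ> y = y, x \<prec> 1 =
  x.\<close>

definition aug_brace :: "('a, 'm) ring_scheme \<Rightarrow> ('k, 'a) aug \<Rightarrow> 'a \<Rightarrow> 'a list \<Rightarrow> 'a"
  where "aug_brace W A x c = split_sum W (\<lambda>v w. aright A (aug_n W A v) (aleft A x (aug_s A w))) c"

lemma aug_s_simps [simp]: "aug_s A [] = aone A" "aug_s A (c @ [z]) = aright A (aug_s A c) z"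
  by (simp_all add: aug_s_def)

context augmented begin

abbreviation "s \<equiv> aug_s A"
abbreviation "n \<equiv> aug_n W A"
abbreviation "pos_set \<equiv> {x \<in> carrier W. \<epsilon> x = \<zero>}"

lemma left_neg: "\<lbrakk>x \<in> carrier W; y \<in> carrier W\<rbrakk> \<Longrightarrow> L (\<ominus>\<^bsub>W\<^esub> x) y = \<ominus>\<^bsub>W\<^esub> L x y"
  "\<lbrakk>x \<in> carrier W; y \<in> carrier W\<rbrakk> \<Longrightarrow> L x (\<ominus>\<^bsub>W\<^esub> y) = \<ominus>\<^bsub>W\<^esub> L x y"
  by (rule bilinear_neg[OF left_bilinear vspace_axioms vspace_axioms vspace_axioms]; assumption)+

lemma right_neg: "\<lbrakk>x \<in> carrier W; y \<in> carrier W\<rbrakk> \<Longrightarrow> R (\<ominus>\<^bsub>W\<^esub> x) y = \<ominus>\<^bsub>W\<^esub> R x y"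
  "\<lbrakk>x \<in> carrier W; y \<in> carrier W\<rbrakk> \<Longrightarrow> R x (\<ominus>\<^bsub>W\<^esub> y) = \<ominus>\<^bsub>W\<^esub> R x y"
  by (rule bilinear_neg[OF right_bilinear vspace_axioms vspace_axioms vspace_axioms]; assumption)+

lemma eps_neg [simp]: "\<lbrakk>x \<in> carrier W; \<epsilon> x = \<zero>\<rbrakk> \<Longrightarrow> \<epsilon> (\<ominus>\<^bsub>W\<^esub> x) = \<zero>"
  by (subst minus_smult) simp_all

lemma s_closed [simp]: "set c \<subseteq> carrier W \<Longrightarrow> s c \<in> carrier W"
  by (induction c rule: rev_induct) auto

lemma n_closed [simp]: "set c \<subseteq> carrier W \<Longrightarrow> n c \<in> carrier W"
  by (induction c) auto

lemma eps_s [simp]: "set c \<subseteq> carrier W \<Longrightarrow> \<epsilon> (s c) = (if c = [] then \<one> else \<zero>)"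
  by (cases c rule: rev_cases) auto

lemma eps_n [simp]: "set c \<subseteq> carrier W \<Longrightarrow> \<epsilon> (n c) = (if c = [] then \<one> else \<zero>)"
  by (cases c) auto

lemma pos_setD: "set c \<subseteq> pos_set \<Longrightarrow> set c \<subseteq> carrier W"
  by auto

text \<open>A telescoping sum. Writing a word as a c, \<open>right_left\<close> gives
  \<open>R (s q) (n (a # c))\<close> = - \<open>L (s (q @ [a])) (n c)\<close>, so each \<succ> term
  cancels the \<prec> terms of the longer prefix. The prefix \<open>q\<close> makes the induction go
  through.\<close>

lemma s_conv_n_aux:
  assumes "set c \<subseteq> carrier W" "set q \<subseteq> carrier W"
  shows "split_sum W (\<lambda>v w. L (s (q @ v)) (n w) \<oplus>\<^bsub>W\<^esub> R (s (q @ v)) (n w)) c = L (s q) (n c)"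
  using assms
proof (induction c arbitrary: q)
  case (Cons a c)
  have "split_sum W (\<lambda>v w. L (s (q @ a # v)) (n w) \<oplus>\<^bsub>W\<^esub> R (s (q @ a # v)) (n w)) c = L (s (q @ [a])) (n c)"
    using Cons.IH[of "q @ [a]"] Cons.prems by simp
  also have "\<dots> = \<ominus>\<^bsub>W\<^esub> R (s q) (n (a # c))"
    using Cons.prems by (simp add: right_left right_neg)
  finally show ?case using Cons.prems by (simp add: right_neg left_neg a_assoc l_neg r_neg)
qed simp

text \<open>The telescoping sum with empty prefix leaves 1 \<prec> \<open>n c\<close> = 0. The unit
  term in the associative product occurs only if both parts are empty.\<close>

lemma s_conv_n:
  assumes "set c \<subseteq> carrier W"
  shows "split_sum W (\<lambda>v w. M (s v) (n w)) c = (if c = [] then u else \<zero>\<^bsub>W\<^esub>)"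
proof (cases c)
  case (Cons a d)
  have "split_sum W (\<lambda>v w. M (s v) (n w)) c = split_sum W (\<lambda>v w. L (s ([] @ v)) (n w) \<oplus>\<^bsub>W\<^esub> R (s ([] @ v)) (n w)) c"
  proof (rule split_sum_cong)
    fix v w assume vw: "c = v @ w"
    then have "set v \<subseteq> carrier W" "set w \<subseteq> carrier W" "v \<noteq> [] \<or> w \<noteq> []" using assms Cons by auto
    then show "M (s v) (n w) = L (s ([] @ v)) (n w) \<oplus>\<^bsub>W\<^esub> R (s ([] @ v)) (n w)"
      by (auto simp: mul_eq)
  qed
  also have "\<dots> = \<zero>\<^bsub>W\<^esub>" using s_conv_n_aux[OF assms, of "[]"] assms by simp
  finally show ?thesis using Cons by simp
qed simp

text \<open>The \<prec> part can be factored at the first letter, as -a \<prec> (\<open>n v\<close>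
  * \<open>s w\<close>), and the \<succ> part at the last letter, as (\<open>n v\<close> *
  \<open>s w\<close>) \<succ> z. Both inner sums are convolutions over shorter words, hence vanish
  unless the word has one letter, and then -a + a = 0.\<close>

lemma n_conv_s:
  assumes "set c \<subseteq> pos_set"
  shows "split_sum W (\<lambda>v w. M (n v) (s w)) c = (if c = [] then u else \<zero>\<^bsub>W\<^esub>)"
  using assms
proof (induction "length c" arbitrary: c rule: less_induct)
  case less
  show ?case
  proof (cases "c = []")
    case False
    then obtain a d e z where ad: "c = a # d" and ez: "c = e @ [z]" by (metis neq_Nil_conv rev_exhaust)
    have car: "set v \<subseteq> carrier W \<and> set w \<subseteq> carrier W" if "c = v @ w" for v w
      using less.prems that by auto
    have a: "a \<in> carrier W" "\<epsilon> a = \<zero>" "set d \<subseteq> carrier W" 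
      using less.prems[unfolded ad] by auto
    have z: "z \<in> carrier W" "\<epsilon> z = \<zero>" "set e \<subseteq> carrier W"
      using less.prems[unfolded ez] by auto
    have IH: "split_sum W (\<lambda>v w. M (n v) (s w)) d = (if d = [] then u else \<zero>\<^bsub>W\<^esub>)"
      "split_sum W (\<lambda>v w. M (n v) (s w)) e = (if e = [] then u else \<zero>\<^bsub>W\<^esub>)"
      using less.hyps[of d] less.hyps[of e] less.prems[unfolded ad] less.prems[unfolded ez]
        arg_cong[OF ad, of length] arg_cong[OF ez, of length] by auto
    have "split_sum W (\<lambda>v w. M (n v) (s w)) c = split_sum W (\<lambda>v w. L (n v) (s w) \<oplus>\<^bsub>W\<^esub> R (n v) (s w)) c"
    proof (rule split_sum_cong)
      fix v w assume vw: "c = v @ w"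
      then have "set v \<subseteq> carrier W" "set w \<subseteq> carrier W" "v \<noteq> [] \<or> w \<noteq> []" using car False by auto
      then show "M (n v) (s w) = L (n v) (s w) \<oplus>\<^bsub>W\<^esub> R (n v) (s w)" by (auto simp: mul_eq)
    qed
    also have "\<dots> = split_sum W (\<lambda>v w. L (n v) (s w)) c \<oplus>\<^bsub>W\<^esub> split_sum W (\<lambda>v w. R (n v) (s w)) c"
      using car by (intro split_sum_add) auto
    also have "split_sum W (\<lambda>v w. L (n v) (s w)) c = split_sum W (\<lambda>v w. \<ominus>\<^bsub>W\<^esub> L a (M (n v) (s w))) d"
    proof -
      have "split_sum W (\<lambda>v w. L (n (a # v)) (s w)) d = split_sum W (\<lambda>v w. \<ominus>\<^bsub>W\<^esub> L a (M (n v) (s w))) d"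
        using a by (intro split_sum_cong) (auto simp: left_neg left_left)
      moreover have "split_sum W (\<lambda>v w. \<ominus>\<^bsub>W\<^esub> L a (M (n v) (s w))) d \<in> carrier W"
        using a by (intro split_sum_closed) auto
      ultimately show ?thesis
        using a by (simp add: ad)
    qed
    also have "\<dots> = \<ominus>\<^bsub>W\<^esub> L a (split_sum W (\<lambda>v w. M (n v) (s w)) d)"
    proof -
      have "(\<lambda>y. \<ominus>\<^bsub>W\<^esub> L a y) \<in> lin_maps K W W" using a by (intro lin_mapsI) (auto simp: minus_add smult_r_minus a_comm)
      then show ?thesis using a by (subst split_sum_lin[symmetric]) auto
    qed
    also have "split_sum W (\<lambda>v w. R (n v) (s w)) c = split_sum W (\<lambda>v w. R (n v) (s (w @ [z]))) e \<oplus>\<^bsub>W\<^esub> R (n c) u"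
      unfolding ez using car by (subst split_sum_snoc) (auto simp: ez)
    also have "split_sum W (\<lambda>v w. R (n v) (s (w @ [z]))) e = split_sum W (\<lambda>v w. R (M (n v) (s w)) z) e"
      using z by (intro split_sum_cong) (auto simp: right_right)
    also have "\<dots> = R (split_sum W (\<lambda>v w. M (n v) (s w)) e) z"
      using z by (subst split_sum_lin[OF bilinear_left[OF right_bilinear], of z]) auto
    finally have "split_sum W (\<lambda>v w. M (n v) (s w)) c =
      \<ominus>\<^bsub>W\<^esub> L a (if d = [] then u else \<zero>\<^bsub>W\<^esub>) \<oplus>\<^bsub>W\<^esub> (R (if e = [] then u else \<zero>\<^bsub>W\<^esub>) z \<oplus>\<^bsub>W\<^esub> R (n c) u)"
      by (simp add: IH)
    moreover have "n c \<in> carrier W" by (rule n_closed[OF pos_setD[OF less.prems]])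
    \<comment> \<open>The one-letter case: removing the first and removing the last letter both
      leave the empty word, and the two letters coincide.\<close>
    moreover have "d = [] \<longleftrightarrow> e = []" "d = [] \<Longrightarrow> a = z" using ad ez by (auto simp: Cons_eq_append_conv)
    ultimately show ?thesis using a z False by (auto simp: l_neg)
  qed simp
qed

lemma brace_closed [simp]: "\<lbrakk>x \<in> carrier W; set c \<subseteq> carrier W\<rbrakk> \<Longrightarrow> aug_brace W A x c \<in> carrier W"
  unfolding aug_brace_def by (rule split_sum_closed) auto

text \<open>The brace is by definition the convolution of \<open>n\<close> with the words b \<prec>
  \<open>s w\<close>; convolving with \<open>s\<close> from the left undoes this. It is the rule
  that moves a \<prec> past a word at the price of braces.\<close>

lemma left_word_eq_braces:
  assumes b: "b \<in> carrier W" and c: "set c \<subseteq> carrier W"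
  shows "L b (s c) = split_sum W (\<lambda>v w. R (s v) (aug_brace W A b w)) c"
proof -
  have car: "set v \<subseteq> carrier W \<and> set w \<subseteq> carrier W" if "c = v @ w" for v w
    using c that by auto
  have "split_sum W (\<lambda>v w. R (s v) (aug_brace W A b w)) c =
    split_sum W (\<lambda>v w. split_sum W (\<lambda>w1 w2. R (M (s v) (n w1)) (L b (s w2))) w) c"
  proof (rule split_sum_cong)
    fix v w assume vw: "c = v @ w"
    have "R (s v) (aug_brace W A b w) = split_sum W (\<lambda>w1 w2. R (s v) (R (n w1) (L b (s w2)))) w"
      unfolding aug_brace_def using b car[OF vw] by (intro split_sum_lin[OF bilinear_right[OF right_bilinear]]) auto
    also have "\<dots> = split_sum W (\<lambda>w1 w2. R (M (s v) (n w1)) (L b (s w2))) w"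
      using b car[OF vw] by (intro split_sum_cong) (auto simp: right_right)
    finally show "R (s v) (aug_brace W A b w) = split_sum W (\<lambda>w1 w2. R (M (s v) (n w1)) (L b (s w2))) w" .
  qed
  \<comment> \<open>Regroup the three-part factorization so that the two factors that are inverse to
    each other are summed first.\<close>
  also have "\<dots> = split_sum W (\<lambda>v w. split_sum W (\<lambda>v1 v2. R (M (s v1) (n v2)) (L b (s w))) v) c"
    using b c by (intro split_sum_assoc[symmetric]) auto
  also have "\<dots> = split_sum W (\<lambda>v w. R (if v = [] then u else \<zero>\<^bsub>W\<^esub>) (L b (s w))) c"
  proof (rule split_sum_cong)
    fix v w assume vw: "c = v @ w"
    then show "split_sum W (\<lambda>v1 v2. R (M (s v1) (n v2)) (L b (s w))) v = R (if v = [] then u else \<zero>\<^bsub>W\<^esub>) (L b (s w))"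
      using b car[OF vw] s_conv_n[of v]
      by (subst split_sum_lin[OF bilinear_left[OF right_bilinear], symmetric]) auto
  qed
  also have "\<dots> = L b (s c)"
    using b c by (subst split_sum_first) auto
  finally show ?thesis ..
qed


subsection \<open>The span of the right iterated products\<close>

lemma span_bilinear_closed:
  assumes S: "S \<subseteq> carrier W" and f: "bilinear K W W W f"
    and c: "\<And>x y. \<lbrakk>x \<in> S; y \<in> S\<rbrakk> \<Longrightarrow> f x y \<in> span_in K W S"
    and xy: "x \<in> span_in K W S" "y \<in> span_in K W S"
  shows "f x y \<in> span_in K W S"
proof -
  note N = span_submodule[OF S]
  have y: "y \<in> carrier W" by (rule submodule_facts(1)[OF N xy(2)])
  have 1: "f x y \<in> span_in K W S" if x: "x \<in> S" for x
  proof -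
    have x': "x \<in> carrier W" using x S by blast
    have "span_in K W S \<subseteq> {y \<in> carrier W. f x y \<in> span_in K W S}"
      by (rule span_least[OF _ lin_vimage_submodule[OF vspace_axioms bilinear_right[OF f x'] N]]) (use S c x in blast)
    then show ?thesis using xy(2) by blast
  qed
  have "span_in K W S \<subseteq> {x \<in> carrier W. f x y \<in> span_in K W S}"
    by (rule span_least[OF _ lin_vimage_submodule[OF vspace_axioms bilinear_left[OF f y] N]]) (use S 1 in blast)
  then show ?thesis using xy(1) by blast
qed

definition word_span :: "'a set \<Rightarrow> 'a set"
  where "word_span B = span_in K W {s c | c. set c \<subseteq> B}"

context
  fixes B assumes B: "B \<subseteq> pos_set"
    and B_brace: "\<And>x c. \<lbrakk>x \<in> B; set c \<subseteq> B\<rbrakk> \<Longrightarrow> aug_brace W A x c \<in> B"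
begin

lemma word_set_subset: "{s c | c. set c \<subseteq> B} \<subseteq> carrier W"
  using B by (auto intro!: s_closed)

lemma word_span_submodule: "submodule (word_span B) K W"
  unfolding word_span_def by (rule span_submodule[OF word_set_subset])

lemma word_in_span: "set c \<subseteq> B \<Longrightarrow> s c \<in> word_span B"
  unfolding word_span_def by (rule span_incl) auto

lemma word_span_right:
  assumes "x \<in> word_span B" "b \<in> B" shows "R x b \<in> word_span B"
proof -
  have b: "b \<in> carrier W" using B assms by auto
  have "word_span B \<subseteq> {x \<in> carrier W. R x b \<in> word_span B}"
    unfolding word_span_def
  proof (intro span_least[OF _ lin_vimage_submodule[OF vspace_axioms bilinear_left[OF right_bilinear b] word_span_submodule[unfolded word_span_def]]] subsetI)
    fix x assume "x \<in> {s c | c. set c \<subseteq> B}"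
    then obtain c where c: "x = s c" "set c \<subseteq> B" by blast
    have "s (c @ [b]) \<in> word_span B" using c(2) assms(2) by (intro word_in_span) auto
    then have "R x b \<in> word_span B" unfolding c(1) aug_s_simps .
    moreover have "x \<in> carrier W" using word_set_subset c by blast
    ultimately show "x \<in> {x \<in> carrier W. R x b \<in> span_in K W {s c |c. set c \<subseteq> B}}"
      unfolding word_span_def by blast
  qed
  then show ?thesis using assms(1) by blast
qed

lemma split_sum_in_submodule:
  assumes "submodule N K W" "\<And>v w. c = v @ w \<Longrightarrow> f v w \<in> N"
  shows "split_sum W f c \<in> N"
  using assms(2) by (induction c arbitrary: f) (simp_all add: submodule_facts(5)[OF assms(1)])

text \<open>Induction on the total length, for the three products at once. \<open>R\<close> splits
  off the last letter of the second word. For \<open>L\<close> the last letter b of the first word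
  is pushed through by \<open>left_word_eq_braces\<close>; each brace is again a single letter of
  \<open>B\<close>, and the product of words in front of it is shorter.\<close>

lemma word_mul_in_span:
  assumes "set v \<subseteq> B" "set w \<subseteq> B"
  shows "M (s v) (s w) \<in> word_span B \<and> L (s v) (s w) \<in> word_span B \<and> R (s v) (s w) \<in> word_span B"
  using assms
proof (induction "length v + length w" arbitrary: v w rule: less_induct)
  case less
  note N = submodule_facts[OF word_span_submodule]
  have car: "set c \<subseteq> carrier W" if "set c \<subseteq> B" for c using that B by auto
  have "R (s v) (s w) \<in> word_span B"
  proof (cases w rule: rev_cases)
    case Nil then show ?thesis using car[OF less.prems(1)] N(2) by simp
  next
    case (snoc w' z)
    then have "R (s v) (s w) = R (M (s v) (s w')) z"
      using car[OF less.prems(1)] car[OF less.prems(2)] by (simp add: right_right)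
    moreover have "M (s v) (s w') \<in> word_span B" "z \<in> B" using less.hyps[of v w'] less.prems snoc by auto
    ultimately show ?thesis using word_span_right by metis
  qed
  moreover have "L (s v) (s w) \<in> word_span B"
  proof (cases v rule: rev_cases)
    case Nil then show ?thesis using car[OF less.prems(2)] N(2) by simp
  next
    case (snoc v' b)
    have vb: "set v' \<subseteq> B" "b \<in> B" "b \<in> carrier W" "set v' \<subseteq> carrier W" using snoc less.prems B by auto
    have "L (s v) (s w) = R (s v') (L b (s w))"
      using car[OF less.prems(2)] vb by (simp add: snoc right_left)
    also have "\<dots> = split_sum W (\<lambda>w1 w2. R (s v') (R (s w1) (aug_brace W A b w2))) w"
      unfolding left_word_eq_braces[OF vb(3) car[OF less.prems(2)]]
      using vb car[OF less.prems(2)] by (intro split_sum_lin[OF bilinear_right[OF right_bilinear]]) auto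
    also have "\<dots> \<in> word_span B"
    proof (rule split_sum_in_submodule[OF word_span_submodule])
      fix w1 w2 assume w: "w = w1 @ w2"
      have "R (s v') (R (s w1) (aug_brace W A b w2)) = R (M (s v') (s w1)) (aug_brace W A b w2)"
        using vb car[OF less.prems(2)] w by (intro right_right) auto
      moreover have "M (s v') (s w1) \<in> word_span B" using less.hyps[of v' w1] less.prems snoc w by auto
      moreover have "aug_brace W A b w2 \<in> B" using B_brace vb less.prems(2) w by auto
      ultimately show "R (s v') (R (s w1) (aug_brace W A b w2)) \<in> word_span B" using word_span_right by metis
    qed
    finally show ?thesis .
  qed
  moreover have "u \<in> word_span B" using word_in_span[of "[]"] by simp
  ultimately show ?case
    using car[OF less.prems(1)] car[OF less.prems(2)] N(4,5) by (simp add: mul_eq)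
qed

text \<open>The span of the words contains 1 and the generators, and by
  \<open>word_mul_in_span\<close> it is closed under both products.\<close>

lemma generated_word_span:
  assumes "aug_generated K W A B" shows "carrier W \<subseteq> word_span B"
proof -
  have ops: "L x y \<in> word_span B" "R x y \<in> word_span B" if "x \<in> word_span B" "y \<in> word_span B" for x y
  proof -
    have "L x y \<in> word_span B \<and> R x y \<in> word_span B" if xy: "x \<in> {s c | c. set c \<subseteq> B}" "y \<in> {s c | c. set c \<subseteq> B}" for x y
    proof -
      obtain v w where "x = s v" "set v \<subseteq> B" "y = s w" "set w \<subseteq> B" using xy by blast
      then show ?thesis using word_mul_in_span by metis
    qed
    note words = this[unfolded word_span_def]
    note xy = that[unfolded word_span_def]
    show "L x y \<in> word_span B" "R x y \<in> word_span B"
      using span_bilinear_closed[OF word_set_subset left_bilinear conjunct1[OF words] xy]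
        span_bilinear_closed[OF word_set_subset right_bilinear conjunct2[OF words] xy]
      by (auto simp only: word_span_def)
  qed
  moreover have "B \<subseteq> word_span B"
  proof
    fix b assume b: "b \<in> B" then show "b \<in> word_span B" using word_in_span[of "[b]"] B by (auto simp: aug_s_def)
  qed
  moreover have "u \<in> word_span B" using word_in_span[of "[]"] by simp
  ultimately show ?thesis
    using assms word_span_submodule ops unfolding aug_generated_def
    by (elim conjE allE[of _ "word_span B"] impE) auto
qed

end

section \<open>Naturality of words and braces\<close>

lemma aug_homs_word:
  assumes A': "augmented K W' A'" and f: "f \<in> aug_homs K W A W' A'" and "set c \<subseteq> carrier W"
  shows "f (s c) = aug_s A' (map f c)"
  using assms(3) by (induction c rule: rev_induct) (simp_all add: aug_homs_simps[OF f])

end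

lemma aug_homs_n:
  assumes "augmented K W A" "augmented K W' A'" and f: "f \<in> aug_homs K W A W' A'" and "set c \<subseteq> carrier W"
  shows "f (aug_n W A c) = aug_n W' A' (map f c)"
proof -
  interpret A: augmented K W A by fact
  interpret A': augmented K W' A' by fact
  show ?thesis
    using assms(4)
    by (induction c) (simp_all add: aug_homs_simps[OF f] A.lin_neg[OF A'.vspace_axioms aug_homs_lin[OF f]])
qed

lemma aug_homs_brace:
  assumes A: "augmented K W A" and A': "augmented K W' A'" and f: "f \<in> aug_homs K W A W' A'"
    and xc: "x \<in> carrier W" "set c \<subseteq> carrier W"
  shows "f (aug_brace W A x c) = aug_brace W' A' (f x) (map f c)"
proof -
  interpret A: augmented K W A by fact
  interpret A': augmented K W' A' by fact
  have "f (aug_brace W A x c) = split_sum W' (\<lambda>v w. f (aright A (aug_n W A v) (aleft A x (aug_s A w)))) c"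
    unfolding aug_brace_def using xc by (intro A.split_sum_lin[OF aug_homs_lin[OF f]]) auto
  also have "\<dots> = split_sum W' (\<lambda>v w. aright A' (aug_n W' A' (map f v)) (aleft A' (f x) (aug_s A' (map f w)))) c"
    using xc by (intro split_sum_cong)
      (auto simp: aug_homs_simps[OF f] A.aug_homs_word[OF A' f] aug_homs_n[OF A A' f])
  also have "\<dots> = aug_brace W' A' (f x) (map f c)"
    unfolding aug_brace_def split_sum_map ..
  finally show ?thesis .
qed

subsection \<open>Braces in a tensor square\<close>

context augmented begin

interpretation S: two_augs K W A W A by (intro two_augs.intro augmented_axioms)

definition hat :: "'a \<Rightarrow> ('k, 'a, 'a) tensor"
  where "hat x = pure_tensor K W W x u \<oplus>\<^bsub>tensor K W W\<^esub> pure_tensor K W W u x"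

lemma hat_closed [simp]: "x \<in> carrier W \<Longrightarrow> hat x \<in> carrier S.T"
  by (simp add: hat_def)

lemma hat_lin: "hat \<in> lin_maps K W S.T"
  by (intro lin_mapsI) (simp_all add: hat_def S.T.a_ac S.T.smult_r_distr)

lemma map_hat_closed [simp]: "set c \<subseteq> carrier W \<Longrightarrow> set (map hat c) \<subseteq> carrier S.T"
  by auto

text \<open>Right multiplication by z \<otimes> 1 + 1 \<otimes> z appends z to the second factor.
  The first factor receives z only where the second factor is empty, through the correction term of
  the tensor product.\<close>

lemma word_hat:
  assumes "set c \<subseteq> pos_set"
  shows "aug_s S.TA (map hat c) = split_sum S.T (\<lambda>v w. S.pure (s v) (s w)) c"
  using assms
proof (induction c rule: rev_induct)
  case (snoc z c)
  have z: "z \<in> carrier W" "\<epsilon> z = \<zero>" "set c \<subseteq> carrier W" using snoc.prems by auto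
  have "aug_s S.TA (map hat (c @ [z])) = aright S.TA (split_sum S.T (\<lambda>v w. S.pure (s v) (s w)) c) (hat z)"
    using snoc by simp
  also have "\<dots> = split_sum S.T (\<lambda>v w. aright S.TA (S.pure (s v) (s w)) (hat z)) c"
    using z by (intro S.T.split_sum_lin[OF bilinear_left[OF S.TA.right_bilinear]]) auto
  also have "\<dots> = split_sum S.T (\<lambda>v w. S.pure (s v) (s (w @ [z])) \<oplus>\<^bsub>S.T\<^esub> (if w = [] then S.pure (s (v @ [z])) u else \<zero>\<^bsub>S.T\<^esub>)) c"
    using z by (intro split_sum_cong) (auto simp: hat_def S.TA_simps S.T.a_comm)
  also have "\<dots> = split_sum S.T (\<lambda>v w. S.pure (s v) (s (w @ [z]))) c \<oplus>\<^bsub>S.T\<^esub>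
      split_sum S.T (\<lambda>v w. if w = [] then S.pure (s (v @ [z])) u else \<zero>\<^bsub>S.T\<^esub>) c"
    using z by (intro S.T.split_sum_add) auto
  also have "split_sum S.T (\<lambda>v w. if w = [] then S.pure (s (v @ [z])) u else \<zero>\<^bsub>S.T\<^esub>) c = S.pure (s (c @ [z])) u"
    using z by (subst S.T.split_sum_last) auto
  also have "split_sum S.T (\<lambda>v w. S.pure (s v) (s (w @ [z]))) c \<oplus>\<^bsub>S.T\<^esub> S.pure (s (c @ [z])) u =
      split_sum S.T (\<lambda>v w. S.pure (s v) (s w)) (c @ [z])"
  proof (subst S.T.split_sum_snoc)
    fix v w assume "c @ [z] = v @ w"
    then have "set v \<union> set w = set (c @ [z])" by (metis set_append)
    also have "\<dots> \<subseteq> carrier W" using z by simp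
    finally show "S.pure (s v) (s w) \<in> carrier S.T" by simp
  qed simp
  finally show ?case .
qed simp

text \<open>The factors come out in the opposite order to \<open>word_hat\<close>: 1 \<otimes> a
  prepends a in the second factor, while a \<otimes> 1 contributes only if the second factor is
  empty. This reversal is what places \<open>n\<close> next to \<open>s\<close> in
  \<open>brace_hat\<close>.\<close>

lemma n_hat:
  assumes "set c \<subseteq> pos_set"
  shows "aug_n S.T S.TA (map hat c) = split_sum S.T (\<lambda>v w. S.pure (n w) (n v)) c"
  using assms
proof (induction c)
  case (Cons a c)
  have a: "a \<in> carrier W" "\<epsilon> a = \<zero>" "set c \<subseteq> carrier W" using Cons.prems by auto
  have neg: "(\<lambda>X. \<ominus>\<^bsub>S.T\<^esub> aleft S.TA (hat a) X) \<in> lin_maps K S.T S.T"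
    using a by (intro lin_mapsI) (simp_all add: S.T.minus_add S.T.smult_r_minus S.T.a_comm)
  have "aug_n S.T S.TA (map hat (a # c)) = split_sum S.T (\<lambda>v w. \<ominus>\<^bsub>S.T\<^esub> aleft S.TA (hat a) (S.pure (n w) (n v))) c"
    using Cons a by (subst S.T.split_sum_lin[OF neg, symmetric]) auto
  also have "\<dots> = split_sum S.T (\<lambda>v w. (if v = [] then S.pure (n (a # w)) u else \<zero>\<^bsub>S.T\<^esub>) \<oplus>\<^bsub>S.T\<^esub> S.pure (n w) (n (a # v))) c"
    using a by (intro split_sum_cong)
      (auto simp: hat_def S.TA_simps S.T.minus_add S.T.a_comm
        bilinear_neg[OF S.bilinear_pure vspace_axioms vspace_axioms S.T.vspace_axioms])
  also have "\<dots> = split_sum S.T (\<lambda>v w. if v = [] then S.pure (n (a # w)) u else \<zero>\<^bsub>S.T\<^esub>) c \<oplus>\<^bsub>S.T\<^esub>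
      split_sum S.T (\<lambda>v w. S.pure (n w) (n (a # v))) c"
    using a by (intro S.T.split_sum_add) auto
  also have "split_sum S.T (\<lambda>v w. if v = [] then S.pure (n (a # w)) u else \<zero>\<^bsub>S.T\<^esub>) c = S.pure (n (a # c)) u"
    using a by (subst S.T.split_sum_first) auto
  finally show ?case by simp
qed simp

text \<open>In the double expansion the two middle factors convolve to the unit, which leaves
  \<open>1 \<otimes> {x | c}\<close>; hence braces of primitive elements are primitive.\<close>

lemma brace_hat:
  assumes x: "x \<in> carrier W" "\<epsilon> x = \<zero>" and c: "set c \<subseteq> pos_set"
  shows "aug_brace S.T S.TA (hat x) (map hat c) = hat (aug_brace W A x c)"
proof -
  let ?\<beta> = "aug_brace W A x"
  have car: "set v \<subseteq> carrier W \<and> set w \<subseteq> carrier W \<and> set v \<subseteq> pos_set \<and> set w \<subseteq> pos_set" if "c = v @ w" for v w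
    using c that by auto
  have cc: "set c \<subseteq> carrier W" using c by auto
  let ?f = "\<lambda>v1 v2 w1 w2. S.pure (M (n v2) (s w1)) (R (n v1) (L x (s w2)))"
  let ?g = "\<lambda>v w. S.pure (R (n v) (L x (s w))) u"
  \<comment> \<open>The term x \<otimes> 1 survives only against 1 in the second factor, that is for
    an empty second part of the word.\<close>
  have left: "aleft S.TA (hat x) (aug_s S.TA (map hat w)) =
    split_sum S.T (\<lambda>w1 w2. S.pure (s w1) (L x (s w2))) w \<oplus>\<^bsub>S.T\<^esub> S.pure (L x (s w)) u"
    if w: "set w \<subseteq> pos_set" for w
  proof -
    have w': "set w \<subseteq> carrier W" using w by auto
    have "aleft S.TA (hat x) (aug_s S.TA (map hat w)) = split_sum S.T (\<lambda>w1 w2. aleft S.TA (hat x) (S.pure (s w1) (s w2))) w"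
      unfolding word_hat[OF w] using w' x by (intro S.T.split_sum_lin[OF bilinear_right[OF S.TA.left_bilinear]]) auto
    also have "\<dots> = split_sum S.T (\<lambda>w1 w2. S.pure (s w1) (L x (s w2)) \<oplus>\<^bsub>S.T\<^esub> (if w2 = [] then S.pure (L x (s w1)) u else \<zero>\<^bsub>S.T\<^esub>)) w"
      using w' x by (intro split_sum_cong) (auto simp: hat_def S.TA_simps S.T.a_comm)
    also have "\<dots> = split_sum S.T (\<lambda>w1 w2. S.pure (s w1) (L x (s w2))) w \<oplus>\<^bsub>S.T\<^esub>
      split_sum S.T (\<lambda>w1 w2. if w2 = [] then S.pure (L x (s w1)) u else \<zero>\<^bsub>S.T\<^esub>) w"
      using w' x by (intro S.T.split_sum_add) auto
    also have "split_sum S.T (\<lambda>w1 w2. if w2 = [] then S.pure (L x (s w1)) u else \<zero>\<^bsub>S.T\<^esub>) w = S.pure (L x (s w)) u"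
      using w' x by (subst S.T.split_sum_last) auto
    finally show ?thesis .
  qed
  \<comment> \<open>Since \<open>n\<close> reverses the factors, the later part \<open>v2\<close> of
    the left word meets \<open>w1\<close>, the adjacent part of the right word.\<close>
  have right1: "aright S.TA (aug_n S.T S.TA (map hat v)) (S.pure (s w1) (L x (s w2))) = split_sum S.T (\<lambda>v1 v2. ?f v1 v2 w1 w2) v"
    if v: "set v \<subseteq> pos_set" and w: "set w1 \<subseteq> carrier W" "set w2 \<subseteq> carrier W" for v w1 w2
    using v w x unfolding n_hat[OF v]
    by (subst S.T.split_sum_lin[OF bilinear_left[OF S.TA.right_bilinear]])
      (auto intro!: split_sum_cong simp: S.TA_simps dest!: pos_setD)
  have right2: "aright S.TA (aug_n S.T S.TA (map hat v)) (S.pure y u) = S.pure (R (n v) y) u"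
    if v: "set v \<subseteq> pos_set" and y: "y \<in> carrier W" "\<epsilon> y = \<zero>" for v y
  proof -
    have v': "set v \<subseteq> carrier W" using v by auto
    have "aright S.TA (aug_n S.T S.TA (map hat v)) (S.pure y u) =
      split_sum S.T (\<lambda>v1 v2. if v1 = [] then S.pure (R (n v2) y) u else \<zero>\<^bsub>S.T\<^esub>) v"
      using v' y unfolding n_hat[OF v]
      by (subst S.T.split_sum_lin[OF bilinear_left[OF S.TA.right_bilinear]])
        (auto intro!: split_sum_cong simp: S.TA_simps)
    also have "\<dots> = S.pure (R (n v) y) u" using v' y by (subst S.T.split_sum_first) auto
    finally show ?thesis .
  qed
  have "aug_brace S.T S.TA (hat x) (map hat c) =
    split_sum S.T (\<lambda>v w. aright S.TA (aug_n S.T S.TA (map hat v)) (aleft S.TA (hat x) (aug_s S.TA (map hat w)))) c"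
    unfolding aug_brace_def split_sum_map ..
  also have "\<dots> = split_sum S.T (\<lambda>v w. split_sum S.T (\<lambda>w1 w2. split_sum S.T (\<lambda>v1 v2. ?f v1 v2 w1 w2) v) w \<oplus>\<^bsub>S.T\<^esub> ?g v w) c"
  proof (rule split_sum_cong)
    fix v w assume vw: "c = v @ w"
    note k = car[OF vw]
    have nv: "aug_n S.T S.TA (map hat v) \<in> carrier S.T" using k by (intro S.TA.n_closed map_hat_closed) auto
    have "aright S.TA (aug_n S.T S.TA (map hat v)) (aleft S.TA (hat x) (aug_s S.TA (map hat w))) =
      aright S.TA (aug_n S.T S.TA (map hat v)) (split_sum S.T (\<lambda>w1 w2. S.pure (s w1) (L x (s w2))) w) \<oplus>\<^bsub>S.T\<^esub> ?g v w"
    proof -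
      have "split_sum S.T (\<lambda>w1 w2. S.pure (s w1) (L x (s w2))) w \<in> carrier S.T"
        using k x by (intro S.T.split_sum_closed) auto
      then show ?thesis using k nv x by (simp add: left right2)
    qed
    also have "aright S.TA (aug_n S.T S.TA (map hat v)) (split_sum S.T (\<lambda>w1 w2. S.pure (s w1) (L x (s w2))) w) =
      split_sum S.T (\<lambda>w1 w2. aright S.TA (aug_n S.T S.TA (map hat v)) (S.pure (s w1) (L x (s w2)))) w"
      using k nv x by (intro S.T.split_sum_lin[OF bilinear_right[OF S.TA.right_bilinear]]) auto
    also have "\<dots> = split_sum S.T (\<lambda>w1 w2. split_sum S.T (\<lambda>v1 v2. ?f v1 v2 w1 w2) v) w"
      using k x by (intro split_sum_cong right1) auto
    finally show "aright S.TA (aug_n S.T S.TA (map hat v)) (aleft S.TA (hat x) (aug_s S.TA (map hat w))) =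
      split_sum S.T (\<lambda>w1 w2. split_sum S.T (\<lambda>v1 v2. ?f v1 v2 w1 w2) v) w \<oplus>\<^bsub>S.T\<^esub> ?g v w" .
  qed
  also have "\<dots> = split_sum S.T (\<lambda>v w. split_sum S.T (\<lambda>w1 w2. split_sum S.T (\<lambda>v1 v2. ?f v1 v2 w1 w2) v) w) c \<oplus>\<^bsub>S.T\<^esub>
      split_sum S.T ?g c"
    using cc x by (intro S.T.split_sum_add) (auto intro!: S.T.split_sum_closed)
  also have "split_sum S.T ?g c = S.pure (?\<beta> c) u"
    unfolding aug_brace_def using cc x by (intro split_sum_lin[OF bilinear_left[OF S.bilinear_pure], symmetric]) auto
  \<comment> \<open>The word is now cut into v1 v2 w1 w2. One exchange and two reassociations bring
    the sum over the middle block v2 w1 innermost.\<close>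
  also have "split_sum S.T (\<lambda>v w. split_sum S.T (\<lambda>w1 w2. split_sum S.T (\<lambda>v1 v2. ?f v1 v2 w1 w2) v) w) c =
    split_sum S.T (\<lambda>v w. split_sum S.T (\<lambda>v1 v2. split_sum S.T (\<lambda>w1 w2. ?f v1 v2 w1 w2) w) v) c"
    using cc x by (intro split_sum_cong S.T.split_sum_swap) auto
  also have "\<dots> = split_sum S.T (\<lambda>v1 y. split_sum S.T (\<lambda>v2 w. split_sum S.T (\<lambda>w1 w2. ?f v1 v2 w1 w2) w) y) c"
    using cc x by (intro S.T.split_sum_assoc) (auto intro!: S.T.split_sum_closed)
  also have "\<dots> = split_sum S.T (\<lambda>v1 y. split_sum S.T (\<lambda>m w2. split_sum S.T (\<lambda>v2 w1. ?f v1 v2 w1 w2) m) y) c"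
    using cc x by (intro split_sum_cong S.T.split_sum_assoc[symmetric]) auto
  \<comment> \<open>By \<open>n_conv_s\<close> only an empty middle block remains.\<close>
  also have "\<dots> = split_sum S.T (\<lambda>v1 y. S.pure u (R (n v1) (L x (s y)))) c"
  proof (rule split_sum_cong)
    fix v1 y assume vy: "c = v1 @ y"
    note k = car[OF vy]
    have "split_sum S.T (\<lambda>m w2. split_sum S.T (\<lambda>v2 w1. ?f v1 v2 w1 w2) m) y =
      split_sum S.T (\<lambda>m w2. S.pure (if m = [] then u else \<zero>\<^bsub>W\<^esub>) (R (n v1) (L x (s w2)))) y"
    proof (rule split_sum_cong)
      fix m w2 assume "y = m @ w2"
      then have m: "set m \<subseteq> pos_set" "set m \<subseteq> carrier W" "set w2 \<subseteq> carrier W" using k by auto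
      show "split_sum S.T (\<lambda>v2 w1. ?f v1 v2 w1 w2) m = S.pure (if m = [] then u else \<zero>\<^bsub>W\<^esub>) (R (n v1) (L x (s w2)))"
        unfolding n_conv_s[OF m(1), symmetric] using m(2,3) k x
        by (intro split_sum_lin[OF bilinear_left[OF S.bilinear_pure], symmetric]) auto
    qed
    also have "\<dots> = S.pure u (R (n v1) (L x (s y)))"
      using k x by (subst S.T.split_sum_first) auto
    finally show "split_sum S.T (\<lambda>m w2. split_sum S.T (\<lambda>v2 w1. ?f v1 v2 w1 w2) m) y = S.pure u (R (n v1) (L x (s y)))" .
  qed
  also have "\<dots> = S.pure u (?\<beta> c)"
    unfolding aug_brace_def using cc x by (intro split_sum_lin[OF bilinear_right[OF S.bilinear_pure], symmetric]) auto
  finally show ?thesis using cc x by (simp add: hat_def[of "aug_brace W A x c"] S.T.a_comm)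
qed

end


subsection \<open>Braces of a dendriform algebra\<close>

context dend_space begin

lemma nearrow_closed: "\<lbrakk>c \<noteq> []; set c \<subseteq> carrier E\<rbrakk> \<Longrightarrow> nearrow E c \<in> carrier E"
  by (induction c rule: induct_list012) auto

lemma foldl_succ_closed: "\<lbrakk>x \<in> carrier E; set c \<subseteq> carrier E\<rbrakk> \<Longrightarrow> foldl (succ E) x c \<in> carrier E"
  by (induction c arbitrary: x) auto

lemma searrow_closed: "\<lbrakk>c \<noteq> []; set c \<subseteq> carrier E\<rbrakk> \<Longrightarrow> searrow E c \<in> carrier E"
  by (cases c) (auto simp: searrow_def foldl_succ_closed)

lemma brace_term_closed: "\<lbrakk>x \<in> carrier E; set v \<subseteq> carrier E; set w \<subseteq> carrier E\<rbrakk> \<Longrightarrow> brace_term E x v w \<in> carrier E"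
  by (simp add: brace_term_def Let_def nearrow_closed searrow_closed)

definition signed_brace_term :: "'e \<Rightarrow> 'e list \<Rightarrow> 'e list \<Rightarrow> 'e"
  where "signed_brace_term x v w = (if even (length v) then brace_term E x v w else \<ominus>\<^bsub>E\<^esub> brace_term E x v w)"

lemma dend_brace_split_sum:
  assumes "x \<in> carrier E" "set c \<subseteq> carrier E"
  shows "dend_brace E x c = split_sum E (signed_brace_term x) c"
proof -
  have t: "signed_brace_term x v w \<in> carrier E" if "c = v @ w" for v w
    using assms that by (simp add: signed_brace_term_def brace_term_closed)
  have "split_sum E (signed_brace_term x) c = (\<Oplus>\<^bsub>E\<^esub>i\<in>{..length c}. signed_brace_term x (take i c) (drop i c))"
    by (rule split_sum_finsum) (rule t)
  also have "\<dots> = dend_brace E x c"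
    unfolding dend_brace_def
  proof (rule finsum_cong')
    show "(\<lambda>i. if even i then brace_term E x (take i c) (drop i c) else \<ominus>\<^bsub>E\<^esub> brace_term E x (take i c) (drop i c))
        \<in> {..length c} \<rightarrow> carrier E"
    proof (rule Pi_I)
      fix i assume "i \<in> {..length c}"
      moreover have "signed_brace_term x (take i c) (drop i c) \<in> carrier E" by (rule t) simp
      ultimately show "(if even i then brace_term E x (take i c) (drop i c) else \<ominus>\<^bsub>E\<^esub> brace_term E x (take i c) (drop i c)) \<in> carrier E"
        by (simp add: signed_brace_term_def min_absorb2)
    qed
  qed (simp_all add: signed_brace_term_def min_absorb2)
  finally show ?thesis ..
qed

lemma dend_brace_closed: "\<lbrakk>x \<in> carrier E; set c \<subseteq> carrier E\<rbrakk> \<Longrightarrow> dend_brace E x c \<in> carrier E"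
  unfolding dend_brace_split_sum by (rule split_sum_closed) (simp add: signed_brace_term_def brace_term_closed)

text \<open>Translates the concrete brace, with its signs and its special end terms, into the
  uniform \<open>aug_brace\<close> of the target. Interior terms need \<open>right_left\<close>,
  because the concrete term is bracketed to the left.\<close>

lemma pos_maps_dend_brace:
  assumes A: "augmented K W A" and h: "h \<in> pos_maps K E W A" and x: "x \<in> carrier E" and c: "set c \<subseteq> carrier E"
  shows "h (dend_brace E x c) = aug_brace W A (h x) (map h c)"
proof -
  interpret A: augmented K W A by fact
  note l = lin_closed[OF pos_maps_lin[OF h]] and hs = pos_maps_simps[OF h]
  \<comment> \<open>\<open>aug_n\<close> carries one minus sign per letter, hence the parity of the
    length.\<close>
  have n: "aug_n W A (map h v) = (if even (length v) then h (nearrow E v) else \<ominus>\<^bsub>W\<^esub> h (nearrow E v))"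
    if "v \<noteq> []" "set v \<subseteq> carrier E" for v
    using that
  proof (induction v rule: induct_list012)
    case (3 x y v)
    have "nearrow E (y # v) \<in> carrier E" using 3 by (intro nearrow_closed) auto
    then show ?case using 3 by (auto simp: l hs A.left_neg)
  qed (simp_all add: l hs)
  have s: "aug_s A (map h w) = h (searrow E w)" if "w \<noteq> []" "set w \<subseteq> carrier E" for w
  proof -
    have f: "foldl (aright A) (h y) (map h d) = h (foldl (succ E) y d)" if "y \<in> carrier E" "set d \<subseteq> carrier E" for y d
      using that by (induction d arbitrary: y) (simp_all add: hs(3)[symmetric])
    show ?thesis using that by (cases w) (simp_all add: aug_s_def searrow_def l hs f)
  qed
  have t: "h (signed_brace_term x v w) = aright A (aug_n W A (map h v)) (aleft A (h x) (aug_s A (map h w)))"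
    if vw: "set v \<subseteq> carrier E" "set w \<subseteq> carrier E" for v w
  proof -
    define y where "y = (if w = [] then x else x \<prec>\<^bsub>E\<^esub> searrow E w)"
    have y: "y \<in> carrier E" "h y = aleft A (h x) (aug_s A (map h w))"
      using x vw s[of w] by (simp_all add: y_def searrow_closed hs l)
    show ?thesis
    proof (cases "v = []")
      case True
      then have "signed_brace_term x v w = y" by (simp add: signed_brace_term_def brace_term_def y_def)
      then show ?thesis
        unfolding y(2)[symmetric] using True l[OF y(1)] hs(1)[OF y(1)] by simp
    next
      case False
      have nc: "nearrow E v \<in> carrier E" using nearrow_closed False vw by blast
      have b: "h (brace_term E x v w) = aright A (h (nearrow E v)) (h y)"
        using False nc x vw by (simp add: brace_term_def Let_def y_def hs l searrow_closed A.right_left)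
      have bc: "brace_term E x v w \<in> carrier E" using brace_term_closed x vw by blast
      show ?thesis
        unfolding y(2)[symmetric] n[OF False vw(1)]
        using b bc l[OF nc] l[OF y(1)] lin_neg[OF A.vspace_axioms pos_maps_lin[OF h] bc]
        by (simp add: signed_brace_term_def A.right_neg)
    qed
  qed
  have "h (dend_brace E x c) = split_sum W (\<lambda>v w. h (signed_brace_term x v w)) c"
    unfolding dend_brace_split_sum[OF x c] using x c
    by (intro split_sum_lin[OF pos_maps_lin[OF h]]) (simp add: signed_brace_term_def brace_term_closed)
  also have "\<dots> = aug_brace W A (h x) (map h c)"
    unfolding aug_brace_def split_sum_map using c by (intro split_sum_cong t) auto
  finally show ?thesis .
qed

end

subsection \<open>The enveloping algebra\<close>

lemma aug_homs_cong:
  assumes f: "f \<in> aug_homs K W A W' A'" and eq: "\<And>x. x \<in> carrier W \<Longrightarrow> g x = f x" and A: "augmented K W A"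
  shows "g \<in> aug_homs K W A W' A'"
proof -
  interpret A: augmented K W A by fact
  show ?thesis
    by (intro aug_homsI lin_cong[OF aug_homs_lin[OF f] eq A.vspace_axioms])
      (simp_all add: eq aug_homs_simps[OF f])
qed

lemma aug_generated_bialgebra_unique:
  fixes W :: "('k, 'a) udend"
  assumes W: "unital_dendriform_algebra K W"
    and D: "dendriform_bialgebra K (with_comult W \<Delta>)" "dendriform_bialgebra K (with_comult W \<Delta>')"
    and gen: "aug_generated K W (aug_of K W) S" "\<And>s. s \<in> S \<Longrightarrow> \<Delta> s = \<Delta>' s" and x: "x \<in> carrier W"
  shows "\<Delta> x = \<Delta>' x"
proof -
  interpret W: unital_dendriform_algebra K W by fact
  have "\<Delta>1 \<in> aug_homs K W (aug_of K W) (tensor K W W) (tensor_aug K W (aug_of K W) W (aug_of K W))"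
    if "dendriform_bialgebra K (with_comult W \<Delta>1)" for \<Delta>1
    using that W by (subst (asm) dendriform_bialgebra_iff) (simp_all add: with_comult_unital)
  from aug_homs_eqI[OF W.vspace_axioms vspace_tensor[OF W.vspace_axioms W.vspace_axioms] this[OF D(1)] this[OF D(2)] gen x
      W.augmented_aug_of]
  show ?thesis .
qed

locale enveloping = free_dendriform K B for K (structure) and B :: "('k, 'b, 'm) brace_alg_scheme" +
  assumes brace_in: "\<lbrakk>x \<in> carrier B; ys \<noteq> []; set ys \<subseteq> carrier B\<rbrakk> \<Longrightarrow> brace B x ys \<in> carrier B"
begin

abbreviation "U0 \<equiv> unitization K FD"
abbreviation "U \<equiv> unitization K (env K B)"
abbreviation "UA \<equiv> aug_of K U"
abbreviation "gU \<equiv> env_gen K B"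
abbreviation "UU \<equiv> tensor K U U"
abbreviation "UUA \<equiv> tensor_aug K U UA U UA"

lemma gen_closed: "v \<in> carrier B \<Longrightarrow> gen v \<in> carrier FD"
  by (rule lin_closed[OF gen_lin])

lemma gens_closed: "set ys \<subseteq> carrier B \<Longrightarrow> set (map gen ys) \<subseteq> carrier FD"
  using gen_closed by auto

lemma env_rels_subset: "env_rels K B \<subseteq> carrier FD"
proof
  fix z assume "z \<in> env_rels K B"
  then obtain x ys where "z = dend_brace FD (gen x) (map gen ys) \<ominus>\<^bsub>FD\<^esub> gen (brace B x ys)"
    "x \<in> carrier B" "ys \<noteq> []" "set ys \<subseteq> carrier B" unfolding env_rels_def Let_def by blast
  then show "z \<in> carrier FD"
    using FD.dend_brace_closed gen_closed gens_closed brace_in by (simp del: set_map)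
qed

sublocale E: dend_quotient K FD "env_null K B"
  unfolding env_null_def
  by (intro dend_quotient.intro dend_quotient_axioms.intro FD.dend_space_axioms FD.hull_ideal env_rels_subset)

lemma env_eq: "env K B = E.QD"
  by (simp add: env_def)

lemma env_proj_eq: "env_proj K B = E.Q.proj"
  by (simp add: env_proj_def fun_eq_iff)

sublocale FU: dendriform_algebra K FD
  by (rule FD_dendriform)

sublocale EU: dendriform_algebra K "env K B"
  unfolding env_eq by (rule E.dendriform_QD[OF FD_dendriform])

sublocale UU: unital_dendriform_algebra K U
  by (rule EU.unital_unitization)

sublocale UT: two_augs K U UA U UA
  by (intro two_augs.intro UU.augmented_aug_of)

lemma proj_pos_map: "(\<lambda>x. (\<zero>, env_proj K B x)) \<in> pos_maps K FD U UA"
  unfolding env_proj_eq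
proof (intro pos_mapsI)
  show "(\<lambda>x. (\<zero>, E.Q.proj x)) \<in> lin_maps K FD U"
    using lin_comp[OF E.proj_lin_QD[folded env_eq] pos_maps_lin[OF EU.unitization_incl]] .
qed (simp_all add: env_eq E.Q.proj_in_Q EU.unitization_proj[unfolded env_eq] EU.unitization_aug[unfolded env_eq] E.Q.smult_Q E.Q.add_Q)

lemma gU_lin: "gU \<in> lin_maps K B U"
  using lin_comp[OF gen_lin pos_maps_lin[OF proj_pos_map]] by (simp add: env_gen_def[abs_def])

lemma gU_closed [simp]: "b \<in> carrier B \<Longrightarrow> gU b \<in> carrier U"
  by (rule lin_closed[OF gU_lin])

lemma gU_eps [simp]: "b \<in> carrier B \<Longrightarrow> aeps UA (gU b) = \<zero>"
  unfolding env_gen_def using pos_maps_simps(1)[OF proj_pos_map gen_closed] .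

lemma gU_pos: "b \<in> carrier B \<Longrightarrow> gU b \<in> pos U"
  using UU.posI[of "gU b"] gU_closed[of b] gU_eps[of b] by (simp del: unitization_simps)

lemma env_null_kernel:
  assumes A: "augmented K W A" and h: "h \<in> pos_maps K FD W A"
    and br: "\<And>x ys. \<lbrakk>x \<in> carrier B; ys \<noteq> []; set ys \<subseteq> carrier B\<rbrakk> \<Longrightarrow>
      h (gen (brace B x ys)) = aug_brace W A (h (gen x)) (map (\<lambda>b. h (gen b)) ys)"
    and z: "z \<in> env_null K B"
  shows "h z = \<zero>\<^bsub>W\<^esub>"
proof -
  interpret A: augmented K W A by fact
  have "env_rels K B \<subseteq> {x \<in> carrier FD. h x = \<zero>\<^bsub>W\<^esub>}"
  proof
    fix z assume "z \<in> env_rels K B"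
    then obtain x ys where z: "z = dend_brace FD (gen x) (map gen ys) \<ominus>\<^bsub>FD\<^esub> gen (brace B x ys)"
      "x \<in> carrier B" "ys \<noteq> []" "set ys \<subseteq> carrier B" unfolding env_rels_def Let_def by blast
    have c: "dend_brace FD (gen x) (map gen ys) \<in> carrier FD" "gen (brace B x ys) \<in> carrier FD"
      using FD.dend_brace_closed[OF gen_closed[OF z(2)] gens_closed[OF z(4)]] gen_closed[OF brace_in[OF z(2-4)]] by auto
    have "h (dend_brace FD (gen x) (map gen ys)) = h (gen (brace B x ys))"
      using FD.pos_maps_dend_brace[OF A h gen_closed[OF z(2)] gens_closed[OF z(4)]] br[OF z(2-4)]
      by (simp add: comp_def)
    then show "z \<in> {x \<in> carrier FD. h x = \<zero>\<^bsub>W\<^esub>}"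
      using c FD.lin_minus[OF A.vspace_axioms pos_maps_lin[OF h] c] lin_closed[OF pos_maps_lin[OF h] c(2)]
      by (simp add: z(1) A.minus_eq_zero_iff)
  qed
  then have "env_null K B \<subseteq> {x \<in> carrier FD. h x = \<zero>\<^bsub>W\<^esub>}"
    unfolding env_null_def by (rule hull_minimal) (rule FD.kernel_ideal[OF A h])
  then show ?thesis using z by blast
qed

lemma gU_brace:
  assumes "x \<in> carrier B" "ys \<noteq> []" "set ys \<subseteq> carrier B"
  shows "aug_brace U UA (gU x) (map gU ys) = gU (brace B x ys)"
proof -
  let ?d = "dend_brace FD (gen x) (map gen ys)"
  have d: "?d \<in> carrier FD" "gen (brace B x ys) \<in> carrier FD"
    using FD.dend_brace_closed gen_closed gens_closed brace_in assms by (simp_all del: set_map)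
  have "?d \<ominus>\<^bsub>FD\<^esub> gen (brace B x ys) \<in> env_null K B"
    unfolding env_null_def by (rule hull_inc) (use assms in \<open>auto simp: env_rels_def Let_def\<close>)
  then have "env_proj K B ?d = env_proj K B (gen (brace B x ys))"
    using E.Q.coset_eq_iff[OF d] by (simp add: env_proj_eq)
  moreover have "(\<zero>, env_proj K B ?d) = aug_brace U UA (gU x) (map gU ys)"
    using FD.pos_maps_dend_brace[OF UU.augmented_aug_of proj_pos_map gen_closed[OF assms(1)] gens_closed[OF assms(3)]]
    by (simp add: env_gen_def[abs_def] comp_def)
  ultimately show ?thesis by (simp add: env_gen_def)
qed

lemma U_generated: "aug_generated K U UA (gU ` carrier B)"
proof -
  have "gU ` carrier B = Pair \<zero> ` (E.Q.proj ` (gen ` carrier B))"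
    by (simp add: env_gen_def[abs_def] env_proj_eq image_image)
  then show ?thesis
    using EU.unitization_generated[unfolded env_eq, OF E.QD_generated[OF FD_generated]] by (simp add: env_eq)
qed

text \<open>The adjunction in augmented form. The map is extended to D(B) first; compatibility with
  braces says precisely that the extension kills the relations of U(B).\<close>

lemma U_lift:
  assumes A: "augmented K W A" and g: "g \<in> lin_maps K B W" and g0: "\<And>b. b \<in> carrier B \<Longrightarrow> aeps A (g b) = \<zero>"
    and br: "\<And>x ys. \<lbrakk>x \<in> carrier B; ys \<noteq> []; set ys \<subseteq> carrier B\<rbrakk> \<Longrightarrow> g (brace B x ys) = aug_brace W A (g x) (map g ys)"
  shows "\<exists>f \<in> aug_homs K U UA W A. \<forall>b\<in>carrier B. f (gU b) = g b"
proof -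
  interpret A: augmented K W A by fact
  obtain h where h: "h \<in> pos_maps K FD W A" and hg: "\<forall>v\<in>carrier B. h (gen v) = g v"
    using FD_lift[OF A g g0] by blast
  have "h z = \<zero>\<^bsub>W\<^esub>" if "z \<in> env_null K B" for z
  proof (rule env_null_kernel[OF A h _ that])
    fix x ys assume xy: "x \<in> carrier B" "ys \<noteq> []" "set ys \<subseteq> carrier B"
    have m: "map (\<lambda>b. h (gen b)) ys = map g ys" using xy(3) hg by (intro map_cong) auto
    show "h (gen (brace B x ys)) = aug_brace W A (h (gen x)) (map (\<lambda>b. h (gen b)) ys)"
      unfolding m using hg xy brace_in[OF xy] br[OF xy] by simp
  qed
  then obtain h' where h': "h' \<in> pos_maps K (env K B) W A" and hp: "\<forall>x\<in>carrier FD. h' (E.Q.proj x) = h x"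
    using E.lift_pos_map[OF A h] unfolding env_eq by blast
  let ?f = "\<lambda>(a, x). a \<odot>\<^bsub>W\<^esub> aone A \<oplus>\<^bsub>W\<^esub> h' x"
  have "?f (gU b) = g b" if b: "b \<in> carrier B" for b
    using hp hg gen_closed[OF b] lin_closed[OF g b] b by (simp add: env_gen_def env_proj_eq)
  then show ?thesis using EU.unitization_lift[OF A h'] by (intro bexI[of _ ?f]) auto
qed

lemma U_hom_unique:
  assumes "vspace K W" "f \<in> aug_homs K U UA W A" "g \<in> aug_homs K U UA W A"
    "\<And>b. b \<in> carrier B \<Longrightarrow> f (gU b) = g (gU b)" "x \<in> carrier U"
  shows "f x = g x"
  using assms by (intro aug_homs_eqI[OF UU.vspace_axioms assms(1-3) U_generated _ assms(5) UU.augmented_aug_of]) auto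

subsection \<open>The coproduct of the enveloping algebra\<close>

lemma prim_with_comult:
  "x \<in> prim K (with_comult W \<Delta>) \<longleftrightarrow> x \<in> carrier W \<and>
    \<Delta> x = pure_tensor K W W x \<one>\<^bsub>W\<^esub> \<oplus>\<^bsub>tensor K W W\<^esub> pure_tensor K W W \<one>\<^bsub>W\<^esub> x"
  for W :: "('k, 'w) udend"
  by (simp add: prim_def)

interpretation U0: unital_dendriform_algebra K U0
  by (rule FU.unital_unitization)

interpretation T0: two_augs K U0 "aug_of K U0" U0 "aug_of K U0"
  by (intro two_augs.intro U0.augmented_aug_of)

lemma U0_generated: "aug_generated K U0 (aug_of K U0) ((\<lambda>v. (\<zero>, gen v)) ` carrier B)"
  using FU.unitization_generated[OF FD_generated] by (simp add: image_image)

lemma gen0_lin: "(\<lambda>v. (\<zero>, gen v)) \<in> lin_maps K B U0"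
  by (rule lin_comp[OF gen_lin pos_maps_lin[OF FU.unitization_incl]])

lemma hat_eps: "v \<in> carrier B \<Longrightarrow> aeps T0.TA (T0.A.hat (\<zero>, gen v)) = \<zero>"
  using gen_closed[of v] by (simp add: T0.A.hat_def T0.TA_simps)

text \<open>\<open>free_comult\<close> is a definite description, so its properties follow only
  after existence and uniqueness. Uniqueness holds because the values on the generators are
  prescribed.\<close>

lemma free_comult_props:
  shows "free_comult K B \<in> aug_homs K U0 (aug_of K U0) T0.T T0.TA"
    and "v \<in> carrier B \<Longrightarrow> free_comult K B (\<zero>, gen v) = T0.A.hat (\<zero>, gen v)"
proof -
  let ?S = "(\<lambda>v. (\<zero>, gen v)) ` carrier B"
  let ?P = "\<lambda>\<Delta>. \<Delta> \<in> extensional (carrier U0) \<and> dendriform_bialgebra K (with_comult U0 \<Delta>) \<and>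
    (\<forall>v\<in>carrier B. (\<zero>, gen v) \<in> prim K (with_comult U0 \<Delta>))"
  \<comment> \<open>Existence: the universal property of D(B) with the tensor square as target and v
    -> v \<otimes> 1 + 1 \<otimes> v on generators.\<close>
  obtain h where h: "h \<in> pos_maps K FD T0.T T0.TA" "\<forall>v\<in>carrier B. h (gen v) = T0.A.hat (\<zero>, gen v)"
    using FD_lift[OF T0.TA.augmented_axioms lin_comp[OF gen0_lin T0.A.hat_lin] hat_eps] by blast
  define D where "D = (\<lambda>(a, x). a \<odot>\<^bsub>T0.T\<^esub> aone T0.TA \<oplus>\<^bsub>T0.T\<^esub> h x)"
  have D: "D \<in> aug_homs K U0 (aug_of K U0) T0.T T0.TA"
    unfolding D_def by (rule FU.unitization_lift[OF T0.TA.augmented_axioms h(1)])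
  have Dg: "D (\<zero>, gen v) = T0.A.hat (\<zero>, gen v)" if "v \<in> carrier B" for v
    using h(2) that T0.A.hat_closed[of "(\<zero>, gen v)"] gen_closed[OF that] by (simp add: D_def)
  have S: "?S \<subseteq> pos U0" using gen_closed by auto
  have "dendriform_bialgebra K (with_comult U0 (restrict D (carrier U0)))"
    by (rule dendriform_bialgebra_of_generated[OF FU.unital_unitization D U0_generated S])
      (use Dg in \<open>auto simp: T0.A.hat_def\<close>)
  then have ex: "?P (restrict D (carrier U0))"
    using Dg gen_closed by (auto simp: prim_with_comult T0.A.hat_def)
  have unique: "\<Delta> = \<Delta>'" if "?P \<Delta>" "?P \<Delta>'" for \<Delta> \<Delta>'
  proof (rule extensionalityI)
    show "\<Delta> \<in> extensional (carrier U0)" "\<Delta>' \<in> extensional (carrier U0)" using that by auto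
    have eq: "\<Delta> s = \<Delta>' s" if "s \<in> ?S" for s
      using that \<open>?P \<Delta>\<close> \<open>?P \<Delta>'\<close> by (auto simp: prim_with_comult)
    have D: "dendriform_bialgebra K (with_comult U0 \<Delta>)" "dendriform_bialgebra K (with_comult U0 \<Delta>')"
      using that by auto
    show "\<Delta> x = \<Delta>' x" if x: "x \<in> carrier U0" for x
      by (rule aug_generated_bialgebra_unique[OF FU.unital_unitization D U0_generated eq x])
  qed
  have "free_comult K B = (THE \<Delta>. ?P \<Delta>)" by (simp add: free_comult_def Let_def)
  also have "\<dots> = restrict D (carrier U0)"
    by (rule the_equality[of ?P, OF ex]) (rule unique[OF _ ex])
  finally have fc: "free_comult K B = restrict D (carrier U0)" .
  show "free_comult K B \<in> aug_homs K U0 (aug_of K U0) T0.T T0.TA"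
    by (rule aug_homs_cong[OF D _ U0.augmented_aug_of]) (simp add: fc)
  show "v \<in> carrier B \<Longrightarrow> free_comult K B (\<zero>, gen v) = T0.A.hat (\<zero>, gen v)"
    using gen_closed Dg by (simp add: fc)
qed

abbreviation "\<pi> \<equiv> map_prod (\<lambda>a. a) (env_proj K B)"

lemma \<pi>_hom: "\<pi> \<in> aug_homs K U0 (aug_of K U0) U UA"
  by (rule aug_homs_cong[OF FU.unitization_lift[OF UU.augmented_aug_of proj_pos_map] _ U0.augmented_aug_of])
    (auto simp: env_proj_eq env_eq E.Q.proj_in_Q E.Q.zero_Q E.Q.smult_Q E.Q.add_Q)

lemma \<pi>_surj: "\<pi> ` carrier U0 = carrier U"
  by (auto simp: env_eq env_proj_eq E.Q.carrier_Q)

text \<open>By \<open>brace_hat\<close> the assignment b -> b \<otimes> 1 + 1 \<otimes> b is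
  compatible with braces. So the coproduct comes straight from the universal property of U(B); that
  it is induced from D(B) is verified afterwards.\<close>

lemma comult_exists: "\<exists>\<Delta> \<in> aug_homs K U UA UU UUA. \<forall>b\<in>carrier B. \<Delta> (gU b) = UT.A.hat (gU b)"
proof (rule U_lift[OF UT.TA.augmented_axioms])
  show "(\<lambda>b. UT.A.hat (gU b)) \<in> lin_maps K B UU" by (rule lin_comp[OF gU_lin UT.A.hat_lin])
  show "aeps UUA (UT.A.hat (gU b)) = \<zero>" if "b \<in> carrier B" for b
    using gU_closed[OF that] gU_eps[OF that] UU.one_in_carrier by (simp add: UT.A.hat_def UT.TA_simps del: unitization_simps)
  fix x ys assume xy: "x \<in> carrier B" "ys \<noteq> []" "set ys \<subseteq> carrier B"
  have "set (map gU ys) \<subseteq> {x \<in> carrier U. aeps UA x = \<zero>}"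
    using xy(3) gU_closed gU_eps by (auto simp del: unitization_simps aug_of_simps)
  from UT.A.brace_hat[OF gU_closed[OF xy(1)] gU_eps[OF xy(1)] this]
  show "UT.A.hat (gU (brace B x ys)) = aug_brace UU UUA (UT.A.hat (gU x)) (map (\<lambda>b. UT.A.hat (gU b)) ys)"
    by (simp add: gU_brace[OF xy] comp_def)
qed

lemma env_comult_props:
  shows "env_comult K B \<in> aug_homs K U UA UU UUA"
    and "b \<in> carrier B \<Longrightarrow> env_comult K B (gU b) = UT.A.hat (gU b)"
    and "dendriform_bialgebra K (env_bialg K B)"
proof -
  obtain \<Delta> where \<Delta>: "\<Delta> \<in> aug_homs K U UA UU UUA" and \<Delta>g: "\<forall>b\<in>carrier B. \<Delta> (gU b) = UT.A.hat (gU b)"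
    using comult_exists by blast
  let ?P = "\<lambda>\<Delta>. \<Delta> \<in> extensional (carrier U) \<and>
    (\<forall>x\<in>carrier U0. \<Delta> (\<pi> x) = tensor_map K U U \<pi> \<pi> (free_comult K B x))"
  \<comment> \<open>Both sides are morphisms out of the unitization of D(B) that agree on
    generators, so this coproduct is the one induced by the projection.\<close>
  have c: "\<Delta> (\<pi> x) = tensor_map K U U \<pi> \<pi> (free_comult K B x)" if x: "x \<in> carrier U0" for x
  proof (rule aug_homs_eqI[OF U0.vspace_axioms UT.vspace_T aug_homs_comp[OF \<pi>_hom \<Delta>]
        aug_homs_comp[OF free_comult_props(1) aug_homs_tensor_map[OF U0.augmented_aug_of U0.augmented_aug_of
          UU.augmented_aug_of UU.augmented_aug_of \<pi>_hom \<pi>_hom]] U0_generated _ x U0.augmented_aug_of])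
    fix s assume "s \<in> (\<lambda>v. (\<zero>, gen v)) ` carrier B"
    then obtain v where v: "s = (\<zero>, gen v)" "v \<in> carrier B" by blast
    note tm = tensor_map_lin[OF U0.vspace_axioms U0.vspace_axioms UU.vspace_axioms UU.vspace_axioms
        aug_homs_lin[OF \<pi>_hom] aug_homs_lin[OF \<pi>_hom]]
    have s: "s \<in> carrier U0" using v gen_closed by simp
    have "\<pi> \<one>\<^bsub>U0\<^esub> = \<one>\<^bsub>U\<^esub>" using aug_homs_simps(1)[OF \<pi>_hom] by simp
    moreover have "\<pi> s = gU v" by (simp add: v env_gen_def)
    ultimately have "tensor_map K U U \<pi> \<pi> (T0.A.hat s) = UT.A.hat (gU v)"
      using s U0.one_in_carrier
      by (simp add: T0.A.hat_def UT.A.hat_def lin_add[OF tm(1)] tm(2) del: unitization_simps)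
    then show "\<Delta> (\<pi> s) = tensor_map K U U \<pi> \<pi> (free_comult K B s)"
      using free_comult_props(2)[OF v(2)] \<Delta>g v(2) \<open>\<pi> s = gU v\<close> by (simp add: v(1))
  qed
  have "env_comult K B = (THE \<Delta>. ?P \<Delta>)" by (simp add: env_comult_def Let_def)
  also have "\<dots> = restrict \<Delta> (carrier U)"
  proof (rule the_equality)
    have "\<pi> x \<in> carrier U" if "x \<in> carrier U0" for x
      by (rule lin_closed[OF aug_homs_lin[OF \<pi>_hom] that])
    then show "?P (restrict \<Delta> (carrier U))" using c by (simp del: unitization_simps)
    fix \<Delta>' assume P: "?P \<Delta>'"
    show "\<Delta>' = restrict \<Delta> (carrier U)"
    proof (rule extensionalityI[where A = "carrier U"])
      show "\<Delta>' \<in> extensional (carrier U)" using P by blast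
      fix y assume y: "y \<in> carrier U"
      \<comment> \<open>Surjectivity of the projection makes the induced coproduct unique.\<close>
      then obtain x where "y = \<pi> x" "x \<in> carrier U0" unfolding \<pi>_surj[symmetric] by (rule imageE)
      then show "\<Delta>' y = restrict \<Delta> (carrier U) y" using P c y by (simp del: unitization_simps)
    qed simp
  qed
  finally have ec: "env_comult K B = restrict \<Delta> (carrier U)" .
  show "env_comult K B \<in> aug_homs K U UA UU UUA"
    by (rule aug_homs_cong[OF \<Delta> _ UU.augmented_aug_of]) (simp add: ec)
  show "b \<in> carrier B \<Longrightarrow> env_comult K B (gU b) = UT.A.hat (gU b)"
    using \<Delta>g gU_closed[of b] by (simp add: ec del: unitization_simps)
  show "dendriform_bialgebra K (env_bialg K B)"
    unfolding env_bialg_def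
    by (rule dendriform_bialgebra_of_generated[OF UU.unital_dendriform_algebra_axioms \<Delta> U_generated])
      (use gU_pos \<Delta>g in \<open>auto simp: ec UT.A.hat_def simp del: unitization_simps\<close>)
qed

section \<open>The adjunct of a brace morphism\<close>

lemma env_unital: "unital_dendriform_algebra K (env_bialg K B)"
  unfolding env_bialg_def with_comult_unital by (rule UU.unital_dendriform_algebra_axioms)

lemma env_homs_eq:
  assumes "unital_dendriform_algebra K W"
  shows "unital_dend_homs K (env_bialg K B) W = aug_homs K U UA W (aug_of K W)"
  using unital_dend_homs_eq[OF env_unital assms] by (simp add: env_bialg_def)

text \<open>The description \<open>env_adjunct\<close> is resolved as before: \<open>U_lift\<close>
  gives existence, generation by B gives uniqueness, and restriction to the carrier gives
  extensionality.\<close>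

lemma env_adjunct_props:
  assumes W: "unital_dendriform_algebra K W" and g: "g \<in> lin_maps K B W" and g0: "\<And>b. b \<in> carrier B \<Longrightarrow> g b \<in> pos W"
    and br: "\<And>x ys. \<lbrakk>x \<in> carrier B; ys \<noteq> []; set ys \<subseteq> carrier B\<rbrakk> \<Longrightarrow>
      g (brace B x ys) = aug_brace W (aug_of K W) (g x) (map g ys)"
  shows "env_adjunct K B W g \<in> extensional (carrier U)"
    and "env_adjunct K B W g \<in> aug_homs K U UA W (aug_of K W)"
    and "b \<in> carrier B \<Longrightarrow> env_adjunct K B W g (gU b) = g b"
proof -
  interpret W: unital_dendriform_algebra K W by fact
  let ?P = "\<lambda>h. h \<in> extensional (carrier (env_bialg K B)) \<and> h \<in> unital_dend_homs K (env_bialg K B) W \<and>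
      (\<forall>b\<in>carrier B. h (env_gen K B b) = g b)"
  have c: "carrier (env_bialg K B) = carrier U" by (simp add: env_bialg_def)
  obtain f where f: "f \<in> aug_homs K U UA W (aug_of K W)" and fg: "\<forall>b\<in>carrier B. f (gU b) = g b"
    using U_lift[OF W.augmented_aug_of g _ br] W.proj_pos(1)[OF g0] by auto
  have r: "restrict f (carrier U) \<in> aug_homs K U UA W (aug_of K W)"
    by (rule aug_homs_cong[OF f _ UU.augmented_aug_of]) simp
  have "\<exists>!h. ?P h"
  proof (rule ex1I)
    show "?P (restrict f (carrier U))"
      using r fg gU_closed by (simp add: c env_homs_eq[OF W] del: unitization_simps)
    fix h assume h: "?P h"
    show "h = restrict f (carrier U)"
    proof (rule extensionalityI[where A = "carrier U"])
      show "h \<in> extensional (carrier U)" using h c by simp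
      fix x assume x: "x \<in> carrier U"
      show "h x = restrict f (carrier U) x"
        by (rule U_hom_unique[OF W.vspace_axioms _ r _ x])
          (use h fg gU_closed in \<open>simp_all add: env_homs_eq[OF W] del: unitization_simps\<close>)
    qed simp
  qed
  from theI'[OF this]
  show "env_adjunct K B W g \<in> extensional (carrier U)"
    and "env_adjunct K B W g \<in> aug_homs K U UA W (aug_of K W)"
    and "b \<in> carrier B \<Longrightarrow> env_adjunct K B W g (gU b) = g b"
    unfolding env_adjunct_def[symmetric] by (simp_all add: c env_homs_eq[OF W] del: unitization_simps)
qed

end

section \<open>Connected dendriform bialgebras\<close>

locale connected_augmented = augmented K W A + coalgebra K W \<Delta> "aeps A"
  for K (structure) and W :: "('k, 'a, 'm) module_scheme" and A and \<Delta> +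
  assumes \<Delta>_hom: "\<Delta> \<in> aug_homs K W A (tensor K W W) (tensor_aug K W A W A)"
    and coradical_eq: "coradical K W \<Delta> = {a \<odot>\<^bsub>W\<^esub> aone A | a. a \<in> carrier K}"
    and filtration_exhaustive: "(\<Union>n. coradical_filtration K W \<Delta> n) = carrier W"
begin

interpretation S: two_augs K W A W A by (intro two_augs.intro augmented_axioms)

lemmas \<Delta>_simps [simp] = lin_simps[OF aug_homs_lin[OF \<Delta>_hom]]
lemmas \<Delta>_ops = aug_homs_simps[OF \<Delta>_hom, simplified]

subsection \<open>Sweedler calculus\<close>

definition sw :: "('k, 'e, 'n) module_scheme \<Rightarrow> ('a \<Rightarrow> 'a \<Rightarrow> 'e) \<Rightarrow> 'a \<Rightarrow> 'e"
  where "sw E f x = tensor_lift K E f (\<Delta> x)"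

lemma sw_lin: "\<lbrakk>vspace K E; bilinear K W W E f\<rbrakk> \<Longrightarrow> sw E f \<in> lin_maps K W E"
  unfolding sw_def[abs_def] by (rule lin_comp[OF aug_homs_lin[OF \<Delta>_hom] S.tensor_lift_lin])

lemma sw_closed: "\<lbrakk>vspace K E; bilinear K W W E f; x \<in> carrier W\<rbrakk> \<Longrightarrow> sw E f x \<in> carrier E"
  by (rule lin_closed[OF sw_lin])

lemma sw_post:
  assumes "vspace K E" "vspace K E'" and f: "bilinear K W W E f" and g: "g \<in> lin_maps K E E'" and x: "x \<in> carrier W"
  shows "g (sw E f x) = sw E' (\<lambda>a b. g (f a b)) x"
  unfolding sw_def
  by (rule S.tensor_lift_unique[OF assms(2) bilinear_post[OF f g] lin_comp[OF S.tensor_lift_lin[OF assms(1) f] g]])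
    (simp_all add: S.tensor_lift_pure[OF assms(1) f] x)

lemma sw_add:
  assumes E: "vspace K E" and f: "bilinear K W W E f" and g: "bilinear K W W E g" and x: "x \<in> carrier W"
  shows "sw E (\<lambda>a b. f a b \<oplus>\<^bsub>E\<^esub> g a b) x = sw E f x \<oplus>\<^bsub>E\<^esub> sw E g x"
  unfolding sw_def
  by (rule S.tensor_lift_unique[OF E bilinear_sum[OF E f g] lin_sum[OF E S.tensor_lift_lin[OF E f] S.tensor_lift_lin[OF E g]], symmetric])
    (simp_all add: S.tensor_lift_pure[OF E f] S.tensor_lift_pure[OF E g] x)

lemma sw_cong:
  assumes "vspace K E" "bilinear K W W E f" "x \<in> carrier W"
    "\<And>a b. \<lbrakk>a \<in> carrier W; b \<in> carrier W\<rbrakk> \<Longrightarrow> g a b = f a b"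
  shows "sw E g x = sw E f x"
  unfolding sw_def using assms by (intro S.tensor_lift_cong) auto

lemma sw_one: "\<lbrakk>vspace K E; bilinear K W W E f\<rbrakk> \<Longrightarrow> sw E f u = f u u"
  by (simp add: sw_def \<Delta>_ops S.tensor_lift_pure)

lemma sw_prim:
  assumes "vspace K E" "bilinear K W W E f" "x \<in> carrier W" "\<Delta> x = hat x"
  shows "sw E f x = f x u \<oplus>\<^bsub>E\<^esub> f u x"
  using assms by (simp add: sw_def hat_def lin_add[OF S.tensor_lift_lin] S.tensor_lift_pure)

lemma counit_bilinear':
  assumes "vspace K E" "g \<in> lin_maps K W E"
  shows "bilinear K W W E (\<lambda>a b. \<epsilon> a \<odot>\<^bsub>E\<^esub> g b)" "bilinear K W W E (\<lambda>a b. \<epsilon> b \<odot>\<^bsub>E\<^esub> g a)"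
proof -
  interpret E: vspace K E by fact
  show "bilinear K W W E (\<lambda>a b. \<epsilon> a \<odot>\<^bsub>E\<^esub> g b)" "bilinear K W W E (\<lambda>a b. \<epsilon> b \<odot>\<^bsub>E\<^esub> g a)"
    by (intro bilinearI; simp add: lin_simps[OF assms(2)] E.smult_l_distr E.smult_r_distr E.smult_assoc1[symmetric] m_ac)+
qed

lemma sw_counit:
  assumes E: "vspace K E" and g: "g \<in> lin_maps K W E" and x: "x \<in> carrier W"
  shows "sw E (\<lambda>a b. \<epsilon> a \<odot>\<^bsub>E\<^esub> g b) x = g x" "sw E (\<lambda>a b. \<epsilon> b \<odot>\<^bsub>E\<^esub> g a) x = g x"
proof -
  have "sw E (\<lambda>a b. g (\<epsilon> a \<odot>\<^bsub>W\<^esub> b)) x = g x" "sw E (\<lambda>a b. g (\<epsilon> b \<odot>\<^bsub>W\<^esub> a)) x = g x"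
    using sw_post[OF vspace_axioms E counit_bilinear(1) g x] sw_post[OF vspace_axioms E counit_bilinear(2) g x]
      counit_left[OF x] counit_right[OF x] by (simp_all add: sw_def)
  then show "sw E (\<lambda>a b. \<epsilon> a \<odot>\<^bsub>E\<^esub> g b) x = g x" "sw E (\<lambda>a b. \<epsilon> b \<odot>\<^bsub>E\<^esub> g a) x = g x"
    using sw_cong[OF E counit_bilinear'(1)[OF E g] x, of "\<lambda>a b. g (\<epsilon> a \<odot>\<^bsub>W\<^esub> b)"]
      sw_cong[OF E counit_bilinear'(2)[OF E g] x, of "\<lambda>a b. g (\<epsilon> b \<odot>\<^bsub>W\<^esub> a)"]
    by (simp_all add: lin_smult[OF g])
qed

text \<open>Linear dependence on a parameter passes through a Sweedler sum, which makes nested sums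
  well-behaved.\<close>

lemma sw_lin_param:
  assumes "vspace K V" "vspace K E" "x \<in> carrier W"
    "\<And>c. c \<in> carrier V \<Longrightarrow> bilinear K W W E (f c)"
    "\<And>a b. \<lbrakk>a \<in> carrier W; b \<in> carrier W\<rbrakk> \<Longrightarrow> (\<lambda>c. f c a b) \<in> lin_maps K V E"
  shows "(\<lambda>c. sw E (f c) x) \<in> lin_maps K V E"
  unfolding sw_def using assms by (intro S.lin_tensor_lift) auto

text \<open>In Sweedler notation the sums of f (x11, x12, x2) and f (x1, x21, x22) agree: both are
  the same linear map applied to the two sides of coassociativity.\<close>

lemma sw_coassoc:
  assumes E: "vspace K E" and x: "x \<in> carrier W"
    and 1: "\<And>b c. \<lbrakk>b \<in> carrier W; c \<in> carrier W\<rbrakk> \<Longrightarrow> (\<lambda>a. f a b c) \<in> lin_maps K W E"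
    and 2: "\<And>a c. \<lbrakk>a \<in> carrier W; c \<in> carrier W\<rbrakk> \<Longrightarrow> (\<lambda>b. f a b c) \<in> lin_maps K W E"
    and 3: "\<And>a b. \<lbrakk>a \<in> carrier W; b \<in> carrier W\<rbrakk> \<Longrightarrow> (\<lambda>c. f a b c) \<in> lin_maps K W E"
  shows "sw E (\<lambda>a b. sw E (\<lambda>c d. f c d b) a) x = sw E (\<lambda>a b. sw E (\<lambda>c d. f a c d) b) x"
proof -
  interpret TW: two_spaces K S.T W by (intro two_spaces.intro S.vspace_T vspace_axioms)
  interpret WT: two_spaces K W S.T by (intro two_spaces.intro S.vspace_T vspace_axioms)
  have b1: "bilinear K W W E (\<lambda>c d. f c d b)" if "b \<in> carrier W" for b
    unfolding bilinear_def using 1 2 that by auto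
  have b2: "bilinear K W W E (f a)" if "a \<in> carrier W" for a
    unfolding bilinear_def using 2 3 that by auto
  have B: "bilinear K S.T W E (\<lambda>X b. tensor_lift K E (\<lambda>c d. f c d b) X)"
    unfolding bilinear_def
    by (intro conjI ballI S.tensor_lift_lin[OF E b1] S.lin_tensor_lift[OF vspace_axioms E] b1 3)
  \<comment> \<open>The map induced by f on the left-bracketed triple tensor product.\<close>
  define \<Phi> where "\<Phi> = tensor_lift K E (\<lambda>X b. tensor_lift K E (\<lambda>c d. f c d b) X)"
  note \<Phi> = TW.tensor_lift_lin[OF E B, folded \<Phi>_def] TW.tensor_lift_pure[OF E B, folded \<Phi>_def]
  note vs = vspace_axioms
  note m1 = tensor_map_lin[OF vs vs S.vspace_T vs aug_homs_lin[OF \<Delta>_hom] lin_id]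
  note m2 = tensor_map_lin[OF vs vs vs S.vspace_T lin_id aug_homs_lin[OF \<Delta>_hom]]
  note as = tensor_assoc_lin[OF vs vs vs]
  have s1: "bilinear K W W E (\<lambda>a b. sw E (\<lambda>c d. f c d b) a)"
    unfolding bilinear_def
    by (intro conjI ballI sw_lin[OF E b1] sw_lin_param[OF vs E] b1 3)
  have s2: "bilinear K W W E (\<lambda>a b. sw E (f a) b)"
    unfolding bilinear_def
    by (intro conjI ballI sw_lin[OF E b2] sw_lin_param[OF vs E] b2 1)
  have "\<Phi> (tensor_map K S.T W \<Delta> (\<lambda>y. y) (\<Delta> x)) = sw E (\<lambda>a b. sw E (\<lambda>c d. f c d b) a) x"
    unfolding sw_def[of E "\<lambda>a b. sw E (\<lambda>c d. f c d b) a"]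
    by (rule S.tensor_lift_unique[OF E s1 lin_comp[OF m1(1) \<Phi>(1)]]) (simp_all add: m1(2) \<Phi>(2) sw_def x)
  moreover have "\<Phi> (tensor_assoc K W W W (WT.pure a Y)) = tensor_lift K E (f a) Y"
    if "a \<in> carrier W" "Y \<in> carrier S.T" for a Y
    using that(2)
  proof (induction rule: S.tensor_induct)
    case (pure v w)
    then show ?case using that(1) by (simp add: as(2) \<Phi>(2) S.tensor_lift_pure[OF E b1] S.tensor_lift_pure[OF E b2])
  next
    case (add X Y)
    then show ?case
      using that(1) lin_closed[OF as(1)]
      by (simp add: lin_add[OF as(1)] lin_add[OF \<Phi>(1)] lin_add[OF S.tensor_lift_lin[OF E b2]])
  qed
  then have "\<Phi> (tensor_assoc K W W W (tensor_map K W S.T (\<lambda>y. y) \<Delta> (\<Delta> x))) = sw E (\<lambda>a b. sw E (f a) b) x"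
    unfolding sw_def[of E "\<lambda>a b. sw E (f a) b"]
    by (intro S.tensor_lift_unique[OF E s2 lin_comp[OF m2(1) lin_comp[OF as(1) \<Phi>(1)]]]) (simp_all add: m2(2) sw_def x)
  ultimately show ?thesis using coassoc[OF x] by simp
qed

lemma sw_in_submodule:
  assumes E: "vspace K E" and f: "bilinear K W W E f" and N: "submodule N K E"
    and c: "\<And>a b. \<lbrakk>a \<in> carrier W; b \<in> carrier W\<rbrakk> \<Longrightarrow> f a b \<in> N" and x: "x \<in> carrier W"
  shows "sw E f x \<in> N"
proof -
  have "tensor_lift K E f X \<in> N" if "X \<in> carrier S.T" for X
    using that
    by (induction rule: S.tensor_induct)
      (simp_all add: S.tensor_lift_pure[OF E f] c lin_add[OF S.tensor_lift_lin[OF E f]] vspace.submodule_facts(5)[OF E N])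
  then show ?thesis by (simp add: sw_def x)
qed

subsection \<open>The coradical filtration\<close>

abbreviation "F \<equiv> coradical_filtration K W \<Delta>"

text \<open>The projection onto the kernel of \<epsilon> along 1, obtained from
  \<open>left_one\<close> without a choice of decomposition.\<close>

definition p :: "'a \<Rightarrow> 'a" where "p x = L x u"

lemma p_lin: "p \<in> lin_maps K W W"
  unfolding p_def[abs_def] by (rule bilinear_left[OF left_bilinear]) simp

lemmas p_simps [simp] = lin_simps[OF p_lin]

lemma p_one [simp]: "p u = \<zero>\<^bsub>W\<^esub>" and eps_p [simp]: "x \<in> carrier W \<Longrightarrow> \<epsilon> (p x) = \<zero>"
  by (simp_all add: p_def)

lemma p_decomp: "x \<in> carrier W \<Longrightarrow> p x \<oplus>\<^bsub>W\<^esub> \<epsilon> x \<odot>\<^bsub>W\<^esub> u = x"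
  by (simp add: p_def left_one)

lemma p_pos [simp]: "\<lbrakk>x \<in> carrier W; \<epsilon> x = \<zero>\<rbrakk> \<Longrightarrow> p x = x"
  by (simp add: p_def)

lemma tensor_sub_submodule:
  assumes "X \<subseteq> carrier W" "Y \<subseteq> carrier W"
  shows "submodule (tensor_sub K W W X Y) K S.T" "{S.pure v w |v w. v \<in> X \<and> w \<in> Y} \<subseteq> carrier S.T"
proof -
  show 1: "{S.pure v w |v w. v \<in> X \<and> w \<in> Y} \<subseteq> carrier S.T" using subsetD[OF assms(1)] subsetD[OF assms(2)] by auto
  show "submodule (tensor_sub K W W X Y) K S.T"
    unfolding tensor_sub_def by (rule S.T.span_submodule[OF 1])
qed

lemma tensor_sub_mono: "\<lbrakk>X \<subseteq> X'; Y \<subseteq> Y'\<rbrakk> \<Longrightarrow> tensor_sub K W W X Y \<subseteq> tensor_sub K W W X' Y'"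
  unfolding tensor_sub_def span_in_def by (rule hull_mono) blast

lemma F_zero: "F 0 = {a \<odot>\<^bsub>W\<^esub> u | a. a \<in> carrier K}"
  by (simp add: coradical_eq)

lemma F_SucE:
  assumes "x \<in> F (Suc k)"
  obtains X Y where "x \<in> carrier W" "\<Delta> x = X \<oplus>\<^bsub>S.T\<^esub> Y" "X \<in> tensor_sub K W W (carrier W) (F k)"
    "Y \<in> tensor_sub K W W (F 0) (carrier W)"
  using assms by (auto simp: set_add_def')

lemma F_SucI:
  assumes "x \<in> carrier W" "\<Delta> x = X \<oplus>\<^bsub>S.T\<^esub> Y" "X \<in> tensor_sub K W W (carrier W) (F k)"
    "Y \<in> tensor_sub K W W (F 0) (carrier W)"
  shows "x \<in> F (Suc k)"
  using assms by (auto simp: set_add_def')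

lemma F_submodule: "submodule (F k) K W"
proof (induction k)
  case 0
  show ?case
    unfolding F_zero
  proof (rule submodule_spaceI)
    show "\<zero>\<^bsub>W\<^esub> \<in> {a \<odot>\<^bsub>W\<^esub> u |a. a \<in> carrier K}" by (intro CollectI exI[of _ \<zero>]) simp
    fix x assume "x \<in> {a \<odot>\<^bsub>W\<^esub> u |a. a \<in> carrier K}"
    then obtain a where a: "x = a \<odot>\<^bsub>W\<^esub> u" "a \<in> carrier K" by blast
    show "x \<oplus>\<^bsub>W\<^esub> y \<in> {a \<odot>\<^bsub>W\<^esub> u |a. a \<in> carrier K}" if "y \<in> {a \<odot>\<^bsub>W\<^esub> u |a. a \<in> carrier K}" for y
    proof -
      from that obtain b where "y = b \<odot>\<^bsub>W\<^esub> u" "b \<in> carrier K" by blast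
      with a show ?thesis by (intro CollectI exI[of _ "a \<oplus> b"]) (simp add: smult_l_distr)
    qed
    show "b \<odot>\<^bsub>W\<^esub> x \<in> {a \<odot>\<^bsub>W\<^esub> u |a. a \<in> carrier K}" if "b \<in> carrier K" for b
      using that a by (intro CollectI exI[of _ "b \<otimes> a"]) (simp add: smult_assoc1)
  qed auto
next
  case (Suc k)
  have F0: "F 0 \<subseteq> carrier W" by (auto simp: coradical_eq)
  have Fn: "F k \<subseteq> carrier W" using submodule_facts(1)[OF Suc] by blast
  note N1 = S.T.submodule_facts[OF tensor_sub_submodule(1)[OF order_refl Fn]]
  note N2 = S.T.submodule_facts[OF tensor_sub_submodule(1)[OF F0 order_refl]]
  show ?case
  proof (rule submodule_spaceI)
    show "F (Suc k) \<subseteq> carrier W" by auto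
    have z: "\<Delta> \<zero>\<^bsub>W\<^esub> = \<zero>\<^bsub>S.T\<^esub> \<oplus>\<^bsub>S.T\<^esub> \<zero>\<^bsub>S.T\<^esub>"
      using lin_zero_vec[OF S.vspace_T aug_homs_lin[OF \<Delta>_hom]] by simp
    show "\<zero>\<^bsub>W\<^esub> \<in> F (Suc k)" by (rule F_SucI[OF _ z N1(2) N2(2)]) simp
    show "x \<oplus>\<^bsub>W\<^esub> y \<in> F (Suc k)" if x: "x \<in> F (Suc k)" and y: "y \<in> F (Suc k)" for x y
    proof -
      from x obtain X Y where X: "x \<in> carrier W" "\<Delta> x = X \<oplus>\<^bsub>S.T\<^esub> Y" "X \<in> tensor_sub K W W (carrier W) (F k)"
        "Y \<in> tensor_sub K W W (F 0) (carrier W)" by (rule F_SucE)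
      from y obtain X' Y' where Y: "y \<in> carrier W" "\<Delta> y = X' \<oplus>\<^bsub>S.T\<^esub> Y'" "X' \<in> tensor_sub K W W (carrier W) (F k)"
        "Y' \<in> tensor_sub K W W (F 0) (carrier W)" by (rule F_SucE)
      have "\<Delta> (x \<oplus>\<^bsub>W\<^esub> y) = (X \<oplus>\<^bsub>S.T\<^esub> X') \<oplus>\<^bsub>S.T\<^esub> (Y \<oplus>\<^bsub>S.T\<^esub> Y')"
        using X Y N1(1) N2(1) by (simp add: S.T.a_ac)
      from F_SucI[OF _ this N1(5)[OF X(3) Y(3)] N2(5)[OF X(4) Y(4)]] X Y show ?thesis by simp
    qed
    show "a \<odot>\<^bsub>W\<^esub> x \<in> F (Suc k)" if a: "a \<in> carrier K" and x: "x \<in> F (Suc k)" for a x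
    proof -
      from x obtain X Y where X: "x \<in> carrier W" "\<Delta> x = X \<oplus>\<^bsub>S.T\<^esub> Y" "X \<in> tensor_sub K W W (carrier W) (F k)"
        "Y \<in> tensor_sub K W W (F 0) (carrier W)" by (rule F_SucE)
      have "\<Delta> (a \<odot>\<^bsub>W\<^esub> x) = a \<odot>\<^bsub>S.T\<^esub> X \<oplus>\<^bsub>S.T\<^esub> a \<odot>\<^bsub>S.T\<^esub> Y"
        using X a N1(1) N2(1) by (simp add: S.T.smult_r_distr)
      from F_SucI[OF _ this N1(4)[OF a X(3)] N2(4)[OF a X(4)]] X a show ?thesis by simp
    qed
  qed
qed

lemma F_subset: "x \<in> F k \<Longrightarrow> x \<in> carrier W"
  by (rule submodule_facts(1)[OF F_submodule])

text \<open>At the start, 1 \<otimes> 1 lies in W \<otimes> \<open>F 0\<close>; afterwards the step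
  is monotone in the previous stage.\<close>

lemma F_Suc_mono: "F k \<subseteq> F (Suc k)"
proof (induction k)
  case 0
  have F0: "F 0 \<subseteq> carrier W" using F_subset by blast
  note N1 = S.T.submodule_facts[OF tensor_sub_submodule(1)[OF order_refl F0]]
  note N2 = S.T.submodule_facts[OF tensor_sub_submodule(1)[OF F0 order_refl]]
  show ?case
  proof
    fix x assume "x \<in> F 0"
    then obtain a where a: "x = a \<odot>\<^bsub>W\<^esub> u" "a \<in> carrier K" unfolding F_zero by blast
    have "\<one> \<odot>\<^bsub>W\<^esub> u \<in> F 0" unfolding F_zero by blast
    then have "S.pure u u \<in> tensor_sub K W W (carrier W) (F 0)"
      unfolding tensor_sub_def by (intro S.T.span_incl) auto
    then have "a \<odot>\<^bsub>S.T\<^esub> S.pure u u \<in> tensor_sub K W W (carrier W) (F 0)" using N1(4) a by blast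
    moreover have "\<Delta> x = a \<odot>\<^bsub>S.T\<^esub> S.pure u u \<oplus>\<^bsub>S.T\<^esub> \<zero>\<^bsub>S.T\<^esub>" using a by (simp add: \<Delta>_ops)
    moreover have "x \<in> carrier W" using a by simp
    ultimately show "x \<in> F (Suc 0)" by (intro F_SucI[OF _ _ _ N2(2)])
  qed
next
  case (Suc k)
  show ?case
  proof
    fix x assume "x \<in> F (Suc k)"
    then obtain X Y where X: "x \<in> carrier W" "\<Delta> x = X \<oplus>\<^bsub>S.T\<^esub> Y" "X \<in> tensor_sub K W W (carrier W) (F k)"
        "Y \<in> tensor_sub K W W (F 0) (carrier W)" by (rule F_SucE)
    show "x \<in> F (Suc (Suc k))"
      by (rule F_SucI[OF X(1,2) subsetD[OF tensor_sub_mono[OF order_refl Suc] X(3)] X(4)])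
  qed
qed

lemma F_mono: "m \<le> k \<Longrightarrow> F m \<subseteq> F k"
  using F_Suc_mono by (rule lift_Suc_mono_le)

lemma F_ex: "x \<in> carrier W \<Longrightarrow> \<exists>k. x \<in> F k"
  using filtration_exhaustive by blast

text \<open>The coproduct of \<open>F (Suc k)\<close> lies in W \<otimes> \<open>F k\<close> +
  \<open>F 0\<close> \<otimes> W, and \<open>F 0\<close> is K 1 by connectedness. Vanishing at 1 in
  the left argument disposes of the second part, so only the values on \<open>F k\<close> in the
  right argument count. Every induction along the filtration rests on this.\<close>

lemma sw_tail:
  assumes E: "vspace K E" and f: "bilinear K W W E f" and g: "bilinear K W W E g"
    and f0: "\<And>b. b \<in> carrier W \<Longrightarrow> f u b = \<zero>\<^bsub>E\<^esub>" and g0: "\<And>b. b \<in> carrier W \<Longrightarrow> g u b = \<zero>\<^bsub>E\<^esub>"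
    and eq: "\<And>a b. \<lbrakk>a \<in> carrier W; b \<in> F k\<rbrakk> \<Longrightarrow> f a b = g a b" and x: "x \<in> F (Suc k)"
  shows "sw E f x = sw E g x"
proof -
  interpret E: vspace K E by fact
  from x obtain X Y where X: "x \<in> carrier W" "\<Delta> x = X \<oplus>\<^bsub>S.T\<^esub> Y" "X \<in> tensor_sub K W W (carrier W) (F k)"
        "Y \<in> tensor_sub K W W (F 0) (carrier W)" by (rule F_SucE)
  have F0: "F 0 \<subseteq> carrier W" and Fn: "F k \<subseteq> carrier W" using F_subset by blast+
  note N1 = tensor_sub_submodule[OF order_refl Fn] and N2 = tensor_sub_submodule[OF F0 order_refl]
  note lf = S.tensor_lift_lin[OF E f] S.tensor_lift_pure[OF E f]
  note lg = S.tensor_lift_lin[OF E g] S.tensor_lift_pure[OF E g]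
  have "tensor_lift K E f X = tensor_lift K E g X"
  proof (rule S.T.lin_eq_on_span[OF X(3)[unfolded tensor_sub_def] N1(2) E lf(1) lg(1)])
    fix Z assume "Z \<in> {S.pure v w |v w. v \<in> carrier W \<and> w \<in> F k}"
    then obtain v w where "Z = S.pure v w" "v \<in> carrier W" "w \<in> F k" by blast
    then show "tensor_lift K E f Z = tensor_lift K E g Z" using F_subset by (simp add: lf(2) lg(2) eq)
  qed
  moreover have "tensor_lift K E f Y = tensor_lift K E g Y"
  proof (rule S.T.lin_eq_on_span[OF X(4)[unfolded tensor_sub_def] N2(2) E lf(1) lg(1)])
    fix Z assume "Z \<in> {S.pure v w |v w. v \<in> F 0 \<and> w \<in> carrier W}"
    then obtain a w where "Z = S.pure (a \<odot>\<^bsub>W\<^esub> u) w" "a \<in> carrier K" "w \<in> carrier W" unfolding F_zero by blast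
    then show "tensor_lift K E f Z = tensor_lift K E g Z"
      by (simp add: lin_smult[OF lf(1)] lin_smult[OF lg(1)] lf(2) lg(2) f0 g0)
  qed
  ultimately show ?thesis
    unfolding sw_def X(2) using X(3,4) S.T.submodule_facts(1)[OF N1(1)] S.T.submodule_facts(1)[OF N2(1)]
    by (simp add: lin_add[OF lf(1)] lin_add[OF lg(1)])
qed

end

subsection \<open>The projection onto the primitive elements\<close>

lemma (in augmented) s_single: "\<lbrakk>b \<in> carrier W; \<epsilon> b = \<zero>\<rbrakk> \<Longrightarrow> s [b] = b"
  by (simp add: aug_s_def)

context connected_augmented begin

interpretation S: two_augs K W A W A by (intro two_augs.intro augmented_axioms)

lemma sw_zero: "\<lbrakk>vspace K E; x \<in> carrier W\<rbrakk> \<Longrightarrow> sw E (\<lambda>_ _. \<zero>\<^bsub>E\<^esub>) x = \<zero>\<^bsub>E\<^esub>"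
proof -
  assume E: "vspace K E" and x: "x \<in> carrier W"
  interpret E: vspace K E by fact
  show ?thesis
    unfolding sw_def by (rule S.tensor_lift_unique[OF E _ lin_zero_map[OF E], symmetric]) (auto intro!: bilinearI simp: x)
qed

lemma sw_pure: "x \<in> carrier W \<Longrightarrow> sw S.T S.pure x = \<Delta> x"
  unfolding sw_def by (rule S.tensor_lift_unique[OF S.vspace_T S.bilinear_pure lin_id, symmetric]) simp_all

section \<open>Convolution and the recursion for the projection\<close>

definition conv :: "('a \<Rightarrow> 'a) \<Rightarrow> ('a \<Rightarrow> 'a) \<Rightarrow> 'a \<Rightarrow> 'a"
  where "conv f g x = sw W (\<lambda>a b. R (f a) (g b)) x"

context
  fixes f g assumes f: "f \<in> lin_maps K W W" and g: "g \<in> lin_maps K W W"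
begin

lemma conv_bilinear: "bilinear K W W W (\<lambda>a b. R (f a) (g b))"
  by (rule bilinear_comp[OF right_bilinear f g])

lemma conv_lin: "conv f g \<in> lin_maps K W W"
  unfolding conv_def[abs_def] by (rule sw_lin[OF vspace_axioms conv_bilinear])

lemma conv_closed: "x \<in> carrier W \<Longrightarrow> conv f g x \<in> carrier W"
  by (rule lin_closed[OF conv_lin])

lemma eps_conv: "x \<in> carrier W \<Longrightarrow> \<epsilon> (conv f g x) = \<zero>"
proof -
  assume x: "x \<in> carrier W"
  have "submodule pos_set K W" by (rule submodule_spaceI) auto
  then have "conv f g x \<in> pos_set"
    unfolding conv_def
    by (intro sw_in_submodule[OF vspace_axioms conv_bilinear _ _ x]) (simp_all add: lin_closed[OF f] lin_closed[OF g])
  then show ?thesis by simp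
qed

end

text \<open>The recursion for e does not decrease its argument, so it is unrolled k times starting
  from 0; on stage k of the filtration the result is already final.\<close>

primrec es :: "nat \<Rightarrow> 'a \<Rightarrow> 'a" where
  "es 0 x = \<zero>\<^bsub>W\<^esub>"
| "es (Suc k) x = p x \<ominus>\<^bsub>W\<^esub> conv p (es k) x"

lemma es_lin: "es k \<in> lin_maps K W W"
proof (induction k)
  case 0
  show ?case by (rule lin_cong[OF lin_zero_map[OF vspace_axioms] _ vspace_axioms]) simp
next
  case (Suc k)
  show ?case
    by (rule lin_cong[OF lin_diff[OF vspace_axioms p_lin conv_lin[OF p_lin Suc]] _ vspace_axioms]) simp
qed

lemma es_one: "es k u = \<zero>\<^bsub>W\<^esub>"
  by (cases k) (simp_all add: conv_def sw_one[OF vspace_axioms conv_bilinear[OF p_lin es_lin]] lin_closed[OF es_lin])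

text \<open>\<open>p\<close> vanishes at 1, so on \<open>F (Suc k)\<close> the convolution depends
  only on the values of its right factor on \<open>F k\<close>, where the induction hypothesis
  applies.\<close>

lemma es_Suc: "x \<in> F k \<Longrightarrow> es (Suc k) x = es k x"
proof (induction k arbitrary: x)
  case 0
  then obtain a where a: "x = a \<odot>\<^bsub>W\<^esub> u" "a \<in> carrier K" unfolding F_zero by blast
  have "es (Suc 0) x = a \<odot>\<^bsub>W\<^esub> es (Suc 0) u" using a by (simp only: lin_smult[OF es_lin] one_closed)
  then show ?case using a by (simp only: es_one es.simps(1) smult_r_null)
next
  case (Suc k)
  have "conv p (es (Suc k)) x = conv p (es k) x"
    unfolding conv_def
    by (rule sw_tail[OF vspace_axioms conv_bilinear[OF p_lin es_lin] conv_bilinear[OF p_lin es_lin] _ _ _ Suc.prems])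
      (simp_all only: Suc.IH p_one lin_closed[OF es_lin] right_zero)
  then show ?case by simp
qed

lemma es_stable: "k \<le> m \<Longrightarrow> x \<in> F k \<Longrightarrow> es m x = es k x"
proof (induction m rule: dec_induct)
  case (step m)
  have "x \<in> F m" using F_mono[OF step.hyps(1)] step.prems by blast
  then show ?case using step es_Suc by metis
qed simp

text \<open>\<open>LEAST\<close> merely selects a stage: by \<open>es_stable\<close> every k with x
  in \<open>F k\<close> gives the same value.\<close>

definition e :: "'a \<Rightarrow> 'a" where "e x = es (LEAST k. x \<in> F k) x"

lemma e_eq: "x \<in> F k \<Longrightarrow> e x = es k x"
  unfolding e_def by (metis LeastI Least_le es_stable)

lemma e_lin: "e \<in> lin_maps K W W"
proof (rule lin_mapsI)
  show "e x \<in> carrier W" if "x \<in> carrier W" for x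
    using F_ex[OF that] e_eq lin_closed[OF es_lin that] by metis
  show "e (x \<oplus>\<^bsub>W\<^esub> y) = e x \<oplus>\<^bsub>W\<^esub> e y" if xy: "x \<in> carrier W" "y \<in> carrier W" for x y
  proof -
    obtain k m where "x \<in> F k" "y \<in> F m" using F_ex xy by blast
    then have x: "x \<in> F (max k m)" and y: "y \<in> F (max k m)"
      using F_mono[of k "max k m"] F_mono[of m "max k m"] by auto
    have "x \<oplus>\<^bsub>W\<^esub> y \<in> F (max k m)" by (rule submodule_facts(5)[OF F_submodule x y])
    from e_eq[OF x] e_eq[OF y] e_eq[OF this] show ?thesis using xy by (simp only: lin_add[OF es_lin])
  qed
  show "e (a \<odot>\<^bsub>W\<^esub> x) = a \<odot>\<^bsub>W\<^esub> e x" if a: "a \<in> carrier K" and x: "x \<in> carrier W" for a x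
  proof -
    obtain k where k: "x \<in> F k" using F_ex x by blast
    have "a \<odot>\<^bsub>W\<^esub> x \<in> F k" by (rule submodule_facts(4)[OF F_submodule a k])
    from e_eq[OF k] e_eq[OF this] show ?thesis using a x by (simp only: lin_smult[OF es_lin])
  qed
qed

lemmas e_simps [simp] = lin_simps[OF e_lin]

lemma e_one [simp]: "e u = \<zero>\<^bsub>W\<^esub>"
proof -
  have "u \<in> F 0" unfolding F_zero using smult_one[of u] by (intro CollectI exI[of _ \<one>]) simp
  then show ?thesis by (simp only: e_eq es_one)
qed

lemmas conv_pe = p_lin e_lin

text \<open>The recursion passes to the limit, since on \<open>F (Suc k)\<close> the convolution
  with e equals the convolution with \<open>es k\<close>.\<close>

lemma e_rec: "x \<in> carrier W \<Longrightarrow> e x = p x \<ominus>\<^bsub>W\<^esub> conv p e x"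
proof -
  assume "x \<in> carrier W"
  then obtain k where "x \<in> F k" using F_ex by blast
  then have x: "x \<in> F (Suc k)" using F_Suc_mono by blast
  have "conv p e x = conv p (es k) x"
    unfolding conv_def
    by (rule sw_tail[OF vspace_axioms conv_bilinear[OF conv_pe] conv_bilinear[OF p_lin es_lin] _ _ _ x])
      (simp_all only: e_eq p_one lin_closed[OF es_lin] e_simps right_zero)
  then show ?thesis using e_eq[OF x] by simp
qed

lemma p_rec: "x \<in> carrier W \<Longrightarrow> p x = e x \<oplus>\<^bsub>W\<^esub> conv p e x"
  using e_rec[of x] conv_closed[OF conv_pe, of x] by (simp add: a_minus_def a_assoc l_neg)

lemma eps_e [simp]: "x \<in> carrier W \<Longrightarrow> \<epsilon> (e x) = \<zero>"
  using conv_closed[OF conv_pe, of x] eps_conv[OF conv_pe, of x] by (simp add: e_rec a_minus_def)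

definition prims :: "'a set" where "prims = {x \<in> carrier W. \<Delta> x = hat x}"

text \<open>The counit law applied to x \<otimes> 1 + 1 \<otimes> x gives x = x + \<epsilon>(x) 1;
  applying \<epsilon> to this forces \<epsilon>(x) = 0.\<close>

lemma prims_pos: "prims \<subseteq> pos_set"
proof
  fix x assume "x \<in> prims"
  then have x: "x \<in> carrier W" "\<Delta> x = hat x" by (auto simp: prims_def)
  have "x = x \<oplus>\<^bsub>W\<^esub> \<epsilon> x \<odot>\<^bsub>W\<^esub> u"
    using counit_left[OF x(1)] sw_prim[OF vspace_axioms counit_bilinear(1) x] x by (simp add: sw_def a_comm)
  moreover have "\<epsilon> (x \<oplus>\<^bsub>W\<^esub> \<epsilon> x \<odot>\<^bsub>W\<^esub> u) = \<epsilon> x \<oplus> \<epsilon> x" using x by simp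
  ultimately have "\<epsilon> x \<oplus> \<zero> = \<epsilon> x \<oplus> \<epsilon> x" using x(1) by simp
  then have "\<epsilon> x = \<zero>" using x(1) by (metis R.r_neg1 R.zero_closed eps_simps(1))
  then show "x \<in> pos_set" using x(1) by simp
qed

text \<open>The coproduct is a morphism and therefore commutes with braces, and so does x -> x
  \<otimes> 1 + 1 \<otimes> x by \<open>brace_hat\<close>; the two agree on primitive
  arguments.\<close>

lemma prims_brace: "\<lbrakk>x \<in> prims; set c \<subseteq> prims\<rbrakk> \<Longrightarrow> aug_brace W A x c \<in> prims"
proof -
  assume x: "x \<in> prims" and c: "set c \<subseteq> prims"
  have c': "set c \<subseteq> pos_set" "set c \<subseteq> carrier W" using c prims_pos by auto
  have "map \<Delta> c = map hat c" using c by (auto simp: prims_def)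
  moreover have x': "x \<in> carrier W" "\<epsilon> x = \<zero>" "\<Delta> x = hat x" using x prims_pos by (auto simp: prims_def)
  ultimately have "\<Delta> (aug_brace W A x c) = hat (aug_brace W A x c)"
    using aug_homs_brace[OF augmented_axioms S.TA.augmented_axioms \<Delta>_hom x'(1) c'(2)] brace_hat[OF x'(1,2) c'(1)]
    by (simp only:)
  then show ?thesis unfolding prims_def using x'(1) c'(2) by simp
qed

lemma prims_submodule: "submodule prims K W"
  unfolding prims_def by (rule lin_equalizer_submodule[OF S.vspace_T aug_homs_lin[OF \<Delta>_hom] hat_lin])

subsection \<open>The projection takes values in the primitive elements\<close>

text \<open>For primitive y the coproduct of a \<succ> y is this sum plus (a \<succ> y) \<otimes>
  1.\<close>

definition right_coprod :: "'a \<Rightarrow> 'a \<Rightarrow> ('k, 'a, 'a) tensor"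
  where "right_coprod a y = sw S.T (\<lambda>c d. S.pure c (R d y)) a"

lemma right_pure_bilinear: "y \<in> carrier W \<Longrightarrow> bilinear K W W S.T (\<lambda>c d. S.pure c (R d y))"
  by (rule bilinear_comp[OF S.bilinear_pure lin_id bilinear_left[OF right_bilinear]])

lemma right_coprod_bilinear: "bilinear K W W S.T right_coprod"
  unfolding bilinear_def right_coprod_def[abs_def]
  by (intro conjI ballI sw_lin[OF S.vspace_T right_pure_bilinear]
    sw_lin_param[OF vspace_axioms S.vspace_T _ right_pure_bilinear]
    lin_comp[OF bilinear_right[OF right_bilinear] bilinear_right[OF S.bilinear_pure]])

lemmas right_coprod_simps = bilinear_simps[OF right_coprod_bilinear]

lemma right_hat:
  assumes a: "a \<in> carrier W" and y: "y \<in> carrier W" "\<epsilon> y = \<zero>"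
  shows "aright S.TA (\<Delta> a) (hat y) = right_coprod a y \<oplus>\<^bsub>S.T\<^esub> S.pure (R a y) u"
proof -
  note T = S.vspace_T
  have g: "(\<lambda>X. aright S.TA X (hat y)) \<in> lin_maps K S.T S.T"
    by (rule bilinear_left[OF S.TA.right_bilinear]) (simp add: y)
  have h: "(\<lambda>c. S.pure (R c y) u) \<in> lin_maps K W S.T"
    by (rule lin_comp[OF bilinear_left[OF right_bilinear y(1)] bilinear_left[OF S.bilinear_pure]]) simp
  note b = counit_bilinear'(2)[OF T h]
  note bs = bilinear_sum[OF T right_pure_bilinear[OF y(1)] b]
  have "aright S.TA (\<Delta> a) (hat y) = sw S.T (\<lambda>c d. S.pure c (R d y) \<oplus>\<^bsub>S.T\<^esub> \<epsilon> d \<odot>\<^bsub>S.T\<^esub> S.pure (R c y) u) a"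
    unfolding sw_def
    by (rule S.tensor_lift_unique[OF T bs g]) (simp_all add: y a hat_def S.TA_simps S.T.a_comm)
  also have "\<dots> = right_coprod a y \<oplus>\<^bsub>S.T\<^esub> S.pure (R a y) u"
    unfolding right_coprod_def sw_add[OF T right_pure_bilinear[OF y(1)] b a] sw_counit(2)[OF T h a] ..
  finally show ?thesis .
qed

text \<open>With c the convolution term, e(x) = x - c when \<epsilon>(x) = 0, and the identity then
  rearranges to the primitivity of e(x); it is written without subtraction. The assumption
  \<open>IH\<close> says that inside the Sweedler sum of x the values of e may be treated as
  primitive.\<close>

lemma comult_conv:
  assumes x: "x \<in> carrier W"
    and IH: "sw S.T (\<lambda>a b. aright S.TA (\<Delta> (p a)) (\<Delta> (e b))) x = sw S.T (\<lambda>a b. aright S.TA (\<Delta> (p a)) (hat (e b))) x"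
  shows "\<Delta> (conv p e x) \<oplus>\<^bsub>S.T\<^esub> S.pure u (e x) \<oplus>\<^bsub>S.T\<^esub> S.pure x u = \<Delta> x \<oplus>\<^bsub>S.T\<^esub> S.pure (conv p e x) u"
proof -
  note T = S.vspace_T
  note \<Delta>_lin = aug_homs_lin[OF \<Delta>_hom]
  have pu: "(\<lambda>a. S.pure a u) \<in> lin_maps K W S.T" by (rule bilinear_left[OF S.bilinear_pure one_closed])
  have up: "(\<lambda>b. S.pure u b) \<in> lin_maps K W S.T" by (rule bilinear_right[OF S.bilinear_pure one_closed])
  note b1 = bilinear_comp[OF S.TA.right_bilinear lin_comp[OF p_lin \<Delta>_lin] lin_comp[OF e_lin hat_lin]]
  note b2 = counit_bilinear'(1)[OF T lin_comp[OF e_lin up]]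
  note b3 = bilinear_comp[OF right_coprod_bilinear lin_id e_lin]
  note b4 = bilinear_post[OF conv_bilinear[OF conv_pe] pu]
  note b5 = bilinear_comp[OF S.bilinear_pure lin_id p_lin]
  note b6 = counit_bilinear'(2)[OF T pu]
  \<comment> \<open>If the left factor is not projected, the sum acquires the term 1 \<succ> e(b),
    so \<open>p_rec\<close> takes the closed form p(b) = sum of b1 \<succ> e(b2).\<close>
  have p: "p b = sw W (\<lambda>c d. R c (e d)) b" if b: "b \<in> carrier W" for b
  proof -
    note c = counit_bilinear'(1)[OF vspace_axioms e_lin]
    have "sw W (\<lambda>c d. R c (e d)) b = sw W (\<lambda>c d. \<epsilon> c \<odot>\<^bsub>W\<^esub> e d \<oplus>\<^bsub>W\<^esub> R (p c) (e d)) b"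
    proof (rule sw_cong[OF vspace_axioms bilinear_sum[OF vspace_axioms c conv_bilinear[OF conv_pe]] b])
      fix c d assume cd: "c \<in> carrier W" "d \<in> carrier W"
      have "R c (e d) = R (p c \<oplus>\<^bsub>W\<^esub> \<epsilon> c \<odot>\<^bsub>W\<^esub> u) (e d)" by (simp only: p_decomp[OF cd(1)])
      then show "R c (e d) = \<epsilon> c \<odot>\<^bsub>W\<^esub> e d \<oplus>\<^bsub>W\<^esub> R (p c) (e d)" using cd by (simp add: a_comm)
    qed
    then show ?thesis
      unfolding sw_add[OF vspace_axioms c conv_bilinear[OF conv_pe] b] sw_counit(1)[OF vspace_axioms e_lin b]
        conv_def[symmetric] p_rec[OF b] by simp
  qed
  have "\<Delta> (conv p e x) = sw S.T (\<lambda>a b. aright S.TA (\<Delta> (p a)) (hat (e b))) x"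
    unfolding IH[symmetric] conv_def sw_post[OF vspace_axioms T conv_bilinear[OF conv_pe] \<Delta>_lin x]
    by (rule sw_cong[OF T bilinear_comp[OF S.TA.right_bilinear lin_comp[OF p_lin \<Delta>_lin] lin_comp[OF e_lin \<Delta>_lin]] x])
      (simp add: \<Delta>_ops)
  then have "\<Delta> (conv p e x) \<oplus>\<^bsub>S.T\<^esub> S.pure u (e x) =
    sw S.T (\<lambda>a b. aright S.TA (\<Delta> (p a)) (hat (e b)) \<oplus>\<^bsub>S.T\<^esub> \<epsilon> a \<odot>\<^bsub>S.T\<^esub> S.pure u (e b)) x"
    unfolding sw_add[OF T b1 b2 x] sw_counit(1)[OF T lin_comp[OF e_lin up] x] by simp
  \<comment> \<open>Since \<open>right_coprod\<close> sends 1 and y to 1 \<otimes> y, the added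
    counit term is exactly the part of a along 1 that p had removed.\<close>
  also have "\<dots> = sw S.T (\<lambda>a b. right_coprod a (e b) \<oplus>\<^bsub>S.T\<^esub> S.pure (R (p a) (e b)) u) x"
  proof (rule sw_cong[OF T bilinear_sum[OF T b3 b4] x])
    fix a b assume ab: "a \<in> carrier W" "b \<in> carrier W"
    have "right_coprod u (e b) = S.pure u (e b)"
      unfolding right_coprod_def using ab by (simp add: sw_one[OF T right_pure_bilinear])
    moreover have "right_coprod a (e b) = right_coprod (p a \<oplus>\<^bsub>W\<^esub> \<epsilon> a \<odot>\<^bsub>W\<^esub> u) (e b)" by (simp only: p_decomp[OF ab(1)])
    ultimately show "aright S.TA (\<Delta> (p a)) (hat (e b)) \<oplus>\<^bsub>S.T\<^esub> \<epsilon> a \<odot>\<^bsub>S.T\<^esub> S.pure u (e b) =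
        right_coprod a (e b) \<oplus>\<^bsub>S.T\<^esub> S.pure (R (p a) (e b)) u"
      using ab by (simp add: right_hat right_coprod_simps S.T.a_ac)
  qed
  also have "\<dots> = sw S.T (\<lambda>a b. right_coprod a (e b)) x \<oplus>\<^bsub>S.T\<^esub> S.pure (conv p e x) u"
    unfolding sw_add[OF T b3 b4 x] conv_def sw_post[OF vspace_axioms T conv_bilinear[OF conv_pe] pu x] ..
  \<comment> \<open>Coassociativity turns the sum into x1 \<otimes> (x2 \<succ> e(x3)), whose second
    factor is p by the closed form above.\<close>
  also have "sw S.T (\<lambda>a b. right_coprod a (e b)) x = sw S.T (\<lambda>a b. S.pure a (p b)) x"
  proof -
    have "sw S.T (\<lambda>a b. right_coprod a (e b)) x = sw S.T (\<lambda>a b. sw S.T (\<lambda>c d. S.pure a (R c (e d))) b) x"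
      unfolding right_coprod_def
    proof (rule sw_coassoc[OF T x])
      fix b c assume bc: "b \<in> carrier W" "c \<in> carrier W"
      show "(\<lambda>a. S.pure a (R b (e c))) \<in> lin_maps K W S.T"
        by (rule bilinear_left[OF S.bilinear_pure]) (simp add: bc)
      show "(\<lambda>a. S.pure b (R a (e c))) \<in> lin_maps K W S.T"
        by (rule lin_comp[OF bilinear_left[OF right_bilinear] bilinear_right[OF S.bilinear_pure]]) (simp_all add: bc)
      show "(\<lambda>a. S.pure b (R c (e a))) \<in> lin_maps K W S.T"
        by (rule lin_comp[OF e_lin lin_comp[OF bilinear_right[OF right_bilinear] bilinear_right[OF S.bilinear_pure]]]) (simp_all add: bc)
    qed
    also have "\<dots> = sw S.T (\<lambda>a b. S.pure a (p b)) x"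
    proof (rule sw_cong[OF T b5 x])
      fix a b assume ab: "a \<in> carrier W" "b \<in> carrier W"
      show "sw S.T (\<lambda>c d. S.pure a (R c (e d))) b = S.pure a (p b)"
        unfolding p[OF ab(2)]
        by (rule sw_post[OF vspace_axioms T bilinear_comp[OF right_bilinear lin_id e_lin] bilinear_right[OF S.bilinear_pure ab(1)] ab(2), symmetric])
    qed
    finally show ?thesis .
  qed
  finally have "\<Delta> (conv p e x) \<oplus>\<^bsub>S.T\<^esub> S.pure u (e x) = sw S.T (\<lambda>a b. S.pure a (p b)) x \<oplus>\<^bsub>S.T\<^esub> S.pure (conv p e x) u" .
  \<comment> \<open>The coproduct of x, with its second factor decomposed along 1.\<close>
  moreover have "sw S.T (\<lambda>a b. S.pure a (p b)) x \<oplus>\<^bsub>S.T\<^esub> S.pure x u = \<Delta> x"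
  proof -
    have "\<Delta> x = sw S.T (\<lambda>a b. S.pure a (p b) \<oplus>\<^bsub>S.T\<^esub> \<epsilon> b \<odot>\<^bsub>S.T\<^esub> S.pure a u) x"
      unfolding sw_pure[OF x, symmetric]
    proof (rule sw_cong[OF T bilinear_sum[OF T b5 b6] x])
      fix a b assume ab: "a \<in> carrier W" "b \<in> carrier W"
      have "S.pure a b = S.pure a (p b \<oplus>\<^bsub>W\<^esub> \<epsilon> b \<odot>\<^bsub>W\<^esub> u)" by (simp only: p_decomp[OF ab(2)])
      then show "S.pure a b = S.pure a (p b) \<oplus>\<^bsub>S.T\<^esub> \<epsilon> b \<odot>\<^bsub>S.T\<^esub> S.pure a u" using ab by simp
    qed
    then show ?thesis unfolding sw_add[OF T b5 b6 x] sw_counit(2)[OF T pu x] by simp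
  qed
  moreover have "sw S.T (\<lambda>a b. S.pure a (p b)) x \<in> carrier S.T" by (rule sw_closed[OF T b5 x])
  ultimately show ?thesis using x conv_closed[OF conv_pe x] by (metis S.T.a_assoc S.T.a_comm S.pure_simps(1) one_closed)
qed

text \<open>Induction along the coradical filtration: for x in \<open>F (Suc k)\<close> the second
  Sweedler factor may be taken in \<open>F k\<close>, where e is already known to have primitive
  values.\<close>

lemma e_prim: "x \<in> carrier W \<Longrightarrow> e x \<in> prims"
proof -
  have "\<Delta> (e x) = hat (e x)" if "x \<in> F k" for k x
    using that
  proof (induction k arbitrary: x)
    case 0
    then have "e x = \<zero>\<^bsub>W\<^esub>" by (simp only: e_eq es.simps)
    then show ?case
      using lin_zero_vec[OF S.vspace_T aug_homs_lin[OF \<Delta>_hom]] lin_zero_vec[OF S.vspace_T hat_lin] by simp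
  next
    case (Suc k)
    have x: "x \<in> carrier W" by (rule F_subset[OF Suc.prems])
    note \<Delta>_lin = aug_homs_lin[OF \<Delta>_hom]
    have z: "\<Delta> \<zero>\<^bsub>W\<^esub> = \<zero>\<^bsub>S.T\<^esub>" by (rule lin_zero_vec[OF S.vspace_T \<Delta>_lin])
    have C: "conv p e x \<in> carrier W" by (rule conv_closed[OF conv_pe x])
    have "sw S.T (\<lambda>a b. aright S.TA (\<Delta> (p a)) (\<Delta> (e b))) x = sw S.T (\<lambda>a b. aright S.TA (\<Delta> (p a)) (hat (e b))) x"
      by (rule sw_tail[OF S.vspace_T
          bilinear_comp[OF S.TA.right_bilinear lin_comp[OF p_lin \<Delta>_lin] lin_comp[OF e_lin \<Delta>_lin]]
          bilinear_comp[OF S.TA.right_bilinear lin_comp[OF p_lin \<Delta>_lin] lin_comp[OF e_lin hat_lin]] _ _ _ Suc.prems])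
        (simp_all add: z Suc.IH)
    from comult_conv[OF x this]
    have 1: "\<Delta> (conv p e x) \<oplus>\<^bsub>S.T\<^esub> S.pure u (e x) \<oplus>\<^bsub>S.T\<^esub> S.pure x u = \<Delta> x \<oplus>\<^bsub>S.T\<^esub> S.pure (conv p e x) u" .
    have dec: "x = e x \<oplus>\<^bsub>W\<^esub> conv p e x \<oplus>\<^bsub>W\<^esub> \<epsilon> x \<odot>\<^bsub>W\<^esub> u" using p_decomp[OF x] p_rec[OF x] by simp
    have 2: "\<Delta> x = \<Delta> (e x) \<oplus>\<^bsub>S.T\<^esub> \<Delta> (conv p e x) \<oplus>\<^bsub>S.T\<^esub> \<epsilon> x \<odot>\<^bsub>S.T\<^esub> S.pure u u"
    proof -
      have "\<Delta> x = \<Delta> (e x \<oplus>\<^bsub>W\<^esub> conv p e x \<oplus>\<^bsub>W\<^esub> \<epsilon> x \<odot>\<^bsub>W\<^esub> u)" using dec by simp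
      then show ?thesis using x C by (simp add: \<Delta>_ops)
    qed
    have 3: "S.pure x u = S.pure (e x) u \<oplus>\<^bsub>S.T\<^esub> S.pure (conv p e x) u \<oplus>\<^bsub>S.T\<^esub> \<epsilon> x \<odot>\<^bsub>S.T\<^esub> S.pure u u"
    proof -
      have "S.pure x u = S.pure (e x \<oplus>\<^bsub>W\<^esub> conv p e x \<oplus>\<^bsub>W\<^esub> \<epsilon> x \<odot>\<^bsub>W\<^esub> u) u" using dec by simp
      then show ?thesis using x C by simp
    qed
    \<comment> \<open>Everything that the two sides have in common, including the 1 \<otimes> 1 term
      of an x outside the kernel of \<epsilon>; cancelling it leaves the claim.\<close>
    define Z where "Z = \<Delta> (conv p e x) \<oplus>\<^bsub>S.T\<^esub> (S.pure (conv p e x) u \<oplus>\<^bsub>S.T\<^esub> \<epsilon> x \<odot>\<^bsub>S.T\<^esub> S.pure u u)"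
    have Z: "Z \<in> carrier S.T" using C x by (simp add: Z_def)
    have "hat (e x) \<oplus>\<^bsub>S.T\<^esub> Z = \<Delta> (conv p e x) \<oplus>\<^bsub>S.T\<^esub> S.pure u (e x) \<oplus>\<^bsub>S.T\<^esub> S.pure x u"
      unfolding 3 using C x by (simp add: Z_def hat_def S.T.a_ac)
    also have "\<dots> = \<Delta> (e x) \<oplus>\<^bsub>S.T\<^esub> Z"
      unfolding 1 2 using C x by (simp add: Z_def S.T.a_ac)
    finally have "hat (e x) \<oplus>\<^bsub>S.T\<^esub> Z = \<Delta> (e x) \<oplus>\<^bsub>S.T\<^esub> Z" .
    then show ?case using S.T.add.right_cancel[of Z "hat (e x)" "\<Delta> (e x)"] Z x by simp
  qed
  moreover assume "x \<in> carrier W"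
  ultimately show "e x \<in> prims" unfolding prims_def using F_ex by simp blast
qed

subsection \<open>The words in primitive elements span\<close>

text \<open>\<open>conv_iter e k x\<close> is the sum of e(x1) \<succ> ... \<succ> e(x_{k+1}),
  bracketed to the left, hence a combination of words of length k + 1 in primitive elements.\<close>

primrec conv_iter :: "('a \<Rightarrow> 'a) \<Rightarrow> nat \<Rightarrow> 'a \<Rightarrow> 'a" where
  "conv_iter f 0 = f"
| "conv_iter f (Suc k) = conv (conv_iter f k) e"

lemma conv_iter_lin: "f \<in> lin_maps K W W \<Longrightarrow> conv_iter f k \<in> lin_maps K W W"
  by (induction k) (simp_all add: conv_lin[OF _ e_lin])

lemma right_e_lin: "y \<in> carrier W \<Longrightarrow> (\<lambda>z. R y (e z)) \<in> lin_maps K W W"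
  by (rule lin_comp[OF e_lin bilinear_right[OF right_bilinear]])

text \<open>Linearity also in the prefix y is what permits y to be a Sweedler factor in
  \<open>conv_iter_Suc\<close>.\<close>

lemma conv_iter_right_bilinear: "bilinear K W W W (\<lambda>y. conv_iter (\<lambda>z. R y (e z)) k)"
proof -
  have "(\<lambda>y. conv_iter (\<lambda>z. R y (e z)) k b) \<in> lin_maps K W W" if "b \<in> carrier W" for b
    using that
  proof (induction k arbitrary: b)
    case 0
    then show ?case using bilinear_left[OF right_bilinear] by simp
  next
    case (Suc k)
    have "(\<lambda>y. sw W (\<lambda>a c. R (conv_iter (\<lambda>z. R y (e z)) k a) (e c)) b) \<in> lin_maps K W W"
      by (rule sw_lin_param[OF vspace_axioms vspace_axioms Suc.prems])
        (simp_all add: conv_bilinear[OF conv_iter_lin[OF right_e_lin] e_lin]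
          lin_comp[OF Suc.IH bilinear_left[OF right_bilinear]])
    then show ?case by (simp add: conv_def[abs_def])
  qed
  then show ?thesis unfolding bilinear_def by (auto intro!: conv_iter_lin[OF right_e_lin])
qed

text \<open>Reassociates the iterated convolution, so that the recursion is in the right tensor factor,
  where the filtration degree drops.\<close>

lemma conv_iter_Suc:
  assumes f: "f \<in> lin_maps K W W" and x: "x \<in> carrier W"
  shows "conv_iter f (Suc k) x = sw W (\<lambda>a b. conv_iter (\<lambda>z. R (f a) (e z)) k b) x"
  using x
proof (induction k arbitrary: x)
  case (Suc k)
  note H = conv_iter_right_bilinear and v = vspace_axioms
  have "conv_iter f (Suc (Suc k)) x = sw W (\<lambda>a b. R (conv_iter f (Suc k) a) (e b)) x"
    by (simp only: conv_iter.simps(2)[of f "Suc k"] conv_def)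
  also have "\<dots> = sw W (\<lambda>a b. sw W (\<lambda>c d. R (conv_iter (\<lambda>z. R (f c) (e z)) k d) (e b)) a) x"
  proof (rule sw_cong[OF v _ Suc.prems, symmetric])
    show "bilinear K W W W (\<lambda>a b. R (conv_iter f (Suc k) a) (e b))"
      by (rule conv_bilinear[OF conv_iter_lin[OF f] e_lin])
    fix a b assume ab: "a \<in> carrier W" "b \<in> carrier W"
    have "R (conv_iter f (Suc k) a) (e b) = R (sw W (\<lambda>c d. conv_iter (\<lambda>z. R (f c) (e z)) k d) a) (e b)"
      by (simp only: Suc.IH[OF ab(1)])
    also have "\<dots> = sw W (\<lambda>c d. R (conv_iter (\<lambda>z. R (f c) (e z)) k d) (e b)) a"
      by (rule sw_post[OF v v bilinear_comp[OF H f lin_id] bilinear_left[OF right_bilinear] ab(1)]) (simp add: ab)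
    finally show "sw W (\<lambda>c d. R (conv_iter (\<lambda>z. R (f c) (e z)) k d) (e b)) a = R (conv_iter f (Suc k) a) (e b)" ..
  qed
  also have "\<dots> = sw W (\<lambda>a b. sw W (\<lambda>c d. R (conv_iter (\<lambda>z. R (f a) (e z)) k c) (e d)) b) x"
  proof (rule sw_coassoc[OF v Suc.prems])
    fix b c assume bc: "b \<in> carrier W" "c \<in> carrier W"
    show "(\<lambda>a. R (conv_iter (\<lambda>z. R (f a) (e z)) k b) (e c)) \<in> lin_maps K W W"
      by (rule lin_comp[OF f lin_comp[OF bilinear_left[OF H] bilinear_left[OF right_bilinear]]]) (simp_all add: bc)
    show "(\<lambda>a. R (conv_iter (\<lambda>z. R (f b) (e z)) k a) (e c)) \<in> lin_maps K W W"
      by (rule lin_comp[OF bilinear_right[OF H] bilinear_left[OF right_bilinear]]) (simp_all add: bc lin_closed[OF f])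
    show "(\<lambda>a. R (conv_iter (\<lambda>z. R (f b) (e z)) k c) (e a)) \<in> lin_maps K W W"
      by (rule right_e_lin) (simp add: bc lin_closed[OF f] bilinear_simps(1)[OF H])
  qed
  finally show ?case by (simp only: conv_iter.simps(2)[of _ k] conv_def[abs_def])
qed (simp add: conv_def)

text \<open>After \<open>conv_iter_Suc\<close> the inner iteration starts from z -> f(a) \<succ>
  e(z), which again vanishes at 1, so the induction runs over all such f.\<close>

lemma conv_iter_vanish:
  "\<lbrakk>f \<in> lin_maps K W W; f u = \<zero>\<^bsub>W\<^esub>; x \<in> F k\<rbrakk> \<Longrightarrow> conv_iter f k x = \<zero>\<^bsub>W\<^esub>"
proof (induction k arbitrary: f x)
  case 0
  then obtain a where "x = a \<odot>\<^bsub>W\<^esub> u" "a \<in> carrier K" unfolding F_zero by blast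
  then show ?case using 0 by (simp add: lin_smult[OF 0(1)])
next
  case (Suc k)
  note f = Suc.prems(1) and x = F_subset[OF Suc.prems(3)]
  note b = bilinear_comp[OF conv_iter_right_bilinear f lin_id]
  have v: "conv_iter (\<lambda>z. R (f a) (e z)) k d = \<zero>\<^bsub>W\<^esub>" if "a \<in> carrier W" "d \<in> F k" for a d
    using that by (intro Suc.IH right_e_lin) (simp_all add: lin_closed[OF f])
  have "sw W (\<lambda>a d. conv_iter (\<lambda>z. R (f a) (e z)) k d) x = sw W (\<lambda>_ _. \<zero>\<^bsub>W\<^esub>) x"
  proof (rule sw_tail[OF vspace_axioms b _ _ _ v Suc.prems(3)])
    show "bilinear K W W W (\<lambda>_ _. \<zero>\<^bsub>W\<^esub>)" by (intro bilinearI) simp_all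
    show "conv_iter (\<lambda>z. R (f u) (e z)) k d = \<zero>\<^bsub>W\<^esub>" if "d \<in> carrier W" for d
      using bilinear_zero(1)[OF conv_iter_right_bilinear vspace_axioms vspace_axioms vspace_axioms that]
      by (simp add: Suc.prems(2))
  qed simp
  then show ?case unfolding conv_iter_Suc[OF f x] by (simp add: sw_zero[OF vspace_axioms x])
qed

text \<open>Substitutes p = e + (convolution of p and e) into the leftmost factor.\<close>

lemma conv_iter_p:
  "x \<in> carrier W \<Longrightarrow> conv_iter p k x = conv_iter e k x \<oplus>\<^bsub>W\<^esub> conv_iter p (Suc k) x"
proof (induction k arbitrary: x)
  case 0
  then show ?case using p_rec by simp
next
  case (Suc k)
  note l = conv_iter_lin[OF p_lin] conv_iter_lin[OF e_lin]
  have "conv (conv_iter p k) e x = sw W (\<lambda>a b. R (conv_iter e k a) (e b) \<oplus>\<^bsub>W\<^esub> R (conv_iter p (Suc k) a) (e b)) x"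
    unfolding conv_def
    by (rule sw_cong[OF vspace_axioms bilinear_sum[OF vspace_axioms conv_bilinear[OF l(2) e_lin] conv_bilinear[OF l(1) e_lin]] Suc.prems])
      (simp only: Suc.IH right_simps lin_closed[OF l(1)] lin_closed[OF l(2)] e_simps)
  also have "\<dots> = conv (conv_iter e k) e x \<oplus>\<^bsub>W\<^esub> conv (conv_iter p (Suc k)) e x"
    unfolding sw_add[OF vspace_axioms conv_bilinear[OF l(2) e_lin] conv_bilinear[OF l(1) e_lin] Suc.prems] conv_def ..
  finally show ?case by (simp only: conv_iter.simps(2))
qed

lemma prim_words:
  shows "submodule (word_span prims) K W" "set c \<subseteq> prims \<Longrightarrow> s c \<in> word_span prims"
    "\<lbrakk>y \<in> word_span prims; b \<in> prims\<rbrakk> \<Longrightarrow> R y b \<in> word_span prims"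
  using word_span_submodule[OF prims_pos prims_brace] word_in_span[OF prims_pos prims_brace]
    word_span_right[OF prims_pos prims_brace] by blast+

lemma conv_iter_e_in_span: "x \<in> carrier W \<Longrightarrow> conv_iter e k x \<in> word_span prims"
proof (induction k arbitrary: x)
  case 0
  have "s [e x] \<in> word_span prims" using 0 e_prim by (intro prim_words(2)) auto
  then show ?case using 0 by (simp add: aug_s_def)
next
  case (Suc k)
  show ?case
    unfolding conv_iter.simps conv_def
    by (rule sw_in_submodule[OF vspace_axioms conv_bilinear[OF conv_iter_lin[OF e_lin] e_lin] prim_words(1) _ Suc.prems])
      (rule prim_words(3)[OF Suc.IH e_prim])
qed

text \<open>Iterating \<open>conv_iter_p\<close> writes p(x) as the sum of
  \<open>conv_iter e i x\<close> for i < k plus the remainder \<open>conv_iter p k x\<close>, and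
  the remainder vanishes for x in \<open>F k\<close>. The component along 1 is the empty
  word.\<close>

lemma prims_span: "carrier W \<subseteq> word_span prims"
proof
  fix x assume x: "x \<in> carrier W"
  note N = submodule_facts[OF prim_words(1)]
  obtain k where k: "x \<in> F k" using F_ex x by blast
  have "conv_iter p i x \<in> word_span prims" if "i \<le> k" for i
    using that
  proof (induction i rule: inc_induct)
    case base
    have "conv_iter p k x = \<zero>\<^bsub>W\<^esub>" by (rule conv_iter_vanish[OF p_lin p_one k])
    then show ?case using N(2) by simp
  next
    case (step i)
    then show ?case unfolding conv_iter_p[OF x, of i] by (intro N(5) conv_iter_e_in_span[OF x])
  qed
  from this[of 0] have "p x \<in> word_span prims" by simp
  moreover have "u \<in> word_span prims" using prim_words(2)[of "[]"] by simp
  ultimately have "p x \<oplus>\<^bsub>W\<^esub> \<epsilon> x \<odot>\<^bsub>W\<^esub> u \<in> word_span prims" using x by (intro N(4,5)) simp_all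
  then show "x \<in> word_span prims" by (simp only: p_decomp[OF x])
qed

subsection \<open>Reading off the letters of a word\<close>

lemma e_of_prim: "b \<in> prims \<Longrightarrow> e b = b"
proof -
  assume "b \<in> prims"
  then have b: "b \<in> carrier W" "\<Delta> b = hat b" "\<epsilon> b = \<zero>" using prims_pos by (auto simp: prims_def)
  have "conv p e b = \<zero>\<^bsub>W\<^esub>"
    unfolding conv_def sw_prim[OF vspace_axioms conv_bilinear[OF conv_pe] b(1,2)] using b by simp
  then show ?thesis using b by (simp add: e_rec)
qed

text \<open>The coproduct of a word in primitive elements b is the word in b \<otimes> 1 + 1
  \<otimes> b, which \<open>word_hat\<close> expands by deconcatenation.\<close>

lemma sw_word:
  assumes E: "vspace K E" and f: "bilinear K W W E f" and c: "set c \<subseteq> prims"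
  shows "sw E f (s c) = split_sum E (\<lambda>v w. f (s v) (s w)) c"
proof -
  have c': "set c \<subseteq> pos_set" "set c \<subseteq> carrier W" using c prims_pos by auto
  have "map \<Delta> c = map hat c" using c by (auto simp: prims_def)
  then have "\<Delta> (s c) = split_sum S.T (\<lambda>v w. S.pure (s v) (s w)) c"
    using aug_homs_word[OF S.TA.augmented_axioms \<Delta>_hom c'(2)] word_hat[OF c'(1)] by (simp only:)
  moreover have "tensor_lift K E f (split_sum S.T (\<lambda>v w. S.pure (s v) (s w)) c) =
      split_sum E (\<lambda>v w. tensor_lift K E f (S.pure (s v) (s w))) c"
    using c' by (intro S.T.split_sum_lin[OF S.tensor_lift_lin[OF E f]]) auto
  ultimately have "sw E f (s c) = split_sum E (\<lambda>v w. tensor_lift K E f (S.pure (s v) (s w))) c"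
    unfolding sw_def by simp
  also have "\<dots> = split_sum E (\<lambda>v w. f (s v) (s w)) c"
    using c' by (intro split_sum_cong S.tensor_lift_pure[OF E f]) auto
  finally show ?thesis .
qed

text \<open>Only the factorization with a one letter second factor survives.\<close>

lemma sw_last_letter:
  assumes E: "vspace K E" and f: "bilinear K W W E f" and c: "set c \<subseteq> prims" "b \<in> prims"
    and f1: "\<And>v. v \<in> carrier W \<Longrightarrow> f v u = \<zero>\<^bsub>E\<^esub>"
    and f2: "\<And>v w. \<lbrakk>c = v @ w; w \<noteq> []\<rbrakk> \<Longrightarrow> f (s v) (s (w @ [b])) = \<zero>\<^bsub>E\<^esub>"
  shows "sw E f (s (c @ [b])) = f (s c) b"
proof -
  interpret E: vspace K E by fact
  have cb: "set c \<subseteq> carrier W" "b \<in> carrier W" "\<epsilon> b = \<zero>" using c prims_pos by auto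
  have cl: "f (s v) (s w) \<in> carrier E" if "c @ [b] = v @ w" for v w
  proof -
    have "set v \<union> set w = set (c @ [b])" using that by (metis set_append)
    also have "\<dots> \<subseteq> carrier W" using cb by simp
    finally show ?thesis by (simp add: bilinear_simps(1)[OF f])
  qed
  have "sw E f (s (c @ [b])) = split_sum E (\<lambda>v w. f (s v) (s w)) (c @ [b])"
    using c by (intro sw_word[OF E f]) auto
  also have "\<dots> = split_sum E (\<lambda>v w. f (s v) (s (w @ [b]))) c \<oplus>\<^bsub>E\<^esub> f (s (c @ [b])) (s [])"
    by (rule E.split_sum_snoc[OF cl])
  also have "split_sum E (\<lambda>v w. f (s v) (s (w @ [b]))) c = f (s c) (s ([] @ [b]))"
    using cl[of c "[b]"] f2 by (intro E.split_sum_last) simp_all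
  finally show ?thesis using cb s_single by (simp add: f1 bilinear_simps(1)[OF f])
qed

text \<open>In the convolution of p and e every last factor of two or more letters dies: by
  induction, or, if it is the whole word, because p(1) = 0. What remains is \<open>s c\<close>
  \<succ> b, the word itself, and e is the difference of p and this convolution.\<close>

lemma e_of_word:
  assumes "set c \<subseteq> prims" "b \<in> prims" "c \<noteq> []"
  shows "e (s (c @ [b])) = \<zero>\<^bsub>W\<^esub>"
  using assms
proof (induction "length c" arbitrary: c rule: less_induct)
  case less
  have cb: "set c \<subseteq> carrier W" "b \<in> carrier W" "\<epsilon> b = \<zero>" using less.prems prims_pos by auto
  have "conv p e (s (c @ [b])) = R (p (s c)) (e b)"
    unfolding conv_def
  proof (rule sw_last_letter[OF vspace_axioms conv_bilinear[OF conv_pe] less.prems(1,2)])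
    fix v w assume c: "c = v @ w" "w \<noteq> []"
    show "R (p (s v)) (e (s (w @ [b]))) = \<zero>\<^bsub>W\<^esub>"
    proof (cases "v = []")
      case True
      have "s (w @ [b]) \<in> carrier W" using c cb by (intro s_closed) auto
      then show ?thesis using True by (simp del: aug_s_simps(2))
    next
      case False
      then have "e (s (w @ [b])) = \<zero>\<^bsub>W\<^esub>" using c less.prems by (intro less.hyps) auto
      moreover have "s v \<in> carrier W" using c cb by (intro s_closed) auto
      ultimately show ?thesis by simp
    qed
  qed simp
  also have "\<dots> = s (c @ [b])" using cb less.prems by (simp add: e_of_prim)
  finally show ?case using cb by (simp add: e_rec a_minus_def r_neg del: e_simps)
qed

text \<open>Rebuilds a word in another algebra from its last letter backwards, with t reading off
  single letters. The depth k bounds the number of letters that are recovered.\<close>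

primrec psi :: "('k, 'e, 'n) module_scheme \<Rightarrow> ('k, 'e) aug \<Rightarrow> ('a \<Rightarrow> 'e) \<Rightarrow> nat \<Rightarrow> 'a \<Rightarrow> 'e" where
  "psi U A' t 0 x = \<zero>\<^bsub>U\<^esub>"
| "psi U A' t (Suc k) x = t x \<oplus>\<^bsub>U\<^esub> sw U (\<lambda>a b. aright A' (psi U A' t k a) (t b)) x"

context
  fixes U :: "('k, 'e, 'n) module_scheme" and A' t
  assumes A': "augmented K U A'" and t: "t \<in> lin_maps K W U" and t_one: "t u = \<zero>\<^bsub>U\<^esub>"
    and t_pos: "\<And>b. b \<in> prims \<Longrightarrow> aeps A' (t b) = \<zero>"
    and t_word: "\<And>c b. \<lbrakk>set c \<subseteq> prims; b \<in> prims; c \<noteq> []\<rbrakk> \<Longrightarrow> t (s (c @ [b])) = \<zero>\<^bsub>U\<^esub>"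
begin

interpretation U: augmented K U A' by (rule A')

lemma psi_lin: "psi U A' t k \<in> lin_maps K W U"
proof (induction k)
  case 0
  show ?case by (rule lin_cong[OF lin_zero_map[OF U.vspace_axioms] _ vspace_axioms]) simp
next
  case (Suc k)
  show ?case
    by (rule lin_cong[OF lin_sum[OF U.vspace_axioms t sw_lin[OF U.vspace_axioms bilinear_comp[OF U.right_bilinear Suc t]]] _ vspace_axioms]) simp
qed

lemma psi_bilinear: "bilinear K W W U (\<lambda>a b. aright A' (psi U A' t k a) (t b))"
  by (rule bilinear_comp[OF U.right_bilinear psi_lin t])

lemma psi_one: "psi U A' t k u = \<zero>\<^bsub>U\<^esub>"
  by (cases k) (simp_all add: t_one sw_one[OF U.vspace_axioms psi_bilinear] lin_closed[OF psi_lin])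

text \<open>As t kills words of two or more letters, the first summand accounts for one-letter
  words, and for longer words \<open>sw_last_letter\<close> leaves only the last letter attached to
  the image of the rest.\<close>

lemma psi_word:
  "\<lbrakk>set c \<subseteq> prims; c \<noteq> []; length c \<le> k\<rbrakk> \<Longrightarrow> psi U A' t k (s c) = aug_s A' (map t c)"
proof (induction k arbitrary: c)
  case (Suc k)
  then obtain w b where c: "c = w @ [b]" by (metis rev_exhaust)
  have wb: "set w \<subseteq> prims" "b \<in> prims" "set w \<subseteq> carrier W" "b \<in> carrier W" "\<epsilon> b = \<zero>"
    using Suc.prems prims_pos c by auto
  have sw: "sw U (\<lambda>a b. aright A' (psi U A' t k a) (t b)) (s c) = aright A' (psi U A' t k (s w)) (t b)"
    unfolding c
  proof (rule sw_last_letter[OF U.vspace_axioms psi_bilinear wb(1,2)])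
    fix v x assume vx: "w = v @ x" "x \<noteq> []"
    then have "t (s (x @ [b])) = \<zero>\<^bsub>U\<^esub>" using wb by (intro t_word) auto
    moreover have "s v \<in> carrier W" using vx wb by (intro s_closed) auto
    ultimately show "aright A' (psi U A' t k (s v)) (t (s (x @ [b]))) = \<zero>\<^bsub>U\<^esub>"
      by (simp add: lin_closed[OF psi_lin] del: aug_s_simps(2))
  qed (simp add: t_one lin_closed[OF psi_lin])
  show ?case
  proof (cases "w = []")
    case True
    then show ?thesis
      using sw wb c by (simp add: psi_one lin_closed[OF t] t_pos s_single U.s_single)
  next
    case False
    have "psi U A' t k (s w) = aug_s A' (map t w)" using Suc.IH[of w] False Suc.prems c by auto
    moreover have "t (s c) = \<zero>\<^bsub>U\<^esub>" unfolding c by (rule t_word[OF wb(1,2) False])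
    moreover have "set (map t w) \<subseteq> carrier U" using wb(3) lin_closed[OF t] by auto
    ultimately show ?thesis using sw wb(4) by (simp add: c lin_closed[OF t])
  qed
qed simp

end

end

subsection \<open>Bijectivity of a map that is the identity on primitive elements\<close>

text \<open>From here on U(B) enters through its morphisms and generators, and its representation by
  pairs should stay folded.\<close>

declare unitization_simps [simp del] aug_of_simps [simp del]

context connected_augmented begin

context
  fixes U :: "('k, 'e, 'n) module_scheme" and A' f j
  assumes A': "augmented K U A'" and f: "f \<in> aug_homs K U A' W A"
    and j_lin: "(\<lambda>x. j (e x)) \<in> lin_maps K W U"
    and j_pos: "\<And>b. b \<in> prims \<Longrightarrow> aeps A' (j b) = \<zero>"
    and fj: "\<And>b. b \<in> prims \<Longrightarrow> f (j b) = b"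
begin

interpretation U: augmented K U A' by (rule A')

text \<open>\<open>j\<close> is meaningful on primitive elements only, which is why its linearity is
  stated after composition with e; on primitive elements e is the identity.\<close>

lemma section_closed: "b \<in> prims \<Longrightarrow> j b \<in> carrier U"
  using lin_closed[OF j_lin, of b] prims_pos e_of_prim by auto

lemma section_word:
  assumes "set c \<subseteq> prims" shows "f (aug_s A' (map j c)) = s c"
proof -
  have "f (aug_s A' (map j c)) = s (map f (map j c))"
    using assms section_closed by (intro U.aug_homs_word[OF augmented_axioms f]) auto
  also have "map f (map j c) = c"
    using assms fj by (induction c) auto
  finally show ?thesis .
qed

text \<open>The image is a subspace that contains all words in primitive elements, and these span by
  \<open>prims_span\<close>.\<close>

lemma section_surj: "f ` carrier U = carrier W"
proof
  show "f ` carrier U \<subseteq> carrier W" using lin_closed[OF aug_homs_lin[OF f]] by blast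
  have "word_span prims \<subseteq> f ` carrier U"
    unfolding word_span_def
  proof (rule span_least[OF _ U.lin_image_submodule[OF vspace_axioms aug_homs_lin[OF f]]], rule subsetI)
    fix x assume "x \<in> {s c |c. set c \<subseteq> prims}"
    then obtain c where c: "x = s c" "set c \<subseteq> prims" by blast
    have "aug_s A' (map j c) \<in> carrier U" using c(2) section_closed by (intro U.s_closed) auto
    then show "x \<in> f ` carrier U" unfolding c(1) section_word[OF c(2), symmetric] by blast
  qed
  then show "carrier W \<subseteq> f ` carrier U" using prims_span by blast
qed

lemma section_inj:
  assumes gen: "aug_generated K U A' (j ` prims)"
    and jb: "\<And>x c. \<lbrakk>x \<in> prims; set c \<subseteq> prims\<rbrakk> \<Longrightarrow> aug_brace U A' (j x) (map j c) \<in> j ` prims"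
  shows "inj_on f (carrier U)"
proof -
  define t where "t = (\<lambda>x. j (e x))"
  \<comment> \<open>Obtained from the linear composite, since e maps zero to zero.\<close>
  have j0: "j \<zero>\<^bsub>W\<^esub> = \<zero>\<^bsub>U\<^esub>"
    using lin_zero_vec[OF U.vspace_axioms j_lin] lin_zero_vec[OF vspace_axioms e_lin] by simp
  note t = j_lin[folded t_def]
  have tb: "t b = j b" if "b \<in> prims" for b using that by (simp add: t_def e_of_prim)
  have t1: "t u = \<zero>\<^bsub>U\<^esub>" by (simp add: t_def j0)
  have tp: "aeps A' (t b) = \<zero>" if "b \<in> prims" for b using that by (simp add: tb j_pos)
  have tw: "t (s (c @ [b])) = \<zero>\<^bsub>U\<^esub>" if "set c \<subseteq> prims" "b \<in> prims" "c \<noteq> []" for c b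
    unfolding t_def e_of_word[OF that] j0 ..
  have P: "psi U A' t k \<in> lin_maps K W U" "psi U A' t k u = \<zero>\<^bsub>U\<^esub>"
    "\<lbrakk>set c \<subseteq> prims; c \<noteq> []; length c \<le> k\<rbrakk> \<Longrightarrow> psi U A' t k (s c) = U.s (map t c)" for k c
    using psi_lin[OF A' t t1] psi_one[OF A' t t1] psi_word[OF A' t t1] tp tw by blast+
  define \<Psi> where "\<Psi> m y = \<epsilon> (f y) \<odot>\<^bsub>U\<^esub> aone A' \<oplus>\<^bsub>U\<^esub> psi U A' t m (f y)" for m y
  note fl = lin_simps[OF aug_homs_lin[OF f]]
  have \<Psi>_lin: "\<Psi> m \<in> lin_maps K U U" for m
    by (rule lin_mapsI)
      (simp_all add: \<Psi>_def fl lin_simps[OF P(1)] U.smult_l_distr U.smult_r_distr U.smult_assoc1 U.a_ac)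
  \<comment> \<open>A single m does not work for all of U, but the elements fixed by all
    sufficiently late \<open>\<Psi> m\<close> form a subspace.\<close>
  define N where "N = {y \<in> carrier U. \<exists>k. \<forall>m\<ge>k. \<Psi> m y = y}"
  have N: "submodule N K U"
  proof (rule U.submodule_spaceI)
    show "N \<subseteq> carrier U" by (auto simp: N_def)
    show "\<zero>\<^bsub>U\<^esub> \<in> N" by (simp add: N_def U.lin_zero_vec[OF U.vspace_axioms \<Psi>_lin])
    show "x \<oplus>\<^bsub>U\<^esub> y \<in> N" if "x \<in> N" "y \<in> N" for x y
    proof -
      from that obtain k l where "\<forall>m\<ge>k. \<Psi> m x = x" "\<forall>m\<ge>l. \<Psi> m y = y" "x \<in> carrier U" "y \<in> carrier U"
        by (auto simp: N_def)
      then show ?thesis by (auto simp: N_def lin_add[OF \<Psi>_lin] intro!: exI[of _ "max k l"])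
    qed
    show "a \<odot>\<^bsub>U\<^esub> x \<in> N" if "a \<in> carrier K" "x \<in> N" for a x
    proof -
      from that obtain k where "\<forall>m\<ge>k. \<Psi> m x = x" "x \<in> carrier U" by (auto simp: N_def)
      then show ?thesis using that(1) by (auto simp: N_def lin_smult[OF \<Psi>_lin] intro!: exI[of _ k])
    qed
  qed
  have "U.word_span (j ` prims) \<subseteq> N"
    unfolding U.word_span_def
  proof (rule U.span_least[OF _ N], rule subsetI)
    fix y assume "y \<in> {U.s c |c. set c \<subseteq> j ` prims}"
    \<comment> \<open>A word in the image letters is lifted letter by letter to a word in primitive
      elements.\<close>
    then obtain c' where c': "y = U.s c'" "c' \<in> lists (j ` prims)" by (auto simp: lists_eq_set)
    then obtain c where c: "y = U.s (map j c)" "set c \<subseteq> prims" unfolding lists_image by auto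
    have y: "y \<in> carrier U" unfolding c(1) using c(2) section_closed by (intro U.s_closed) auto
    have sc: "set c \<subseteq> carrier W" using c(2) prims_pos by auto
    have "\<Psi> m y = y" if "length c \<le> m" for m
    proof (cases "c = []")
      case True
      then show ?thesis using section_word[OF c(2)] by (simp add: \<Psi>_def c(1) P(2))
    next
      case False
      have m: "map t c = map j c" using c(2) tb by (intro map_cong) auto
      then show ?thesis
        using P(3)[OF c(2) False that, unfolded m] False y section_word[OF c(2)] sc unfolding \<Psi>_def c(1) by simp
    qed
    then show "y \<in> N" using y by (auto simp: N_def)
  qed
  moreover have "carrier U \<subseteq> U.word_span (j ` prims)"
  proof (rule U.generated_word_span[OF _ _ gen])
    show "j ` prims \<subseteq> U.pos_set" using section_closed j_pos by auto
    fix x c assume x: "x \<in> j ` prims" and "set c \<subseteq> j ` prims"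
    then have "c \<in> lists (j ` prims)" by (auto simp: lists_eq_set)
    then obtain d where d: "c = map j d" "set d \<subseteq> prims" unfolding lists_image by auto
    from x obtain b where "x = j b" "b \<in> prims" by (rule imageE)
    then show "aug_brace U A' x c \<in> j ` prims" using jb[of b d] d by simp
  qed
  ultimately have all: "carrier U \<subseteq> N" by (rule order_trans[rotated])
  show ?thesis
  proof (rule inj_onI)
    fix x y assume "x \<in> carrier U" "y \<in> carrier U" and eq: "f x = f y"
    then have "x \<in> N" "y \<in> N" using all by (auto intro: subsetD)
    then obtain k l where "\<forall>m\<ge>k. \<Psi> m x = x" "\<forall>m\<ge>l. \<Psi> m y = y" unfolding N_def by auto
    then have "\<Psi> (max k l) x = x" "\<Psi> (max k l) y = y" by (meson max.cobounded1 max.cobounded2)+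
    then show "x = y" unfolding \<Psi>_def eq by (rule trans[OF sym])
  qed
qed

end

end

subsection \<open>The canonical map\<close>

lemma tensor_map_hat:
  assumes "augmented K W A" "augmented K W' A'" "f \<in> aug_homs K W A W' A'" "x \<in> carrier W"
  shows "tensor_map K W' W' f f (augmented.hat K W A x) = augmented.hat K W' A' (f x)"
proof -
  interpret A: augmented K W A by fact
  interpret A': augmented K W' A' by fact
  interpret T: two_augs K W A W A by (intro two_augs.intro A.augmented_axioms)
  note l = aug_homs_lin[OF assms(3)]
  note tm = tensor_map_lin[OF A.vspace_axioms A.vspace_axioms A'.vspace_axioms A'.vspace_axioms l l]
  show ?thesis
    using assms(4) by (simp add: A.hat_def A'.hat_def lin_add[OF tm(1)] tm(2) aug_homs_simps(1)[OF assms(3)])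
qed

lemma connected_dend_bialgD:
  assumes "connected_dend_bialg K D"
  shows "unital_dendriform_algebra K D" and "connected_augmented K D (aug_of K D) (comult D)"
proof -
  have b: "dendriform_bialgebra K D" and c: "connected_coalgebra K D (comult D) \<one>\<^bsub>D\<^esub>"
    using assms by (auto simp: connected_dend_bialg_def)
  show u: "unital_dendriform_algebra K D" by (rule dendriform_bialgebra.axioms(1)[OF b])
  have h: "comult D \<in> aug_homs K D (aug_of K D) (tensor K D D) (tensor_aug K D (aug_of K D) D (aug_of K D))"
    using b unfolding dendriform_bialgebra_iff[OF u] by blast
  show "connected_augmented K D (aug_of K D) (comult D)"
    using c h dendriform_bialgebra.axioms(2)[OF b]
    by (intro connected_augmented.intro connected_augmented_axioms.intro unital_dendriform_algebra.augmented_aug_of[OF u])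
      (auto simp: connected_coalgebra_def aug_of_simps)
qed

section \<open>A connected bialgebra and the enveloping algebra of its primitive elements\<close>

locale connected_bialgebra =
  fixes K :: "('k, 'm) ring_scheme" (structure) and D :: "('k, 'a) dend_bialg"
  assumes connected: "connected_dend_bialg K D"
begin

abbreviation "DA \<equiv> aug_of K D"
abbreviation "B \<equiv> prim_brace K D"

sublocale D: unital_dendriform_algebra K D
  by (rule connected_dend_bialgD(1)[OF connected])

sublocale C: connected_augmented K D DA "comult D"
  by (rule connected_dend_bialgD(2)[OF connected])

lemma prim_eq: "prim K D = C.prims"
  by (simp add: prim_def C.prims_def C.hat_def aug_of_simps)

lemma B_simps [simp]: "carrier B = C.prims" "zero B = zero D" "add B = add D" "smult B = smult D"
  by (simp_all add: prim_brace_def prim_eq)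

lemma prims_facts: "x \<in> C.prims \<Longrightarrow> x \<in> carrier D" "x \<in> C.prims \<Longrightarrow> x \<in> pos D"
  using C.prims_pos D.posI by (auto simp: aug_of_simps)

text \<open>The brace of \<open>B\<close> is computed in the positive part of D, whose inclusion
  into D preserves both products; \<open>pos_maps_dend_brace\<close> then compares the two
  braces.\<close>

lemma B_brace:
  assumes "x \<in> C.prims" "set c \<subseteq> C.prims" shows "brace B x c = aug_brace D DA x c"
proof -
  have "(\<lambda>x. x) \<in> pos_maps K (plus_part D) D DA"
    by (intro pos_mapsI lin_mapsI) (simp_all add: aug_of_simps D.omit_prec D.omit_succ)
  then have "dend_brace (plus_part D) x c = aug_brace D DA x (map (\<lambda>x. x) c)"
    using assms prims_facts
    by (intro dend_space.pos_maps_dend_brace[OF dendriform_algebra.dend_space[OF D.plus_dendriform] C.augmented_axioms]) auto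
  then show ?thesis by (simp add: prim_brace_def)
qed

lemma vspace_B: "vspace K B"
  using submodule.submodule_is_module[OF C.prims_submodule vspace_module[OF D.vspace_axioms]] D.field_axioms
    module_cong(1)[of B "D\<lparr>carrier := C.prims\<rparr>", where K = K]
  by (intro vspaceI) simp_all

sublocale Env: enveloping K B
  by (intro enveloping.intro free_dendriform.intro vspace_B enveloping_axioms.intro)
    (simp add: B_brace C.prims_brace)

lemma prim_incl_lin: "(\<lambda>b. b) \<in> lin_maps K B D"
  by (intro lin_mapsI) (simp_all add: prims_facts)

lemma canonical_props:
  shows "canonical_map K D \<in> aug_homs K Env.U Env.UA D DA"
    and "b \<in> C.prims \<Longrightarrow> canonical_map K D (Env.gU b) = b"
  unfolding canonical_map_def
  using Env.env_adjunct_props[OF D.unital_dendriform_algebra_axioms prim_incl_lin] prims_facts(2) B_brace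
  by simp_all

text \<open>The bijectivity criterion with \<open>j\<close> the inclusion of generators into U(B):
  the generators generate, and by the defining relations their braces are generators again.\<close>

lemma canonical_bij: "bij_betw (canonical_map K D) (carrier Env.U) (carrier D)"
proof -
  have "C.e \<in> lin_maps K D B" by (intro lin_mapsI) (simp_all add: C.e_prim)
  then have j: "(\<lambda>x. Env.gU (C.e x)) \<in> lin_maps K D Env.U" by (rule lin_comp) (rule Env.gU_lin)
  have j0: "aeps Env.UA (Env.gU b) = \<zero>" if "b \<in> C.prims" for b using that Env.gU_eps[of b] by simp
  have br: "aug_brace Env.U Env.UA (Env.gU x) (map Env.gU c) \<in> Env.gU ` C.prims"
    if "x \<in> C.prims" "set c \<subseteq> C.prims" for x c
  proof (cases "c = []")
    \<comment> \<open>The brace without arguments is its first entry; the relations of U(B) concern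
      nonempty lists only.\<close>
    case True
    then have "aug_brace Env.U Env.UA (Env.gU x) (map Env.gU c) = Env.gU x"
      using that Env.gU_closed[of x] j0[of x] by (simp add: aug_brace_def)
    then show ?thesis using that by simp
  next
    case False
    then show ?thesis using that Env.gU_brace[of x c] by (simp add: B_brace C.prims_brace)
  qed
  note p = Env.UT.A.augmented_axioms canonical_props(1) j j0 canonical_props(2)
  have "aug_generated K Env.U Env.UA (Env.gU ` C.prims)" using Env.U_generated by simp
  then show ?thesis
    unfolding bij_betw_def using C.section_inj[OF p _ br] C.section_surj[OF p] by blast
qed

text \<open>Compatibility with the coproducts is an equality of morphisms out of U(B); on a
  generator b both sides are b \<otimes> 1 + 1 \<otimes> b.\<close>

lemma canonical_iso: "canonical_map K D \<in> dend_bialg_isos K (env_bialg K B) D"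
proof -
  let ?can = "canonical_map K D"
  note c = canonical_props(1)
  have "comult D (?can x) = tensor_map K D D ?can ?can (env_comult K B x)" if x: "x \<in> carrier Env.U" for x
  proof (rule Env.U_hom_unique[OF _ aug_homs_comp[OF c C.\<Delta>_hom] aug_homs_comp[OF Env.env_comult_props(1)
        aug_homs_tensor_map[OF Env.UT.A.augmented_axioms Env.UT.A.augmented_axioms C.augmented_axioms C.augmented_axioms c c]] _ x])
    show "vspace K (tensor K D D)" by (rule vspace_tensor[OF D.vspace_axioms D.vspace_axioms])
    fix b assume "b \<in> carrier B"
    then have b: "b \<in> carrier B" "b \<in> C.prims" by simp_all
    have "comult D b = C.hat b" using b by (simp add: C.prims_def)
    then show "comult D (?can (Env.gU b)) = tensor_map K D D ?can ?can (env_comult K B (Env.gU b))"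
      using tensor_map_hat[OF Env.UT.A.augmented_axioms C.augmented_axioms c Env.gU_closed[OF b(1)]]
        Env.env_comult_props(2)[OF b(1)] canonical_props(2)[OF b(2)] by simp
  qed
  moreover have "?can \<in> unital_dend_homs K (env_bialg K B) D"
    unfolding Env.env_homs_eq[OF D.unital_dendriform_algebra_axioms] by (rule c)
  moreover have "proj_unit K D (?can x) = proj_unit K Env.U x" if "x \<in> carrier Env.U" for x
    using aug_homs_simps(2)[OF c that] by (simp add: aug_of_simps)
  ultimately show ?thesis
    using canonical_bij by (simp add: dend_bialg_isos_def dend_bialg_homs_def env_bialg_def)
qed

text \<open>A bialgebra morphism maps primitive elements to primitive elements and respects their
  braces, so \<open>env_map\<close> is defined by the adjunction. Both composites are then morphisms
  out of U(B) that send a generator b to f(b).\<close>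

lemma canonical_natural:
  fixes D' :: "('k, 'b) dend_bialg"
  assumes D': "connected_dend_bialg K D'" and f: "f \<in> dend_bialg_homs K D D'" and x: "x \<in> carrier Env.U"
  shows "canonical_map K D' (env_map K B (prim_brace K D') f x) = f (canonical_map K D x)"
proof -
  interpret D': connected_bialgebra K D' by (rule connected_bialgebra.intro[OF D'])
  have fh: "f \<in> aug_homs K D DA D' D'.DA"
    using f unital_dend_homs_eq[OF D.unital_dendriform_algebra_axioms D'.D.unital_dendriform_algebra_axioms]
    by (simp add: dend_bialg_homs_def)
  note fl = lin_simps[OF aug_homs_lin[OF fh]]
  have fp: "f b \<in> D'.C.prims" if b: "b \<in> C.prims" for b
  proof -
    have "comult D' (f b) = tensor_map K D' D' f f (C.hat b)"
      using f b by (simp add: dend_bialg_homs_def C.prims_def)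
    then show ?thesis
      using tensor_map_hat[OF C.augmented_axioms D'.C.augmented_axioms fh] b fl(1) by (simp add: C.prims_def D'.C.prims_def)
  qed
  let ?W = "env_bialg K D'.B"
  let ?g = "\<lambda>b. D'.Env.gU (f b)"
  have W: "unital_dendriform_algebra K ?W" by (rule D'.Env.env_unital)
  have "f \<in> lin_maps K B D'.B"
    by (intro lin_mapsI) (simp_all add: fp fl prims_facts)
  then have g: "?g \<in> lin_maps K B ?W"
    unfolding env_bialg_def with_comult_lin_maps by (rule lin_comp) (rule D'.Env.gU_lin)
  have g0: "?g b \<in> pos ?W" if "b \<in> carrier B" for b
    using D'.Env.gU_pos[of "f b"] fp that by (simp add: env_bialg_def)
  \<comment> \<open>The identity, read as a morphism from the plain unitization to the same algebra
    with its coproduct attached, transports braces between the two records.\<close>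
  have "(\<lambda>y. y) \<in> aug_homs K D'.Env.U D'.Env.UA ?W (aug_of K ?W)"
    by (simp add: env_bialg_def aug_homs_id)
  note idh = aug_homs_brace[OF D'.Env.UT.A.augmented_axioms unital_dendriform_algebra.augmented_aug_of[OF W] this]
  have br: "?g (brace B y ys) = aug_brace ?W (aug_of K ?W) (?g y) (map ?g ys)"
    if y: "y \<in> carrier B" "ys \<noteq> []" "set ys \<subseteq> carrier B" for y ys
  proof -
    have y': "f y \<in> carrier D'.B" "map f ys \<noteq> []" "set (map f ys) \<subseteq> carrier D'.B" using y fp by auto
    have "f (brace B y ys) = brace D'.B (f y) (map f ys)"
      using y y' aug_homs_brace[OF C.augmented_axioms D'.C.augmented_axioms fh, of y ys] prims_facts(1)
      by (simp add: B_brace D'.B_brace subset_iff)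
    then have "?g (brace B y ys) = aug_brace D'.Env.U D'.Env.UA (?g y) (map D'.Env.gU (map f ys))"
      by (simp only: D'.Env.gU_brace[OF y'])
    also have "\<dots> = aug_brace ?W (aug_of K ?W) (?g y) (map ?g ys)"
    proof -
      have "set (map D'.Env.gU (map f ys)) \<subseteq> carrier D'.Env.U"
        unfolding set_map[of D'.Env.gU] by (rule image_subsetI) (rule D'.Env.gU_closed, erule subsetD[OF y'(3)])
      from idh[OF D'.Env.gU_closed[OF y'(1)] this] show ?thesis by (simp only: map_map comp_def id_def list.map_ident)
    qed
    finally show ?thesis .
  qed
  have m: "env_map K B D'.B f \<in> aug_homs K Env.U Env.UA ?W (aug_of K ?W)"
    "b \<in> carrier B \<Longrightarrow> env_map K B D'.B f (Env.gU b) = ?g b" for b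
    unfolding env_map_def by (rule Env.env_adjunct_props[OF W g g0 br]; assumption)+
  have mh: "env_map K B D'.B f \<in> aug_homs K Env.U Env.UA D'.Env.U D'.Env.UA"
    using m(1) by (simp add: env_bialg_def)
  show ?thesis
  proof (rule Env.U_hom_unique[OF D'.D.vspace_axioms aug_homs_comp[OF mh D'.canonical_props(1)]
        aug_homs_comp[OF canonical_props(1) fh] _ x])
    fix b assume b: "b \<in> carrier B"
    then show "canonical_map K D' (env_map K B D'.B f (Env.gU b)) = f (canonical_map K D (Env.gU b))"
      using m(2)[OF b] D'.canonical_props(2)[OF fp] canonical_props(2)[of b] by simp
  qed
qed

end

theorem proposition15:
  fixes K :: "('k, 'm) ring_scheme" and D :: "('k, 'a) dend_bialg"
  assumes "field K" and "connected_dend_bialg K D"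
  shows "dendriform_bialgebra K (env_bialg K (prim_brace K D)) \<and>
    canonical_map K D \<in> dend_bialg_isos K (env_bialg K (prim_brace K D)) D \<and>
    (\<forall>b\<in>prim K D. canonical_map K D (env_gen K (prim_brace K D) b) = b) \<and>
    (\<forall>(D' :: ('k, 'b) dend_bialg) f.
      connected_dend_bialg K D' \<and> f \<in> dend_bialg_homs K D D' \<longrightarrow>
      (\<forall>x\<in>carrier (env_bialg K (prim_brace K D)).
        canonical_map K D' (env_map K (prim_brace K D) (prim_brace K D') f x) =
        f (canonical_map K D x)))"
proof -
  interpret connected_bialgebra K D by (rule connected_bialgebra.intro[OF assms(2)])
  have "carrier (env_bialg K B) = carrier Env.U" by (simp add: env_bialg_def)
  then show ?thesis
    using Env.env_comult_props(3) canonical_iso canonical_props(2) canonical_natural by (auto simp: prim_eq)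
qed

end
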